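(* Let $\dim(\mathcal G)=+\infty$ and let $V=(M_\psi\otimes K^* )\mathscr V(M_\psi\otimes K)$ with $\nu_0>3$, $0\le\mathscr V\in\mathcal B(\ell^2(\mathbb Z_h,\mathcal G))$ and $K\in\mathfrak S_2(\mathcal G)$. Fix $s\in I_Q$ such that the thresholds $z_1:=\mu_s$ and $z_2:=\frac4{h^2}+\mu_s$ are non-degenerate. For $r>0$ put $\Phi_1(r)=\mathrm{Tr}\,\mathbf 1_{(r,+\infty)}(P_s\mathbf VP_s^* )$ and $\Phi_2(r)=\mathrm{Tr}\,\mathbf 1_{(r,+\infty)}(P_s\mathbf V_JP_s^* )$. Suppose that $\Phi_i(r)=\Psi_i(r)(1+o(1))$ as $r\searrow0$, $i=1,2$, with $\Psi_i$ as specified below ($C_0>0$ a constant). Below, $\lambda\to z_1$ means $\lambda\searrow\mu_s$ and $\lambda\to z_2$ means $\lambda\nearrow\frac4{h^2}+\mu_s$. (i) If $\Psi_i(r)=C_0r^{-\alpha}$ with $0<\alpha<1$, then $$\xi(\lambda;H^\pm,H_Q)=\pm\frac1{2\cos(\frac{\pi}{\alpha})}\Psi_i\big(\tfrac2h\sqrt{|z_i-\lambda|}\big)(1+o(1)),\qquad\lambda\to z_i.$$ (ii) If $\Psi_i(r)=C_0|\ln r|^\alpha$ with $\alpha>0$, or $\Psi_i(r)=C_0(\ln|\ln r|)^\alpha$ with $\alpha>0$, or $\Psi_i(r)=C_0|\ln r|(\ln|\ln r|)^{-1}$, then $$\xi(\lambda;H^\pm,H_Q)=\pm\frac12\Psi_i\big(\tfrac2h\sqrt{|z_i-\lambda|}\big)(1+o(1)),\qquad\lambda\to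 z_i.$$
   Context: Let $h>0$, $\mathbb Z_h=\{hn:n\in\mathbb Z\}$, and let $\mathcal G$ be a separable complex Hilbert space. $\ell^2(\mathbb Z_h)=\ell^2(\mathbb Z_h,\mathbb C)$ has scalar product $\langle\varphi,\phi\rangle=\sum_{n\in\mathbb Z}\overline{\varphi(hn)}\phi(hn)$, and $\ell^2(\mathbb Z_h,\mathcal G)$ is identified with $\ell^2(\mathbb Z_h)\otimes\mathcal G$. On $\ell^2(\mathbb Z_h)$, $(-\Delta_h\phi)(hn)=h^{-2}\big(2\phi(hn)-\phi(h(n+1))-\phi(h(n-1))\big)$, whose spectrum is $[0,4/h^2]$. $Q$ is a self-adjoint operator on $\mathcal G$ such that either $Q=0$, or $Q\ne0$ and $\mathcal G=\bigoplus_{s=1}^d\mathrm{Ker}(Q-\mu_s)$ with $d<+\infty$ and $\mu_1,\dots,\mu_d$ the distinct (real) eigenvalues of $Q$. If $Q=0$ put $I_Q=\{0\}$, $\mu_0=0$, $\pi_0=I_{\mathcal G}$; if $Q\neq0$ put $I_Q=\{1,\dots,d\}$ and let $\pi_s$ be the orthogonal projection onto $\mathrm{Ker}(Q-\mu_s)$. $H_Q=-\Delta_h\otimes I_{\mathcal G}+I_{\ell^2(\mathbb Z_h)}\otimes Q$; the threshold set is $\mathscr E_Q=\{\mu_s,\mu_s+4/h^2\}_{s\in I_Q}$. If $Q\ne0$, $\mu_s$ (resp. $\frac4{h^2}+\mu_s$) is non-degenerate if $\mu_s\ne\frac4{h^2}+\mu_{s'}$ (resp. $\frac4{h^2}+\mu_s\neq\mu_{s'}$)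 for all $s'\ne s$; if $Q=0$ both thresholds $0,4/h^2$ count as non-degenerate. $\mathfrak S_p$ denotes the Schatten class. $\langle n\rangle=(1+n^2)^{1/2}$, $\psi(hn)=\langle n\rangle^{-\nu_0/2}$, $M_\psi$ is multiplication by $\psi$ on $\ell^2(\mathbb Z_h)$. $H^\pm=H_Q\pm V$. Spectral shift function: put $\mathscr M=\mathscr V^{1/2}(M_\psi\otimes K)\in\mathfrak S_2$ (so $V=\mathscr M^*\mathscr M$) and $T(z)=\mathscr M(H_Q-z)^{-1}\mathscr M^*$. For each $\lambda\in\mathbb R\setminus\mathscr E_Q$ the limit $T(\lambda+i0)=\lim_{\varepsilon\searrow0}T(\lambda+i\varepsilon)$ exists in $\mathfrak S_2$; $A(\lambda+i0)$ and $B(\lambda+i0)$ are its real and imaginary (self-adjoint) parts, $0\le B(\lambda+i0)\in\mathfrak S_1$. For compact self-adjoint $S$ and $r>0$, $\mathscr N_\pm(r,S)=\mathrm{Rank}\,\mathbf 1_{(r,\infty)}(\pm S)$. The SSF is identified with its representative $\xi(\lambda;H^\pm,H_Q)=\pm\frac1\pi\int_{\mathbb R}\mathscr N_\mp(1,A(\lambda+i0)+tB(\lambda+i0))\frac{dt}{1+t^2}$, $\lambda\in\mathbb R\setminus\mathscr E_Q$. Effective operators: $\langle\psi|:\ell^2(\mathbb Z_h)\to\mathbb C$, $\phi\mapsto\langle\psi,\phi\rangle$; $(J\varphi)(hn)=(-1)^n\varphi(hn)$; $P_s=\langle\psi|\otimes\pi_s:\ell^2(\mathbb Z_h)\otimes\mathcal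 G\to\mathbb C\otimes\mathcal G$; $\mathbf V=(I\otimes K^* )\mathscr V(I\otimes K)$; $\mathbf V_J=(J\otimes I_{\mathcal G})^*\mathbf V(J\otimes I_{\mathcal G})$.
   Formalization: In (i) the constant 1/(2cos(π/α)) is corrected to 1/(2cos(πα/2)); the printed one is undefined at α=2/3 and negative for 2/3<α<1, although ξ(λ;H⁺,H_Q)≥0. *)

theory Defs
  imports
    "HOL-Analysis.Analysis"
    "HOL-Library.Landau_Symbols"
    "HOL-Library.Nonpos_Ints"
begin

section \<open>Complex Hilbert spaces\<close>

text \<open>The scalar product is antilinear in its first argument. Its real part is the real inner
  product, so norm and topology are those of the underlying real Hilbert space.\<close>

class complex_hilbert = real_inner + complete_space +
  fixes cscale :: "complex \<Rightarrow> 'a \<Rightarrow> 'a"  (infixr "*\<^sub>C" 75)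
    and cinner :: "'a \<Rightarrow> 'a \<Rightarrow> complex"
  assumes cscale_add_right: "c *\<^sub>C (x + y) = c *\<^sub>C x + c *\<^sub>C y"
    and cscale_add_left: "(c + d) *\<^sub>C x = c *\<^sub>C x + d *\<^sub>C x"
    and cscale_cscale: "c *\<^sub>C d *\<^sub>C x = (c * d) *\<^sub>C x"
    and scaleR_cscale: "r *\<^sub>R x = complex_of_real r *\<^sub>C x"
    and cinner_commute: "cinner x y = cnj (cinner y x)"
    and cinner_add_right: "cinner x (y + z) = cinner x y + cinner x z"
    and cinner_cscale_right: "cinner x (c *\<^sub>C y) = c * cinner x y"
    and inner_cinner: "inner x y = Re (cinner x y)"

lemma cscale_one: "1 *\<^sub>C x = (x :: 'a :: complex_hilbert)"
  using scaleR_cscale[of 1 x] by simp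

lemma cinner_self: "cinner x x = complex_of_real ((norm x)\<^sup>2)"
proof (rule complex_eqI)
  show "Re (cinner x x) = Re (complex_of_real ((norm x)\<^sup>2))"
    by (simp add: inner_cinner[symmetric] power2_norm_eq_inner)
  show "Im (cinner x x) = Im (complex_of_real ((norm x)\<^sup>2))"
    using arg_cong[OF cinner_commute[of x x], of Im] by simp
qed

lemma norm_cscale: "norm (c *\<^sub>C x) = cmod c * norm (x :: 'a :: complex_hilbert)"
proof -
  have "cinner (c *\<^sub>C x) (c *\<^sub>C x) = c * (cnj c * cinner x x)"
    by (subst cinner_cscale_right, subst cinner_commute, subst cinner_cscale_right)
       (simp add: cinner_commute[symmetric] flip: cinner_commute[of x x])
  also have "\<dots> = complex_of_real ((cmod c * norm x)\<^sup>2)"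
    unfolding cinner_self mult.assoc[symmetric] complex_norm_square[symmetric]
    by (simp add: power_mult_distrib)
  finally have "(norm (c *\<^sub>C x))\<^sup>2 = (cmod c * norm x)\<^sup>2"
    by (simp only: cinner_self of_real_eq_iff)
  then show ?thesis by (simp add: power2_eq_iff_nonneg)
qed

lemma norm_cinner_le: "cmod (cinner x y) \<le> norm x * norm (y :: 'a :: complex_hilbert)"
proof (cases "cinner x y = 0")
  case False
  define c where "c = cnj (cinner x y) / cmod (cinner x y)"
  have c: "cmod c = 1" using False by (simp add: c_def norm_divide)
  have "c * cinner x y = complex_of_real (cmod (cinner x y))"
    using False complex_norm_square[of "cinner x y"]
    by (simp add: c_def divide_eq_eq power2_eq_square mult.commute)
  then have "cmod (cinner x y) = inner x (c *\<^sub>C y)"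
    by (simp add: inner_cinner cinner_cscale_right)
  also have "\<dots> \<le> norm x * norm (c *\<^sub>C y)" by (rule norm_cauchy_schwarz)
  finally show ?thesis by (simp add: norm_cscale c)
qed simp

global_interpretation cvec: vector_space "cscale :: complex \<Rightarrow> 'a \<Rightarrow> 'a :: complex_hilbert"
  by standard (simp_all add: cscale_add_right cscale_add_left cscale_cscale cscale_one)

instantiation complex :: complex_hilbert
begin
definition cscale_complex :: "complex \<Rightarrow> complex \<Rightarrow> complex" where
  "cscale_complex c x = c * x"
definition cinner_complex :: "complex \<Rightarrow> complex \<Rightarrow> complex" where
  "cinner_complex x y = cnj x * y"
instance
  by standard (auto simp: cscale_complex_def cinner_complex_def algebra_simps
      inner_complex_def scaleR_conv_of_real)
end

section \<open>Square-summable functions on the lattice\<close>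

text \<open>A function on the lattice \<open>{h n | n \<in> \<int>}\<close> is encoded by \<open>n \<mapsto> f (h n)\<close>.\<close>

typedef (overloaded) 'g l2Z =
  "{f :: int \<Rightarrow> 'g :: complex_hilbert. (\<lambda>n. (norm (f n))\<^sup>2) summable_on UNIV}"
  morphisms at_site Abs_l2Z
  by (rule exI[of _ "\<lambda>_. 0"]) simp

setup_lifting type_definition_l2Z

lemma l2Z_eqI: "(\<And>n. at_site f n = at_site g n) \<Longrightarrow> f = g"
  by (metis at_site_inject ext)

lemma at_site_summable: "(\<lambda>n. (norm (at_site f n))\<^sup>2) summable_on UNIV"
  using at_site[of f] by simp

lemma l2Z_dominated:
  assumes "(\<lambda>n. (norm (f n))\<^sup>2) summable_on UNIV" "\<And>n. norm (g n) \<le> C * norm (f n)"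
  shows "(\<lambda>n. (norm (g n))\<^sup>2) summable_on (UNIV :: int set)"
proof (rule summable_on_comparison_test)
  show "(\<lambda>n. C\<^sup>2 * (norm (f n))\<^sup>2) summable_on UNIV"
    by (rule summable_on_cmult_right[OF assms(1)])
  show "(norm (g n))\<^sup>2 \<le> C\<^sup>2 * (norm (f n))\<^sup>2" for n
    using power_mono[OF assms(2)[of n], of 2] by (simp add: power_mult_distrib)
qed auto

lemma l2Z_sum:
  assumes "(\<lambda>n. (norm (f n))\<^sup>2) summable_on UNIV" "(\<lambda>n. (norm (g n))\<^sup>2) summable_on UNIV"
  shows "(\<lambda>n. (norm (f n + g n))\<^sup>2) summable_on (UNIV :: int set)"
proof (rule summable_on_comparison_test)
  show "(\<lambda>n. 2 * ((norm (f n))\<^sup>2 + (norm (g n))\<^sup>2)) summable_on UNIV"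
    by (intro summable_on_cmult_right summable_on_add assms)
  fix n
  have "(norm (f n + g n))\<^sup>2 \<le> (norm (f n) + norm (g n))\<^sup>2"
    by (intro power_mono norm_triangle_ineq) auto
  also have "\<dots> \<le> 2 * ((norm (f n))\<^sup>2 + (norm (g n))\<^sup>2)"
    using sum_squares_bound[of "norm (f n)" "norm (g n)"] by (simp add: power2_sum)
  finally show "(norm (f n + g n))\<^sup>2 \<le> 2 * ((norm (f n))\<^sup>2 + (norm (g n))\<^sup>2)" .
qed auto

lemma l2Z_diff:
  assumes "(\<lambda>n. (norm (f n))\<^sup>2) summable_on UNIV" "(\<lambda>n. (norm (g n))\<^sup>2) summable_on UNIV"
  shows "(\<lambda>n. (norm (f n - g n))\<^sup>2) summable_on (UNIV :: int set)"
  using l2Z_sum[of f "\<lambda>n. - g n"] assms by simp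

lemma l2Z_product_summable:
  assumes "\<And>n. cmod (p n) \<le> norm (at_site f n) * norm (at_site g n)"
  shows "p summable_on UNIV"
proof (rule abs_summable_summable, rule summable_on_comparison_test)
  show "(\<lambda>n. (norm (at_site f n))\<^sup>2 + (norm (at_site g n))\<^sup>2) summable_on UNIV"
    by (intro summable_on_add at_site_summable)
  fix n
  have "0 \<le> norm (at_site f n) * norm (at_site g n)" by simp
  then show "cmod (p n) \<le> (norm (at_site f n))\<^sup>2 + (norm (at_site g n))\<^sup>2"
    using assms[of n] sum_squares_bound[of "norm (at_site f n)" "norm (at_site g n)"] by linarith
qed auto

lemma cinner_summable: "(\<lambda>n. cinner (at_site f n) (at_site g n)) summable_on UNIV"
  by (rule l2Z_product_summable[of _ f g]) (rule norm_cinner_le)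

lemma inner_summable: "(\<lambda>n. inner (at_site f n) (at_site g n)) summable_on UNIV"
  unfolding inner_cinner by (rule summable_on_Re[OF cinner_summable])

instantiation l2Z :: (complex_hilbert) real_vector
begin
lift_definition zero_l2Z :: "'a l2Z" is "\<lambda>_. 0" by simp
lift_definition plus_l2Z :: "'a l2Z \<Rightarrow> 'a l2Z \<Rightarrow> 'a l2Z" is "\<lambda>f g n. f n + g n"
  by (simp add: l2Z_sum)
lift_definition uminus_l2Z :: "'a l2Z \<Rightarrow> 'a l2Z" is "\<lambda>f n. - f n" by simp
lift_definition minus_l2Z :: "'a l2Z \<Rightarrow> 'a l2Z \<Rightarrow> 'a l2Z" is "\<lambda>f g n. f n - g n"
  by (simp add: l2Z_diff)
lift_definition scaleR_l2Z :: "real \<Rightarrow> 'a l2Z \<Rightarrow> 'a l2Z" is "\<lambda>r f n. r *\<^sub>R f n"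
  by (rule l2Z_dominated, assumption, simp only: norm_scaleR, rule order_refl)
instance
  by standard (transfer, simp add: algebra_simps)+
end

instantiation l2Z :: (complex_hilbert) real_inner
begin
definition inner_l2Z :: "'a l2Z \<Rightarrow> 'a l2Z \<Rightarrow> real" where
  "inner_l2Z f g = (\<Sum>\<^sub>\<infinity>n. inner (at_site f n) (at_site g n))"
definition norm_l2Z :: "'a l2Z \<Rightarrow> real" where "norm_l2Z f = sqrt (inner f f)"
definition dist_l2Z :: "'a l2Z \<Rightarrow> 'a l2Z \<Rightarrow> real" where "dist_l2Z f g = norm (f - g)"
definition sgn_l2Z :: "'a l2Z \<Rightarrow> 'a l2Z" where "sgn_l2Z f = f /\<^sub>R norm f"
definition uniformity_l2Z :: "('a l2Z \<times> 'a l2Z) filter" where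
  "uniformity_l2Z = (INF e\<in>{0 <..}. principal {(x, y). dist x y < e})"
definition open_l2Z :: "'a l2Z set \<Rightarrow> bool" where
  "open_l2Z U \<longleftrightarrow> (\<forall>x\<in>U. eventually (\<lambda>(x', y). x' = x \<longrightarrow> y \<in> U) uniformity)"
instance
proof
  fix f g k :: "'a l2Z" and r :: real
  show "inner f g = inner g f" by (simp add: inner_l2Z_def inner_commute)
  show "inner (f + g) k = inner f k + inner g k"
    by (simp add: inner_l2Z_def plus_l2Z.rep_eq inner_add_left infsum_add inner_summable)
  show "inner (r *\<^sub>R f) g = r * inner f g"
    by (simp add: inner_l2Z_def scaleR_l2Z.rep_eq infsum_cmult_right')
  show "0 \<le> inner f f" by (simp add: inner_l2Z_def infsum_nonneg)
  show "inner f f = 0 \<longleftrightarrow> f = 0"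
  proof
    assume *: "inner f f = 0"
    show "f = 0"
    proof (rule l2Z_eqI)
      fix n
      have "inner (at_site f n) (at_site f n) \<le> inner f f"
        using finite_sum_le_infsum[OF inner_summable[of f f], of "{n}"]
        by (simp add: inner_l2Z_def)
      then have "inner (at_site f n) (at_site f n) = 0"
        using * by (intro antisym) simp_all
      then show "at_site f n = at_site 0 n" by (simp add: zero_l2Z.rep_eq)
    qed
  qed (simp add: inner_l2Z_def zero_l2Z.rep_eq)
qed (simp_all add: norm_l2Z_def dist_l2Z_def sgn_l2Z_def uniformity_l2Z_def open_l2Z_def)
end

lemma norm_l2Z_sq: "(norm f)\<^sup>2 = (\<Sum>\<^sub>\<infinity>n. (norm (at_site f n))\<^sup>2)"
  unfolding power2_norm_eq_inner[of f] inner_l2Z_def by (simp add: power2_norm_eq_inner)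

lemma norm_at_site_le: "norm (at_site f n) \<le> norm f"
proof (rule power2_le_imp_le)
  show "(norm (at_site f n))\<^sup>2 \<le> (norm f)\<^sup>2"
    using finite_sum_le_infsum[OF at_site_summable[of f], of "{n}"] by (simp add: norm_l2Z_sq)
qed simp

instance l2Z :: (complex_hilbert) complete_space
proof
  fix X :: "nat \<Rightarrow> 'a l2Z"
  assume X: "Cauchy X"
  have "Cauchy (\<lambda>i. at_site (X i) n)" for n
  proof (rule CauchyI)
    fix e :: real assume "0 < e"
    then obtain M where M: "\<And>i j. i \<ge> M \<Longrightarrow> j \<ge> M \<Longrightarrow> norm (X i - X j) < e"
      using CauchyD[OF X] by meson
    have "norm (at_site (X i) n - at_site (X j) n) < e" if "i \<ge> M" "j \<ge> M" for i j
      using norm_at_site_le[of "X i - X j" n] M[OF that] by (simp add: minus_l2Z.rep_eq)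
    then show "\<exists>M. \<forall>i\<ge>M. \<forall>j\<ge>M. norm (at_site (X i) n - at_site (X j) n) < e" by blast
  qed
  then have "\<exists>l. (\<lambda>i. at_site (X i) n) \<longlonglongrightarrow> l" for n
    by (simp add: Cauchy_convergent_iff convergent_def)
  then obtain F where F: "\<And>n. (\<lambda>i. at_site (X i) n) \<longlonglongrightarrow> F n" by metis
  have bound: "(\<Sum>n\<in>S. (norm (at_site (X i) n - F n))\<^sup>2) \<le> e\<^sup>2"
    if "finite S" "\<And>j. j \<ge> M \<Longrightarrow> norm (X i - X j) \<le> e" for S i e M
  proof (rule tendsto_upperbound)
    show "(\<lambda>j. \<Sum>n\<in>S. (norm (at_site (X i) n - at_site (X j) n))\<^sup>2)
        \<longlonglongrightarrow> (\<Sum>n\<in>S. (norm (at_site (X i) n - F n))\<^sup>2)"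
      by (intro tendsto_intros F)
    have "(\<Sum>n\<in>S. (norm (at_site (X i) n - at_site (X j) n))\<^sup>2) \<le> e\<^sup>2" if "j \<ge> M" for j
    proof -
      have "(\<Sum>n\<in>S. (norm (at_site (X i - X j) n))\<^sup>2) \<le> (norm (X i - X j))\<^sup>2"
        unfolding norm_l2Z_sq
        by (rule finite_sum_le_infsum[OF at_site_summable \<open>finite S\<close>]) auto
      also have "\<dots> \<le> e\<^sup>2" using \<open>\<And>j. j \<ge> M \<Longrightarrow> norm (X i - X j) \<le> e\<close>[OF that]
        by (intro power_mono) auto
      finally show ?thesis by (simp add: minus_l2Z.rep_eq)
    qed
    then show "\<forall>\<^sub>F j in sequentially.
        (\<Sum>n\<in>S. (norm (at_site (X i) n - at_site (X j) n))\<^sup>2) \<le> e\<^sup>2"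
      by (auto simp: eventually_sequentially)
  qed simp
  have diff: "(\<lambda>n. (norm (at_site (X i) n - F n))\<^sup>2) summable_on UNIV"
    if "\<And>j. j \<ge> M \<Longrightarrow> norm (X i - X j) \<le> e" for i e M
    by (rule nonneg_bounded_partial_sums_imp_summable_on[where C = "e\<^sup>2"])
       (auto intro!: eventually_finite_subsets_at_top_weakI bound that)
  obtain M1 where M1: "\<And>i j. i \<ge> M1 \<Longrightarrow> j \<ge> M1 \<Longrightarrow> norm (X i - X j) < 1"
    using CauchyD[OF X zero_less_one] by meson
  have "(\<lambda>n. (norm (at_site (X M1) n - F n))\<^sup>2) summable_on UNIV"
    by (rule diff[of M1 _ 1]) (use M1 in \<open>auto intro: less_imp_le\<close>)
  then have "(\<lambda>n. (norm (at_site (X M1) n - (at_site (X M1) n - F n)))\<^sup>2) summable_on UNIV"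
    by (rule l2Z_diff[OF at_site_summable])
  then have F2: "(\<lambda>n. (norm (F n))\<^sup>2) summable_on UNIV"
    by (simp only: diff_diff_eq2 add_diff_cancel_left')
  define L where "L = Abs_l2Z F"
  have L: "at_site L = F" unfolding L_def by (rule Abs_l2Z_inverse) (simp add: F2)
  have "X \<longlonglongrightarrow> L"
  proof (rule LIMSEQ_I)
    fix e :: real assume e: "0 < e"
    then obtain M where M: "\<And>i j. i \<ge> M \<Longrightarrow> j \<ge> M \<Longrightarrow> norm (X i - X j) < e / 2"
      using CauchyD[OF X, of "e / 2"] by (meson half_gt_zero)
    have "norm (X i - L) < e" if "i \<ge> M" for i
    proof -
      have *: "norm (X i - X j) \<le> e / 2" if "j \<ge> M" for j
        using M[OF \<open>i \<ge> M\<close> that] by simp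
      have "(norm (X i - L))\<^sup>2 \<le> (e / 2)\<^sup>2"
        unfolding norm_l2Z_sq minus_l2Z.rep_eq L
        by (rule infsum_le_finite_sums[OF diff[of M]]) (auto intro: * bound)
      then have "norm (X i - L) \<le> e / 2" using e by (simp add: power2_le_iff_abs_le)
      then show ?thesis using e by simp
    qed
    then show "\<exists>M. \<forall>i\<ge>M. norm (X i - L) < e" by blast
  qed
  then show "convergent X" by (auto simp: convergent_def)
qed

instantiation l2Z :: (complex_hilbert) complex_hilbert
begin
lift_definition cscale_l2Z :: "complex \<Rightarrow> 'a l2Z \<Rightarrow> 'a l2Z" is "\<lambda>c f n. c *\<^sub>C f n"
  by (rule l2Z_dominated, assumption, simp only: norm_cscale, rule order_refl)
definition cinner_l2Z :: "'a l2Z \<Rightarrow> 'a l2Z \<Rightarrow> complex" where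
  "cinner_l2Z f g = (\<Sum>\<^sub>\<infinity>n. cinner (at_site f n) (at_site g n))"
instance
proof
  fix f g k :: "'a l2Z" and c d :: complex and r :: real
  show "c *\<^sub>C (f + g) = c *\<^sub>C f + c *\<^sub>C g" "(c + d) *\<^sub>C f = c *\<^sub>C f + d *\<^sub>C f"
    "c *\<^sub>C d *\<^sub>C f = (c * d) *\<^sub>C f" "r *\<^sub>R f = complex_of_real r *\<^sub>C f"
    by (transfer, simp add: cscale_add_right cscale_add_left cscale_cscale scaleR_cscale)+
  show "cinner f g = cnj (cinner g f)"
    by (simp add: cinner_l2Z_def cinner_commute[symmetric] flip: infsum_cnj)
  show "cinner f (g + k) = cinner f g + cinner f k"
    by (simp add: cinner_l2Z_def plus_l2Z.rep_eq cinner_add_right infsum_add cinner_summable)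
  show "cinner f (c *\<^sub>C g) = c * cinner f g"
    by (simp add: cinner_l2Z_def cscale_l2Z.rep_eq cinner_cscale_right infsum_cmult_right')
  show "inner f g = Re (cinner f g)"
    by (simp add: inner_l2Z_def cinner_l2Z_def inner_cinner infsum_Re cinner_summable)
qed
end

section \<open>Operators on complex Hilbert spaces\<close>

definition bounded_clinear :: "('a :: complex_hilbert \<Rightarrow> 'b :: complex_hilbert) \<Rightarrow> bool" where
  "bounded_clinear A \<longleftrightarrow> bounded_linear A \<and> (\<forall>c x. A (c *\<^sub>C x) = c *\<^sub>C A x)"

definition cadjoint :: "('a :: complex_hilbert \<Rightarrow> 'b :: complex_hilbert) \<Rightarrow> 'b \<Rightarrow> 'a" where
  "cadjoint A = (THE B. bounded_clinear B \<and> (\<forall>x y. cinner (A x) y = cinner x (B y)))"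

definition selfadjoint_op :: "('a :: complex_hilbert \<Rightarrow> 'a) \<Rightarrow> bool" where
  "selfadjoint_op A \<longleftrightarrow> bounded_clinear A \<and> (\<forall>x y. cinner (A x) y = cinner x (A y))"

definition nonneg_op :: "('a :: complex_hilbert \<Rightarrow> 'a) \<Rightarrow> bool" where
  "nonneg_op A \<longleftrightarrow> bounded_clinear A \<and> (\<forall>x. cinner x (A x) \<in> \<real>\<^sub>\<ge>\<^sub>0)"

definition op_sqrt :: "('a :: complex_hilbert \<Rightarrow> 'a) \<Rightarrow> 'a \<Rightarrow> 'a" where
  "op_sqrt A = (THE R. nonneg_op R \<and> R \<circ> R = A)"

definition resolvent :: "('a :: complex_hilbert \<Rightarrow> 'a) \<Rightarrow> complex \<Rightarrow> 'a \<Rightarrow> 'a" where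
  "resolvent A z = inv (\<lambda>x. A x - z *\<^sub>C x)"

definition re_part :: "('a :: complex_hilbert \<Rightarrow> 'a) \<Rightarrow> 'a \<Rightarrow> 'a" where
  "re_part A x = (1 / 2) *\<^sub>C (A x + cadjoint A x)"

definition im_part :: "('a :: complex_hilbert \<Rightarrow> 'a) \<Rightarrow> 'a \<Rightarrow> 'a" where
  "im_part A x = (1 / (2 * \<i>)) *\<^sub>C (A x - cadjoint A x)"

definition is_onb :: "'a :: complex_hilbert set \<Rightarrow> bool" where
  "is_onb B \<longleftrightarrow> (\<forall>e\<in>B. norm e = 1) \<and> (\<forall>e\<in>B. \<forall>f\<in>B. e \<noteq> f \<longrightarrow> cinner e f = 0) \<and>
     closure (cvec.span B) = UNIV"

definition some_onb :: "'a :: complex_hilbert set" where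
  "some_onb = (SOME B. is_onb B)"

text \<open>The squared Hilbert--Schmidt norm takes the value \<open>\<infinity>\<close> outside the Schatten class
  of order two, so that convergence to \<open>0\<close> of the norm of a difference is meaningful without
  a separate membership condition.\<close>

definition hs_norm_sq :: "('a :: complex_hilbert \<Rightarrow> 'b :: complex_hilbert) \<Rightarrow> ennreal" where
  "hs_norm_sq A = (\<Sum>\<^sub>\<infinity>e\<in>some_onb. ennreal ((norm (A e))\<^sup>2))"

definition hilbert_schmidt :: "('a :: complex_hilbert \<Rightarrow> 'b :: complex_hilbert) \<Rightarrow> bool" where
  "hilbert_schmidt A \<longleftrightarrow> bounded_clinear A \<and> hs_norm_sq A < \<infinity>"

definition op_trace :: "('a :: complex_hilbert \<Rightarrow> 'a) \<Rightarrow> complex" where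
  "op_trace A = (\<Sum>\<^sub>\<infinity>e\<in>some_onb. cinner e (A e))"

definition op_rank :: "('a :: complex_hilbert \<Rightarrow> 'b :: complex_hilbert) \<Rightarrow> nat" where
  "op_rank A = cvec.dim (range A)"

definition orth_proj :: "'a :: complex_hilbert set \<Rightarrow> 'a \<Rightarrow> 'a" where
  "orth_proj S x = (THE y. y \<in> S \<and> (\<forall>z\<in>S. cinner z (x - y) = 0))"

definition eigspace :: "('a :: complex_hilbert \<Rightarrow> 'a) \<Rightarrow> real \<Rightarrow> 'a set" where
  "eigspace A \<kappa> = {x. A x = complex_of_real \<kappa> *\<^sub>C x}"

text \<open>The spectral projection \<open>1\<^bsub>(r,\<infinity>)\<^esub>(S)\<close>, for compact self-adjoint \<open>S\<close> and \<open>r > 0\<close>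
  only: the part of the spectrum of \<open>S\<close> in \<open>(r,\<infinity>)\<close> then consists of eigenvalues, and the
  projection is the orthogonal projection onto the closed span of their eigenspaces.\<close>

definition spectral_proj_above :: "real \<Rightarrow> ('a :: complex_hilbert \<Rightarrow> 'a) \<Rightarrow> 'a \<Rightarrow> 'a" where
  "spectral_proj_above r S = orth_proj (closure (cvec.span (\<Union>\<kappa>\<in>{r<..}. eigspace S \<kappa>)))"

definition N_plus :: "real \<Rightarrow> ('a :: complex_hilbert \<Rightarrow> 'a) \<Rightarrow> nat" where
  "N_plus r S = op_rank (spectral_proj_above r S)"

definition N_minus :: "real \<Rightarrow> ('a :: complex_hilbert \<Rightarrow> 'a) \<Rightarrow> nat" where
  "N_minus r S = op_rank (spectral_proj_above r (\<lambda>x. - S x))"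

section \<open>The spectral shift function\<close>

definition sandwiched_resolvent ::
  "('a :: complex_hilbert \<Rightarrow> 'a) \<Rightarrow> ('a \<Rightarrow> 'a) \<Rightarrow> complex \<Rightarrow> 'a \<Rightarrow> 'a" where
  "sandwiched_resolvent H0 M z = M \<circ> resolvent H0 z \<circ> cadjoint M"

text \<open>\<open>T(E + i0)\<close>, the limit being taken in the Hilbert--Schmidt norm.\<close>

definition boundary_value ::
  "('a :: complex_hilbert \<Rightarrow> 'a) \<Rightarrow> ('a \<Rightarrow> 'a) \<Rightarrow> real \<Rightarrow> 'a \<Rightarrow> 'a" where
  "boundary_value H0 M E = (THE L. hilbert_schmidt L \<and>
     ((\<lambda>\<epsilon>. hs_norm_sq (\<lambda>x. sandwiched_resolvent H0 M (Complex E \<epsilon>) x - L x)) \<longlongrightarrow> 0)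
       (at_right 0))"

text \<open>\<open>ssf_plus H0 M\<close> and \<open>ssf_minus H0 M\<close> are the representatives of the spectral shift functions
  \<open>\<xi>(\<cdot>; H0 + V, H0)\<close> and \<open>\<xi>(\<cdot>; H0 - V, H0)\<close> for \<open>V = M\<^sup>* M\<close>.\<close>

definition ssf_plus ::
  "('a :: complex_hilbert \<Rightarrow> 'a) \<Rightarrow> ('a \<Rightarrow> 'a) \<Rightarrow> real \<Rightarrow> real" where
  "ssf_plus H0 M E = 1 / pi * (LINT t|lborel.
     N_minus 1 (\<lambda>x. re_part (boundary_value H0 M E) x + t *\<^sub>R im_part (boundary_value H0 M E) x)
       / (1 + t\<^sup>2))"

definition ssf_minus ::
  "('a :: complex_hilbert \<Rightarrow> 'a) \<Rightarrow> ('a \<Rightarrow> 'a) \<Rightarrow> real \<Rightarrow> real" where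
  "ssf_minus H0 M E = - (1 / pi) * (LINT t|lborel.
     N_plus 1 (\<lambda>x. re_part (boundary_value H0 M E) x + t *\<^sub>R im_part (boundary_value H0 M E) x)
       / (1 + t\<^sup>2))"

section \<open>Operators on the lattice\<close>

text \<open>\<open>'g l2Z\<close> plays the role of the tensor product of \<open>complex l2Z\<close> and \<open>'g\<close>. Operators of the
  form \<open>A \<otimes> B\<close> are given by their action on \<open>'g\<close>-valued functions; their action on
  elementary tensors is recorded below.\<close>

lift_definition elem_tensor :: "complex l2Z \<Rightarrow> 'g \<Rightarrow> 'g :: complex_hilbert l2Z"  (infixr "\<otimes>\<^sub>e" 70)
  is "\<lambda>\<phi> g n. \<phi> n *\<^sub>C g"
  by (rule l2Z_dominated, assumption, simp only: norm_cscale, subst mult.commute, rule order_refl)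

text \<open>\<open>neg_laplacian h\<close> is the operator \<open>- \<Delta>\<^sub>h\<close> on \<open>complex l2Z\<close> and \<open>- \<Delta>\<^sub>h \<otimes> I\<close> on \<open>'g l2Z\<close>.\<close>

lift_definition neg_laplacian :: "real \<Rightarrow> 'g :: complex_hilbert l2Z \<Rightarrow> 'g l2Z"
  is "\<lambda>h f n. (1 / h\<^sup>2) *\<^sub>R (2 *\<^sub>R f n - f (n + 1) - f (n - 1))"
proof -
  fix h :: real and f :: "int \<Rightarrow> 'g"
  assume f: "(\<lambda>n. (norm (f n))\<^sup>2) summable_on UNIV"
  have shift: "(\<lambda>n. (norm (f (n + k)))\<^sup>2) summable_on UNIV" for k
    using f summable_on_reindex_bij_betw[of "\<lambda>n. n + k" UNIV UNIV "\<lambda>n. (norm (f n))\<^sup>2"]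
    by (simp add: bij_plus_right)
  have "(\<lambda>n. (norm (2 *\<^sub>R f n))\<^sup>2) summable_on UNIV"
    by (rule l2Z_dominated[OF f, where C = 2]) simp
  then have "(\<lambda>n. (norm (2 *\<^sub>R f n - f (n + 1) - f (n - 1)))\<^sup>2) summable_on UNIV"
    using shift[of 1] shift[of "-1"] by (intro l2Z_diff) simp_all
  then show "(\<lambda>n. (norm ((1 / h\<^sup>2) *\<^sub>R (2 *\<^sub>R f n - f (n + 1) - f (n - 1))))\<^sup>2) summable_on UNIV"
    by (rule l2Z_dominated[where C = "\<bar>1 / h\<^sup>2\<bar>"]) simp
qed

text \<open>\<open>mult_tensor a B\<close> is \<open>M\<^sub>a \<otimes> B\<close>, where \<open>M\<^sub>a\<close> is multiplication by the bounded function \<open>a\<close>.\<close>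

definition mult_tensor ::
  "(int \<Rightarrow> real) \<Rightarrow> ('g :: complex_hilbert \<Rightarrow> 'g) \<Rightarrow> 'g l2Z \<Rightarrow> 'g l2Z" where
  "mult_tensor a B f = Abs_l2Z (\<lambda>n. a n *\<^sub>R B (at_site f n))"

text \<open>\<open>bra_tensor a B\<close> is \<open>\<langle>a| \<otimes> B\<close> for real-valued square-summable \<open>a\<close>.\<close>

definition bra_tensor ::
  "(int \<Rightarrow> real) \<Rightarrow> ('g :: complex_hilbert \<Rightarrow> 'g) \<Rightarrow> 'g l2Z \<Rightarrow> 'g" where
  "bra_tensor a B f = (\<Sum>\<^sub>\<infinity>n. a n *\<^sub>R B (at_site f n))"

lemma neg_laplacian_elem_tensor: "neg_laplacian h (\<phi> \<otimes>\<^sub>e g) = neg_laplacian h \<phi> \<otimes>\<^sub>e g"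
  by transfer
     (simp add: fun_eq_iff scaleR_cscale cscale_complex_def cvec.scale_left_diff_distrib
        cvec.scale_right_diff_distrib algebra_simps)

lemma at_site_mult_tensor:
  assumes "bounded_clinear B" "\<And>n. \<bar>a n\<bar> \<le> C"
  shows "at_site (mult_tensor a B f) n = a n *\<^sub>R B (at_site f n)"
proof -
  obtain D where D: "\<And>x. norm (B x) \<le> norm x * D" "D \<ge> 0"
    using assms(1) unfolding bounded_clinear_def by (meson bounded_linear.nonneg_bounded)
  have "norm (a n *\<^sub>R B (at_site f n)) \<le> (C * D) * norm (at_site f n)" for n
    using mult_mono[OF assms(2)[of n] D(1)[of "at_site f n"]] D(2) assms(2)[of 0]
    by (simp add: mult_ac)
  then have "(\<lambda>n. (norm (a n *\<^sub>R B (at_site f n)))\<^sup>2) summable_on UNIV"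
    by (rule l2Z_dominated[OF at_site_summable[of f]])
  then show ?thesis by (simp add: mult_tensor_def Abs_l2Z_inverse)
qed

lemma mult_tensor_elem_tensor:
  assumes "bounded_clinear B" "\<And>n. \<bar>a n\<bar> \<le> C"
  shows "mult_tensor a B (\<phi> \<otimes>\<^sub>e g) = mult_tensor a (\<lambda>x. x) \<phi> \<otimes>\<^sub>e B g"
proof -
  have id: "bounded_clinear (\<lambda>x :: complex. x)"
    by (simp add: bounded_clinear_def bounded_linear_ident)
  show ?thesis
    using assms(1)
    by (intro l2Z_eqI)
       (simp add: at_site_mult_tensor[OF assms] at_site_mult_tensor[OF id assms(2)]
          elem_tensor.rep_eq bounded_clinear_def scaleR_cscale cscale_cscale cscale_complex_def)
qed

lemma bra_tensor_elem_tensor: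
  assumes "bounded_clinear B" "(\<lambda>n. (a n)\<^sup>2) summable_on UNIV"
  shows "bra_tensor a B (\<phi> \<otimes>\<^sub>e g) = cinner (Abs_l2Z (\<lambda>n. complex_of_real (a n))) \<phi> *\<^sub>C B g"
proof -
  define \<psi> where "\<psi> = Abs_l2Z (\<lambda>n. complex_of_real (a n))"
  have \<psi>: "at_site \<psi> n = complex_of_real (a n)" for n
    unfolding \<psi>_def by (subst Abs_l2Z_inverse) (simp_all add: assms(2))
  have lin: "bounded_linear (\<lambda>c. c *\<^sub>C B g)"
    by (rule bounded_linear_intro[where K = "norm (B g)"])
       (simp_all add: cscale_add_left scaleR_cscale cscale_complex_def cscale_cscale norm_cscale)
  have "bra_tensor a B (\<phi> \<otimes>\<^sub>e g) = (\<Sum>\<^sub>\<infinity>n. cinner (at_site \<psi> n) (at_site \<phi> n) *\<^sub>C B g)"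
    using assms(1)
    by (simp add: bra_tensor_def elem_tensor.rep_eq bounded_clinear_def scaleR_cscale
        cscale_cscale \<psi> cinner_complex_def)
  also have "\<dots> = cinner \<psi> \<phi> *\<^sub>C B g"
    unfolding cinner_l2Z_def by (rule infsumI[OF has_sum_bounded_linear[OF lin has_sum_infsum[OF cinner_summable]]])
  finally show ?thesis by (simp add: \<psi>_def)
qed

definition psi :: "real \<Rightarrow> int \<Rightarrow> real" where
  "psi \<nu> n = sqrt (1 + (real_of_int n)\<^sup>2) powr (- \<nu> / 2)"

definition J_op :: "'g :: complex_hilbert l2Z \<Rightarrow> 'g l2Z" where
  "J_op = mult_tensor (\<lambda>n. (- 1) powi n) (\<lambda>x. x)"

section \<open>The model\<close>

definition I_Q :: "('g :: complex_hilbert \<Rightarrow> 'g) \<Rightarrow> nat \<Rightarrow> nat set" where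
  "I_Q Q d = (if Q = (\<lambda>_. 0) then {0} else {1..d})"

text \<open>Either \<open>Q = 0\<close> and \<open>\<mu> 0 = 0\<close>, or \<open>\<mu> 1, \<dots>, \<mu> d\<close> are the distinct eigenvalues of \<open>Q \<noteq> 0\<close>
  and the space is the direct sum of the eigenspaces. Orthogonality and uniqueness of the
  decomposition follow from self-adjointness.\<close>

definition finite_spectral_decomposition ::
  "('g :: complex_hilbert \<Rightarrow> 'g) \<Rightarrow> nat \<Rightarrow> (nat \<Rightarrow> real) \<Rightarrow> bool" where
  "finite_spectral_decomposition Q d \<mu> \<longleftrightarrow> selfadjoint_op Q \<and>
     (if Q = (\<lambda>_. 0) then \<mu> 0 = 0
      else inj_on \<mu> {1..d} \<and> (\<forall>s\<in>{1..d}. eigspace Q (\<mu> s) \<noteq> {0}) \<and>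
        (\<forall>x. \<exists>y. (\<forall>s\<in>{1..d}. y s \<in> eigspace Q (\<mu> s)) \<and> x = (\<Sum>s\<in>{1..d}. y s)))"

text \<open>For \<open>Q = 0\<close> this is the identity, because then \<open>\<mu> 0 = 0\<close>.\<close>

definition pi_proj :: "('g :: complex_hilbert \<Rightarrow> 'g) \<Rightarrow> (nat \<Rightarrow> real) \<Rightarrow> nat \<Rightarrow> 'g \<Rightarrow> 'g" where
  "pi_proj Q \<mu> s = orth_proj (eigspace Q (\<mu> s))"

definition H_free :: "real \<Rightarrow> ('g :: complex_hilbert \<Rightarrow> 'g) \<Rightarrow> 'g l2Z \<Rightarrow> 'g l2Z" where
  "H_free h Q f = neg_laplacian h f + mult_tensor (\<lambda>_. 1) Q f"

text \<open>The two thresholds attached to \<open>\<mu> s\<close> are indexed by \<open>i \<in> {1, 2}\<close>; \<open>toward_threshold\<close> is the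
  corresponding one-sided limit from inside the band \<open>(\<mu> s, 4 / h\<^sup>2 + \<mu> s)\<close>. For \<open>Q = 0\<close> the
  non-degeneracy conditions are vacuous.\<close>

definition threshold :: "real \<Rightarrow> real \<Rightarrow> nat \<Rightarrow> real" where
  "threshold h \<mu>s i = (if i = 1 then \<mu>s else 4 / h\<^sup>2 + \<mu>s)"

definition toward_threshold :: "real \<Rightarrow> real \<Rightarrow> nat \<Rightarrow> real filter" where
  "toward_threshold h \<mu>s i = (if i = 1 then at_right \<mu>s else at_left (4 / h\<^sup>2 + \<mu>s))"

definition nondegenerate_lower ::
  "real \<Rightarrow> ('g :: complex_hilbert \<Rightarrow> 'g) \<Rightarrow> nat \<Rightarrow> (nat \<Rightarrow> real) \<Rightarrow> nat \<Rightarrow> bool" where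
  "nondegenerate_lower h Q d \<mu> s \<longleftrightarrow> (\<forall>s'\<in>I_Q Q d. s' \<noteq> s \<longrightarrow> \<mu> s \<noteq> 4 / h\<^sup>2 + \<mu> s')"

definition nondegenerate_upper ::
  "real \<Rightarrow> ('g :: complex_hilbert \<Rightarrow> 'g) \<Rightarrow> nat \<Rightarrow> (nat \<Rightarrow> real) \<Rightarrow> nat \<Rightarrow> bool" where
  "nondegenerate_upper h Q d \<mu> s \<longleftrightarrow> (\<forall>s'\<in>I_Q Q d. s' \<noteq> s \<longrightarrow> 4 / h\<^sup>2 + \<mu> s \<noteq> \<mu> s')"

text \<open>The factor \<open>\<V>\<^bsup>1/2\<^esup> (M\<^sub>\<psi> \<otimes> K)\<close>, so that \<open>M\<^sup>* M\<close> is the perturbation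
  \<open>V = (M\<^sub>\<psi> \<otimes> K\<^sup>*) \<V> (M\<^sub>\<psi> \<otimes> K)\<close>.\<close>

definition M_factor ::
  "real \<Rightarrow> ('g :: complex_hilbert l2Z \<Rightarrow> 'g l2Z) \<Rightarrow> ('g \<Rightarrow> 'g) \<Rightarrow> 'g l2Z \<Rightarrow> 'g l2Z" where
  "M_factor \<nu> \<V> K = op_sqrt \<V> \<circ> mult_tensor (psi \<nu>) K"

definition bold_V ::
  "('g :: complex_hilbert l2Z \<Rightarrow> 'g l2Z) \<Rightarrow> ('g \<Rightarrow> 'g) \<Rightarrow> 'g l2Z \<Rightarrow> 'g l2Z" where
  "bold_V \<V> K = mult_tensor (\<lambda>_. 1) (cadjoint K) \<circ> \<V> \<circ> mult_tensor (\<lambda>_. 1) K"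

definition bold_V_J ::
  "('g :: complex_hilbert l2Z \<Rightarrow> 'g l2Z) \<Rightarrow> ('g \<Rightarrow> 'g) \<Rightarrow> 'g l2Z \<Rightarrow> 'g l2Z" where
  "bold_V_J \<V> K = cadjoint J_op \<circ> bold_V \<V> K \<circ> J_op"

definition P_op ::
  "real \<Rightarrow> ('g :: complex_hilbert \<Rightarrow> 'g) \<Rightarrow> (nat \<Rightarrow> real) \<Rightarrow> nat \<Rightarrow> 'g l2Z \<Rightarrow> 'g" where
  "P_op \<nu> Q \<mu> s = bra_tensor (psi \<nu>) (pi_proj Q \<mu> s)"

text \<open>The spectral counting functions \<open>\<Phi>\<^sub>1\<close> and \<open>\<Phi>\<^sub>2\<close> of the effective operators.
  With \<open>r = (2 / h) * sqrt \<bar>z - E\<bar>\<close>, the leading term of the spectral shift function at the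
  threshold \<open>z\<close> is \<open>(1 / \<pi>) \<integral>\<^sub>0\<^sup>\<infinity> \<Phi>(r / t) / (1 + t\<^sup>2) dt\<close>. For \<open>\<Phi>(r) = C r\<^bsup>-\<alpha>\<^esup>\<close> with
  \<open>0 < \<alpha> < 1\<close> the factor is \<open>(1 / \<pi>) \<integral>\<^sub>0\<^sup>\<infinity> t\<^bsup>\<alpha>\<^esup> / (1 + t\<^sup>2) dt = 1 / (2 cos (\<pi> \<alpha> / 2))\<close>.\<close>

definition Phi :: "nat \<Rightarrow> real \<Rightarrow> ('g :: complex_hilbert \<Rightarrow> 'g) \<Rightarrow> (nat \<Rightarrow> real) \<Rightarrow> nat \<Rightarrow>
    ('g l2Z \<Rightarrow> 'g l2Z) \<Rightarrow> ('g \<Rightarrow> 'g) \<Rightarrow> real \<Rightarrow> real" where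
  "Phi i \<nu> Q \<mu> s \<V> K r = Re (op_trace (spectral_proj_above r
     (P_op \<nu> Q \<mu> s \<circ> (if i = 1 then bold_V \<V> K else bold_V_J \<V> K) \<circ> cadjoint (P_op \<nu> Q \<mu> s))))"

end

theory Submission
  imports Defs "HOL-Real_Asymp.Real_Asymp"
begin

text \<open>Let \<open>T(E + i0) = A + i B\<close> be the boundary value of the sandwiched resolvent, computed from the
  explicit lattice Green function. As \<open>E\<close> tends to a nondegenerate threshold of the band \<open>s\<close>, the
  weight \<open>\<nu> > 3\<close> keeps \<open>A\<close> bounded in Hilbert--Schmidt norm, whereas \<open>B\<close> lies between
  \<open>(1 \<mp> \<eta>) Y\<^sup>* Y / \<rho> \<mp> S\<close> with \<open>S \<ge> 0\<close> of bounded trace and \<open>\<rho> = (2 / h) \<bar>z - E\<bar>\<^bsup>1/2\<^esup>\<close>; here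
  \<open>Y\<close> does not depend on \<open>E\<close>, and \<open>Y Y\<^sup>*\<close> is the effective operator, whose counting function is \<open>\<Phi>\<close>. By Weyl's inequalities the number of eigenvalues of \<open>A + t B\<close> above \<open>1\<close> is, for \<open>t > 0\<close>,
  \<open>\<Phi>(c \<rho> / t)\<close> with \<open>c\<close> close to \<open>1\<close>, up to errors whose integrals against \<open>dt / (1 + t\<^sup>2)\<close> stay bounded.
  Since \<open>\<Phi>\<close> is regularly varying of index \<open>-\<alpha>\<close>, dominated convergence with Potter's bound gives
  \<open>\<integral> \<Phi>(\<rho> / t) dt / (1 + t\<^sup>2) \<sim> \<Phi>(\<rho>) \<integral> t\<^sup>\<alpha> dt / (1 + t\<^sup>2)\<close> over \<open>t > 0\<close>, and the last integral is
  \<open>\<pi> / (2 cos (\<pi> \<alpha> / 2))\<close>; the logarithmic cases have index \<open>0\<close>.\<close>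

section \<open>Hilbert space geometry\<close>

text \<open>Near an edge of the band the Green function is singular like 1 / sin \<theta>, where the
  root of the characteristic equation is exp(i \<theta>) and \<theta> tends to 0 or \<pi>. Its real
  part -h^2 sin(|j| \<theta>) / (2 sin \<theta>) stays below h^2 |j| / 2 in modulus: the singularity
  is traded for linear growth, and psi(n) (1 + |n|) is square-summable exactly when \<nu> > 3. The
  imaginary part h^2 cos(j \<theta>) / (2 sin \<theta>) is singular but, by the addition theorem, a
  sum of two product kernels. The cosine factor tends to 1 or to (-1)^n, which is where J comes
  from; the sine factor and the deviation of the cosine are at most |n| |exp(i \<theta>) \<mp> 1|,
  so their squares beat the singular coefficient. Nondegeneracy keeps the other bands away from
  their own edges. Since only a Hilbert--Schmidt bound on A is used, the sign of A is irrelevant,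
  and one estimate serves both perturbations +V and -V.\<close>

instance complex_hilbert \<subseteq> banach ..

lemma cinner_add_left: "cinner (x + y) z = cinner x z + cinner y z"
  by (metis cinner_add_right cinner_commute complex_cnj_add)

lemma cinner_cscale_left: "cinner (c *\<^sub>C x) y = cnj c * cinner x y"
  by (metis cinner_commute cinner_cscale_right complex_cnj_mult)

lemma cinner_scaleR_right: "cinner x (r *\<^sub>R y) = complex_of_real r * cinner x y"
  by (simp add: scaleR_cscale cinner_cscale_right)

lemma cinner_scaleR_left: "cinner (r *\<^sub>R x) y = complex_of_real r * cinner x y"
  by (simp add: scaleR_cscale cinner_cscale_left)

lemma cinner_zero_right [simp]: "cinner x 0 = 0"
  using cinner_add_right[of x 0 0] by simp

lemma cinner_zero_left [simp]: "cinner 0 x = 0"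
  using cinner_add_left[of 0 0 x] by simp

lemma cinner_minus_right: "cinner x (- y) = - cinner x y"
  using cinner_add_right[of x y "- y"] by (simp add: eq_neg_iff_add_eq_0 add.commute)

lemma cinner_minus_left: "cinner (- x) y = - cinner x y"
  using cinner_add_left[of x "- x" y] by (simp add: eq_neg_iff_add_eq_0 add.commute)

lemma cinner_diff_right: "cinner x (y - z) = cinner x y - cinner x z"
  using cinner_add_right[of x y "- z"] by (simp add: cinner_minus_right)

lemma cinner_diff_left: "cinner (x - y) z = cinner x z - cinner y z"
  using cinner_add_left[of x "- y" z] by (simp add: cinner_minus_left)

lemma cinner_sum_right: "cinner x (\<Sum>i\<in>I. f i) = (\<Sum>i\<in>I. cinner x (f i))"
  by (induction I rule: infinite_finite_induct) (auto simp: cinner_add_right)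

lemma cinner_sum_left: "cinner (\<Sum>i\<in>I. f i) x = (\<Sum>i\<in>I. cinner (f i) x)"
  by (induction I rule: infinite_finite_induct) (auto simp: cinner_add_left)

lemma bounded_bilinear_cinner: "bounded_bilinear cinner"
  by (rule bounded_bilinear.intro)
     (auto simp: cinner_add_left cinner_add_right cinner_scaleR_left cinner_scaleR_right
        scaleR_conv_of_real norm_cinner_le intro!: exI[of _ 1])

lemmas tendsto_cinner [tendsto_intros] = bounded_bilinear.tendsto[OF bounded_bilinear_cinner]

lemma bounded_bilinear_cscale: "bounded_bilinear cscale"
  by (rule bounded_bilinear.intro)
     (auto simp: cscale_add_left cscale_add_right scaleR_cscale cscale_cscale
        cscale_complex_def mult.commute norm_cscale intro!: exI[of _ 1])

lemmas tendsto_cscale [tendsto_intros] = bounded_bilinear.tendsto[OF bounded_bilinear_cscale]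

lemma cinner_eq_zero_commute: "cinner x y = 0 \<longleftrightarrow> cinner y x = 0"
  by (metis cinner_commute complex_cnj_zero)

lemma pythagoras: "cinner x y = 0 \<Longrightarrow> (norm (x + y))\<^sup>2 = (norm x)\<^sup>2 + (norm y)\<^sup>2"
  by (simp add: power2_norm_eq_inner inner_add_left inner_add_right inner_commute[of y x])
     (simp add: inner_cinner)

lemma norm_sum_sq_le: "(norm (x + y))\<^sup>2 \<le> 2 * (norm x)\<^sup>2 + 2 * (norm (y :: 'a :: real_normed_vector))\<^sup>2"
proof -
  have "(norm (x + y))\<^sup>2 \<le> (norm x + norm y)\<^sup>2"
    by (intro power_mono norm_triangle_ineq) auto
  then show ?thesis
    using sum_squares_bound[of "norm x" "norm y"] by (simp add: power2_sum)
qed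

lemma bounded_clinearI:
  assumes "\<And>x y. A (x + y) = A x + A y" "\<And>c x. A (c *\<^sub>C x) = c *\<^sub>C A x"
    "\<And>x. norm (A x) \<le> norm x * K"
  shows "bounded_clinear A"
  unfolding bounded_clinear_def
  using assms by (auto intro!: bounded_linear_intro[where K = K] simp: scaleR_cscale)

lemma bounded_clinear_bounded:
  assumes "bounded_clinear A"
  obtains K where "K > 0" "\<And>x. norm (A x) \<le> K * norm x"
  using bounded_linear.pos_bounded[of A] assms unfolding bounded_clinear_def
  by (auto simp: mult.commute)

context
  fixes A :: "'a :: complex_hilbert \<Rightarrow> 'b :: complex_hilbert"
  assumes A: "bounded_clinear A"
begin

lemma bounded_clinear_linear: "bounded_linear A"
  using A by (simp add: bounded_clinear_def)

lemma bounded_clinear_add: "A (x + y) = A x + A y"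
  using bounded_linear.linear[OF bounded_clinear_linear] by (rule linear_add)

lemma bounded_clinear_diff: "A (x - y) = A x - A y"
  using bounded_linear.linear[OF bounded_clinear_linear] by (rule linear_diff)

lemma bounded_clinear_zero: "A 0 = 0"
  using bounded_linear.linear[OF bounded_clinear_linear] by (rule linear_0)

lemma bounded_clinear_sum: "A (\<Sum>i\<in>I. f i) = (\<Sum>i\<in>I. A (f i))"
  using bounded_linear.linear[OF bounded_clinear_linear] by (rule linear_sum)

lemma bounded_clinear_cscale: "A (c *\<^sub>C x) = c *\<^sub>C A x"
  using A by (simp add: bounded_clinear_def)

lemma bounded_clinear_scaleR: "A (r *\<^sub>R x) = r *\<^sub>R A x"
  by (simp add: scaleR_cscale bounded_clinear_cscale)

end

lemma bounded_clinear_ident: "bounded_clinear (\<lambda>x. x)"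
  by (simp add: bounded_clinear_def bounded_linear_ident)

lemma bounded_clinear_const_zero: "bounded_clinear (\<lambda>x. 0)"
  by (simp add: bounded_clinear_def)

lemma bounded_clinear_compose:
  assumes "bounded_clinear A" "bounded_clinear B"
  shows "bounded_clinear (\<lambda>x. A (B x))"
  using assms by (auto simp: bounded_clinear_def intro: bounded_linear_compose)

lemma bounded_clinear_plus:
  assumes "bounded_clinear A" "bounded_clinear B"
  shows "bounded_clinear (\<lambda>x. A x + B x)"
  using assms by (auto simp: bounded_clinear_def cscale_add_right intro: bounded_linear_add)

lemma bounded_clinear_scaled:
  assumes "bounded_clinear A"
  shows "bounded_clinear (\<lambda>x. c *\<^sub>C A x)"
proof -
  have "bounded_linear (\<lambda>x. c *\<^sub>C A x)"
    using bounded_linear_compose[OF bounded_bilinear.bounded_linear_right[OF bounded_bilinear_cscale]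
        bounded_clinear_linear[OF assms]] .
  then show ?thesis
    by (simp add: bounded_clinear_def bounded_clinear_cscale[OF assms] cscale_cscale mult.commute)
qed

lemma bounded_clinear_scaledR:
  assumes "bounded_clinear A"
  shows "bounded_clinear (\<lambda>x. r *\<^sub>R A x)"
  using bounded_clinear_scaled[OF assms, of "complex_of_real r"] by (simp add: scaleR_cscale)

lemma bounded_clinear_uminus:
  assumes "bounded_clinear A"
  shows "bounded_clinear (\<lambda>x. - A x)"
  using bounded_clinear_scaled[OF assms, of "-1"] by (simp add: cscale_one)

lemma bounded_clinear_minus_op:
  assumes "bounded_clinear A" "bounded_clinear B"
  shows "bounded_clinear (\<lambda>x. A x - B x)"
  using bounded_clinear_plus[OF assms(1) bounded_clinear_uminus[OF assms(2)]] by simp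

lemma bounded_clinear_sum_op:
  assumes "\<And>i. i \<in> I \<Longrightarrow> bounded_clinear (A i)"
  shows "bounded_clinear (\<lambda>x. \<Sum>i\<in>I. A i x)"
  using assms
  by (induction I rule: infinite_finite_induct)
     (auto intro: bounded_clinear_plus bounded_clinear_const_zero)

section \<open>Closed subspaces, projections and the Riesz representation\<close>

lemma subspace_closure:
  assumes "cvec.subspace S"
  shows "cvec.subspace (closure S)"
proof (rule cvec.subspaceI)
  show "0 \<in> closure S"
    using cvec.subspace_0[OF assms] closure_subset by blast
next
  fix x y assume "x \<in> closure S" "y \<in> closure S"
  then obtain f g where fg: "\<And>n. f n \<in> S" "f \<longlonglongrightarrow> x" "\<And>n. g n \<in> S" "g \<longlonglongrightarrow> y"
    by (auto simp: closure_sequential)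
  then show "x + y \<in> closure S"
    unfolding closure_sequential
    by (intro exI[of _ "\<lambda>n. f n + g n"]) (auto intro: tendsto_add cvec.subspace_add[OF assms])
next
  fix c x assume "x \<in> closure S"
  then obtain f where f: "\<And>n. f n \<in> S" "f \<longlonglongrightarrow> x"
    by (auto simp: closure_sequential)
  then show "c *\<^sub>C x \<in> closure S"
    unfolding closure_sequential
    by (intro exI[of _ "\<lambda>n. c *\<^sub>C f n"])
       (auto intro: tendsto_cscale cvec.subspace_scale[OF assms])
qed

text \<open>The form is antilinear on the left, so \<open>inner (\<i> *\<^sub>C x) y\<close> is the
  imaginary part of \<open>cinner x y\<close>. Real variational arguments thus yield complex
  orthogonality.\<close>

lemma cinner_zeroI:
  assumes "inner x y = 0" "inner (\<i> *\<^sub>C x) y = 0"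
  shows "cinner x y = 0"
  using assms by (intro complex_eqI) (simp_all add: inner_cinner cinner_cscale_left)

text \<open>Moving from y along z changes the squared distance by a quadratic polynomial in the
  step; at its minimizer t the distance would drop unless the linear term vanishes. The real
  argument is applied to z and to i z.\<close>

lemma minimal_distance_orthogonal:
  assumes S: "cvec.subspace S" and y: "y \<in> S" and min: "\<And>w. w \<in> S \<Longrightarrow> norm (x - y) \<le> norm (x - w)"
    and z: "z \<in> S"
  shows "cinner z (x - y) = 0"
proof -
  have *: "inner z (x - y) = 0" if z: "z \<in> S" for z
  proof (rule ccontr)
    assume ne: "inner z (x - y) \<noteq> 0"
    then have z0: "z \<noteq> 0" by auto
    define u where "u = x - y"
    define t where "t = inner z u / inner z z"
    have "y + t *\<^sub>R z \<in> S"
      unfolding scaleR_cscale using y z S by (intro cvec.subspace_add cvec.subspace_scale)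
    then have "norm (x - y) \<le> norm (x - (y + t *\<^sub>R z))" by (rule min)
    also have "x - (y + t *\<^sub>R z) = u - t *\<^sub>R z" by (simp add: u_def)
    finally have "(norm u)\<^sup>2 \<le> (norm (u - t *\<^sub>R z))\<^sup>2"
      unfolding u_def by (intro power_mono) auto
    also have "\<dots> = (norm u)\<^sup>2 - 2 * t * inner z u + t\<^sup>2 * inner z z"
      unfolding power2_norm_eq_inner
      by (simp add: inner_diff_left inner_diff_right inner_commute[of u z] power2_eq_square
          algebra_simps)
    finally have "2 * t * inner z u \<le> t\<^sup>2 * inner z z" by simp
    also have "\<dots> = t * inner z u" using z0 by (simp add: t_def power2_eq_square)
    finally have "t * inner z u \<le> 0" by simp
    moreover have "t * inner z u = (inner z u)\<^sup>2 / inner z z"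
      by (simp add: t_def power2_eq_square)
    ultimately show False using ne z0 unfolding u_def[symmetric]
      by (metis divide_le_0_iff inner_gt_zero_iff not_less zero_less_power2)
  qed
  show ?thesis
    by (intro cinner_zeroI * z cvec.subspace_scale[OF S])
qed

text \<open>A minimizing sequence for the distance is Cauchy by the parallelogram identity, because
  midpoints stay in the subspace; completeness then supplies the minimizer.\<close>

lemma closed_subspace_projection:
  fixes x :: "'a :: complex_hilbert"
  assumes S: "cvec.subspace S" "closed S"
  obtains y where "y \<in> S" "\<And>z. z \<in> S \<Longrightarrow> cinner z (x - y) = 0"
proof -
  define d where "d = infdist x S"
  have ne: "S \<noteq> {}" using cvec.subspace_0[OF S(1)] by auto
  have dle: "d \<le> norm (x - w)" if "w \<in> S" for w
    using infdist_le[OF that, of x] by (simp add: d_def dist_norm)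
  have d0: "0 \<le> d" by (simp add: d_def infdist_nonneg)
  have "\<exists>y\<in>S. norm (x - y) < d + 1 / Suc n" for n
    using cInf_lessD[of "dist x ` S" "d + 1 / Suc n"] ne
    by (auto simp: d_def infdist_notempty[OF ne] dist_norm)
  then obtain Y where Y: "\<And>n. Y n \<in> S" "\<And>n. norm (x - Y n) < d + 1 / Suc n" by metis
  have par: "(norm (Y m - Y n))\<^sup>2 \<le> 2 * ((norm (x - Y m))\<^sup>2 + (norm (x - Y n))\<^sup>2) - 4 * d\<^sup>2" for m n
  proof -
    have "(1/2) *\<^sub>R (Y m + Y n) \<in> S"
      unfolding scaleR_cscale by (intro cvec.subspace_scale cvec.subspace_add S Y)
    then have "d\<^sup>2 \<le> (norm (x - (1/2) *\<^sub>R (Y m + Y n)))\<^sup>2"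
      using dle d0 by (intro power_mono) auto
    moreover have "(norm (Y m - Y n))\<^sup>2 + 4 * (norm (x - (1/2) *\<^sub>R (Y m + Y n)))\<^sup>2
        = 2 * ((norm (x - Y m))\<^sup>2 + (norm (x - Y n))\<^sup>2)"
      by (simp add: power2_norm_eq_inner inner_diff_left inner_diff_right inner_add_left inner_add_right
          inner_commute algebra_simps)
    ultimately show ?thesis by linarith
  qed
  have lim: "(\<lambda>n. norm (x - Y n)) \<longlonglongrightarrow> d"
  proof (rule tendsto_sandwich[where f = "\<lambda>_. d" and h = "\<lambda>n. d + 1 / real (Suc n)"])
    show "(\<lambda>n. d + 1 / real (Suc n)) \<longlonglongrightarrow> d"
      using tendsto_add[OF tendsto_const[of d] lim_inverse_n'[THEN LIMSEQ_Suc]] by simp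
    show "\<forall>\<^sub>F n in sequentially. d \<le> norm (x - Y n)"
      by (intro always_eventually allI dle Y(1))
    show "\<forall>\<^sub>F n in sequentially. norm (x - Y n) \<le> d + 1 / real (Suc n)"
      by (intro always_eventually allI less_imp_le Y(2))
  qed (rule tendsto_const)
  have "Cauchy Y"
  proof (rule CauchyI)
    fix e :: real assume e: "0 < e"
    have "(\<lambda>n. (norm (x - Y n))\<^sup>2) \<longlonglongrightarrow> d\<^sup>2" by (intro tendsto_intros lim)
    then have "\<forall>\<^sub>F n in sequentially. (norm (x - Y n))\<^sup>2 < d\<^sup>2 + e\<^sup>2 / 4"
      using e by (intro order_tendstoD(2)) auto
    then obtain N where N: "\<And>n. n \<ge> N \<Longrightarrow> (norm (x - Y n))\<^sup>2 < d\<^sup>2 + e\<^sup>2 / 4"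
      by (auto simp: eventually_sequentially)
    have "norm (Y m - Y n) < e" if "m \<ge> N" "n \<ge> N" for m n
    proof (rule power2_less_imp_less)
      show "(norm (Y m - Y n))\<^sup>2 < e\<^sup>2" using par[of m n] N[OF that(1)] N[OF that(2)] by argo
    qed (use e in auto)
    then show "\<exists>M. \<forall>m\<ge>M. \<forall>n\<ge>M. norm (Y m - Y n) < e" by blast
  qed
  then obtain y where y: "Y \<longlonglongrightarrow> y" using Cauchy_convergent convergent_def by blast
  have yS: "y \<in> S" using closed_sequentially[OF S(2)] Y(1) y by blast
  have "(\<lambda>n. norm (x - Y n)) \<longlonglongrightarrow> norm (x - y)" by (intro tendsto_intros y)
  then have "norm (x - y) = d" using lim LIMSEQ_unique by blast
  then show ?thesis
    using minimal_distance_orthogonal[OF S(1) yS] dle that[OF yS] by metis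
qed

text \<open>\<open>orth_proj\<close> is a definite description: two candidates differ by a vector of
  S that is orthogonal to itself.\<close>

lemma orth_proj_eqI:
  assumes "cvec.subspace S" "y \<in> S" "\<And>z. z \<in> S \<Longrightarrow> cinner z (x - y) = 0"
  shows "orth_proj S x = y"
  unfolding orth_proj_def
proof (rule the_equality)
  fix w assume w: "w \<in> S \<and> (\<forall>z\<in>S. cinner z (x - w) = 0)"
  have "w - y \<in> S" using assms(1,2) w cvec.subspace_diff by blast
  then have "cinner (w - y) (x - y) - cinner (w - y) (x - w) = 0" using w assms(3) by simp
  then have "cinner (w - y) (w - y) = 0" by (simp flip: cinner_diff_right)
  then show "w = y" by (simp add: cinner_self)
qed (use assms in auto)

lemma cinner_ext: "(\<And>z. cinner z x = cinner z y) \<Longrightarrow> x = y"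
proof -
  assume *: "\<And>z. cinner z x = cinner z y"
  have "cinner (x - y) (x - y) = 0" by (subst cinner_diff_right) (simp add: *)
  then show "x = y" by (simp add: cinner_self)
qed

text \<open>A vector u orthogonal to the kernel represents f up to a scalar, because f(u) v - f(v) u
  lies in the kernel for every v.\<close>

lemma riesz_representation:
  fixes f :: "'a :: complex_hilbert \<Rightarrow> complex"
  assumes f: "bounded_clinear f"
  obtains y where "\<And>x. f x = cinner y x"
proof (cases "\<forall>x. f x = 0")
  case True
  then show ?thesis using that[of 0] by simp
next
  case False
  then obtain x where x: "f x \<noteq> 0" by blast
  define S where "S = {x. f x = 0}"
  have S: "cvec.subspace S"
    by (rule cvec.subspaceI)
       (auto simp: S_def bounded_clinear_zero[OF f] bounded_clinear_add[OF f] bounded_clinear_cscale[OF f]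
         cscale_complex_def)
  have "closed S"
    unfolding S_def
    by (intro closed_Collect_eq continuous_intros linear_continuous_on bounded_clinear_linear f)
  then obtain y where y: "y \<in> S" "\<And>z. z \<in> S \<Longrightarrow> cinner z (x - y) = 0"
    using closed_subspace_projection[OF S] by metis
  define u where "u = x - y"
  have fu: "f u = f x" using y(1) by (simp add: u_def S_def bounded_clinear_diff[OF f])
  then have u0: "u \<noteq> 0" using x bounded_clinear_zero[OF f] by auto
  have "f v = cinner ((cnj (f u) / cinner u u) *\<^sub>C u) v" for v
  proof -
    have "f (f u *\<^sub>C v - f v *\<^sub>C u) = 0"
      by (simp add: bounded_clinear_diff[OF f] bounded_clinear_cscale[OF f] cscale_complex_def)
    then have "cinner (f u *\<^sub>C v - f v *\<^sub>C u) u = 0" using y(2) by (simp add: S_def u_def)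
    then have "cinner u (f u *\<^sub>C v - f v *\<^sub>C u) = 0" by (simp add: cinner_eq_zero_commute)
    then have "f v * cinner u u = f u * cinner u v"
      by (simp add: cinner_diff_right cinner_cscale_right)
    moreover have "cinner u u \<noteq> 0" using u0 by (simp add: cinner_self)
    ultimately show ?thesis
      by (simp add: cinner_cscale_left field_simps cinner_self)
  qed
  then show ?thesis using that by blast
qed

section \<open>Adjoints\<close>

text \<open>B y is the Riesz vector of the functional x -> <y, A x>; the bound on B comes from
  testing the adjoint identity at x = B y.\<close>

lemma adjoint_exists:
  fixes A :: "'a :: complex_hilbert \<Rightarrow> 'b :: complex_hilbert"
  assumes A: "bounded_clinear A"
  obtains B where "bounded_clinear B" "\<And>x y. cinner (A x) y = cinner x (B y)"
proof -
  obtain K where K: "K > 0" "\<And>x. norm (A x) \<le> K * norm x" using bounded_clinear_bounded[OF A] by metis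
  have "\<exists>z. \<forall>x. cinner y (A x) = cinner z x" for y
  proof -
    have "bounded_clinear (\<lambda>x. cinner y (A x))"
    proof (rule bounded_clinearI)
      show "norm (cinner y (A x)) \<le> norm x * (norm y * K)" for x
        using order_trans[OF norm_cinner_le[of y "A x"] mult_left_mono[OF K(2)[of x] norm_ge_zero[of y]]]
        by (simp add: mult_ac)
    qed (auto simp: bounded_clinear_add[OF A] bounded_clinear_cscale[OF A] cinner_add_right
        cinner_cscale_right cscale_complex_def)
    then show ?thesis using riesz_representation by metis
  qed
  then obtain B where B': "\<And>x y. cinner y (A x) = cinner (B y) x" by metis
  have B: "cinner (A x) y = cinner x (B y)" for x y
    by (metis B' cinner_commute)
  have "bounded_clinear B"
  proof (rule bounded_clinearI)
    show "B (x + y) = B x + B y" for x y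
      by (rule cinner_ext) (simp add: cinner_add_right flip: B)
    show "B (c *\<^sub>C x) = c *\<^sub>C B x" for c x
      by (rule cinner_ext) (simp add: cinner_cscale_right flip: B)
    fix y
    have "(norm (B y))\<^sup>2 = cmod (cinner (A (B y)) y)" unfolding B by (simp add: cinner_self norm_power)
    also have "\<dots> \<le> K * norm (B y) * norm y"
      using order_trans[OF norm_cinner_le mult_right_mono[OF K(2)]] by simp
    finally have "norm (B y) * norm (B y) \<le> norm (B y) * (norm y * K)"
      by (simp add: power2_eq_square mult_ac)
    then show "norm (B y) \<le> norm y * K"
      using K(1) by (cases "norm (B y) = 0") (auto dest: mult_left_le_imp_le)
  qed
  then show ?thesis using B that by blast
qed

lemma cadjoint_eqI:
  assumes "bounded_clinear B" "\<And>x y. cinner (A x) y = cinner x (B y)"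
  shows "cadjoint A = B"
  unfolding cadjoint_def
proof (rule the_equality)
  fix C assume C: "bounded_clinear C \<and> (\<forall>x y. cinner (A x) y = cinner x (C y))"
  show "C = B"
  proof
    fix y show "C y = B y" by (rule cinner_ext) (use C assms(2) in metis)
  qed
qed (use assms in auto)

lemma
  assumes "bounded_clinear A"
  shows bounded_clinear_cadjoint: "bounded_clinear (cadjoint A)"
    and cinner_cadjoint_right: "cinner x (cadjoint A y) = cinner (A x) y"
    and cinner_cadjoint_left: "cinner (cadjoint A y) x = cinner y (A x)"
proof -
  obtain B where "bounded_clinear B" "\<And>x y. cinner (A x) y = cinner x (B y)"
    using adjoint_exists[OF assms] by metis
  with cadjoint_eqI[of B A] show "bounded_clinear (cadjoint A)"
    and *: "cinner x (cadjoint A y) = cinner (A x) y" for x y by auto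
  show "cinner (cadjoint A y) x = cinner y (A x)"
    by (metis * cinner_commute)
qed

lemma cadjoint_cadjoint: "bounded_clinear A \<Longrightarrow> cadjoint (cadjoint A) = A"
  by (intro cadjoint_eqI) (auto simp: cinner_cadjoint_left)

lemma cadjoint_compose:
  assumes "bounded_clinear A" "bounded_clinear B"
  shows "cadjoint (\<lambda>x. A (B x)) = (\<lambda>x. cadjoint B (cadjoint A x))"
  using assms
  by (intro cadjoint_eqI) (auto intro: bounded_clinear_compose bounded_clinear_cadjoint
      simp: cinner_cadjoint_right)

lemma selfadjoint_op_cadjoint: "selfadjoint_op A \<Longrightarrow> cadjoint A = A"
  by (intro cadjoint_eqI) (auto simp: selfadjoint_op_def)

lemma norm_cadjoint_le:
  assumes A: "bounded_clinear A" and "\<And>x. norm (A x) \<le> K * norm x" and "0 \<le> K"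
  shows "norm (cadjoint A y) \<le> K * norm y"
proof (cases "cadjoint A y = 0")
  case True
  then show ?thesis using assms(3) by simp
next
  case False
  have "(norm (cadjoint A y))\<^sup>2 = cmod (cinner (cadjoint A y) (cadjoint A y))"
    by (simp add: cinner_self norm_power)
  also have "\<dots> = cmod (cinner (A (cadjoint A y)) y)" by (simp add: cinner_cadjoint_right[OF A])
  also have "\<dots> \<le> K * norm (cadjoint A y) * norm y"
    using order_trans[OF norm_cinner_le mult_right_mono[OF assms(2)]] by simp
  finally show ?thesis using False by (simp add: power2_eq_square)
qed

section \<open>Orthonormal sets\<close>

definition orthonormal :: "'a :: complex_hilbert set \<Rightarrow> bool" where
  "orthonormal B \<longleftrightarrow> (\<forall>e\<in>B. norm e = 1) \<and> (\<forall>e\<in>B. \<forall>f\<in>B. e \<noteq> f \<longrightarrow> cinner e f = 0)"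

text \<open>Meaningful for finite \<open>E\<close>; over an infinite set the sum has the default
  value 0.\<close>

definition proj_onto :: "'a :: complex_hilbert set \<Rightarrow> 'a \<Rightarrow> 'a" where
  "proj_onto E x = (\<Sum>e\<in>E. cinner e x *\<^sub>C e)"

lemma is_onb_iff: "is_onb B \<longleftrightarrow> orthonormal B \<and> closure (cvec.span B) = UNIV"
  by (auto simp: is_onb_def orthonormal_def)

lemma orthonormal_subset: "orthonormal B \<Longrightarrow> A \<subseteq> B \<Longrightarrow> orthonormal A"
  by (auto simp: orthonormal_def)

lemma orthonormal_cinner:
  "orthonormal E \<Longrightarrow> e \<in> E \<Longrightarrow> f \<in> E \<Longrightarrow> cinner e f = (if e = f then 1 else 0)"
  by (auto simp: orthonormal_def cinner_self)

lemma orthonormal_insert: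
  assumes "orthonormal E" "norm u = 1" "\<And>e. e \<in> E \<Longrightarrow> cinner e u = 0"
  shows "orthonormal (insert u E)"
  using assms by (auto simp: orthonormal_def) (metis cinner_eq_zero_commute)

lemma cinner_combination:
  assumes "orthonormal E" "finite E" "e \<in> E"
  shows "cinner e (\<Sum>f\<in>E. c f *\<^sub>C f) = c e"
proof -
  have "cinner e (\<Sum>f\<in>E. c f *\<^sub>C f) = (\<Sum>f\<in>E. if f = e then c e else 0)"
    unfolding cinner_sum_right cinner_cscale_right
    by (intro sum.cong refl) (auto simp: orthonormal_cinner[OF assms(1,3)])
  then show ?thesis using assms by simp
qed

lemma cinner_proj_onto:
  "orthonormal E \<Longrightarrow> finite E \<Longrightarrow> e \<in> E \<Longrightarrow> cinner e (proj_onto E x) = cinner e x"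
  unfolding proj_onto_def by (rule cinner_combination)

lemma proj_onto_in_span: "proj_onto E x \<in> cvec.span E"
  unfolding proj_onto_def by (intro cvec.span_sum cvec.span_scale cvec.span_base)

lemma cinner_span_zero:
  assumes "\<And>e. e \<in> E \<Longrightarrow> cinner e x = 0" "y \<in> cvec.span E"
  shows "cinner y x = 0"
  using assms(2)
  by (induction rule: cvec.span_induct_alt) (auto simp: cinner_add_left cinner_cscale_left assms(1))

lemma cinner_closure_span_zero:
  assumes "\<And>e. e \<in> E \<Longrightarrow> cinner e x = 0" "y \<in> closure (cvec.span E)"
  shows "cinner y x = 0"
proof -
  obtain f where f: "\<And>n. f n \<in> cvec.span E" "f \<longlonglongrightarrow> y" using assms(2) by (auto simp: closure_sequential)
  have "(\<lambda>n. cinner (f n) x) \<longlonglongrightarrow> cinner y x" by (intro tendsto_intros f)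
  moreover have "cinner (f n) x = 0" for n using cinner_span_zero[OF assms(1) f(1)] by blast
  ultimately show ?thesis by (simp add: LIMSEQ_const_iff)
qed

lemma cinner_diff_proj_onto:
  assumes "orthonormal E" "finite E" "y \<in> cvec.span E"
  shows "cinner y (x - proj_onto E x) = 0"
  by (rule cinner_span_zero[OF _ assms(3)])
     (simp add: cinner_diff_right cinner_proj_onto[OF assms(1,2)])

lemma norm_proj_onto:
  assumes "orthonormal E" "finite E"
  shows "(norm (proj_onto E x))\<^sup>2 = (\<Sum>e\<in>E. (cmod (cinner e x))\<^sup>2)"
proof -
  have "cinner (proj_onto E x) (proj_onto E x) = (\<Sum>e\<in>E. cnj (cinner e x) * cinner e (proj_onto E x))"
    by (subst proj_onto_def) (simp add: cinner_sum_left cinner_cscale_left)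
  also have "\<dots> = (\<Sum>e\<in>E. complex_of_real ((cmod (cinner e x))\<^sup>2))"
    by (intro sum.cong refl) (simp only: cinner_proj_onto[OF assms] complex_norm_square mult.commute)
  also have "\<dots> = complex_of_real (\<Sum>e\<in>E. (cmod (cinner e x))\<^sup>2)" by simp
  finally show ?thesis unfolding cinner_self of_real_eq_iff .
qed

lemma norm_diff_proj_onto:
  assumes "orthonormal E" "finite E"
  shows "(norm x)\<^sup>2 = (\<Sum>e\<in>E. (cmod (cinner e x))\<^sup>2) + (norm (x - proj_onto E x))\<^sup>2"
  using pythagoras[OF cinner_diff_proj_onto[OF assms proj_onto_in_span], of x x]
  by (simp add: norm_proj_onto[OF assms])

lemma bessel:
  assumes "orthonormal E" "finite E"
  shows "(\<Sum>e\<in>E. (cmod (cinner e x))\<^sup>2) \<le> (norm x)\<^sup>2"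
  using norm_diff_proj_onto[OF assms, of x] by simp

lemma proj_onto_closest:
  assumes "orthonormal E" "finite E" "y \<in> cvec.span E"
  shows "norm (x - proj_onto E x) \<le> norm (x - y)"
proof (rule power2_le_imp_le)
  have "proj_onto E x - y \<in> cvec.span E"
    by (intro cvec.span_diff proj_onto_in_span assms)
  from pythagoras[OF cinner_diff_proj_onto[OF assms(1,2) this], of x]
  show "(norm (x - proj_onto E x))\<^sup>2 \<le> (norm (x - y))\<^sup>2" by simp
qed simp

lemma proj_onto_span:
  assumes "orthonormal E" "finite E" "x \<in> cvec.span E"
  shows "proj_onto E x = x"
  using proj_onto_closest[OF assms, of x] by simp

lemma orthonormal_independent:
  assumes "orthonormal E"
  shows "cvec.independent E"
proof
  assume "cvec.dependent E"
  then obtain e where e: "e \<in> E" "e \<in> cvec.span (E - {e})" by (auto simp: cvec.dependent_def)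
  have "cinner e e = 0"
    by (rule cinner_span_zero[OF _ e(2)]) (use e(1) in \<open>auto simp: orthonormal_cinner[OF assms]\<close>)
  then show False using e(1) by (simp add: orthonormal_cinner[OF assms])
qed

lemma in_span_finite:
  assumes "y \<in> cvec.span B"
  obtains F where "finite F" "F \<subseteq> B" "y \<in> cvec.span F"
proof -
  obtain F r where "finite F" "F \<subseteq> B" "y = (\<Sum>a\<in>F. r a *\<^sub>C a)"
    using assms by (auto simp: cvec.span_explicit)
  moreover have "(\<Sum>a\<in>F. r a *\<^sub>C a) \<in> cvec.span F"
    by (intro cvec.span_sum cvec.span_scale cvec.span_base)
  ultimately show ?thesis using that by blast
qed

text \<open>Density gives a finite F whose span comes within sqrt \<epsilon> of x. For every finite
  G above F the Fourier sum is at least as close, so the defect in Bessel's inequality is below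
  \<epsilon>.\<close>

lemma parseval:
  assumes "is_onb B"
  shows "((\<lambda>e. (cmod (cinner e x))\<^sup>2) has_sum (norm x)\<^sup>2) B"
  unfolding has_sum_def tendsto_iff
proof (intro allI impI)
  fix \<epsilon> :: real assume \<epsilon>: "\<epsilon> > 0"
  have B: "orthonormal B" using assms by (simp add: is_onb_iff)
  have "x \<in> closure (cvec.span B)" using assms by (simp add: is_onb_iff)
  then obtain y where y: "y \<in> cvec.span B" "norm (x - y) < sqrt \<epsilon>"
    using \<epsilon> by (metis closure_approachable dist_norm norm_minus_commute real_sqrt_gt_0_iff)
  obtain F where F: "finite F" "F \<subseteq> B" "y \<in> cvec.span F" using in_span_finite[OF y(1)] by metis
  have "dist (\<Sum>e\<in>G. (cmod (cinner e x))\<^sup>2) ((norm x)\<^sup>2) < \<epsilon>" if G: "finite G" "F \<subseteq> G" "G \<subseteq> B" for G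
  proof -
    have oG: "orthonormal G" using orthonormal_subset[OF B] G by blast
    have "norm (x - proj_onto G x) \<le> norm (x - y)"
      by (rule proj_onto_closest[OF oG G(1)]) (use F(3) cvec.span_mono[OF G(2)] in blast)
    then have "(norm (x - proj_onto G x))\<^sup>2 < (sqrt \<epsilon>)\<^sup>2"
      using y(2) by (intro power_strict_mono) auto
    then show ?thesis using \<epsilon> norm_diff_proj_onto[OF oG G(1), of x] by (simp add: dist_real_def)
  qed
  then show "\<forall>\<^sub>F G in finite_subsets_at_top B. dist (\<Sum>e\<in>G. (cmod (cinner e x))\<^sup>2) ((norm x)\<^sup>2) < \<epsilon>"
    unfolding eventually_finite_subsets_at_top using F by blast
qed

text \<open>This gives \<open>some_onb\<close> its meaning. A maximal orthonormal set has dense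
  span, since otherwise the normalized difference between a vector and its projection to the closed
  span could be added.\<close>

lemma onb_exists: "\<exists>B :: 'a :: complex_hilbert set. is_onb B"
proof -
  have "\<exists>M\<in>{B :: 'a set. orthonormal B}. \<forall>X\<in>{B. orthonormal B}. M \<subseteq> X \<longrightarrow> X = M"
  proof (rule subset_Zorn')
    fix C :: "'a set set" assume C: "subset.chain {B. orthonormal B} C"
    have "cinner e f = 0" if e: "e \<in> X" "X \<in> C" and f: "f \<in> Y" "Y \<in> C" and "e \<noteq> f" for e f X Y
    proof -
      have "X \<subseteq> Y \<or> Y \<subseteq> X" "orthonormal X" "orthonormal Y"
        using C e f by (auto simp: subset.chain_def)
      then show ?thesis using that by (auto simp: orthonormal_def)
    qed
    then show "\<Union>C \<in> {B. orthonormal B}" using C by (auto simp: subset.chain_def orthonormal_def)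
  qed
  then obtain M :: "'a set" where M: "orthonormal M" and max: "\<And>X. orthonormal X \<Longrightarrow> M \<subseteq> X \<Longrightarrow> X = M"
    by auto
  have "x \<in> closure (cvec.span M)" for x
  proof (rule ccontr)
    assume x: "x \<notin> closure (cvec.span M)"
    obtain y where y: "y \<in> closure (cvec.span M)" "\<And>z. z \<in> closure (cvec.span M) \<Longrightarrow> cinner z (x - y) = 0"
      using closed_subspace_projection[OF subspace_closure[OF cvec.subspace_span] closed_closure] by metis
    define u where "u = (1 / norm (x - y)) *\<^sub>R (x - y)"
    have ne: "x - y \<noteq> 0" using x y(1) by auto
    have "e \<in> closure (cvec.span M)" if "e \<in> M" for e
      using that closure_subset cvec.span_base by blast
    then have ort: "cinner e u = 0" if "e \<in> M" for e
      using y(2) that by (simp add: u_def cinner_scaleR_right)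
    have nu: "norm u = 1" using ne by (simp add: u_def)
    then have "u \<in> M" using max[OF orthonormal_insert[OF M nu ort]] by blast
    then show False using ort[of u] nu by (simp add: cinner_self)
  qed
  then show ?thesis using M by (auto simp: is_onb_iff)
qed

lemma some_onb: "is_onb some_onb"
  unfolding some_onb_def by (rule someI_ex) (rule onb_exists)

lemma some_onb_orthonormal: "orthonormal some_onb"
  by (rule conjunct1[OF some_onb[unfolded is_onb_iff]])

lemma gram_schmidt:
  assumes "finite F"
  obtains G where "finite G" "orthonormal G" "cvec.span G = cvec.span F"
proof -
  have "\<exists>G. finite G \<and> orthonormal G \<and> cvec.span G = cvec.span F"
    using assms
  proof (induction F)
    case empty
    show ?case by (rule exI[of _ "{}"]) (auto simp: orthonormal_def)
  next
    case (insert f F)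
    from insert.IH obtain G where G: "finite G" "orthonormal G" "cvec.span G = cvec.span F"
      by (elim exE conjE)
    show ?case
    proof (cases "f \<in> cvec.span F")
      case True
      have "cvec.span (insert f F) = cvec.span F" using True by (rule cvec.span_redundant)
      then have "cvec.span G = cvec.span (insert f F)" by (simp only: G(3))
      then show ?thesis using G(1,2) by blast
    next
      case False
      define v where "v = f - proj_onto G f"
      define u where "u = (1 / norm v) *\<^sub>R v"
      have v: "v \<noteq> 0" using False proj_onto_in_span[of G f] G(3) by (auto simp: v_def)
      have "orthonormal (insert u G)"
        using v cinner_diff_proj_onto[OF G(2,1) cvec.span_base]
        by (intro orthonormal_insert G) (auto simp: u_def v_def cinner_scaleR_right)
      moreover have "cvec.span (insert u G) = cvec.span (insert f F)"
      proof (rule cvec.span_subspace[symmetric, THEN sym])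
        have GF: "x \<in> cvec.span (insert f F)" if "x \<in> cvec.span G" for x
          using that G(3) cvec.span_mono[of F "insert f F"] by auto
        have "u \<in> cvec.span (insert f F)"
          unfolding u_def v_def scaleR_cscale
          by (intro cvec.span_scale cvec.span_diff cvec.span_base GF proj_onto_in_span) simp
        then show "insert u G \<subseteq> cvec.span (insert f F)" using GF cvec.span_base by blast
        have Gu: "x \<in> cvec.span (insert u G)" if "x \<in> cvec.span G" for x
          using that cvec.span_mono[of G "insert u G"] by auto
        have f: "f = norm v *\<^sub>R u + proj_onto G f" using v by (simp add: u_def v_def)
        have "norm v *\<^sub>R u + proj_onto G f \<in> cvec.span (insert u G)"
          unfolding scaleR_cscale
          by (intro cvec.span_add cvec.span_scale cvec.span_base Gu proj_onto_in_span insertI1)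
        with f have "f \<in> cvec.span (insert u G)" by simp
        then show "cvec.span (insert f F) \<subseteq> cvec.span (insert u G)"
          using Gu G(3) cvec.span_base by (intro cvec.span_minimal cvec.subspace_span) blast
      qed (rule cvec.subspace_span)
      ultimately show ?thesis using G(1) by blast
    qed
  qed
  then show ?thesis using that by blast
qed

text \<open>The projections of F to the span of E generate at most \<open>card F\<close> dimensions,
  so some e in E lies outside. Its component orthogonal to them is also orthogonal to F, because
  each f differs from its projection by a vector orthogonal to the span of E.\<close>

lemma exists_orthogonal_in_span:
  assumes E: "orthonormal E" "finite E" and F: "finite F" "card F < card E"
  obtains x where "x \<in> cvec.span E" "x \<noteq> 0" "\<And>f. f \<in> F \<Longrightarrow> cinner f x = 0"
proof -
  obtain G where G: "finite G" "orthonormal G" "cvec.span G = cvec.span (proj_onto E ` F)"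
    using gram_schmidt[of "proj_onto E ` F"] F by blast
  have "\<not> E \<subseteq> cvec.span (proj_onto E ` F)"
    using cvec.independent_span_bound[of "proj_onto E ` F" E] orthonormal_independent[OF E(1)]
      card_image_le[OF F(1), of "proj_onto E"] F by auto
  then obtain e where e: "e \<in> E" "e \<notin> cvec.span G" using G(3) by blast
  define x where "x = e - proj_onto G e"
  have "proj_onto E ` F \<subseteq> cvec.span E" using proj_onto_in_span by blast
  then have "cvec.span (proj_onto E ` F) \<subseteq> cvec.span E"
    by (rule cvec.span_minimal[OF _ cvec.subspace_span])
  then have "proj_onto G e \<in> cvec.span E" using proj_onto_in_span[of G e] G(3) by blast
  then have "x \<in> cvec.span E" using cvec.span_diff[OF cvec.span_base[OF e(1)]] by (simp add: x_def)
  moreover have "x \<noteq> 0" using e(2) proj_onto_in_span[of G e] by (auto simp: x_def)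
  moreover have "cinner f x = 0" if "f \<in> F" for f
  proof -
    have "proj_onto E f \<in> cvec.span G" unfolding G(3) using that by (intro cvec.span_base) blast
    then have *: "cinner (proj_onto E f) x = 0" unfolding x_def by (rule cinner_diff_proj_onto[OF G(2,1)])
    have "cinner x (f - proj_onto E f) = 0"
      by (rule cinner_diff_proj_onto[OF E]) fact
    then have "cinner (f - proj_onto E f) x = 0" by (simp only: cinner_eq_zero_commute)
    with * show ?thesis by (simp add: cinner_diff_left)
  qed
  ultimately show ?thesis using that by blast
qed

section \<open>Hilbert--Schmidt operators\<close>

text \<open>Bounds the squared Hilbert--Schmidt norm through finite partial sums, so that estimates
  stay in the reals; the empty sum forces \<open>c\<close> to be nonnegative.\<close>

definition hs_le :: "('a :: complex_hilbert \<Rightarrow> 'b :: complex_hilbert) \<Rightarrow> real \<Rightarrow> bool" where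
  "hs_le A c \<longleftrightarrow> (\<forall>F. finite F \<and> F \<subseteq> some_onb \<longrightarrow> (\<Sum>e\<in>F. (norm (A e))\<^sup>2) \<le> c)"

lemma hs_le_nonneg: "hs_le A c \<Longrightarrow> 0 \<le> c"
  unfolding hs_le_def by (drule spec[of _ "{}"]) simp

lemma hs_le_mono: "hs_le A c \<Longrightarrow> c \<le> d \<Longrightarrow> hs_le A d"
  unfolding hs_le_def by (meson order_trans)

lemma hs_norm_sq_le_iff:
  assumes "0 \<le> c"
  shows "hs_norm_sq A \<le> ennreal c \<longleftrightarrow> hs_le A c"
proof -
  have "hs_norm_sq A = (SUP F\<in>{F. finite F \<and> F \<subseteq> some_onb}. \<Sum>e\<in>F. ennreal ((norm (A e))\<^sup>2))"
    unfolding hs_norm_sq_def by (rule nonneg_infsum_complete) simp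
  then show ?thesis using assms
    by (simp add: SUP_le_iff hs_le_def sum_nonneg flip: ennreal_le_iff)
qed

lemma hilbert_schmidt_iff: "hilbert_schmidt A \<longleftrightarrow> bounded_clinear A \<and> (\<exists>c. hs_le A c)"
proof -
  have "hs_norm_sq A < \<infinity> \<longleftrightarrow> (\<exists>c. hs_le A c)"
  proof
    assume "hs_norm_sq A < \<infinity>"
    then obtain c where "0 \<le> c" "hs_norm_sq A = ennreal c"
      by (metis ennreal_cases infinity_ennreal_def less_irrefl)
    then show "\<exists>c. hs_le A c" using hs_norm_sq_le_iff[of c A] by auto
  next
    assume "\<exists>c. hs_le A c"
    then obtain c where "hs_le A c" ..
    then have "hs_norm_sq A \<le> ennreal c" using hs_norm_sq_le_iff hs_le_nonneg by blast
    then show "hs_norm_sq A < \<infinity>" by (simp add: le_less_trans)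
  qed
  then show ?thesis by (simp add: hilbert_schmidt_def)
qed

lemma has_sum_sum:
  fixes f :: "'i \<Rightarrow> 'a \<Rightarrow> 'b :: topological_comm_monoid_add"
  assumes "finite I" "\<And>i. i \<in> I \<Longrightarrow> (f i has_sum s i) A"
  shows "((\<lambda>x. \<Sum>i\<in>I. f i x) has_sum (\<Sum>i\<in>I. s i)) A"
  using assms by (induction I rule: finite_induct) (auto intro: has_sum_add)

text \<open>Parseval expands each adjoint image in \<open>some_onb\<close>; after exchanging the
  sums, Bessel's inequality for F bounds the inner one by the norm of A e.\<close>

lemma hs_le_cadjoint_orthonormal:
  assumes A: "bounded_clinear A" "hs_le A c" and F: "finite F" "orthonormal F"
  shows "(\<Sum>f\<in>F. (norm (cadjoint A f))\<^sup>2) \<le> c"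
proof (rule has_sum_le_finite_sums)
  show "((\<lambda>e. \<Sum>f\<in>F. (cmod (cinner e (cadjoint A f)))\<^sup>2) has_sum (\<Sum>f\<in>F. (norm (cadjoint A f))\<^sup>2)) some_onb"
    by (intro has_sum_sum F parseval some_onb)
  fix G :: "'a set" assume G: "finite G" "G \<subseteq> some_onb"
  have "(\<Sum>e\<in>G. \<Sum>f\<in>F. (cmod (cinner e (cadjoint A f)))\<^sup>2) \<le> (\<Sum>e\<in>G. (norm (A e))\<^sup>2)"
  proof (rule sum_mono)
    fix e
    have "cmod (cinner e (cadjoint A f)) = cmod (cinner f (A e))" for f
      by (metis A(1) cinner_cadjoint_right cinner_commute complex_mod_cnj)
    then show "(\<Sum>f\<in>F. (cmod (cinner e (cadjoint A f)))\<^sup>2) \<le> (norm (A e))\<^sup>2"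
      using bessel[OF F(2,1), of "A e"] by simp
  qed
  then show "(\<Sum>e\<in>G. \<Sum>f\<in>F. (cmod (cinner e (cadjoint A f)))\<^sup>2) \<le> c"
    using A(2) G unfolding hs_le_def by (meson order_trans)
qed

lemma hs_le_cadjoint:
  "bounded_clinear A \<Longrightarrow> hs_le A c \<Longrightarrow> hs_le (cadjoint A) c"
  using hs_le_cadjoint_orthonormal orthonormal_subset[OF some_onb_orthonormal]
  unfolding hs_le_def by blast

text \<open>Passing to the adjoint twice frees the bound from the particular basis
  \<open>some_onb\<close>.\<close>

lemma hs_le_orthonormal:
  assumes "bounded_clinear A" "hs_le A c" "finite F" "orthonormal F"
  shows "(\<Sum>f\<in>F. (norm (A f))\<^sup>2) \<le> c"
  using hs_le_cadjoint_orthonormal[OF bounded_clinear_cadjoint[OF assms(1)] hs_le_cadjoint[OF assms(1,2)] assms(3,4)]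
  by (simp add: cadjoint_cadjoint[OF assms(1)])

lemma hs_le_norm:
  assumes "bounded_clinear A" "hs_le A c"
  shows "(norm (A x))\<^sup>2 \<le> c * (norm x)\<^sup>2"
proof (cases "x = 0")
  case False
  define u where "u = (1 / norm x) *\<^sub>R x"
  have "(norm (A u))\<^sup>2 \<le> c"
    using hs_le_orthonormal[OF assms, of "{u}"] False by (simp add: orthonormal_def u_def)
  then show ?thesis using False
    by (simp add: u_def bounded_clinear_scaleR[OF assms(1)] power_divide divide_simps)
qed (simp add: bounded_clinear_zero[OF assms(1)])

lemma hs_le_dominated:
  assumes "hs_le A c" "\<And>x. norm (D x) \<le> d * norm (A x)"
  shows "hs_le D (d\<^sup>2 * c)"
  unfolding hs_le_def
proof (intro allI impI)
  fix F :: "'a set" assume F: "finite F \<and> F \<subseteq> some_onb"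
  have "(\<Sum>e\<in>F. (norm (D e))\<^sup>2) \<le> (\<Sum>e\<in>F. d\<^sup>2 * (norm (A e))\<^sup>2)"
    using power_mono[OF assms(2) norm_ge_zero, of _ 2] by (intro sum_mono) (simp add: power_mult_distrib)
  also have "\<dots> \<le> d\<^sup>2 * c"
    using assms(1) F unfolding hs_le_def by (auto simp flip: sum_distrib_left intro!: mult_left_mono)
  finally show "(\<Sum>e\<in>F. (norm (D e))\<^sup>2) \<le> d\<^sup>2 * c" .
qed

text \<open>Partial sums over a basis control multiplication from the left only; taking adjoints
  turns the right factor into a left one.\<close>

lemma hs_le_compose_right:
  assumes A: "bounded_clinear A" "hs_le A c" and D: "bounded_clinear D"
    and d: "0 \<le> d" "\<And>x. norm (D x) \<le> d * norm x"
  shows "hs_le (\<lambda>x. A (D x)) (d\<^sup>2 * c)"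
proof -
  have AD: "bounded_clinear (\<lambda>x. A (D x))" by (rule bounded_clinear_compose[OF A(1) D])
  have "hs_le (\<lambda>x. cadjoint D (cadjoint A x)) (d\<^sup>2 * c)"
    by (rule hs_le_dominated[OF hs_le_cadjoint[OF A]]) (rule norm_cadjoint_le[OF D d(2,1)])
  then have "hs_le (cadjoint (\<lambda>x. A (D x))) (d\<^sup>2 * c)" by (simp add: cadjoint_compose[OF A(1) D])
  from hs_le_cadjoint[OF bounded_clinear_cadjoint[OF AD] this] show ?thesis
    by (simp add: cadjoint_cadjoint[OF AD])
qed

lemma hs_le_add:
  assumes "hs_le A c" "hs_le B d"
  shows "hs_le (\<lambda>x. A x + B x) (2 * c + 2 * d)"
  unfolding hs_le_def
proof (intro allI impI)
  fix F :: "'a set" assume F: "finite F \<and> F \<subseteq> some_onb"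
  have "(\<Sum>e\<in>F. (norm (A e + B e))\<^sup>2) \<le> (\<Sum>e\<in>F. 2 * (norm (A e))\<^sup>2 + 2 * (norm (B e))\<^sup>2)"
    by (intro sum_mono norm_sum_sq_le)
  also have "\<dots> = 2 * (\<Sum>e\<in>F. (norm (A e))\<^sup>2) + 2 * (\<Sum>e\<in>F. (norm (B e))\<^sup>2)"
    by (simp add: sum.distrib sum_distrib_left)
  also have "\<dots> \<le> 2 * c + 2 * d"
    using assms F unfolding hs_le_def by (intro add_mono mult_left_mono) auto
  finally show "(\<Sum>e\<in>F. (norm (A e + B e))\<^sup>2) \<le> 2 * c + 2 * d" .
qed

lemma hs_le_zero: "hs_le (\<lambda>x. 0) 0"
  by (simp add: hs_le_def)

text \<open>The power of two comes from iterating the two-term inequality for squares. It is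
  harmless because the number of bands is fixed.\<close>

lemma hs_le_sum:
  assumes "finite I" "\<And>i. i \<in> I \<Longrightarrow> hs_le (A i) (c i)"
  shows "hs_le (\<lambda>x. \<Sum>i\<in>I. A i x) (2 ^ card I * (\<Sum>i\<in>I. c i))"
  using assms
proof (induction I rule: finite_induct)
  case (insert i I)
  have "0 \<le> c i" using hs_le_nonneg insert.prems by blast
  moreover have "(2::real) \<le> 2 * 2 ^ card I" by (simp add: one_le_power)
  ultimately have "2 * c i \<le> 2 * 2 ^ card I * c i" by (intro mult_right_mono) auto
  moreover have "hs_le (\<lambda>x. \<Sum>i\<in>insert i I. A i x) (2 * c i + 2 * (2 ^ card I * (\<Sum>i\<in>I. c i)))"
    using insert by (simp add: hs_le_add)
  ultimately show ?case using insert(1,2) by (elim hs_le_mono) (simp add: algebra_simps)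
qed (simp add: hs_le_zero)

lemma hs_le_zero_imp:
  assumes "bounded_clinear A" "hs_le A 0"
  shows "A x = 0"
  using hs_le_norm[OF assms, of x] by simp

section \<open>Spectral counting functions\<close>

lemma combination_ball_compact:
  assumes "finite F"
  shows "compact {\<Sum>f\<in>F. c f *\<^sub>C f | c :: 'a :: complex_hilbert \<Rightarrow> complex. \<forall>f\<in>F. cmod (c f) \<le> M}"
  using assms
proof (induction F rule: finite_induct)
  case empty
  then show ?case by simp
next
  case (insert g F)
  let ?S = "{\<Sum>f\<in>F. c f *\<^sub>C f | c. \<forall>f\<in>F. cmod (c f) \<le> M}"
  let ?T = "(\<lambda>a. a *\<^sub>C g) ` cball 0 M"
  have "compact ?T"
    by (intro compact_continuous_image linear_continuous_on compact_cball
        bounded_bilinear.bounded_linear_left[OF bounded_bilinear_cscale])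
  then have "compact {x + y | x y. x \<in> ?T \<and> y \<in> ?S}" using insert.IH by (rule compact_sums)
  also have "{x + y | x y. x \<in> ?T \<and> y \<in> ?S}
      = {\<Sum>f\<in>insert g F. c f *\<^sub>C f | c. \<forall>f\<in>insert g F. cmod (c f) \<le> M}"
  proof (intro set_eqI iffI)
    fix z assume "z \<in> {x + y | x y. x \<in> ?T \<and> y \<in> ?S}"
    then obtain a c where ac: "z = a *\<^sub>C g + (\<Sum>f\<in>F. c f *\<^sub>C f)" "cmod a \<le> M" "\<forall>f\<in>F. cmod (c f) \<le> M"
      by auto
    have "(\<Sum>f\<in>F. (c(g := a)) f *\<^sub>C f) = (\<Sum>f\<in>F. c f *\<^sub>C f)"
      using insert(2) by (intro sum.cong) auto
    then have "z = (\<Sum>f\<in>insert g F. (c(g := a)) f *\<^sub>C f)"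
      using ac(1) insert(1,2) by simp
    moreover have "\<forall>f\<in>insert g F. cmod ((c(g := a)) f) \<le> M" using ac by auto
    ultimately show "z \<in> {\<Sum>f\<in>insert g F. c f *\<^sub>C f | c. \<forall>f\<in>insert g F. cmod (c f) \<le> M}"
      by blast
  next
    fix z assume "z \<in> {\<Sum>f\<in>insert g F. c f *\<^sub>C f | c. \<forall>f\<in>insert g F. cmod (c f) \<le> M}"
    then obtain c where "z = (\<Sum>f\<in>insert g F. c f *\<^sub>C f)" "\<forall>f\<in>insert g F. cmod (c f) \<le> M"
      by blast
    then show "z \<in> {x + y | x y. x \<in> ?T \<and> y \<in> ?S}"
      using insert(1,2) by fastforce
  qed
  finally show ?case .
qed

lemma selfadjoint_opD:
  assumes "selfadjoint_op S"
  shows "bounded_clinear S" "cinner (S x) y = cinner x (S y)" "inner (S x) y = inner x (S y)"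
  using assms by (auto simp: selfadjoint_op_def inner_cinner)

text \<open>Outside a finite part F of the basis the squared Hilbert--Schmidt mass is at most
  \<epsilon>^2. Self-adjointness turns <e, S x> into <S e, x>, so this mass controls the tail of S
  x.\<close>

lemma hs_tail:
  assumes S: "selfadjoint_op S" "hs_le S c" and \<epsilon>: "0 < \<epsilon>"
  obtains F where "finite F" "orthonormal F"
    "\<And>x. norm (S x - proj_onto F (S x)) \<le> \<epsilon> * norm x"
proof -
  define s where "s = infsum (\<lambda>e. (norm (S e))\<^sup>2) some_onb"
  have "(\<lambda>e. (norm (S e))\<^sup>2) summable_on some_onb"
    by (rule nonneg_bounded_partial_sums_imp_summable_on[where C = c])
       (use S(2) in \<open>auto simp: hs_le_def intro!: eventually_finite_subsets_at_top_weakI\<close>)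
  then have s: "((\<lambda>e. (norm (S e))\<^sup>2) has_sum s) some_onb" by (simp add: s_def)
  then obtain F where F: "finite F" "F \<subseteq> some_onb" "dist (\<Sum>e\<in>F. (norm (S e))\<^sup>2) s \<le> \<epsilon>\<^sup>2"
    using has_sum_finite_approximation[OF s, of "\<epsilon>\<^sup>2"] \<epsilon> by auto
  have oF: "orthonormal F" using orthonormal_subset[OF some_onb_orthonormal F(2)] .
  have "norm (S x - proj_onto F (S x)) \<le> \<epsilon> * norm x" for x
  proof (rule power2_le_imp_le)
    have "(norm (S x))\<^sup>2 \<le> (\<Sum>e\<in>F. (cmod (cinner e (S x)))\<^sup>2) + (\<epsilon> * norm x)\<^sup>2"
    proof (rule has_sum_le_finite_sums[OF parseval[OF some_onb]])
      fix G :: "'a set" assume G: "finite G" "G \<subseteq> some_onb"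
      have "(\<Sum>e\<in>G. (cmod (cinner e (S x)))\<^sup>2) \<le> (\<Sum>e\<in>F \<union> (G - F). (cmod (cinner e (S x)))\<^sup>2)"
        using G F by (intro sum_mono2) auto
      also have "\<dots> = (\<Sum>e\<in>F. (cmod (cinner e (S x)))\<^sup>2) + (\<Sum>e\<in>G - F. (cmod (cinner e (S x)))\<^sup>2)"
        using G F by (intro sum.union_disjoint) auto
      also have "(\<Sum>e\<in>G - F. (cmod (cinner e (S x)))\<^sup>2) \<le> (\<Sum>e\<in>G - F. (norm (S e))\<^sup>2 * (norm x)\<^sup>2)"
      proof (rule sum_mono)
        fix e
        have "cmod (cinner e (S x)) \<le> norm (S e) * norm x"
          using norm_cinner_le[of "S e" x] by (simp add: selfadjoint_opD[OF S(1)])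
        then show "(cmod (cinner e (S x)))\<^sup>2 \<le> (norm (S e))\<^sup>2 * (norm x)\<^sup>2"
          by (metis norm_ge_zero power_mono power_mult_distrib)
      qed
      also have "\<dots> = (\<Sum>e\<in>G - F. (norm (S e))\<^sup>2) * (norm x)\<^sup>2" by (simp add: sum_distrib_right)
      also have "\<dots> \<le> \<epsilon>\<^sup>2 * (norm x)\<^sup>2"
      proof (rule mult_right_mono)
        have "(\<Sum>e\<in>F. (norm (S e))\<^sup>2) + (\<Sum>e\<in>G - F. (norm (S e))\<^sup>2) = (\<Sum>e\<in>F \<union> (G - F). (norm (S e))\<^sup>2)"
          using G F by (intro sum.union_disjoint[symmetric]) auto
        also have "\<dots> \<le> s" using G F by (intro finite_sum_le_has_sum[OF s]) auto
        finally show "(\<Sum>e\<in>G - F. (norm (S e))\<^sup>2) \<le> \<epsilon>\<^sup>2"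
          using F(3) by (simp add: dist_real_def)
      qed simp
      finally show "(\<Sum>e\<in>G. (cmod (cinner e (S x)))\<^sup>2) \<le> (\<Sum>e\<in>F. (cmod (cinner e (S x)))\<^sup>2) + (\<epsilon> * norm x)\<^sup>2"
        by (simp add: power_mult_distrib)
    qed
    then show "(norm (S x - proj_onto F (S x)))\<^sup>2 \<le> (\<epsilon> * norm x)\<^sup>2"
      using norm_diff_proj_onto[OF oF F(1), of "S x"] by simp
  qed (use \<epsilon> in simp)
  then show ?thesis using that F(1) oF by blast
qed

text \<open>Up to \<epsilon> / 4 the image of the ball lies in a set of combinations with bounded
  coefficients of finitely many vectors, which is compact; hence the image is totally
  bounded.\<close>

lemma hs_compact_image:
  assumes S: "selfadjoint_op S" "hs_le S c"
  shows "compact (closure (S ` cball 0 1))"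
  unfolding compact_eq_totally_bounded
proof (intro conjI allI impI)
  show "complete (closure (S ` cball 0 1))" by (simp add: complete_eq_closed)
  fix \<epsilon> :: real assume \<epsilon>: "0 < \<epsilon>"
  obtain M where M: "M > 0" "\<And>x. norm (S x) \<le> M * norm x"
    using bounded_clinear_bounded[OF selfadjoint_opD(1)[OF S(1)]] by metis
  obtain F where F: "finite F" "orthonormal F" "\<And>x. norm (S x - proj_onto F (S x)) \<le> \<epsilon> / 4 * norm x"
    using hs_tail[OF S, of "\<epsilon> / 4"] \<epsilon> by auto
  define C where "C = {\<Sum>f\<in>F. c f *\<^sub>C f | c. \<forall>f\<in>F. cmod (c f) \<le> M}"
  have "compact C" unfolding C_def by (rule combination_ball_compact[OF F(1)])
  then obtain k where k: "finite k" "C \<subseteq> (\<Union>x\<in>k. ball x (\<epsilon> / 4))"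
    unfolding compact_eq_totally_bounded using \<epsilon> by (meson zero_less_divide_iff zero_less_numeral)
  have "S ` cball 0 1 \<subseteq> (\<Union>x\<in>k. cball x (\<epsilon> / 2))"
  proof
    fix z assume "z \<in> S ` cball 0 1"
    then obtain x where x: "z = S x" "norm x \<le> 1" by auto
    have "cmod (cinner f (S x)) \<le> M" if "f \<in> F" for f
    proof -
      have "cmod (cinner f (S x)) \<le> norm f * norm (S x)" by (rule norm_cinner_le)
      also have "\<dots> = norm (S x)" using F(2) that by (simp add: orthonormal_def)
      also have "\<dots> \<le> M * norm x" by (rule M(2))
      also have "\<dots> \<le> M" using x(2) M(1) by simp
      finally show ?thesis .
    qed
    then have "proj_onto F (S x) \<in> C" by (auto simp: C_def proj_onto_def intro!: exI[of _ "\<lambda>f. cinner f (S x)"])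
    then obtain y where y: "y \<in> k" "dist y (proj_onto F (S x)) < \<epsilon> / 4" using k by auto
    have "dist (proj_onto F (S x)) z \<le> \<epsilon> / 4 * norm x"
      using F(3)[of x] by (simp add: dist_norm x(1) norm_minus_commute)
    also have "\<dots> \<le> \<epsilon> / 4" using x(2) \<epsilon> by simp
    finally have "dist y z \<le> \<epsilon> / 2" using dist_triangle[of y z "proj_onto F (S x)"] y(2) by simp
    then show "z \<in> (\<Union>x\<in>k. cball x (\<epsilon> / 2))" using y(1) by auto
  qed
  then have "closure (S ` cball 0 1) \<subseteq> (\<Union>x\<in>k. cball x (\<epsilon> / 2))"
    using k(1) by (intro closure_minimal closed_UN) auto
  also have "\<dots> \<subseteq> (\<Union>x\<in>k. ball x \<epsilon>)" using \<epsilon> by auto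
  finally show "\<exists>k. finite k \<and> closure (S ` cball 0 1) \<subseteq> (\<Union>x\<in>k. ball x \<epsilon>)" using k(1) by blast
qed

text \<open>A maximizing sequence for the form on the orthogonal complement of \<open>E\<close> converges along
  a subsequence, because \<open>\<parallel>(m - S) x\<parallel>\<^sup>2\<close> is controlled by \<open>\<langle>x, (m - S) x\<rangle>\<close>.\<close>

lemma eigenvector_above:
  assumes S: "selfadjoint_op S" "hs_le S c" and r: "0 \<le> r"
    and E: "\<And>e. e \<in> E \<Longrightarrow> \<exists>\<kappa>::real. S e = complex_of_real \<kappa> *\<^sub>C e"
    and x0: "\<And>e. e \<in> E \<Longrightarrow> cinner e x0 = 0" "r * (norm x0)\<^sup>2 < inner x0 (S x0)"
  obtains v \<kappa> where "norm v = 1" "r < \<kappa>" "S v = complex_of_real \<kappa> *\<^sub>C v" "\<And>e. e \<in> E \<Longrightarrow> cinner e v = 0"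
proof -
  note SD = selfadjoint_opD[OF S(1)]
  note lin = bounded_clinear_scaleR[OF SD(1)] bounded_clinear_diff[OF SD(1)] bounded_clinear_zero[OF SD(1)]
  obtain M where M: "M > 0" "\<And>x. norm (S x) \<le> M * norm x"
    using bounded_clinear_bounded[OF SD(1)] by metis
  define V where "V = {x. \<forall>e\<in>E. cinner e x = 0}"
  define U where "U = {x\<in>V. norm x = 1}"
  define q where "q x = inner x (S x)" for x
  define m where "m = Sup (q ` U)"
  have VS: "S x \<in> V" if "x \<in> V" for x
  proof -
    have "cinner e (S x) = 0" if e: "e \<in> E" for e
    proof -
      obtain \<kappa> :: real where "S e = complex_of_real \<kappa> *\<^sub>C e" using E[OF e] by blast
      then have "cinner (S e) x = 0" using \<open>x \<in> V\<close> e by (simp add: V_def cinner_cscale_left)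
      then show ?thesis by (simp add: SD)
    qed
    then show ?thesis by (simp add: V_def)
  qed
  have Vlin: "a *\<^sub>R x + b *\<^sub>R y \<in> V" if "x \<in> V" "y \<in> V" for a b x y
    using that by (simp add: V_def cinner_add_right cinner_scaleR_right)
  have Vdiff: "x - y \<in> V" if "x \<in> V" "y \<in> V" for x y
    using that by (simp add: V_def cinner_diff_right)
  have Vsc: "a *\<^sub>R x \<in> V" if "x \<in> V" for a x
    using that by (simp add: V_def cinner_scaleR_right)
  have qle: "\<bar>q x\<bar> \<le> M * (norm x)\<^sup>2" for x
    using Cauchy_Schwarz_ineq2[of x "S x"] mult_left_mono[OF M(2)[of x], of "norm x"]
    by (simp add: q_def power2_eq_square mult_ac)
  have "q x \<le> M" if "x \<in> U" for x using abs_le_D1[OF qle[of x]] that by (simp add: U_def)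
  then have bdd: "bdd_above (q ` U)" by (rule bdd_aboveI2)
  have qhom: "q (a *\<^sub>R x) = a\<^sup>2 * q x" for a x
    by (simp add: q_def lin power2_eq_square)
  have qm: "q x \<le> m * (norm x)\<^sup>2" if "x \<in> V" for x
  proof (cases "x = 0")
    case False
    have "(1 / norm x) *\<^sub>R x \<in> U" using False that by (simp add: U_def Vsc)
    then have "q ((1 / norm x) *\<^sub>R x) \<le> m" unfolding m_def by (intro cSup_upper bdd imageI)
    then show ?thesis using False by (simp add: qhom power_divide divide_simps)
  qed (simp add: q_def)
  have x0V: "x0 \<in> V" using x0(1) by (simp add: V_def)
  have x0n: "x0 \<noteq> 0" using x0(2) by (auto simp: lin)
  have "r * (norm x0)\<^sup>2 < m * (norm x0)\<^sup>2" using qm[OF x0V] x0(2) by (simp add: q_def)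
  then have rm: "r < m" using x0n by simp
  then have m0: "0 < m" using r by simp
  define D where "D x = m *\<^sub>R x - S x" for x
  define L where "L = m + M"
  have L: "L > 0" using m0 M(1) by (simp add: L_def)
  have Dn: "norm (D x) \<le> L * norm x" for x
    using norm_triangle_ineq4[of "m *\<^sub>R x" "S x"] M(2)[of x] m0 by (simp add: D_def L_def algebra_simps)
  have DV: "D x \<in> V" if "x \<in> V" for x unfolding D_def by (intro Vdiff Vsc VS that)
  have Dpos: "0 \<le> inner x (D x)" if "x \<in> V" for x
    using qm[OF that] by (simp add: D_def inner_diff_right q_def dot_square_norm)
  \<comment> \<open>Positivity of the form of D at x - D x / L, where L bounds the norm of D, leaves
    exactly this inequality.\<close>
  have Dsq: "(norm (D x))\<^sup>2 \<le> L * inner x (D x)" if "x \<in> V" for x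
  proof -
    define y where "y = D x"
    have "inner (D y) x = inner y (D x)"
      by (simp add: D_def inner_diff_left inner_diff_right SD(3))
    then have sym: "inner x (D y) = inner y (D x)" by (simp only: inner_commute[of x])
    have Dlin: "D (x - (1/L) *\<^sub>R y) = D x - (1/L) *\<^sub>R D y"
      by (simp add: D_def lin algebra_simps)
    have "0 \<le> inner (x - (1/L) *\<^sub>R y) (D (x - (1/L) *\<^sub>R y))"
      by (intro Dpos Vdiff Vsc that) (simp add: y_def DV that)
    also have "\<dots> = inner x (D x) - 2 / L * inner y (D x) + inner y (D y) / L\<^sup>2"
      unfolding Dlin by (simp add: inner_diff_left inner_diff_right sym power2_eq_square
          diff_divide_distrib)
    also have "inner y (D x) = (norm y)\<^sup>2" by (simp add: y_def dot_square_norm)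
    also have "inner y (D y) / L\<^sup>2 \<le> (L * (norm y)\<^sup>2) / L\<^sup>2"
      using Cauchy_Schwarz_ineq2[of y "D y"] mult_left_mono[OF Dn[of y], of "norm y"]
      by (intro divide_right_mono) (auto simp: power2_eq_square mult_ac)
    also have "\<dots> = (norm y)\<^sup>2 / L" using L by (simp add: power2_eq_square)
    finally show ?thesis using L by (simp add: y_def field_simps)
  qed
  have Une: "q ` U \<noteq> {}"
    using x0V x0n Vsc[of x0 "1 / norm x0"] by (auto simp: U_def intro!: exI[of _ "(1 / norm x0) *\<^sub>R x0"])
  have "\<exists>x\<in>U. m - 1 / Suc n < q x" for n
    using less_cSupD[OF Une, of "m - 1 / Suc n"] by (auto simp: m_def)
  then obtain X where X: "\<And>n. X n \<in> U" "\<And>n. m - 1 / Suc n < q (X n)" by metis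
  have XV: "X n \<in> V" "norm (X n) = 1" for n using X(1)[of n] by (auto simp: U_def)
  have "(norm (D (X n)))\<^sup>2 \<le> L * (1 / Suc n)" for n
  proof -
    have "inner (X n) (D (X n)) = m * (norm (X n))\<^sup>2 - q (X n)"
      by (simp add: D_def inner_diff_right q_def dot_square_norm)
    also have "\<dots> \<le> 1 / Suc n" using X(2)[of n] XV by simp
    finally show ?thesis using Dsq[OF XV(1)[of n]] mult_left_mono[of _ _ L] L by (meson less_imp_le order_trans)
  qed
  note Dle = this
  have "(\<lambda>n. (norm (D (X n)))\<^sup>2) \<longlonglongrightarrow> 0"
  proof (rule tendsto_sandwich)
    show "\<forall>\<^sub>F n in sequentially. 0 \<le> (norm (D (X n)))\<^sup>2" by simp
    show "\<forall>\<^sub>F n in sequentially. (norm (D (X n)))\<^sup>2 \<le> L * (1 / Suc n)"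
      by (intro always_eventually allI Dle)
    show "(\<lambda>n. L * (1 / Suc n)) \<longlonglongrightarrow> 0"
      using tendsto_mult[OF tendsto_const[of L] lim_inverse_n'[THEN LIMSEQ_Suc]] by simp
  qed (rule tendsto_const)
  then have "(\<lambda>n. sqrt ((norm (D (X n)))\<^sup>2)) \<longlonglongrightarrow> sqrt 0" by (rule tendsto_real_sqrt)
  then have D0: "(\<lambda>n. D (X n)) \<longlonglongrightarrow> 0" by (simp add: tendsto_norm_zero_iff)
  have "S (X n) \<in> closure (S ` cball 0 1)" for n
    by (rule subsetD[OF closure_subset]) (simp add: XV(2))
  then obtain l \<phi> where l: "strict_mono \<phi>" "((\<lambda>n. S (X n)) \<circ> \<phi>) \<longlonglongrightarrow> l"
    using seq_compactE[OF compact_imp_seq_compact[OF hs_compact_image[OF S]], of "\<lambda>n. S (X n)"] by metis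
  note l(2)[unfolded o_def]
  note l = l(1) this
  \<comment> \<open>Since m x = D x + S x and m > 0, convergence of D X to 0 and of S X along a
    subsequence forces convergence of X itself.\<close>
  have "(\<lambda>n. (1 / m) *\<^sub>R (D (X (\<phi> n)) + S (X (\<phi> n)))) \<longlonglongrightarrow> (1 / m) *\<^sub>R (0 + l)"
    using LIMSEQ_subseq_LIMSEQ[OF D0 l(1)] by (intro tendsto_intros l) (simp add: o_def)
  then have Xl: "(\<lambda>n. X (\<phi> n)) \<longlonglongrightarrow> (1 / m) *\<^sub>R l" (is "_ \<longlonglongrightarrow> ?v")
    using m0 by (simp add: D_def)
  have "(\<lambda>n. S (X (\<phi> n))) \<longlonglongrightarrow> S ?v"
    by (rule bounded_linear.tendsto[OF bounded_clinear_linear[OF SD(1)] Xl])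
  then have "S ?v = l" using l(2) LIMSEQ_unique by blast
  then have "S ?v = complex_of_real m *\<^sub>C ?v" using m0 by (simp flip: scaleR_cscale)
  moreover have "norm ?v = 1"
    using LIMSEQ_unique[OF tendsto_norm[OF Xl, unfolded XV] tendsto_const] .
  moreover have "cinner e ?v = 0" if "e \<in> E" for e
  proof -
    have "(\<lambda>n. cinner e (X (\<phi> n))) \<longlonglongrightarrow> cinner e ?v" by (intro tendsto_intros Xl)
    moreover have "cinner e (X (\<phi> n)) = 0" for n using XV(1) that by (auto simp: V_def)
    ultimately show ?thesis by (simp add: LIMSEQ_const_iff)
  qed
  ultimately show ?thesis using that rm by blast
qed

section \<open>Finite spectrum above a positive level\<close>

lemma eigenvectors_orthogonal:
  assumes S: "selfadjoint_op S"
    and "S x = complex_of_real a *\<^sub>C x" "S y = complex_of_real b *\<^sub>C y" "a \<noteq> b"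
  shows "cinner x y = 0"
proof -
  have "complex_of_real a * cinner x y = complex_of_real b * cinner x y"
    using selfadjoint_opD(2)[OF S, of x y] assms(2,3) by (simp add: cinner_cscale_left cinner_cscale_right)
  then show ?thesis using assms(4) by simp
qed

text \<open>Each orthonormal eigenvector with eigenvalue above r takes r^2 from the squared
  Hilbert--Schmidt norm, so such families have at most c / r^2 members. One of maximal cardinality
  leaves no eigenvector above r in its orthogonal complement.\<close>

lemma hs_spectral_above:
  assumes S: "selfadjoint_op S" "hs_le S c" and r: "0 < r"
  obtains E where "finite E" "orthonormal E"
    "\<And>e. e \<in> E \<Longrightarrow> \<exists>\<kappa>>r. S e = complex_of_real \<kappa> *\<^sub>C e"
    "(\<Union>\<kappa>\<in>{r<..}. eigspace S \<kappa>) \<subseteq> cvec.span E"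
    "\<And>x. (\<And>e. e \<in> E \<Longrightarrow> cinner e x = 0) \<Longrightarrow> inner x (S x) \<le> r * (norm x)\<^sup>2"
proof -
  define P where "P E \<longleftrightarrow> finite E \<and> orthonormal E \<and> (\<forall>e\<in>E. \<exists>\<kappa>>r. S e = complex_of_real \<kappa> *\<^sub>C e)" for E
  have bound: "card E \<le> nat \<lceil>c / r\<^sup>2\<rceil>" if "P E" for E
  proof -
    have "r\<^sup>2 \<le> (norm (S e))\<^sup>2" if e: "e \<in> E" for e
    proof -
      obtain \<kappa> where "\<kappa> > r" "S e = complex_of_real \<kappa> *\<^sub>C e" using \<open>P E\<close> e unfolding P_def by blast
      moreover have "norm e = 1" using \<open>P E\<close> e by (auto simp: P_def orthonormal_def)
      ultimately show ?thesis using r by (simp add: norm_cscale abs_of_pos power_mono)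
    qed
    then have "real (card E) * r\<^sup>2 \<le> (\<Sum>e\<in>E. (norm (S e))\<^sup>2)" by (rule sum_bounded_below)
    also have "\<dots> \<le> c"
      using that by (intro hs_le_orthonormal[OF selfadjoint_opD(1)[OF S(1)] S(2)]) (auto simp: P_def)
    finally have "real (card E) \<le> c / r\<^sup>2" using r by (simp add: field_simps)
    then show ?thesis by linarith
  qed
  have "P {}" by (simp add: P_def orthonormal_def)
  then obtain E where E: "P E" and max: "\<And>F. P F \<Longrightarrow> card F \<le> card E"
    using ex_has_greatest_nat[of P "{}" card "nat \<lceil>c / r\<^sup>2\<rceil> + 1"] bound by (auto simp: less_Suc_eq_le)
  have fin: "finite E" and on: "orthonormal E" and eig: "\<And>e. e \<in> E \<Longrightarrow> \<exists>\<kappa>>r. S e = complex_of_real \<kappa> *\<^sub>C e"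
    using E by (auto simp: P_def)
  have noext: False if v: "norm v = 1" "r < \<kappa>" "S v = complex_of_real \<kappa> *\<^sub>C v" "\<And>e. e \<in> E \<Longrightarrow> cinner e v = 0" for v \<kappa>
  proof -
    have "v \<notin> E" using v(1) v(4)[of v] by (auto simp: cinner_self)
    moreover have "P (insert v E)"
      using E orthonormal_insert[OF on v(1,4)] v(2,3) by (auto simp: P_def)
    ultimately show False using max[of "insert v E"] fin by simp
  qed
  have "x \<in> cvec.span E" if x: "S x = complex_of_real \<kappa> *\<^sub>C x" "r < \<kappa>" for x \<kappa>
  proof -
    \<comment> \<open>The component of x orthogonal to \<open>E\<close> is again an eigenvector for
      \<kappa>, since only the vectors of \<open>E\<close> with the same eigenvalue contribute to
      the projection. Maximality of \<open>E\<close> then makes it zero.\<close>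
    define y where "y = x - proj_onto E x"
    have y0: "cinner e y = 0" if "e \<in> E" for e
      unfolding y_def by (rule cinner_diff_proj_onto[OF on fin cvec.span_base[OF that]])
    have "S (proj_onto E x) = (\<Sum>e\<in>E. cinner e x *\<^sub>C S e)"
      by (simp add: proj_onto_def bounded_clinear_sum[OF selfadjoint_opD(1)[OF S(1)]]
          bounded_clinear_cscale[OF selfadjoint_opD(1)[OF S(1)]])
    also have "\<dots> = (\<Sum>e\<in>E. complex_of_real \<kappa> *\<^sub>C (cinner e x *\<^sub>C e))"
    proof (rule sum.cong)
      fix e assume e: "e \<in> E"
      obtain \<kappa>' where "S e = complex_of_real \<kappa>' *\<^sub>C e" using eig[OF e] by blast
      then show "cinner e x *\<^sub>C S e = complex_of_real \<kappa> *\<^sub>C (cinner e x *\<^sub>C e)"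
        using eigenvectors_orthogonal[OF S(1) _ x(1)] by (cases "\<kappa>' = \<kappa>") (auto simp: cscale_cscale mult.commute)
    qed simp
    also have "\<dots> = complex_of_real \<kappa> *\<^sub>C proj_onto E x" by (simp add: proj_onto_def cvec.scale_sum_right)
    finally have Sy: "S y = complex_of_real \<kappa> *\<^sub>C y"
      by (simp add: y_def bounded_clinear_diff[OF selfadjoint_opD(1)[OF S(1)]] x(1) cvec.scale_right_diff_distrib)
    have "y = 0"
    proof (rule ccontr)
      assume ne: "y \<noteq> 0"
      show False
      proof (rule noext)
        show "norm ((1 / norm y) *\<^sub>R y) = 1" using ne by simp
        show "S ((1 / norm y) *\<^sub>R y) = complex_of_real \<kappa> *\<^sub>C ((1 / norm y) *\<^sub>R y)"
          unfolding bounded_clinear_scaleR[OF selfadjoint_opD(1)[OF S(1)]] Sy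
          by (simp add: scaleR_cscale cscale_cscale mult.commute)
      qed (use x(2) y0 in \<open>auto simp: cinner_scaleR_right\<close>)
    qed
    then show ?thesis using proj_onto_in_span[of E x] by (simp add: y_def)
  qed
  then have "(\<Union>\<kappa>\<in>{r<..}. eigspace S \<kappa>) \<subseteq> cvec.span E" by (auto simp: eigspace_def)
  moreover have "inner x (S x) \<le> r * (norm x)\<^sup>2" if "\<And>e. e \<in> E \<Longrightarrow> cinner e x = 0" for x
  proof (rule ccontr)
    assume "\<not> inner x (S x) \<le> r * (norm x)\<^sup>2"
    then have "r * (norm x)\<^sup>2 < inner x (S x)" by simp
    then show False
      using eigenvector_above[OF S less_imp_le[OF r] _ that, of E] eig noext by metis
  qed
  ultimately show ?thesis using that fin on eig by blast
qed

text \<open>The closure in the definition is harmless: orthogonality to the span passes to the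
  closure by continuity, so the finite projection meets the description.\<close>

lemma spectral_proj_above_eq:
  assumes E: "finite E" "orthonormal E" "\<And>e. e \<in> E \<Longrightarrow> \<exists>\<kappa>>r. S e = complex_of_real \<kappa> *\<^sub>C e"
    "(\<Union>\<kappa>\<in>{r<..}. eigspace S \<kappa>) \<subseteq> cvec.span E"
  shows "spectral_proj_above r S = proj_onto E"
proof
  fix x
  have "cvec.span (\<Union>\<kappa>\<in>{r<..}. eigspace S \<kappa>) = cvec.span E"
    by (rule cvec.span_eq[THEN iffD2]) (use E(3,4) in \<open>auto simp: eigspace_def intro!: cvec.span_base\<close>)
  moreover have "orth_proj (closure (cvec.span E)) x = proj_onto E x"
  proof (rule orth_proj_eqI[OF subspace_closure[OF cvec.subspace_span]])
    show "proj_onto E x \<in> closure (cvec.span E)" using closure_subset proj_onto_in_span by blast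
    show "cinner z (x - proj_onto E x) = 0" if "z \<in> closure (cvec.span E)" for z
      by (rule cinner_closure_span_zero[OF cinner_diff_proj_onto[OF E(2,1) cvec.span_base] that])
  qed
  ultimately show "spectral_proj_above r S x = proj_onto E x"
    by (simp add: spectral_proj_above_def)
qed

lemma op_rank_proj_onto:
  assumes "finite E" "orthonormal E"
  shows "op_rank (proj_onto E) = card E"
  unfolding op_rank_def
proof (rule cvec.dim_unique)
  show "E \<subseteq> range (proj_onto E)"
    using proj_onto_span[OF assms(2,1) cvec.span_base] by (metis rangeI subsetI)
qed (use assms proj_onto_in_span orthonormal_independent in auto)

text \<open>The diagonal entry at e is the sum of |<e, f>|^2 over f in E, and Parseval sums it over
  e. This reconciles \<open>Phi\<close>, which is a trace, with \<open>N_plus\<close>, which is a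
  rank.\<close>

lemma op_trace_proj_onto:
  assumes "finite E" "orthonormal E"
  shows "Re (op_trace (proj_onto E)) = card E"
proof -
  have "((\<lambda>e. \<Sum>f\<in>E. (cmod (cinner e f))\<^sup>2) has_sum (\<Sum>f\<in>E. (norm f)\<^sup>2)) some_onb"
    by (intro has_sum_sum assms parseval some_onb)
  moreover have "(\<Sum>f\<in>E. (norm f)\<^sup>2) = real (card E)" using assms(2) by (simp add: orthonormal_def)
  ultimately have *: "((\<lambda>e. \<Sum>f\<in>E. (cmod (cinner e f))\<^sup>2) has_sum real (card E)) some_onb" by simp
  have "complex_of_real (\<Sum>f\<in>E. (cmod (cinner e f))\<^sup>2) = cinner e (proj_onto E e)" for e
    unfolding proj_onto_def cinner_sum_right cinner_cscale_right of_real_sum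
    by (intro sum.cong refl) (metis cinner_commute complex_norm_square mult.commute of_real_power)
  then have "((\<lambda>e. cinner e (proj_onto E e)) has_sum complex_of_real (real (card E))) some_onb"
    using has_sum_of_real[OF *, where 'a = complex] by (simp only:)
  then have "op_trace (proj_onto E) = complex_of_real (real (card E))"
    unfolding op_trace_def by (rule infsumI)
  then show ?thesis by simp
qed

text \<open>Glazman's characterization: the counting functions are the least codimensions of subspaces
  on which a quadratic form is nonpositive. Weyl's inequalities are immediate in this form.\<close>

definition codim_le :: "('a :: complex_hilbert \<Rightarrow> real) \<Rightarrow> nat \<Rightarrow> bool" where
  "codim_le q k \<longleftrightarrow> (\<exists>F. finite F \<and> card F \<le> k \<and> (\<forall>x. (\<forall>f\<in>F. cinner f x = 0) \<longrightarrow> q x \<le> 0))"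

lemma codim_le_mono: "codim_le p k \<Longrightarrow> (\<And>x. q x \<le> p x) \<Longrightarrow> k \<le> l \<Longrightarrow> codim_le q l"
  unfolding codim_le_def by (meson order_trans)

lemma codim_le_add:
  assumes "codim_le p k" "codim_le q l"
  shows "codim_le (\<lambda>x. p x + q x) (k + l)"
proof -
  obtain F G where "finite F" "card F \<le> k" "\<And>x. (\<forall>f\<in>F. cinner f x = 0) \<Longrightarrow> p x \<le> 0"
    "finite G" "card G \<le> l" "\<And>x. (\<forall>f\<in>G. cinner f x = 0) \<Longrightarrow> q x \<le> 0"
    using assms unfolding codim_le_def by metis
  moreover have "card (F \<union> G) \<le> card F + card G" by (rule card_Un_le)
  ultimately show ?thesis
    unfolding codim_le_def by (intro exI[of _ "F \<union> G"]) (auto intro: add_nonpos_nonpos)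
qed

lemma codim_le_scale: "codim_le q k \<Longrightarrow> 0 \<le> a \<Longrightarrow> codim_le (\<lambda>x. a * q x) k"
  unfolding codim_le_def by (meson mult_nonneg_nonpos)

lemma inner_proj_onto_eigen:
  assumes S: "selfadjoint_op S" and E: "finite E" "orthonormal E"
    and \<kappa>: "\<And>e. e \<in> E \<Longrightarrow> S e = complex_of_real (\<kappa> e) *\<^sub>C e" and x: "x \<in> cvec.span E"
  shows "inner x (S x) = (\<Sum>e\<in>E. \<kappa> e * (cmod (cinner e x))\<^sup>2)"
proof -
  have x': "x = (\<Sum>e\<in>E. cinner e x *\<^sub>C e)" using proj_onto_span[OF E(2,1) x] by (simp add: proj_onto_def)
  have "S x = (\<Sum>e\<in>E. (complex_of_real (\<kappa> e) * cinner e x) *\<^sub>C e)"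
    by (subst x', simp add: bounded_clinear_sum[OF selfadjoint_opD(1)[OF S]]
        bounded_clinear_cscale[OF selfadjoint_opD(1)[OF S]] \<kappa> cscale_cscale mult.commute)
  then have "cinner x (S x) = (\<Sum>e\<in>E. complex_of_real (\<kappa> e * (cmod (cinner e x))\<^sup>2))"
    by (simp add: cinner_sum_right cinner_cscale_right cinner_commute[of x] complex_norm_square
        mult.assoc del: of_real_power)
  then show ?thesis by (simp add: inner_cinner del: of_real_mult of_real_power flip: of_real_sum)
qed

text \<open>If E had more than k elements, its span would contain a nonzero vector orthogonal to the
  k test vectors, where the form strictly exceeds r times the squared norm.\<close>

lemma codim_le_imp_card_le:
  assumes S: "selfadjoint_op S" and E: "finite E" "orthonormal E"
    and eig: "\<And>e. e \<in> E \<Longrightarrow> \<exists>\<kappa>>r. S e = complex_of_real \<kappa> *\<^sub>C e"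
    and k: "codim_le (\<lambda>x. inner x (S x) - r * (norm x)\<^sup>2) k"
  shows "card E \<le> k"
proof (rule ccontr)
  assume nle: "\<not> card E \<le> k"
  obtain F where F: "finite F" "card F \<le> k" "\<And>x. (\<forall>f\<in>F. cinner f x = 0) \<Longrightarrow> inner x (S x) \<le> r * (norm x)\<^sup>2"
    using k unfolding codim_le_def by force
  obtain x where x: "x \<in> cvec.span E" "x \<noteq> 0" "\<And>f. f \<in> F \<Longrightarrow> cinner f x = 0"
    using exists_orthogonal_in_span[OF E(2,1) F(1)] F(2) nle by (metis not_le_imp_less order_le_less_trans)
  obtain \<kappa> where \<kappa>: "\<And>e. e \<in> E \<Longrightarrow> \<kappa> e > r" "\<And>e. e \<in> E \<Longrightarrow> S e = complex_of_real (\<kappa> e) *\<^sub>C e"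
    using eig by metis
  have n: "(norm x)\<^sup>2 = (\<Sum>e\<in>E. (cmod (cinner e x))\<^sup>2)"
    using norm_proj_onto[OF E(2,1), of x] by (simp add: proj_onto_span[OF E(2,1) x(1)])
  then obtain e where e: "e \<in> E" "cinner e x \<noteq> 0"
    using x(2) by (metis (no_types, lifting) norm_eq_zero power_not_zero sum.neutral zero_power2)
  have "r * (norm x)\<^sup>2 = (\<Sum>e\<in>E. r * (cmod (cinner e x))\<^sup>2)" by (simp add: n sum_distrib_left)
  also have "\<dots> < (\<Sum>e\<in>E. \<kappa> e * (cmod (cinner e x))\<^sup>2)"
    by (rule sum_strict_mono_ex1[OF E(1)])
       (use \<kappa>(1) e in \<open>auto intro!: mult_right_mono mult_strict_right_mono bexI[of _ e] intro: less_imp_le\<close>)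
  also have "\<dots> = inner x (S x)"
    by (rule inner_proj_onto_eigen[OF S E \<kappa>(2) x(1), symmetric])
  finally show False using F(3)[of x] x(3) by auto
qed

text \<open>From here on eigenvalue counts are compared on the side of \<open>codim_le\<close>,
  where no spectral projection occurs. The eigenvectors \<open>E\<close> serve as test vectors in
  one direction, the dimension count gives the other.\<close>

lemma counting_le_iff:
  assumes S: "selfadjoint_op S" "hs_le S c" and r: "0 < r"
  shows "N_plus r S \<le> k \<longleftrightarrow> codim_le (\<lambda>x. inner x (S x) - r * (norm x)\<^sup>2) k"
    and "Re (op_trace (spectral_proj_above r S)) = real (N_plus r S)"
proof -
  obtain E where E: "finite E" "orthonormal E"
    "\<And>e. e \<in> E \<Longrightarrow> \<exists>\<kappa>>r. S e = complex_of_real \<kappa> *\<^sub>C e"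
    "(\<Union>\<kappa>\<in>{r<..}. eigspace S \<kappa>) \<subseteq> cvec.span E"
    "\<And>x. (\<And>e. e \<in> E \<Longrightarrow> cinner e x = 0) \<Longrightarrow> inner x (S x) \<le> r * (norm x)\<^sup>2"
    using hs_spectral_above[OF assms] by metis
  have P: "spectral_proj_above r S = proj_onto E" by (rule spectral_proj_above_eq[OF E(1-4)])
  have N: "N_plus r S = card E" unfolding N_plus_def P by (rule op_rank_proj_onto[OF E(1,2)])
  show "Re (op_trace (spectral_proj_above r S)) = real (N_plus r S)"
    unfolding N P by (rule op_trace_proj_onto[OF E(1,2)])
  show "N_plus r S \<le> k \<longleftrightarrow> codim_le (\<lambda>x. inner x (S x) - r * (norm x)\<^sup>2) k"
  proof
    assume "N_plus r S \<le> k"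
    then show "codim_le (\<lambda>x. inner x (S x) - r * (norm x)\<^sup>2) k"
      unfolding codim_le_def N using E(1,5) by (intro exI[of _ E]) auto
  next
    assume "codim_le (\<lambda>x. inner x (S x) - r * (norm x)\<^sup>2) k"
    then show "N_plus r S \<le> k"
      unfolding N using codim_le_imp_card_le[OF S(1) E(1,2)] E(3) by blast
  qed
qed

lemma N_minus_eq: "N_minus r S = N_plus r (\<lambda>x. - S x)"
  by (simp add: N_minus_def N_plus_def)

text \<open>A Chebyshev bound: each counted eigenvector contributes at least r^2. It is what makes
  the real part of the boundary value cost only a constant.\<close>

lemma N_plus_hs_le:
  assumes S: "selfadjoint_op S" "hs_le S c" and r: "0 < r"
  shows "real (N_plus r S) \<le> c / r\<^sup>2"
proof -
  obtain E where E: "finite E" "orthonormal E"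
    "\<And>e. e \<in> E \<Longrightarrow> \<exists>\<kappa>>r. S e = complex_of_real \<kappa> *\<^sub>C e"
    "(\<Union>\<kappa>\<in>{r<..}. eigspace S \<kappa>) \<subseteq> cvec.span E"
    using hs_spectral_above[OF assms] by metis
  have "spectral_proj_above r S = proj_onto E" by (rule spectral_proj_above_eq[OF E])
  then have N: "N_plus r S = card E" by (simp add: N_plus_def op_rank_proj_onto[OF E(1,2)])
  have "r\<^sup>2 \<le> (norm (S e))\<^sup>2" if e: "e \<in> E" for e
  proof -
    obtain \<kappa> where "\<kappa> > r" "S e = complex_of_real \<kappa> *\<^sub>C e" using E(3)[OF e] by blast
    moreover have "norm e = 1" using E(2) e by (auto simp: orthonormal_def)
    ultimately show ?thesis using r by (simp add: norm_cscale abs_of_pos power_mono)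
  qed
  then have "real (card E) * r\<^sup>2 \<le> (\<Sum>e\<in>E. (norm (S e))\<^sup>2)" by (rule sum_bounded_below)
  also have "\<dots> \<le> c" by (rule hs_le_orthonormal[OF selfadjoint_opD(1)[OF S(1)] S(2) E(1,2)])
  finally show ?thesis using r by (simp add: N field_simps)
qed

section \<open>Square roots of nonnegative operators\<close>

text \<open>Polarization: the sesquilinear defect of symmetry vanishes on the diagonal, and testing
  it at x + y and at x + i y annihilates it.\<close>

lemma nonneg_op_selfadjoint:
  assumes "nonneg_op A"
  shows "selfadjoint_op A"
proof -
  have A: "bounded_clinear A" using assms by (simp add: nonneg_op_def)
  define s where "s x y = cinner (A x) y - cinner x (A y)" for x y
  have diag: "s x x = 0" for x
  proof -
    have "cinner x (A x) \<in> \<real>\<^sub>\<ge>\<^sub>0" using assms by (simp add: nonneg_op_def)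
    then have "cnj (cinner x (A x)) = cinner x (A x)"
      by (metis complex_cnj_complex_of_real nonneg_Reals_cases)
    then show ?thesis unfolding s_def by (metis cinner_commute cancel_comm_monoid_add_class.diff_cancel)
  qed
  have "s x y = 0" for x y
  proof -
    have 1: "s x y + s y x = 0"
      using diag[of "x + y"] diag[of x] diag[of y]
      by (simp add: s_def bounded_clinear_add[OF A] cinner_add_left cinner_add_right algebra_simps)
    have "s (x + \<i> *\<^sub>C y) (x + \<i> *\<^sub>C y) = s x x + s y y + \<i> * (s x y - s y x)"
      by (simp add: s_def bounded_clinear_add[OF A] bounded_clinear_cscale[OF A] cinner_add_left
          cinner_add_right cinner_cscale_left cinner_cscale_right algebra_simps)
    then have "s x y - s y x = 0" by (simp add: diag)
    with 1 show ?thesis by (simp add: algebra_simps)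
  qed
  then show ?thesis by (simp add: selfadjoint_op_def A s_def)
qed

lemma nonneg_op_iff: "nonneg_op A \<longleftrightarrow> selfadjoint_op A \<and> (\<forall>x. 0 \<le> inner x (A x))"
proof
  assume "nonneg_op A"
  then show "selfadjoint_op A \<and> (\<forall>x. 0 \<le> inner x (A x))"
    using nonneg_op_selfadjoint by (auto simp: nonneg_op_def inner_cinner complex_nonneg_Reals_iff)
next
  assume *: "selfadjoint_op A \<and> (\<forall>x. 0 \<le> inner x (A x))"
  have "Im (cinner x (A x)) = 0" for x
  proof -
    have "cnj (cinner x (A x)) = cinner x (A x)"
      using * selfadjoint_opD(2)[of A x x] cinner_commute[of "A x" x] by simp
    then show ?thesis by (metis cnj.simps(2) equal_neg_zero)
  qed
  then show "nonneg_op A"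
    using * by (auto simp: nonneg_op_def inner_cinner complex_nonneg_Reals_iff selfadjoint_op_def)
qed

text \<open>Nonnegativity at x - A x / M, the optimal step along A x when the form is only known to
  be at most M.\<close>

lemma nonneg_op_norm_sq_le:
  assumes A: "nonneg_op A" and M: "0 < M" "\<And>x. inner x (A x) \<le> M * (norm x)\<^sup>2"
  shows "(norm (A x))\<^sup>2 \<le> M * inner x (A x)"
proof -
  have SA: "selfadjoint_op A" using A nonneg_op_iff by blast
  note lin = bounded_clinear_scaleR[OF selfadjoint_opD(1)[OF SA]] bounded_clinear_diff[OF selfadjoint_opD(1)[OF SA]]
  define y where "y = A x"
  have sym: "inner x (A y) = inner y y" by (simp add: y_def flip: selfadjoint_opD(3)[OF SA])
  have "0 \<le> inner (x - (1/M) *\<^sub>R y) (A (x - (1/M) *\<^sub>R y))" using A nonneg_op_iff by blast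
  also have "\<dots> = inner x (A x) - 2 / M * inner y y + inner y (A y) / M\<^sup>2"
    by (simp add: lin inner_diff_left inner_diff_right sym power2_eq_square diff_divide_distrib)
       (simp add: y_def)
  also have "\<dots> \<le> inner x (A x) - 2 / M * inner y y + (M * inner y y) / M\<^sup>2"
    using M(2)[of y] by (intro add_left_mono divide_right_mono) (auto simp: dot_square_norm)
  also have "\<dots> = inner x (A x) - inner y y / M" using M(1) by (simp add: power2_eq_square field_simps)
  finally show ?thesis using M(1) by (simp add: y_def dot_square_norm field_simps)
qed

lemma nonneg_op_kernel:
  assumes A: "nonneg_op A" and "inner x (A x) = 0"
  shows "A x = 0"
proof -
  obtain K where K: "K > 0" "\<And>x. norm (A x) \<le> K * norm x"
    using bounded_clinear_bounded A unfolding nonneg_op_def by metis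
  have "inner x (A x) \<le> K * (norm x)\<^sup>2" for x
    using norm_cauchy_schwarz[of x "A x"] mult_left_mono[OF K(2)[of x], of "norm x"]
    by (simp add: power2_eq_square mult_ac)
  from nonneg_op_norm_sq_le[OF A K(1) this, of x] assms(2) show ?thesis by simp
qed

text \<open>With \<open>A = 1 - B\<close>, the limit of this iteration solves \<open>2 L = B + L\<^sup>2\<close>, i.e. \<open>(1 - L)\<^sup>2 = A\<close>.\<close>

primrec sqrt_iter :: "('a :: complex_hilbert \<Rightarrow> 'a) \<Rightarrow> nat \<Rightarrow> 'a \<Rightarrow> 'a" where
  "sqrt_iter B 0 = (\<lambda>x. 0)"
| "sqrt_iter B (Suc n) = (\<lambda>x. (1/2) *\<^sub>R (B x + sqrt_iter B n (sqrt_iter B n x)))"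

text \<open>The same recursion with \<open>B\<close> replaced by 1. It dominates the norms of the
  iterates and of their increments, so convergence of this scalar sequence suffices.\<close>

primrec sqrt_bound :: "nat \<Rightarrow> real" where
  "sqrt_bound 0 = 0"
| "sqrt_bound (Suc n) = (1 + (sqrt_bound n)\<^sup>2) / 2"

lemma sqrt_bound_range: "0 \<le> sqrt_bound n \<and> sqrt_bound n \<le> 1"
proof (induction n)
  case (Suc n)
  then have "(sqrt_bound n)\<^sup>2 \<le> 1" by (simp add: power_le_one)
  then show ?case by simp
qed simp

lemma sqrt_bound_step: "sqrt_bound n \<le> sqrt_bound (Suc n)"
  using zero_le_power2[of "1 - sqrt_bound n"] by (simp add: power2_eq_square algebra_simps)

lemma sqrt_bound_convergent: "convergent sqrt_bound"
proof -
  have "incseq sqrt_bound" by (intro incseq_SucI sqrt_bound_step)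
  then show ?thesis
    using incseq_convergent[of sqrt_bound 1] sqrt_bound_range unfolding convergent_def by blast
qed

context
  fixes B :: "'a :: complex_hilbert \<Rightarrow> 'a"
  assumes B: "selfadjoint_op B" and B1: "\<And>x. norm (B x) \<le> norm x"
begin

lemma sqrt_iter_clinear: "bounded_clinear (sqrt_iter B n)"
proof (induction n)
  case (Suc n)
  show ?case
    unfolding sqrt_iter.simps
    by (rule bounded_clinear_scaledR[OF bounded_clinear_plus[OF selfadjoint_opD(1)[OF B]
          bounded_clinear_compose[OF Suc Suc]]])
qed (simp add: bounded_clinear_const_zero)

lemma norm_sqrt_iter: "norm (sqrt_iter B n x) \<le> sqrt_bound n * norm x"
proof (induction n arbitrary: x)
  case (Suc n)
  have "norm (sqrt_iter B n (sqrt_iter B n x)) \<le> sqrt_bound n * (sqrt_bound n * norm x)"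
    using sqrt_bound_range[of n] by (intro order_trans[OF Suc] mult_left_mono Suc) auto
  then have "norm (B x + sqrt_iter B n (sqrt_iter B n x)) \<le> norm x + sqrt_bound n * (sqrt_bound n * norm x)"
    using B1[of x] norm_triangle_ineq order_trans by (meson add_mono)
  then show ?case
    by (simp only: sqrt_iter.simps norm_scaleR) (simp add: power2_eq_square field_simps)
qed simp

text \<open>The splitting X X - Y Y = X (X - Y) + (X - Y) Y needs no commutativity and matches p^2 -
  q^2 = p (p - q) + (p - q) q for the majorants.\<close>

lemma sqrt_iter_step:
  "norm (sqrt_iter B (Suc n) x - sqrt_iter B n x) \<le> (sqrt_bound (Suc n) - sqrt_bound n) * norm x"
proof (induction n arbitrary: x)
  case 0
  then show ?case using B1[of x] by simp
next
  case (Suc n)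
  let ?X = "sqrt_iter B (Suc n)" and ?Y = "sqrt_iter B n"
  let ?p = "sqrt_bound (Suc n)" and ?q = "sqrt_bound n"
  have pq: "0 \<le> ?p" "0 \<le> ?p - ?q" using sqrt_bound_range sqrt_bound_step[of n] by simp_all
  have e: "sqrt_iter B (Suc m) y = (1/2) *\<^sub>R (B y + sqrt_iter B m (sqrt_iter B m y))" for m y
    by (simp only: sqrt_iter.simps)
  have "sqrt_iter B (Suc (Suc n)) x - ?X x
      = (1/2) *\<^sub>R (B x + ?X (?X x)) - (1/2) *\<^sub>R (B x + ?Y (?Y x))"
    by (rule arg_cong2[where f = minus, OF e e])
  also have "\<dots> = (1/2) *\<^sub>R (?X (?X x) - ?Y (?Y x))"
    by (simp only: scaleR_diff_right[symmetric] add_diff_cancel_left)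
  also have "?X (?X x) - ?Y (?Y x) = ?X (?X x - ?Y x) + (?X (?Y x) - ?Y (?Y x))"
    by (simp only: bounded_clinear_diff[OF sqrt_iter_clinear]) simp
  finally have "norm (sqrt_iter B (Suc (Suc n)) x - ?X x)
      = (1/2) * norm (?X (?X x - ?Y x) + (?X (?Y x) - ?Y (?Y x)))" by simp
  also have "\<dots> \<le> (1/2) * (?p * ((?p - ?q) * norm x) + (?p - ?q) * (?q * norm x))"
  proof (intro mult_left_mono order_trans[OF norm_triangle_ineq add_mono])
    show "norm (?X (?X x - ?Y x)) \<le> ?p * ((?p - ?q) * norm x)"
      by (intro order_trans[OF norm_sqrt_iter] mult_left_mono Suc pq)
    show "norm (?X (?Y x) - ?Y (?Y x)) \<le> (?p - ?q) * (?q * norm x)"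
      by (intro order_trans[OF Suc] mult_left_mono norm_sqrt_iter pq)
  qed simp
  also have "\<dots> = ((1 + ?p\<^sup>2) / 2 - (1 + ?q\<^sup>2) / 2) * norm x"
    by (simp add: power2_eq_square algebra_simps diff_divide_distrib add_divide_distrib
        del: sqrt_bound.simps)
  also have "(1 + ?p\<^sup>2) / 2 - (1 + ?q\<^sup>2) / 2 = sqrt_bound (Suc (Suc n)) - ?p"
    by (rule arg_cong2[where f = minus, OF sqrt_bound.simps(2)[symmetric] sqrt_bound.simps(2)[symmetric]])
  finally show ?case .
qed

lemma sqrt_iter_diff:
  "norm (sqrt_iter B (n + k) x - sqrt_iter B n x) \<le> (sqrt_bound (n + k) - sqrt_bound n) * norm x"
proof (induction k)
  case (Suc k)
  have "norm (sqrt_iter B (n + Suc k) x - sqrt_iter B n x)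
      \<le> norm (sqrt_iter B (Suc (n + k)) x - sqrt_iter B (n + k) x) + norm (sqrt_iter B (n + k) x - sqrt_iter B n x)"
    using norm_triangle_ineq[of "sqrt_iter B (Suc (n + k)) x - sqrt_iter B (n + k) x"
        "sqrt_iter B (n + k) x - sqrt_iter B n x"] by (simp del: sqrt_iter.simps)
  also have "\<dots> \<le> (sqrt_bound (Suc (n + k)) - sqrt_bound (n + k)) * norm x
      + (sqrt_bound (n + k) - sqrt_bound n) * norm x"
    by (intro add_mono sqrt_iter_step Suc)
  finally show ?case by (simp add: algebra_simps del: sqrt_bound.simps sqrt_iter.simps)
qed simp

lemma sqrt_iter_convergent: "convergent (\<lambda>n. sqrt_iter B n x)"
proof -
  have "Cauchy (\<lambda>n. sqrt_iter B n x)"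
  proof (rule CauchyI)
    fix e :: real assume e: "0 < e"
    have "Cauchy sqrt_bound" by (rule convergent_Cauchy[OF sqrt_bound_convergent])
    then obtain M where M: "\<And>m n. m \<ge> M \<Longrightarrow> n \<ge> M \<Longrightarrow> norm (sqrt_bound m - sqrt_bound n) < e / (norm x + 1)"
      using CauchyD[of sqrt_bound "e / (norm x + 1)"] e by (metis divide_pos_pos norm_ge_zero add_nonneg_pos zero_less_one)
    have *: "norm (sqrt_iter B m x - sqrt_iter B n x) < e" if "n \<ge> M" "m \<ge> n" for m n
    proof -
      have "norm (sqrt_iter B m x - sqrt_iter B n x) \<le> (sqrt_bound m - sqrt_bound n) * norm x"
        using sqrt_iter_diff[of n "m - n" x] that by simp
      also have "\<dots> \<le> e / (norm x + 1) * norm x"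
        using M[of m n] that by (intro mult_right_mono) auto
      also have "\<dots> < e"
        using e mult_strict_left_mono[of "norm x" "norm x + 1" e] add_nonneg_pos[OF norm_ge_zero[of x] zero_less_one]
        by (simp add: pos_divide_less_eq)
      finally show ?thesis .
    qed
    show "\<exists>M. \<forall>m\<ge>M. \<forall>n\<ge>M. norm (sqrt_iter B m x - sqrt_iter B n x) < e"
      using * by (metis linear norm_minus_commute)
  qed
  then show ?thesis by (simp add: Cauchy_convergent_iff)
qed

text \<open>The last clause prepares the uniqueness of square roots: what commutes with
  \<open>B\<close> commutes with every iterate, hence with the limit.\<close>

lemma sqrt_iter_limit:
  obtains L where "selfadjoint_op L" "\<And>x. norm (L x) \<le> norm x" "\<And>x. 2 *\<^sub>R L x = B x + L (L x)"
    "\<And>D x. bounded_clinear D \<Longrightarrow> (\<And>x. D (B x) = B (D x)) \<Longrightarrow> D (L x) = L (D x)"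
proof -
  obtain L where L: "\<And>x. (\<lambda>n. sqrt_iter B n x) \<longlonglongrightarrow> L x"
    using sqrt_iter_convergent unfolding convergent_def by metis
  note lin = bounded_clinear_add[OF sqrt_iter_clinear] bounded_clinear_cscale[OF sqrt_iter_clinear]
  have L1: "norm (L x) \<le> norm x" for x
  proof (rule tendsto_upperbound[OF tendsto_norm[OF L]])
    show "\<forall>\<^sub>F n in sequentially. norm (sqrt_iter B n x) \<le> norm x"
      using order_trans[OF norm_sqrt_iter mult_right_mono[of _ 1]] sqrt_bound_range
      by (intro always_eventually allI) simp
  qed simp
  have clin: "bounded_clinear L"
  proof (rule bounded_clinearI)
    show "L (x + y) = L x + L y" for x y
      using LIMSEQ_unique[OF L[of "x + y"]] tendsto_add[OF L[of x] L[of y]] by (simp add: lin)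
    show "L (c *\<^sub>C x) = c *\<^sub>C L x" for c x
      using LIMSEQ_unique[OF L[of "c *\<^sub>C x"]] tendsto_cscale[OF tendsto_const L[of x]] by (simp add: lin)
    show "norm (L x) \<le> norm x * 1" for x using L1 by simp
  qed
  have sym: "cinner (sqrt_iter B n x) y = cinner x (sqrt_iter B n y)" for n x y
    by (induction n arbitrary: x y)
       (simp_all add: cinner_scaleR_left cinner_scaleR_right cinner_add_left cinner_add_right selfadjoint_opD(2)[OF B])
  have "cinner (L x) y = cinner x (L y)" for x y
    by (rule LIMSEQ_unique[of "\<lambda>n. cinner (sqrt_iter B n x) y"])
       (intro tendsto_cinner L tendsto_const, unfold sym, intro tendsto_cinner L tendsto_const)
  then have sa: "selfadjoint_op L" using clin by (simp add: selfadjoint_op_def)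
  have fix_eq: "2 *\<^sub>R L x = B x + L (L x)" for x
  proof -
    have "(\<lambda>n. sqrt_iter B n (sqrt_iter B n x - L x)) \<longlonglongrightarrow> 0"
    proof (rule Lim_null_comparison)
      show "\<forall>\<^sub>F n in sequentially. norm (sqrt_iter B n (sqrt_iter B n x - L x)) \<le> norm (sqrt_iter B n x - L x)"
        using order_trans[OF norm_sqrt_iter mult_right_mono[of _ 1]] sqrt_bound_range
        by (intro always_eventually allI) simp
      show "(\<lambda>n. norm (sqrt_iter B n x - L x)) \<longlonglongrightarrow> 0"
        using L[of x] by (intro tendsto_norm_zero LIM_zero)
    qed
    from tendsto_add[OF this L[of "L x"]]
    have "(\<lambda>n. sqrt_iter B n (sqrt_iter B n x)) \<longlonglongrightarrow> L (L x)"
      by (simp flip: bounded_clinear_add[OF sqrt_iter_clinear])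
    then have "(\<lambda>n. (1/2) *\<^sub>R (B x + sqrt_iter B n (sqrt_iter B n x))) \<longlonglongrightarrow> (1/2) *\<^sub>R (B x + L (L x))"
      by (intro tendsto_intros)
    moreover have "(\<lambda>n. (1/2) *\<^sub>R (B x + sqrt_iter B n (sqrt_iter B n x))) \<longlonglongrightarrow> L x"
      using LIMSEQ_Suc[OF L[of x]] by simp
    ultimately have "L x = (1/2) *\<^sub>R (B x + L (L x))" using LIMSEQ_unique by blast
    then have "2 *\<^sub>R L x = 2 *\<^sub>R ((1/2) *\<^sub>R (B x + L (L x)))" by (rule arg_cong)
    then show ?thesis by (simp only: scaleR_scaleR) simp
  qed
  have "D (L x) = L (D x)" if D: "bounded_clinear D" "\<And>x. D (B x) = B (D x)" for D x
  proof -
    have comm: "D (sqrt_iter B n x) = sqrt_iter B n (D x)" for n x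
      by (induction n arbitrary: x)
         (simp_all add: bounded_clinear_zero[OF D(1)] bounded_clinear_scaleR[OF D(1)]
           bounded_clinear_add[OF D(1)] D(2))
    have "(\<lambda>n. D (sqrt_iter B n x)) \<longlonglongrightarrow> D (L x)"
      by (rule bounded_linear.tendsto[OF bounded_clinear_linear[OF D(1)] L])
    then show ?thesis using L[of "D x"] LIMSEQ_unique by (simp add: comm)
  qed
  then show ?thesis using that sa L1 fix_eq by blast
qed

end

lemma sqrt_exists:
  fixes A :: "'a :: complex_hilbert \<Rightarrow> 'a"
  assumes A: "nonneg_op A"
  obtains R where "nonneg_op R" "\<And>x. R (R x) = A x"
    "\<And>D x. bounded_clinear D \<Longrightarrow> (\<And>x. D (A x) = A (D x)) \<Longrightarrow> D (R x) = R (D x)"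
proof -
  have SA: "selfadjoint_op A" "\<And>x. 0 \<le> inner x (A x)" using A nonneg_op_iff by blast+
  note Ac = selfadjoint_opD(1)[OF SA(1)]
  obtain K where K: "K > 0" "\<And>x. norm (A x) \<le> K * norm x" using bounded_clinear_bounded[OF Ac] by metis
  \<comment> \<open>Dividing by the norm bound K puts the form of B between 0 and that of the
    identity, which gives B norm at most 1. The root of A is then sqrt K times 1 - L.\<close>
  define B where "B x = x - (1/K) *\<^sub>R A x" for x
  have Bs: "selfadjoint_op B"
    using SA(1) bounded_clinear_minus_op[OF bounded_clinear_ident bounded_clinear_scaledR[OF Ac]]
    unfolding selfadjoint_op_def B_def
    by (auto simp: cinner_diff_left cinner_diff_right cinner_scaleR_left cinner_scaleR_right)
  have Ax: "inner x (A x) \<le> K * (norm x)\<^sup>2" for x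
    using norm_cauchy_schwarz[of x "A x"] mult_left_mono[OF K(2)[of x], of "norm x"]
    by (simp add: power2_eq_square mult_ac)
  have form: "inner x (B x) = (norm x)\<^sup>2 - inner x (A x) / K" for x
    by (simp add: B_def inner_diff_right dot_square_norm)
  have "0 \<le> inner x (B x)" for x using Ax[of x] K(1) by (simp add: form field_simps)
  then have Bn: "nonneg_op B" using Bs nonneg_op_iff by blast
  have Ble: "inner x (B x) \<le> 1 * (norm x)\<^sup>2" for x using SA(2)[of x] K(1) by (simp add: form)
  have B1: "norm (B x) \<le> norm x" for x
  proof (rule power2_le_imp_le)
    have "(norm (B x))\<^sup>2 \<le> 1 * inner x (B x)" by (rule nonneg_op_norm_sq_le[OF Bn zero_less_one Ble])
    with Ble[of x] show "(norm (B x))\<^sup>2 \<le> (norm x)\<^sup>2" by linarith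
  qed simp
  obtain L where L: "selfadjoint_op L" "\<And>x. norm (L x) \<le> norm x" "\<And>x. 2 *\<^sub>R L x = B x + L (L x)"
    "\<And>D x. bounded_clinear D \<Longrightarrow> (\<And>x. D (B x) = B (D x)) \<Longrightarrow> D (L x) = L (D x)"
    using sqrt_iter_limit[OF Bs B1] by metis
  note Lc = selfadjoint_opD(1)[OF L(1)]
  define R where "R x = sqrt K *\<^sub>R (x - L x)" for x
  have "selfadjoint_op R"
    using L(1) bounded_clinear_scaledR[OF bounded_clinear_minus_op[OF bounded_clinear_ident Lc]]
    unfolding selfadjoint_op_def R_def
    by (auto simp: cinner_diff_left cinner_diff_right cinner_scaleR_left cinner_scaleR_right)
  moreover have "0 \<le> inner x (R x)" for x
  proof -
    have "inner x (L x) \<le> norm x * norm x"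
      using norm_cauchy_schwarz[of x "L x"] mult_left_mono[OF L(2)[of x], of "norm x"] by simp
    then show ?thesis using K(1)
      by (auto simp: R_def inner_diff_right dot_square_norm power2_eq_square intro!: mult_nonneg_nonneg)
  qed
  ultimately have "nonneg_op R" using nonneg_op_iff by blast
  moreover have "R (R x) = A x" for x
  proof -
    have "R (R x) = K *\<^sub>R (x - L x - (L x - L (L x)))"
      using K(1) by (simp add: R_def bounded_clinear_scaleR[OF Lc] bounded_clinear_diff[OF Lc]
          flip: scaleR_diff_right)
    also have "x - L x - (L x - L (L x)) = x - 2 *\<^sub>R L x + L (L x)" by (simp add: scaleR_2)
    also have "\<dots> = (1/K) *\<^sub>R A x" by (simp add: L(3) B_def)
    finally show ?thesis using K(1) by simp
  qed
  moreover have "D (R x) = R (D x)" if D: "bounded_clinear D" "\<And>x. D (A x) = A (D x)" for D x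
    using L(4)[OF D(1), of x]
    by (simp add: R_def B_def bounded_clinear_scaleR[OF D(1)] bounded_clinear_diff[OF D(1)] D(2))
  ultimately show ?thesis using that by blast
qed

text \<open>For y = (R - S) x commutation gives (R + S) y = 0. The two nonnegative forms therefore
  both vanish at y, so R y = S y = 0, and <y, y> = <x, (R - S) y> = 0.\<close>

lemma nonneg_op_sqrt_unique:
  assumes R: "nonneg_op R" "nonneg_op S" and eq: "\<And>x. R (R x) = S (S x)"
    and comm: "\<And>x. S (R x) = R (S x)"
  shows "R = S"
proof
  fix x
  have SR: "selfadjoint_op R" "selfadjoint_op S" using R nonneg_op_selfadjoint by blast+
  note lin = bounded_clinear_diff[OF selfadjoint_opD(1)[OF SR(1)]] bounded_clinear_diff[OF selfadjoint_opD(1)[OF SR(2)]]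
  define y where "y = R x - S x"
  have "R y + S y = 0" by (simp add: y_def lin eq comm)
  then have "inner y (R y) + inner y (S y) = 0" by (simp flip: inner_add_right)
  moreover have "0 \<le> inner y (R y)" "0 \<le> inner y (S y)" using R nonneg_op_iff by blast+
  ultimately have "R y = 0" "S y = 0" using nonneg_op_kernel R by (metis add_nonneg_eq_0_iff)+
  moreover have "inner (R x - S x) y = inner x (R y) - inner x (S y)"
    by (simp add: inner_diff_left selfadjoint_opD(3)[OF SR(1)] selfadjoint_opD(3)[OF SR(2)])
  ultimately have "inner y y = 0" by (simp add: y_def[symmetric])
  then show "R x = S x" by (simp add: y_def)
qed

lemma op_sqrt:
  assumes A: "nonneg_op A"
  shows nonneg_op_op_sqrt: "nonneg_op (op_sqrt A)" and op_sqrt_sq: "op_sqrt A (op_sqrt A x) = A x"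
proof -
  obtain R where R: "nonneg_op R" "\<And>x. R (R x) = A x"
    "\<And>D x. bounded_clinear D \<Longrightarrow> (\<And>x. D (A x) = A (D x)) \<Longrightarrow> D (R x) = R (D x)"
    using sqrt_exists[OF A] by metis
  have "op_sqrt A = R"
    unfolding op_sqrt_def
  proof (rule the_equality)
    show "nonneg_op R \<and> R \<circ> R = A" using R by auto
    \<comment> \<open>A competing root commutes with its own square, hence with everything commuting
      with A, in particular with R.\<close>
    fix S assume S: "nonneg_op S \<and> S \<circ> S = A"
    then have SS: "S (S x) = A x" for x by (metis comp_apply)
    have "S (R x) = R (S x)" for x
      by (rule R(3)) (use S in \<open>auto simp: nonneg_op_def SS[symmetric]\<close>)
    then show "S = R" using nonneg_op_sqrt_unique[of R S] R S SS by auto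
  qed
  then show "nonneg_op (op_sqrt A)" "op_sqrt A (op_sqrt A x) = A x" using R by auto
qed

section \<open>Kernel operators on the lattice\<close>

definition l2_seq :: "(int \<Rightarrow> complex) \<Rightarrow> bool" where
  "l2_seq a \<longleftrightarrow> (\<lambda>n. (cmod (a n))\<^sup>2) summable_on UNIV"

definition l2_sq :: "(int \<Rightarrow> complex) \<Rightarrow> real" where
  "l2_sq a = (\<Sum>\<^sub>\<infinity>n. (cmod (a n))\<^sup>2)"

definition lat_bra :: "(int \<Rightarrow> complex) \<Rightarrow> 'g :: complex_hilbert l2Z \<Rightarrow> 'g" where
  "lat_bra a f = (\<Sum>\<^sub>\<infinity>n. a n *\<^sub>C at_site f n)"

text \<open>The adjoint of \<open>lat_bra a\<close>. The conjugate stands here because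
  \<open>lat_bra\<close> pairs without one, as rows of kernels do.\<close>

definition lat_ket :: "(int \<Rightarrow> complex) \<Rightarrow> 'g \<Rightarrow> 'g :: complex_hilbert l2Z" where
  "lat_ket a g = Abs_l2Z (\<lambda>n. cnj (a n) *\<^sub>C g)"

text \<open>The operator with kernel \<open>k\<close> on scalar sequences, tensored with
  \<open>L\<close>.\<close>

definition lat_op :: "(int \<Rightarrow> int \<Rightarrow> complex) \<Rightarrow> ('g \<Rightarrow> 'g) \<Rightarrow> 'g :: complex_hilbert l2Z \<Rightarrow> 'g l2Z" where
  "lat_op k L f = Abs_l2Z (\<lambda>n. L (lat_bra (k n) f))"

lemma has_sum_minus:
  fixes f g :: "'a \<Rightarrow> 'b :: topological_ab_group_add"
  assumes "(f has_sum a) A" "(g has_sum b) A"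
  shows "((\<lambda>x. f x - g x) has_sum (a - b)) A"
  using has_sum_add[OF assms(1), of "\<lambda>x. - g x" "- b"] assms(2) by (simp add: has_sum_uminus)

lemma l2_sq_nonneg: "0 \<le> l2_sq a"
  unfolding l2_sq_def by (rule infsum_nonneg) simp

lemma bounded_linear_cinner: "bounded_linear (cinner x)"
  by (rule bounded_bilinear.bounded_linear_right[OF bounded_bilinear_cinner])

lemma bounded_linear_at_site: "bounded_linear (\<lambda>f. at_site f n)"
  by (rule bounded_linear_intro[where K = 1])
     (simp_all add: plus_l2Z.rep_eq scaleR_l2Z.rep_eq norm_at_site_le)

lemma at_site_Abs:
  assumes "(\<lambda>n. (norm (F n))\<^sup>2) summable_on UNIV"
  shows "at_site (Abs_l2Z F) n = F n"
  using assms by (simp add: Abs_l2Z_inverse)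

lemma at_site_sum: "at_site (\<Sum>i\<in>I. f i) n = (\<Sum>i\<in>I. at_site (f i) n)"
  by (induction I rule: infinite_finite_induct) (auto simp: plus_l2Z.rep_eq zero_l2Z.rep_eq)

lemma norm_l2Z_has_sum: "((\<lambda>n. (norm (at_site f n))\<^sup>2) has_sum (norm f)\<^sup>2) UNIV"
  unfolding norm_l2Z_sq by (rule has_sum_infsum[OF at_site_summable])

lemma norm_l2Z_le:
  assumes "\<And>n. (norm (at_site f n))\<^sup>2 \<le> c n" "(c has_sum C) UNIV"
  shows "(norm f)\<^sup>2 \<le> C"
  by (rule has_sum_mono[OF norm_l2Z_has_sum assms(2,1)])

lemma cinner_l2Z_has_sum: "((\<lambda>n. cinner (at_site f n) (at_site g n)) has_sum cinner f g) UNIV"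
  unfolding cinner_l2Z_def by (rule has_sum_infsum[OF cinner_summable])

lemma at_site_lat_ket:
  assumes "l2_seq a"
  shows "at_site (lat_ket a g) n = cnj (a n) *\<^sub>C g"
  unfolding lat_ket_def
proof (rule at_site_Abs)
  show "(\<lambda>n. (norm (cnj (a n) *\<^sub>C g))\<^sup>2) summable_on UNIV"
    using summable_on_cmult_left[OF assms[unfolded l2_seq_def], of "(norm g)\<^sup>2"]
    by (simp add: norm_cscale power_mult_distrib)
qed

lemma norm_lat_ket:
  assumes "l2_seq a"
  shows "(norm (lat_ket a g))\<^sup>2 = l2_sq a * (norm g)\<^sup>2"
  unfolding norm_l2Z_sq l2_sq_def
  by (simp add: at_site_lat_ket[OF assms] norm_cscale power_mult_distrib infsum_cmult_left')

lemma lat_bra_has_sum: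
  assumes "l2_seq a"
  shows "((\<lambda>n. a n *\<^sub>C at_site f n) has_sum lat_bra a f) UNIV"
  unfolding lat_bra_def
proof (rule has_sum_infsum, rule abs_summable_summable, rule Infinite_Sum.abs_summable_on_comparison_test')
  show "(\<lambda>n. (cmod (a n))\<^sup>2 + (norm (at_site f n))\<^sup>2) summable_on UNIV"
    by (intro summable_on_add assms[unfolded l2_seq_def] at_site_summable)
  show "norm (a n *\<^sub>C at_site f n) \<le> (cmod (a n))\<^sup>2 + (norm (at_site f n))\<^sup>2" for n
    using sum_squares_bound[of "cmod (a n)" "norm (at_site f n)"]
      mult_nonneg_nonneg[OF norm_ge_zero norm_ge_zero, of "a n" "at_site f n"]
    unfolding norm_cscale by linarith
qed

lemma cinner_lat_ket:
  assumes "l2_seq a"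
  shows "cinner (lat_ket a g) f = cinner g (lat_bra a f)"
proof -
  have "((\<lambda>n. cinner g (a n *\<^sub>C at_site f n)) has_sum cinner g (lat_bra a f)) UNIV"
    by (rule has_sum_bounded_linear[OF bounded_linear_cinner lat_bra_has_sum[OF assms]])
  then have "((\<lambda>n. cinner (at_site (lat_ket a g) n) (at_site f n)) has_sum cinner g (lat_bra a f)) UNIV"
    by (simp add: at_site_lat_ket[OF assms] cinner_cscale_left cinner_cscale_right)
  then show ?thesis using cinner_l2Z_has_sum has_sum_unique by blast
qed

lemma norm_lat_bra:
  assumes "l2_seq a"
  shows "norm (lat_bra a f) \<le> sqrt (l2_sq a) * norm f"
proof (cases "lat_bra a f = 0")
  case True
  then show ?thesis by (simp add: l2_sq_nonneg)
next
  case False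
  have "(norm (lat_bra a f))\<^sup>2 = cmod (cinner (lat_ket a (lat_bra a f)) f)"
    by (simp add: cinner_lat_ket[OF assms] cinner_self norm_power)
  also have "\<dots> \<le> norm (lat_ket a (lat_bra a f)) * norm f" by (rule norm_cinner_le)
  also have "norm (lat_ket a (lat_bra a f)) = sqrt (l2_sq a) * norm (lat_bra a f)"
    using arg_cong[OF norm_lat_ket[OF assms, of "lat_bra a f"], of sqrt] by (simp add: real_sqrt_mult)
  finally show ?thesis using False by (simp add: power2_eq_square mult_ac)
qed

lemma cscale_at_site: "at_site (c *\<^sub>C f) n = c *\<^sub>C at_site f n"
  by (rule cscale_l2Z.rep_eq[THEN fun_cong, unfolded])

lemma bounded_clinear_lat_bra:
  assumes "l2_seq a"
  shows "bounded_clinear (lat_bra a)"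
proof (rule bounded_clinearI)
  show "lat_bra a (f + g) = lat_bra a f + lat_bra a g" for f g
    using has_sum_unique[OF lat_bra_has_sum[OF assms, of "f + g"]]
      has_sum_add[OF lat_bra_has_sum[OF assms, of f] lat_bra_has_sum[OF assms, of g]]
    by (simp add: plus_l2Z.rep_eq cscale_add_right)
  show "lat_bra a (c *\<^sub>C f) = c *\<^sub>C lat_bra a f" for c f
    using has_sum_unique[OF lat_bra_has_sum[OF assms, of "c *\<^sub>C f"]]
      has_sum_bounded_linear[OF bounded_bilinear.bounded_linear_right[OF bounded_bilinear_cscale]
        lat_bra_has_sum[OF assms, of f], of c]
    by (simp add: cscale_at_site cscale_cscale mult.commute)
  show "norm (lat_bra a f) \<le> norm f * sqrt (l2_sq a)" for f
    using norm_lat_bra[OF assms, of f] by (simp add: mult.commute)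
qed

lemma l2_seq_diff: "l2_seq a \<Longrightarrow> l2_seq b \<Longrightarrow> l2_seq (\<lambda>n. a n - b n)"
  unfolding l2_seq_def by (rule l2Z_diff)

lemma lat_bra_diff:
  assumes "l2_seq a" "l2_seq b"
  shows "lat_bra (\<lambda>n. a n - b n) f = lat_bra a f - lat_bra b f"
  using has_sum_unique[OF lat_bra_has_sum[OF l2_seq_diff[OF assms], of f]]
    has_sum_minus[OF lat_bra_has_sum[OF assms(1), of f] lat_bra_has_sum[OF assms(2), of f]]
  by (simp add: cvec.scale_left_diff_distrib)

lemma l2_seq_add: "l2_seq a \<Longrightarrow> l2_seq b \<Longrightarrow> l2_seq (\<lambda>n. a n + b n)"
  unfolding l2_seq_def by (rule l2Z_sum)

lemma lat_bra_add:
  assumes "l2_seq a" "l2_seq b"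
  shows "lat_bra (\<lambda>n. a n + b n) f = lat_bra a f + lat_bra b f"
  using has_sum_unique[OF lat_bra_has_sum[OF l2_seq_add[OF assms], of f]]
    has_sum_add[OF lat_bra_has_sum[OF assms(1), of f] lat_bra_has_sum[OF assms(2), of f]]
  by (simp add: cscale_add_left)

lemma l2_seq_scale: "l2_seq a \<Longrightarrow> l2_seq (\<lambda>n. c * a n)"
  using l2Z_dominated[of a "\<lambda>n. c * a n" "cmod c"] by (simp add: l2_seq_def norm_mult)

lemma lat_bra_scale:
  assumes "l2_seq a"
  shows "lat_bra (\<lambda>n. c * a n) f = c *\<^sub>C lat_bra a f"
  using has_sum_unique[OF lat_bra_has_sum[OF l2_seq_scale[OF assms], of c f]]
    has_sum_bounded_linear[OF bounded_bilinear.bounded_linear_right[OF bounded_bilinear_cscale]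
      lat_bra_has_sum[OF assms, of f], of c]
  by (simp add: cscale_cscale)

text \<open>Squared norms are sums over the sites, so the Hilbert--Schmidt bounds of the site
  components add up.\<close>

lemma hs_le_at_sites:
  assumes "\<And>n. hs_le (\<lambda>x. at_site (A x) n) (c n)" "(c has_sum C) UNIV"
  shows "hs_le A C"
  unfolding hs_le_def
proof (intro allI impI)
  fix F :: "'a set" assume F: "finite F \<and> F \<subseteq> some_onb"
  have "((\<lambda>n. \<Sum>e\<in>F. (norm (at_site (A e) n))\<^sup>2) has_sum (\<Sum>e\<in>F. (norm (A e))\<^sup>2)) UNIV"
    by (intro has_sum_sum norm_l2Z_has_sum) (use F in simp)
  then show "(\<Sum>e\<in>F. (norm (A e))\<^sup>2) \<le> C"
    by (rule has_sum_mono[OF _ assms(2)]) (use assms(1) F in \<open>auto simp: hs_le_def\<close>)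
qed

text \<open>Domination by a product weight; for square-summable \<phi> it makes every row
  square-summable and the whole kernel Hilbert--Schmidt.\<close>

definition kernel_le :: "(int \<Rightarrow> real) \<Rightarrow> (int \<Rightarrow> int \<Rightarrow> complex) \<Rightarrow> real \<Rightarrow> bool" where
  "kernel_le \<phi> k B \<longleftrightarrow> 0 \<le> B \<and> (\<forall>n m. cmod (k n m) \<le> B * \<phi> n * \<phi> m)"

lemma kernel_le_cnj_swap: "kernel_le \<phi> k B \<Longrightarrow> kernel_le \<phi> (\<lambda>n m. cnj (k m n)) B"
  by (auto simp: kernel_le_def) (metis mult.assoc mult.commute)

lemma kernel_le_diff: "kernel_le \<phi> k B \<Longrightarrow> kernel_le \<phi> l C \<Longrightarrow> kernel_le \<phi> (\<lambda>n m. k n m - l n m) (B + C)"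
  by (auto simp: kernel_le_def distrib_right intro!: norm_triangle_le_diff add_mono)

lemma kernel_le_add: "kernel_le \<phi> k B \<Longrightarrow> kernel_le \<phi> l C \<Longrightarrow> kernel_le \<phi> (\<lambda>n m. k n m + l n m) (B + C)"
  by (auto simp: kernel_le_def distrib_right intro!: norm_triangle_le add_mono)

lemma kernel_le_scale: "kernel_le \<phi> k B \<Longrightarrow> kernel_le \<phi> (\<lambda>n m. c * k n m) (cmod c * B)"
  by (auto simp: kernel_le_def norm_mult mult.assoc intro!: mult_left_mono)

context
  fixes \<phi> :: "int \<Rightarrow> real"
  assumes \<phi>0: "\<And>n. 0 \<le> \<phi> n" and \<phi>2: "(\<lambda>n. (\<phi> n)\<^sup>2) summable_on UNIV"
begin

lemma weight_has_sum: "((\<lambda>n. (\<phi> n)\<^sup>2) has_sum infsum (\<lambda>n. (\<phi> n)\<^sup>2) UNIV) UNIV"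
  by (rule has_sum_infsum[OF \<phi>2])

lemma weight_sum_nonneg: "0 \<le> infsum (\<lambda>n. (\<phi> n)\<^sup>2) UNIV"
  by (rule infsum_nonneg) simp

lemma l2_seq_dominated:
  assumes "\<And>n. cmod (a n) \<le> B * \<phi> n"
  shows "l2_seq a" "l2_sq a \<le> B\<^sup>2 * infsum (\<lambda>n. (\<phi> n)\<^sup>2) UNIV"
proof -
  have *: "(cmod (a n))\<^sup>2 \<le> B\<^sup>2 * (\<phi> n)\<^sup>2" for n
    using power_mono[OF assms[of n] norm_ge_zero, of 2] by (simp add: power_mult_distrib)
  show a: "l2_seq a"
    unfolding l2_seq_def
    by (rule summable_on_comparison_test[OF summable_on_cmult_right[OF \<phi>2, of "B\<^sup>2"]]) (use * in auto)
  show "l2_sq a \<le> B\<^sup>2 * infsum (\<lambda>n. (\<phi> n)\<^sup>2) UNIV"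
    unfolding l2_sq_def infsum_cmult_right'[symmetric]
    by (rule infsum_mono[OF a[unfolded l2_seq_def] summable_on_cmult_right[OF \<phi>2] *])
qed

context
  fixes k B
  assumes k: "kernel_le \<phi> k B"
begin

lemma kernel_row: "l2_seq (k n)" "sqrt (l2_sq (k n)) \<le> B * \<phi> n * sqrt (infsum (\<lambda>n. (\<phi> n)\<^sup>2) UNIV)"
proof -
  have *: "cmod (k n m) \<le> (B * \<phi> n) * \<phi> m" for m using k by (simp add: kernel_le_def)
  show "l2_seq (k n)" by (rule l2_seq_dominated[OF *])
  show "sqrt (l2_sq (k n)) \<le> B * \<phi> n * sqrt (infsum (\<lambda>n. (\<phi> n)\<^sup>2) UNIV)"
    using real_sqrt_le_mono[OF l2_seq_dominated(2)[OF *]] k \<phi>0[of n]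
    by (simp add: real_sqrt_mult kernel_le_def)
qed

lemma norm_kernel_row:
  "norm (lat_bra (k n) f) \<le> (B * \<phi> n * sqrt (infsum (\<lambda>n. (\<phi> n)\<^sup>2) UNIV)) * norm f"
  by (rule order_trans[OF norm_lat_bra[OF kernel_row(1)] mult_right_mono[OF kernel_row(2)]]) simp

context
  fixes L :: "'g :: complex_hilbert \<Rightarrow> 'g"
  assumes L: "bounded_clinear L"
begin

lemma at_site_lat_op: "at_site (lat_op k L f) n = L (lat_bra (k n) f)"
  unfolding lat_op_def
proof (rule at_site_Abs)
  obtain K where K: "K > 0" "\<And>x. norm (L x) \<le> K * norm x" using bounded_clinear_bounded[OF L] by metis
  let ?S = "infsum (\<lambda>n. (\<phi> n)\<^sup>2) UNIV"
  have "norm (L (lat_bra (k n) f)) \<le> (K * B * sqrt ?S * norm f) * norm (\<phi> n)" for n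
    using order_trans[OF K(2) mult_left_mono[OF norm_kernel_row]] K(1) \<phi>0[of n] by (simp add: mult_ac)
  then show "(\<lambda>n. (norm (L (lat_bra (k n) f)))\<^sup>2) summable_on UNIV"
    by (rule l2Z_dominated[rotated]) (simp add: \<phi>2)
qed

lemma bounded_clinear_lat_op: "bounded_clinear (lat_op k L)"
proof -
  obtain K where K: "K > 0" "\<And>x. norm (L x) \<le> K * norm x" using bounded_clinear_bounded[OF L] by metis
  let ?S = "infsum (\<lambda>n. (\<phi> n)\<^sup>2) UNIV"
  note lin = bounded_clinear_add[OF bounded_clinear_lat_bra[OF kernel_row(1)]]
    bounded_clinear_cscale[OF bounded_clinear_lat_bra[OF kernel_row(1)]]
    bounded_clinear_add[OF L] bounded_clinear_cscale[OF L]
  show ?thesis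
  proof (rule bounded_clinearI)
    show "lat_op k L (f + g) = lat_op k L f + lat_op k L g" for f g
      by (rule l2Z_eqI) (simp add: at_site_lat_op plus_l2Z.rep_eq lin)
    show "lat_op k L (c *\<^sub>C f) = c *\<^sub>C lat_op k L f" for c f
      by (rule l2Z_eqI) (simp add: at_site_lat_op cscale_at_site lin)
    fix f
    have B: "0 \<le> B" using k by (simp add: kernel_le_def)
    have "(norm (lat_op k L f))\<^sup>2 \<le> (K * B * sqrt ?S * norm f)\<^sup>2 * ?S"
    proof (rule norm_l2Z_le[OF _ has_sum_cmult_right[OF weight_has_sum]])
      fix n
      have "norm (L (lat_bra (k n) f)) \<le> (K * B * sqrt ?S * norm f) * \<phi> n"
        using order_trans[OF K(2) mult_left_mono[OF norm_kernel_row]] K(1) by (simp add: mult_ac)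
      then show "(norm (at_site (lat_op k L f) n))\<^sup>2 \<le> (K * B * sqrt ?S * norm f)\<^sup>2 * (\<phi> n)\<^sup>2"
        unfolding at_site_lat_op by (metis norm_ge_zero power_mono power_mult_distrib)
    qed
    also have "\<dots> = (norm f * (K * B * ?S))\<^sup>2"
      using weight_sum_nonneg by (simp add: power_mult_distrib power2_eq_square[of ?S] mult_ac)
    finally show "norm (lat_op k L f) \<le> norm f * (K * B * ?S)"
      by (rule power2_le_imp_le) (use B K(1) weight_sum_nonneg in simp)
  qed
qed

text \<open>The row at site n has norm at most B \<phi>(n) times the root of the weight sum; summing
  the squares over n produces the weight sum a second time.\<close>

lemma hs_le_lat_op:
  assumes "hs_le L c"
  shows "hs_le (lat_op k L) ((B * infsum (\<lambda>n. (\<phi> n)\<^sup>2) UNIV)\<^sup>2 * c)"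
proof -
  let ?S = "infsum (\<lambda>n. (\<phi> n)\<^sup>2) UNIV"
  have B: "0 \<le> B" using k by (simp add: kernel_le_def)
  have S: "0 \<le> ?S" by (rule weight_sum_nonneg)
  have "hs_le (lat_op k L) ((B\<^sup>2 * ?S * c) * ?S)"
  proof (rule hs_le_at_sites[OF _ has_sum_cmult_right[OF weight_has_sum]])
    fix n
    have "hs_le (\<lambda>x. L (lat_bra (k n) x)) ((B * \<phi> n * sqrt ?S)\<^sup>2 * c)"
      by (rule hs_le_compose_right[OF L assms bounded_clinear_lat_bra[OF kernel_row(1)] _ norm_kernel_row])
         (use B S \<phi>0[of n] in simp)
    also have "(B * \<phi> n * sqrt ?S)\<^sup>2 * c = (B\<^sup>2 * ?S * c) * (\<phi> n)\<^sup>2"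
      using S by (simp add: power_mult_distrib)
    finally show "hs_le (\<lambda>x. at_site (lat_op k L x) n) ((B\<^sup>2 * ?S * c) * (\<phi> n)\<^sup>2)"
      by (simp add: at_site_lat_op)
  qed
  then show ?thesis by (simp add: power2_eq_square mult_ac)
qed

end

end

lemma summable_on_product:
  fixes p q :: "int \<Rightarrow> real"
  assumes "\<And>n. 0 \<le> p n" "p summable_on UNIV" "\<And>n. 0 \<le> q n" "q summable_on UNIV"
  shows "(\<lambda>x. p (fst x) * q (snd x)) summable_on UNIV \<times> UNIV"
proof (rule summable_on_SigmaI)
  show "((\<lambda>y. p (fst (x, y)) * q (snd (x, y))) has_sum p x * infsum q UNIV) UNIV" for x
    using has_sum_cmult_right[OF has_sum_infsum[OF assms(4)], of "p x"] by simp
  show "(\<lambda>x. p x * infsum q UNIV) summable_on UNIV" by (rule summable_on_cmult_left[OF assms(2)])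
qed (use assms in auto)

text \<open>Moving the kernel to the other side exchanges a double sum. The family is dominated by a
  product of two summable ones, since \<phi> pairs summably with any square-summable
  function.\<close>

lemma cadjoint_lat_op:
  assumes k: "kernel_le \<phi> k B" and L: "bounded_clinear L"
  shows "cadjoint (lat_op k L) = lat_op (\<lambda>n m. cnj (k m n)) (cadjoint L)"
proof (rule cadjoint_eqI)
  let ?k = "\<lambda>n m. cnj (k m n)"
  note k' = kernel_le_cnj_swap[OF k] and L' = bounded_clinear_cadjoint[OF L]
  show "bounded_clinear (lat_op ?k (cadjoint L))" by (rule bounded_clinear_lat_op[OF k' L'])
  fix f g
  obtain K where K: "K > 0" "\<And>x. norm (L x) \<le> K * norm x" using bounded_clinear_bounded[OF L] by metis
  define t where "t n m = cnj (k n m) * cinner (L (at_site f m)) (at_site g n)" for n m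
  have B: "0 \<le> B" using k by (simp add: kernel_le_def)
  have prod: "(\<lambda>n. \<phi> n * norm (at_site u n)) summable_on UNIV" for u :: "'b :: complex_hilbert l2Z"
  proof (rule summable_on_comparison_test)
    show "(\<lambda>n. (\<phi> n)\<^sup>2 + (norm (at_site u n))\<^sup>2) summable_on UNIV"
      by (intro summable_on_add \<phi>2 at_site_summable)
    fix n
    show "\<phi> n * norm (at_site u n) \<le> (\<phi> n)\<^sup>2 + (norm (at_site u n))\<^sup>2"
      using sum_squares_bound[of "\<phi> n" "norm (at_site u n)"]
        mult_nonneg_nonneg[OF \<phi>0[of n] norm_ge_zero[of "at_site u n"]] by linarith
    show "0 \<le> \<phi> n * norm (at_site u n)" using \<phi>0[of n] by simp
  qed
  have "(\<lambda>x. t (fst x) (snd x)) summable_on UNIV \<times> UNIV"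
  proof (rule abs_summable_summable, rule Infinite_Sum.abs_summable_on_comparison_test')
    show "(\<lambda>x. (B * K) * ((\<phi> (fst x) * norm (at_site g (fst x))) * (\<phi> (snd x) * norm (at_site f (snd x)))))
        summable_on UNIV \<times> UNIV"
      by (intro summable_on_cmult_right summable_on_product prod mult_nonneg_nonneg \<phi>0 norm_ge_zero)
    fix x :: "int \<times> int"
    have "norm (t (fst x) (snd x)) \<le> (B * \<phi> (fst x) * \<phi> (snd x))
        * (K * norm (at_site f (snd x)) * norm (at_site g (fst x)))"
      unfolding t_def norm_mult complex_mod_cnj
      using k B \<phi>0 by (intro mult_mono order_trans[OF norm_cinner_le mult_right_mono[OF K(2)]])
        (auto simp: kernel_le_def)
    then show "norm (t (fst x) (snd x)) \<le> (B * K) * ((\<phi> (fst x) * norm (at_site g (fst x)))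
        * (\<phi> (snd x) * norm (at_site f (snd x))))" by (simp add: mult_ac)
  qed
  then have sw: "(\<Sum>\<^sub>\<infinity>n. \<Sum>\<^sub>\<infinity>m. t n m) = (\<Sum>\<^sub>\<infinity>m. \<Sum>\<^sub>\<infinity>n. t n m)"
    by (intro infsum_swap_banach) (simp add: case_prod_unfold)
  have 1: "cinner (at_site (lat_op k L f) n) (at_site g n) = (\<Sum>\<^sub>\<infinity>m. t n m)" for n
  proof -
    have "bounded_linear (\<lambda>x. cinner (L x) (at_site g n))"
      using bounded_linear_compose[OF bounded_bilinear.bounded_linear_left[OF bounded_bilinear_cinner]
          bounded_clinear_linear[OF L]] .
    from has_sum_bounded_linear[OF this lat_bra_has_sum[OF kernel_row(1)[OF k], of n f]]
    have "((\<lambda>m. t n m) has_sum cinner (L (lat_bra (k n) f)) (at_site g n)) UNIV"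
      by (simp add: t_def bounded_clinear_cscale[OF L] cinner_cscale_left)
    then show ?thesis by (simp add: at_site_lat_op[OF k L] infsumI)
  qed
  have 2: "cinner (at_site f m) (at_site (lat_op ?k (cadjoint L) g) m) = (\<Sum>\<^sub>\<infinity>n. t n m)" for m
  proof -
    have "bounded_linear (\<lambda>x. cinner (at_site f m) (cadjoint L x))"
      using bounded_linear_compose[OF bounded_linear_cinner bounded_clinear_linear[OF L']] .
    from has_sum_bounded_linear[OF this lat_bra_has_sum[OF kernel_row(1)[OF k'], of m g]]
    have "((\<lambda>n. t n m) has_sum cinner (at_site f m) (cadjoint L (lat_bra (?k m) g))) UNIV"
      by (simp add: t_def bounded_clinear_cscale[OF L'] cinner_cscale_right cinner_cadjoint_right[OF L])
    then show ?thesis by (simp add: at_site_lat_op[OF k' L'] infsumI)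
  qed
  show "cinner (lat_op k L f) g = cinner f (lat_op ?k (cadjoint L) g)"
    by (simp add: cinner_l2Z_def 1 2 sw)
qed

lemma lat_op_diff:
  assumes "kernel_le \<phi> k B" "kernel_le \<phi> l C" "bounded_clinear L"
  shows "lat_op (\<lambda>n m. k n m - l n m) L f = lat_op k L f - lat_op l L f"
  by (rule l2Z_eqI)
     (simp add: at_site_lat_op[OF kernel_le_diff[OF assms(1,2)] assms(3)] at_site_lat_op[OF assms(1,3)]
       at_site_lat_op[OF assms(2,3)] minus_l2Z.rep_eq lat_bra_diff kernel_row(1)[OF assms(1)]
       kernel_row(1)[OF assms(2)] bounded_clinear_diff[OF assms(3)])

lemma lat_op_add:
  assumes "kernel_le \<phi> k B" "kernel_le \<phi> l C" "bounded_clinear L"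
  shows "lat_op (\<lambda>n m. k n m + l n m) L f = lat_op k L f + lat_op l L f"
  by (rule l2Z_eqI)
     (simp add: at_site_lat_op[OF kernel_le_add[OF assms(1,2)] assms(3)] at_site_lat_op[OF assms(1,3)]
       at_site_lat_op[OF assms(2,3)] plus_l2Z.rep_eq lat_bra_add kernel_row(1)[OF assms(1)]
       kernel_row(1)[OF assms(2)] bounded_clinear_add[OF assms(3)])

lemma lat_op_scale:
  assumes "kernel_le \<phi> k B" "bounded_clinear L"
  shows "lat_op (\<lambda>n m. c * k n m) L f = c *\<^sub>C lat_op k L f"
  by (rule l2Z_eqI)
     (simp add: at_site_lat_op[OF kernel_le_scale[OF assms(1)] assms(2)] at_site_lat_op[OF assms]
       cscale_at_site lat_bra_scale kernel_row(1)[OF assms(1)] bounded_clinear_cscale[OF assms(2)])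

end

section \<open>Convolutions and the lattice Green function\<close>

lift_definition shift_l2Z :: "int \<Rightarrow> 'g :: complex_hilbert l2Z \<Rightarrow> 'g l2Z" is "\<lambda>j f n. f (n - j)"
  subgoal for j f
    using summable_on_reindex_bij_betw[of "\<lambda>n. n - j" UNIV UNIV "\<lambda>n. (norm (f n))\<^sup>2"]
      bij_betw_byWitness[of UNIV "\<lambda>n. n + j" "\<lambda>n. n - j" UNIV] by simp
  done

lemma bij_minus_const: "bij (\<lambda>n::int. n - j)" "bij (\<lambda>n::int. j - n)"
  by (rule bij_betw_byWitness[of _ "\<lambda>n. n + j"]; simp)
     (rule bij_betw_byWitness[of _ "\<lambda>n. j - n"]; simp)

lemma norm_shift_l2Z: "norm (shift_l2Z j f) = norm f"
proof -
  have "(norm (shift_l2Z j f))\<^sup>2 = (norm f)\<^sup>2"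
    unfolding norm_l2Z_sq shift_l2Z.rep_eq
    by (rule infsum_reindex_bij_betw[OF bij_minus_const(1)])
  then show ?thesis by simp
qed

text \<open>Written as a series of shifts, which converges in norm for absolutely summable
  \<open>a\<close>; the result is then square-summable without further proof.\<close>

definition conv_l2Z :: "(int \<Rightarrow> complex) \<Rightarrow> 'g :: complex_hilbert l2Z \<Rightarrow> 'g l2Z" where
  "conv_l2Z a f = (\<Sum>\<^sub>\<infinity>j. a j *\<^sub>C shift_l2Z j f)"

lemma at_site_conv_l2Z:
  assumes "(\<lambda>j. cmod (a j)) summable_on UNIV"
  shows "((\<lambda>m. a (n - m) *\<^sub>C at_site f m) has_sum at_site (conv_l2Z a f) n) UNIV"
proof -
  have "(\<lambda>j. norm (a j *\<^sub>C shift_l2Z j f)) summable_on UNIV"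
    using summable_on_cmult_left[OF assms, of "norm f"] by (simp add: norm_cscale norm_shift_l2Z)
  then have "(\<lambda>j. a j *\<^sub>C shift_l2Z j f) summable_on UNIV" by (rule abs_summable_summable)
  then have "((\<lambda>j. a j *\<^sub>C shift_l2Z j f) has_sum conv_l2Z a f) UNIV"
    unfolding conv_l2Z_def by (rule has_sum_infsum)
  from has_sum_bounded_linear[OF bounded_linear_at_site this, of n]
  have "((\<lambda>j. a j *\<^sub>C at_site f (n - j)) has_sum at_site (conv_l2Z a f) n) UNIV"
    by (simp add: cscale_at_site shift_l2Z.rep_eq)
  then show ?thesis
    using has_sum_reindex_bij_betw[OF bij_minus_const(2)[of n], of "\<lambda>j. a j *\<^sub>C at_site f (n - j)"] by simp
qed

lemma summable_on_int:
  fixes f :: "int \<Rightarrow> real"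
  assumes "\<And>n. 0 \<le> f n" "summable (\<lambda>n. f (int n))" "summable (\<lambda>n. f (- int n))"
  shows "f summable_on UNIV"
proof -
  have "f summable_on range int"
    using summable_nonneg_imp_summable_on[OF assms(2,1)] by (subst summable_on_reindex) (auto simp: o_def)
  moreover have "f summable_on range (\<lambda>n. - int n)"
    using summable_nonneg_imp_summable_on[OF assms(3,1)]
    by (subst summable_on_reindex) (auto simp: o_def inj_on_def)
  ultimately have "f summable_on range int \<union> range (\<lambda>n. - int n)" by (rule summable_on_union)
  moreover have "n \<in> range int \<union> range (\<lambda>n. - int n)" for n
    by (cases n rule: int_cases2) auto
  then have "range int \<union> range (\<lambda>n. - int n) = UNIV" by blast
  ultimately show ?thesis by simp
qed

text \<open>The decaying fundamental solution, equal to h^2 w^|k| / (1/w - w) for nonzero w: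
  applying the lattice operator minus z gives the unit mass at 0 when w + 1/w = 2 - h^2 z.\<close>

definition green :: "real \<Rightarrow> complex \<Rightarrow> int \<Rightarrow> complex" where
  "green h w k = complex_of_real (h\<^sup>2) * w ^ (nat \<bar>k\<bar> + 1) / (1 - w\<^sup>2)"

lemma green_summable:
  assumes "cmod w < 1"
  shows "(\<lambda>k. cmod (green h w k)) summable_on UNIV"
proof -
  have "(\<lambda>k. cmod w ^ nat \<bar>k\<bar>) summable_on (UNIV :: int set)"
    by (rule summable_on_int) (use assms in \<open>auto intro: summable_geometric\<close>)
  from summable_on_cmult_right[OF this, of "h\<^sup>2 * cmod w / cmod (1 - w\<^sup>2)"] show ?thesis
    by (simp add: green_def norm_mult norm_divide norm_power mult_ac)
qed

text \<open>On either side of the origin the function is a pure power solving the homogeneous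
  recursion. Only k = 0 sees both sides, and the denominator 1 - w^2 normalizes the jump
  there.\<close>

lemma green_difference_equation:
  assumes "w \<noteq> 0" "w\<^sup>2 \<noteq> 1"
  shows "green h w (k + 1) + green h w (k - 1) - (w + 1 / w) * green h w k
    = (if k = 0 then - complex_of_real (h\<^sup>2) else 0)"
proof -
  have ne: "1 - w\<^sup>2 \<noteq> 0" using assms by auto
  have aux: "green h w (int (Suc j) + 1) + green h w (int (Suc j) - 1) - (w + 1 / w) * green h w (int (Suc j)) = 0" for j
  proof -
    define C where "C = complex_of_real (h\<^sup>2) / (1 - w\<^sup>2)"
    have "nat \<bar>int (Suc j) + 1\<bar> + 1 = j + 3" "nat \<bar>int (Suc j) - 1\<bar> + 1 = j + 1"
      "nat \<bar>int (Suc j)\<bar> + 1 = j + 2" by simp_all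
    then have "green h w (int (Suc j) + 1) = C * w ^ (j + 3)" "green h w (int (Suc j) - 1) = C * w ^ (j + 1)"
      "green h w (int (Suc j)) = C * w ^ (j + 2)" by (simp_all only: green_def C_def) simp_all
    then show ?thesis
      using assms(1) by (simp only:) (simp add: field_simps power_add power2_eq_square power3_eq_cube)
  qed
  have sym: "green h w (- j) = green h w j" for j by (simp add: green_def)
  show ?thesis
  proof (cases k rule: int_cases)
    case (nonneg n)
    then show ?thesis
    proof (cases n)
      case 0
      define C where "C = complex_of_real (h\<^sup>2) / (1 - w\<^sup>2)"
      have "green h w 1 = C * w\<^sup>2" "green h w (- 1) = C * w\<^sup>2" "green h w 0 = C * w"
        by (auto simp: green_def C_def power2_eq_square)
      then have "green h w 1 + green h w (- 1) - (w + 1 / w) * green h w 0 = - (C * (1 - w\<^sup>2))"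
        using assms(1) by (simp only:) (simp add: field_simps power2_eq_square)
      also have "C * (1 - w\<^sup>2) = complex_of_real (h\<^sup>2)" using ne by (simp add: C_def)
      finally show ?thesis using nonneg 0 by simp
    next
      case (Suc j)
      then show ?thesis using nonneg aux[of j] by simp
    qed
  next
    case (neg j)
    have "k + 1 = - (int (Suc j) - 1)" "k - 1 = - (int (Suc j) + 1)" using neg by simp_all
    then have "green h w (k + 1) = green h w (int (Suc j) - 1)" "green h w (k - 1) = green h w (int (Suc j) + 1)"
      "green h w k = green h w (int (Suc j))"
      unfolding neg by (simp_all only: sym)
    then show ?thesis using aux[of j] neg by (simp add: add.commute)
  qed
qed

text \<open>The coefficient (w + 1/w - 2) / h^2 is minus the spectral parameter, so this is the
  resolvent equation.\<close>

lemma conv_green_equation: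
  fixes f :: "'g :: complex_hilbert l2Z"
  assumes "w \<noteq> 0" "cmod w < 1" and h: "h > 0"
  defines "u \<equiv> at_site (conv_l2Z (green h w) f)"
  shows "(1 / h\<^sup>2) *\<^sub>R (2 *\<^sub>R u n - u (n + 1) - u (n - 1))
    + (complex_of_real (1 / h\<^sup>2) * (w + 1 / w - 2)) *\<^sub>C u n = at_site f n"
proof -
  have "cmod (w\<^sup>2) < 1" using assms(2) by (simp add: norm_power power_less_one_iff)
  then have w2: "w\<^sup>2 \<noteq> 1" by auto
  let ?c = "complex_of_real (1 / h\<^sup>2)"
  note hs = at_site_conv_l2Z[OF green_summable[OF assms(2), of h], where f = f, folded u_def]
  have scale: "bounded_linear (\<lambda>x. c *\<^sub>C x)" for c
    by (rule bounded_bilinear.bounded_linear_right[OF bounded_bilinear_cscale])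
  have "((\<lambda>m. (?c * (w + 1 / w)) *\<^sub>C (green h w (n - m) *\<^sub>C at_site f m)
      - ?c *\<^sub>C (green h w (n + 1 - m) *\<^sub>C at_site f m) - ?c *\<^sub>C (green h w (n - 1 - m) *\<^sub>C at_site f m))
      has_sum ((?c * (w + 1 / w)) *\<^sub>C u n - ?c *\<^sub>C u (n + 1) - ?c *\<^sub>C u (n - 1))) UNIV"
    by (intro has_sum_minus has_sum_bounded_linear[OF scale] hs)
  also have "(\<lambda>m. (?c * (w + 1 / w)) *\<^sub>C (green h w (n - m) *\<^sub>C at_site f m)
      - ?c *\<^sub>C (green h w (n + 1 - m) *\<^sub>C at_site f m) - ?c *\<^sub>C (green h w (n - 1 - m) *\<^sub>C at_site f m))
      = (\<lambda>m. if m = n then at_site f n else 0)"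
  proof
    fix m
    have "(?c * (w + 1 / w)) *\<^sub>C (green h w (n - m) *\<^sub>C at_site f m)
      - ?c *\<^sub>C (green h w (n + 1 - m) *\<^sub>C at_site f m) - ?c *\<^sub>C (green h w (n - 1 - m) *\<^sub>C at_site f m)
      = (- ?c * (green h w (n - m + 1) + green h w (n - m - 1) - (w + 1 / w) * green h w (n - m))) *\<^sub>C at_site f m"
      by (simp add: cscale_cscale algebra_simps cvec.scale_left_diff_distrib cscale_add_left)
         (simp add: add_divide_distrib cscale_add_left add.commute mult.commute)
    also have "\<dots> = (if m = n then at_site f n else 0)"
      unfolding green_difference_equation[OF assms(1) w2] using h by (simp add: cscale_one)
    finally show "(?c * (w + 1 / w)) *\<^sub>C (green h w (n - m) *\<^sub>C at_site f m)
      - ?c *\<^sub>C (green h w (n + 1 - m) *\<^sub>C at_site f m) - ?c *\<^sub>C (green h w (n - 1 - m) *\<^sub>C at_site f m)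
      = (if m = n then at_site f n else 0)" .
  qed
  finally have *: "((\<lambda>m. if m = n then at_site f n else 0)
      has_sum ((?c * (w + 1 / w)) *\<^sub>C u n - ?c *\<^sub>C u (n + 1) - ?c *\<^sub>C u (n - 1))) UNIV" .
  have "((\<lambda>m. if m = n then at_site f n else 0) has_sum at_site f n) UNIV"
    by (rule has_sum_finite_neutralI[of "{n}"]) auto
  with * have "(?c * (w + 1 / w)) *\<^sub>C u n - ?c *\<^sub>C u (n + 1) - ?c *\<^sub>C u (n - 1) = at_site f n"
    by (rule has_sum_unique)
  moreover have "(1 / h\<^sup>2) *\<^sub>R (2 *\<^sub>R u n - u (n + 1) - u (n - 1)) + (?c * (w + 1 / w - 2)) *\<^sub>C u n
      = (?c * (w + 1 / w)) *\<^sub>C u n - ?c *\<^sub>C u (n + 1) - ?c *\<^sub>C u (n - 1)"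
    by (simp add: scaleR_cscale cvec.scale_right_diff_distrib cvec.scale_left_diff_distrib cscale_cscale
        algebra_simps)
  ultimately show ?thesis by simp
qed

section \<open>Roots of the characteristic equation\<close>

text \<open>A branch of the inverse Joukowski map: the decaying root if there is one, and on the
  unit circle the root in the upper half plane, which is the boundary value from Im b < 0, that is
  from energies with positive imaginary part.\<close>

definition small_root :: "complex \<Rightarrow> complex" where
  "small_root b = (SOME w. w \<noteq> 0 \<and> w + 1 / w = b \<and> (cmod w < 1 \<or> cmod w = 1 \<and> Im w > 0))"

text \<open>The two roots are inverse to each other, so one lies in the closed disc. On the circle
  they are conjugate, and they coincide only at 1 or -1, that is for b = 2 or b = -2.\<close>

lemma small_root:
  assumes "b \<noteq> 2" "b \<noteq> - 2"
  defines "w \<equiv> small_root b"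
  shows "w \<noteq> 0" "w + 1 / w = b" "cmod w < 1 \<or> cmod w = 1 \<and> Im w > 0" "cmod w \<le> 1" "w\<^sup>2 \<noteq> 1"
proof -
  define v where "v = (b + csqrt (b\<^sup>2 - 4)) / 2"
  define c where "c = csqrt (b\<^sup>2 - 4)"
  have "c\<^sup>2 = b\<^sup>2 - 4" by (simp add: c_def)
  then have "(b + c) * (b + c) = 2 * b * b + 2 * b * c - 4"
    by (simp add: power2_eq_square algebra_simps)
  moreover have "v * v + 1 = (b + c) * (b + c) / 4 + 1" by (simp add: v_def c_def)
  ultimately have q: "v * v + 1 = b * v" by (simp only:) (simp add: v_def c_def field_simps)
  then have v0: "v \<noteq> 0" by auto
  then have vb: "v + 1 / v = b" using q by (simp add: field_simps)
  have "\<exists>w. w \<noteq> 0 \<and> w + 1 / w = b \<and> (cmod w < 1 \<or> cmod w = 1 \<and> Im w > 0)"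
  proof (cases "cmod v < 1 \<or> cmod v = 1 \<and> Im v > 0")
    case True
    then show ?thesis using v0 vb by blast
  next
    case False
    then consider "cmod v > 1" | "cmod v = 1" "Im v \<le> 0" by linarith
    then have "cmod (1 / v) < 1 \<or> cmod (1 / v) = 1 \<and> Im (1 / v) > 0"
    proof cases
      case 1
      then show ?thesis by (auto simp: norm_divide divide_less_eq)
    next
      case 2
      have "Im v \<noteq> 0"
      proof
        assume "Im v = 0"
        then have "v = complex_of_real (Re v)" "\<bar>Re v\<bar> = 1" using 2(1) by (auto simp: complex_eq_iff cmod_def)
        then have "v = 1 \<or> v = - 1" by (metis abs_eq_iff' of_real_1 of_real_minus zero_le_one)
        then show False using vb assms(1,2) by auto
      qed
      then show ?thesis using 2 by (simp add: norm_divide Im_divide cmod_power2[symmetric])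
    qed
    then show ?thesis using v0 vb by (intro exI[of _ "1 / v"]) (auto simp: add.commute)
  qed
  from someI_ex[OF this] show w: "w \<noteq> 0" "w + 1 / w = b" "cmod w < 1 \<or> cmod w = 1 \<and> Im w > 0"
    unfolding w_def small_root_def by auto
  then show "cmod w \<le> 1" by auto
  show "w\<^sup>2 \<noteq> 1" using w(2) assms(1,2) by (auto simp: power2_eq_1_iff)
qed

lemma Im_joukowski: "Im (w + 1 / w) = Im w * (1 - 1 / (cmod w)\<^sup>2)"
  by (simp add: Im_divide cmod_power2 algebra_simps)

lemma joukowski_factor_neg: "w \<noteq> 0 \<Longrightarrow> cmod w < 1 \<Longrightarrow> 1 - 1 / (cmod w)\<^sup>2 < 0"
  by (simp add: power_less_one_iff divide_simps)

text \<open>The formula for the imaginary part shows that the circle goes to the real line and,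
  inside the disc, that Im w and Im b have opposite signs.\<close>

lemma small_root_nonreal:
  assumes "Im b < 0"
  shows "cmod (small_root b) < 1" "Im (small_root b) > 0"
proof -
  let ?w = "small_root b"
  have "b \<noteq> 2" "b \<noteq> - 2" using assms by auto
  note w = small_root[OF this]
  have im: "Im ?w * (1 - 1 / (cmod ?w)\<^sup>2) < 0" using assms unfolding Im_joukowski[symmetric] w(2) .
  then show l: "cmod ?w < 1" using w(3) by auto
  have "1 - 1 / (cmod ?w)\<^sup>2 < 0" by (rule joukowski_factor_neg[OF w(1) l])
  then show "Im ?w > 0" using im by (simp add: mult_less_0_iff)
qed

text \<open>A root strictly inside the disc would have to be a real x, and then b^2 - 4 = (x -
  1/x)^2 would be nonnegative. So the root is exp(i \<theta>) with 2 cos \<theta> = b.\<close>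

lemma small_root_inside:
  assumes "\<bar>b\<bar> < 2"
  shows "cmod (small_root (complex_of_real b)) = 1" "Re (small_root (complex_of_real b)) = b / 2"
    "Im (small_root (complex_of_real b)) = sqrt (4 - b\<^sup>2) / 2"
proof -
  let ?w = "small_root (complex_of_real b)"
  have "complex_of_real b \<noteq> 2" "complex_of_real b \<noteq> - 2" using assms by (auto simp: complex_eq_iff)
  note w = small_root[OF this]
  have "Im ?w * (1 - 1 / (cmod ?w)\<^sup>2) = 0" unfolding Im_joukowski[symmetric] w(2) by simp
  show c: "cmod ?w = 1"
  proof (rule ccontr)
    assume "cmod ?w \<noteq> 1"
    then have l: "cmod ?w < 1" using w(3) by auto
    have "1 - 1 / (cmod ?w)\<^sup>2 \<noteq> 0" using joukowski_factor_neg[OF w(1) l] by (rule less_imp_neq)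
    then have "Im ?w = 0" using \<open>Im ?w * _ = 0\<close> unfolding mult_eq_0_iff by blast
    then obtain x where x: "?w = complex_of_real x" by (metis complex_is_Real_iff Reals_cases)
    have x0: "x \<noteq> 0" using w(1) unfolding x by simp
    have "complex_of_real (x + 1 / x) = complex_of_real b" using w(2) unfolding x by simp
    then have xb: "x + 1 / x = b" by (simp only: of_real_eq_iff)
    have "4 \<le> b\<^sup>2"
    proof -
      have "b\<^sup>2 - 4 = (x - 1 / x)\<^sup>2" using x0 unfolding xb[symmetric] by (simp add: field_simps power2_eq_square)
      then show ?thesis by (metis zero_le_power2 diff_ge_0_iff_ge)
    qed
    then have "2\<^sup>2 \<le> \<bar>b\<bar>\<^sup>2" by simp
    then have "2 \<le> \<bar>b\<bar>" by (rule power2_le_imp_le) simp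
    then show False using assms by simp
  qed
  then have "1 / ?w = cnj ?w" using w(1)
    by (simp add: field_simps complex_norm_square[symmetric])
  then have "complex_of_real (2 * Re ?w) = complex_of_real b" using w(2) by (simp add: complex_add_cnj)
  then show re: "Re ?w = b / 2" by (simp only: of_real_eq_iff)
  have "(Im ?w)\<^sup>2 = (4 - b\<^sup>2) / 4" using cmod_power2[of ?w] unfolding c re by (simp add: power_divide field_simps)
  then have "(2 * Im ?w)\<^sup>2 = 4 - b\<^sup>2" by (simp add: power_mult_distrib)
  moreover have "Im ?w > 0" using w(3) c by simp
  ultimately show "Im ?w = sqrt (4 - b\<^sup>2) / 2" by (metis real_sqrt_unique less_imp_le mult_pos_pos zero_less_numeral nonzero_mult_div_cancel_left zero_neq_numeral)
qed

text \<open>On the circle |w + 1/w| is at most 2, so the root is inside and real. The last claim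
  gives the size of the denominator of the Green function.\<close>

lemma small_root_outside:
  assumes "\<bar>b\<bar> > 2"
  shows "cmod (small_root (complex_of_real b)) < 1" "Im (small_root (complex_of_real b)) = 0"
    "cmod (1 / small_root (complex_of_real b) - small_root (complex_of_real b)) = sqrt (b\<^sup>2 - 4)"
proof -
  let ?w = "small_root (complex_of_real b)"
  have "complex_of_real b \<noteq> 2" "complex_of_real b \<noteq> - 2" using assms by (auto simp: complex_eq_iff)
  note w = small_root[OF this]
  have im0: "Im ?w * (1 - 1 / (cmod ?w)\<^sup>2) = 0" unfolding Im_joukowski[symmetric] w(2) by simp
  show l: "cmod ?w < 1"
  proof (rule ccontr)
    assume "\<not> cmod ?w < 1"
    then have "cmod ?w = 1" using w(3) by auto
    then have "\<bar>b\<bar> \<le> 2"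
      using norm_triangle_ineq[of ?w "1 / ?w"] unfolding w(2) by (simp add: norm_divide)
    then show False using assms by simp
  qed
  have "1 - 1 / (cmod ?w)\<^sup>2 \<noteq> 0" using joukowski_factor_neg[OF w(1) l] by (rule less_imp_neq)
  then show "Im ?w = 0" using im0 unfolding mult_eq_0_iff by blast
  have "(1 / ?w - ?w)\<^sup>2 = (?w + 1 / ?w)\<^sup>2 - 4"
    using w(1) by (simp add: field_simps power2_eq_square)
  also have "\<dots> = complex_of_real (b\<^sup>2 - 4)" unfolding w(2) by simp
  finally have "(cmod (1 / ?w - ?w))\<^sup>2 = \<bar>b\<^sup>2 - 4\<bar>" by (metis norm_of_real norm_power)
  moreover have "b\<^sup>2 > 4" using assms power_strict_mono[of 2 "\<bar>b\<bar>" 2] by simp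
  ultimately show "cmod (1 / ?w - ?w) = sqrt (b\<^sup>2 - 4)" by (metis abs_of_pos diff_gt_0_iff_gt norm_ge_zero real_sqrt_unique)
qed

text \<open>The identity (w - v) (w - 1/v) = w (b - b0) reduces continuity to keeping w away from
  the wrong root 1/v. That root lies in the lower half plane if v is on the circle and outside the
  disc otherwise, while w stays in the upper half disc.\<close>

lemma small_root_tendsto:
  assumes b0: "\<bar>b0\<bar> \<noteq> 2" and lim: "(b \<longlongrightarrow> complex_of_real b0) F" and neg: "\<forall>\<^sub>F e in F. Im (b e) < 0"
  shows "((\<lambda>e. small_root (b e)) \<longlongrightarrow> small_root (complex_of_real b0)) F"
proof -
  let ?v = "small_root (complex_of_real b0)"
  have "complex_of_real b0 \<noteq> 2" "complex_of_real b0 \<noteq> - 2" using b0 by (auto simp: complex_eq_iff)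
  note v = small_root[OF this]
  obtain \<delta> where \<delta>: "\<delta> > 0" "\<And>w. cmod w < 1 \<Longrightarrow> Im w > 0 \<Longrightarrow> \<delta> \<le> cmod (w - 1 / ?v)"
  proof (cases "cmod ?v = 1")
    case True
    have "1 / ?v = cnj ?v" using True v(1) by (simp add: field_simps complex_norm_square[symmetric])
    moreover have iv: "Im ?v > 0" using v(3) True by simp
    moreover have "Im ?v \<le> cmod (w - cnj ?v)" if "Im w > 0" for w
      using abs_Im_le_cmod[of "w - cnj ?v"] that iv by simp
    ultimately show ?thesis using that[of "Im ?v"] by simp
  next
    case False
    then have l: "cmod ?v < 1" using v(3) by auto
    have "1 / cmod ?v - 1 \<le> cmod (w - 1 / ?v)" if "cmod w < 1" for w
      using norm_triangle_ineq2[of "1 / ?v" w] that by (simp add: norm_divide norm_minus_commute)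
    moreover have "1 / cmod ?v - 1 > 0" using l v(1) by simp
    ultimately show ?thesis using that[of "1 / cmod ?v - 1"] by simp
  qed
  have bound: "cmod (small_root (b e) - ?v) \<le> cmod (b e - complex_of_real b0) / \<delta>" if "Im (b e) < 0" for e
  proof -
    let ?w = "small_root (b e)"
    note nr = small_root_nonreal[OF that]
    have "b e \<noteq> 2" "b e \<noteq> - 2" using that by auto
    note w = small_root[OF this]
    have "(?w - ?v) * (?w - 1 / ?v) = ?w * ((?w + 1 / ?w) - (?v + 1 / ?v))"
      using w(1) v(1) by (simp add: field_simps)
    also have "\<dots> = ?w * (b e - complex_of_real b0)" unfolding w(2) v(2) ..
    finally have "cmod (?w - ?v) * cmod (?w - 1 / ?v) = cmod ?w * cmod (b e - complex_of_real b0)"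
      by (metis norm_mult)
    moreover have "cmod (?w - ?v) * \<delta> \<le> cmod (?w - ?v) * cmod (?w - 1 / ?v)"
      by (intro mult_left_mono \<delta>(2) nr) simp
    moreover have "cmod ?w * cmod (b e - complex_of_real b0) \<le> 1 * cmod (b e - complex_of_real b0)"
      using nr(1) by (intro mult_right_mono) auto
    ultimately show ?thesis using \<delta>(1) by (simp add: field_simps)
  qed
  have "((\<lambda>e. cmod (b e - complex_of_real b0) / \<delta>) \<longlongrightarrow> 0) F"
    using tendsto_divide[OF tendsto_norm_zero[OF LIM_zero[OF lim]] tendsto_const, of \<delta>] \<delta>(1) by simp
  moreover have "\<forall>\<^sub>F e in F. cmod (small_root (b e) - ?v) \<le> cmod (b e - complex_of_real b0) / \<delta>"
    by (rule eventually_mono[OF neg]) (rule bound)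
  ultimately have "((\<lambda>e. small_root (b e) - ?v) \<longlongrightarrow> 0) F"
    by (rule Lim_null_comparison[rotated])
  then show ?thesis by (simp add: LIM_zero_iff)
qed

section \<open>Weights and the kernels of the sandwiched resolvent\<close>

text \<open>The factor 1 + |n| absorbs the linear growth of the kernels. The square decays like
  |n|^(2 - \<nu>), which is summable for \<nu> > 3.\<close>

definition lat_weight :: "real \<Rightarrow> int \<Rightarrow> real" where
  "lat_weight \<nu> n = psi \<nu> n * (1 + \<bar>real_of_int n\<bar>)"

lemma psi_nonneg: "0 \<le> psi \<nu> n"
  by (simp add: psi_def)

lemma psi_le_one: "0 \<le> \<nu> \<Longrightarrow> psi \<nu> n \<le> 1"
  unfolding psi_def by (rule order_trans[OF powr_mono2'[of _ 1]]) auto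

lemma lat_weight_nonneg: "0 \<le> lat_weight \<nu> n"
  by (simp add: lat_weight_def psi_nonneg)

lemma lat_weight_summable:
  assumes "\<nu> > 3"
  shows "(\<lambda>n. (lat_weight \<nu> n)\<^sup>2) summable_on UNIV"
proof -
  have even: "lat_weight \<nu> (- n) = lat_weight \<nu> n" for n by (simp add: lat_weight_def psi_def)
  have bound: "(lat_weight \<nu> (int n))\<^sup>2 \<le> 4 * real n powr (2 - \<nu>)" if n: "n \<ge> 1" for n
  proof -
    let ?x = "real n"
    have x: "?x \<ge> 1" using n by simp
    have "psi \<nu> (int n) = (1 + ?x\<^sup>2) powr (- \<nu> / 4)"
      by (simp add: psi_def powr_half_sqrt[symmetric] powr_powr)
    also have "\<dots> \<le> (?x\<^sup>2) powr (- \<nu> / 4)" using x assms by (intro powr_mono2') auto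
    also have "\<dots> = ?x powr (- \<nu> / 2)" using x by (simp add: powr_powr powr_realpow[symmetric] flip: powr_numeral)
    finally have "lat_weight \<nu> (int n) \<le> ?x powr (- \<nu> / 2) * (2 * ?x)"
      unfolding lat_weight_def using x by (intro mult_mono) auto
    then have "(lat_weight \<nu> (int n))\<^sup>2 \<le> (?x powr (- \<nu> / 2) * (2 * ?x))\<^sup>2"
      by (intro power_mono lat_weight_nonneg)
    also have "\<dots> = 4 * (?x powr (- \<nu> / 2) * ?x powr (- \<nu> / 2) * ?x powr 2)"
      using x by (simp add: power2_eq_square powr_numeral)
    also have "?x powr (- \<nu> / 2) * ?x powr (- \<nu> / 2) * ?x powr 2 = ?x powr (2 - \<nu>)"
      by (simp only: powr_add[symmetric]) simp
    finally show ?thesis by simp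
  qed
  have "summable (\<lambda>n. (lat_weight \<nu> (int n))\<^sup>2)"
    by (rule summable_comparison_test'[where N = 1 and g = "\<lambda>n. 4 * real n powr (2 - \<nu>)"])
       (use assms bound in \<open>auto simp: summable_real_powr_iff intro!: summable_mult\<close>)
  then show ?thesis by (intro summable_on_int) (simp_all add: even)
qed

definition lat_kernel :: "real \<Rightarrow> real \<Rightarrow> complex \<Rightarrow> int \<Rightarrow> int \<Rightarrow> complex" where
  "lat_kernel \<nu> h w n m = complex_of_real (psi \<nu> n * psi \<nu> m) * green h w (n - m)"

text \<open>The inequality 1 + |n - m| \<le> (1 + |n|) (1 + |m|) distributes linear growth over the
  two weights.\<close>

lemma kernel_le_weighted:
  assumes "0 \<le> C" "\<And>j. cmod (g j) \<le> C * (1 + \<bar>real_of_int j\<bar>)"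
  shows "kernel_le (lat_weight \<nu>) (\<lambda>n m. complex_of_real (psi \<nu> n * psi \<nu> m) * g (n - m)) C"
  unfolding kernel_le_def
proof (intro conjI allI assms(1))
  fix n m
  have "1 + \<bar>real_of_int (n - m)\<bar> \<le> (1 + \<bar>real_of_int n\<bar>) * (1 + \<bar>real_of_int m\<bar>)"
  proof -
    have "(1 + \<bar>real_of_int n\<bar>) * (1 + \<bar>real_of_int m\<bar>)
        = 1 + \<bar>real_of_int n\<bar> + \<bar>real_of_int m\<bar> + \<bar>real_of_int n\<bar> * \<bar>real_of_int m\<bar>"
      by (simp add: algebra_simps)
    moreover have "0 \<le> \<bar>real_of_int n\<bar> * \<bar>real_of_int m\<bar>" by simp
    ultimately show ?thesis using abs_triangle_ineq4[of "real_of_int n" "real_of_int m"] unfolding of_int_diff by linarith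
  qed
  then have "cmod (g (n - m)) \<le> C * ((1 + \<bar>real_of_int n\<bar>) * (1 + \<bar>real_of_int m\<bar>))"
    using assms by (meson mult_left_mono order_trans)
  then have "(psi \<nu> n * psi \<nu> m) * cmod (g (n - m))
      \<le> (psi \<nu> n * psi \<nu> m) * (C * ((1 + \<bar>real_of_int n\<bar>) * (1 + \<bar>real_of_int m\<bar>)))"
    by (intro mult_left_mono mult_nonneg_nonneg psi_nonneg)
  then show "cmod (complex_of_real (psi \<nu> n * psi \<nu> m) * g (n - m)) \<le> C * lat_weight \<nu> n * lat_weight \<nu> m"
    by (simp add: norm_mult lat_weight_def psi_nonneg mult_ac abs_mult del: of_real_mult)
qed

lemma kernel_le_lat_kernel:
  assumes "cmod w \<le> 1"
  shows "kernel_le (lat_weight \<nu>) (lat_kernel \<nu> h w) (h\<^sup>2 / cmod (1 - w\<^sup>2))"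
  unfolding lat_kernel_def
proof (rule kernel_le_weighted)
  fix j
  have "cmod (green h w j) = h\<^sup>2 / cmod (1 - w\<^sup>2) * cmod w ^ (nat \<bar>j\<bar> + 1)"
    by (simp add: green_def norm_mult norm_divide norm_power)
  also have "\<dots> \<le> h\<^sup>2 / cmod (1 - w\<^sup>2) * (1 + \<bar>real_of_int j\<bar>)"
    using power_le_one[OF norm_ge_zero assms, of "nat \<bar>j\<bar> + 1"] by (intro mult_left_mono) auto
  finally show "cmod (green h w j) \<le> h\<^sup>2 / cmod (1 - w\<^sup>2) * (1 + \<bar>real_of_int j\<bar>)" .
qed simp

text \<open>On the closed disc |w^k - v^k| \<le> k |w - v|. The weight tolerates the factor k, so
  continuity holds up to the unit circle, where powers no longer decay.\<close>

lemma kernel_le_lat_kernel_diff: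
  assumes "cmod w \<le> 1" "cmod v \<le> 1" "w\<^sup>2 \<noteq> 1" "v\<^sup>2 \<noteq> 1"
  shows "kernel_le (lat_weight \<nu>) (\<lambda>n m. lat_kernel \<nu> h w n m - lat_kernel \<nu> h v n m)
    (h\<^sup>2 * (cmod (w - v) / cmod (1 - w\<^sup>2) + cmod (1 / (1 - w\<^sup>2) - 1 / (1 - v\<^sup>2))))"
proof -
  let ?C = "h\<^sup>2 * (cmod (w - v) / cmod (1 - w\<^sup>2) + cmod (1 / (1 - w\<^sup>2) - 1 / (1 - v\<^sup>2)))"
  have "cmod (green h w j - green h v j) \<le> ?C * (1 + \<bar>real_of_int j\<bar>)" for j
  proof -
    let ?k = "nat \<bar>j\<bar> + 1"
    have k: "real ?k = 1 + \<bar>real_of_int j\<bar>" by simp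
    have "green h w j - green h v j = complex_of_real (h\<^sup>2) *
        ((w ^ ?k - v ^ ?k) / (1 - w\<^sup>2) + v ^ ?k * (1 / (1 - w\<^sup>2) - 1 / (1 - v\<^sup>2)))"
      by (simp add: green_def diff_divide_distrib algebra_simps)
    then have "cmod (green h w j - green h v j) = h\<^sup>2 *
        cmod ((w ^ ?k - v ^ ?k) / (1 - w\<^sup>2) + v ^ ?k * (1 / (1 - w\<^sup>2) - 1 / (1 - v\<^sup>2)))"
      by (simp only: norm_mult norm_of_real abs_of_nonneg[OF zero_le_power2])
    also have "\<dots> \<le> h\<^sup>2 * (real ?k * cmod (w - v) / cmod (1 - w\<^sup>2)
        + real ?k * cmod (1 / (1 - w\<^sup>2) - 1 / (1 - v\<^sup>2)))"
    proof (intro mult_left_mono norm_triangle_le add_mono)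
      show "cmod ((w ^ ?k - v ^ ?k) / (1 - w\<^sup>2)) \<le> real ?k * cmod (w - v) / cmod (1 - w\<^sup>2)"
        unfolding norm_divide by (intro divide_right_mono norm_power_diff assms) simp
      have "cmod v ^ ?k \<le> real ?k"
        using power_le_one[OF norm_ge_zero assms(2), of ?k] by simp
      then show "cmod (v ^ ?k * (1 / (1 - w\<^sup>2) - 1 / (1 - v\<^sup>2)))
          \<le> real ?k * cmod (1 / (1 - w\<^sup>2) - 1 / (1 - v\<^sup>2))"
        unfolding norm_mult norm_power by (rule mult_right_mono) simp
    qed simp
    also have "\<dots> = ?C * (1 + \<bar>real_of_int j\<bar>)" unfolding k by (simp add: algebra_simps)
    finally show ?thesis .
  qed
  then have "kernel_le (lat_weight \<nu>)
      (\<lambda>n m. complex_of_real (psi \<nu> n * psi \<nu> m) * (green h w (n - m) - green h v (n - m))) ?C"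
    by (intro kernel_le_weighted) auto
  then show ?thesis by (simp add: lat_kernel_def right_diff_distrib)
qed

section \<open>The resolvent of the free operator\<close>

lemma bounded_clinear_mult_tensor:
  assumes B: "bounded_clinear B" and a: "\<And>n. \<bar>a n\<bar> \<le> C"
  shows "bounded_clinear (mult_tensor a B)"
proof -
  obtain D where D: "D > 0" "\<And>x. norm (B x) \<le> D * norm x" using bounded_clinear_bounded[OF B] by metis
  have C: "0 \<le> C" using a[of 0] by simp
  note at = at_site_mult_tensor[OF B a]
  show ?thesis
  proof (rule bounded_clinearI)
    show "mult_tensor a B (f + g) = mult_tensor a B f + mult_tensor a B g" for f g
      by (rule l2Z_eqI) (simp add: at plus_l2Z.rep_eq bounded_clinear_add[OF B] scaleR_right_distrib)
    show "mult_tensor a B (c *\<^sub>C f) = c *\<^sub>C mult_tensor a B f" for c f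
      by (rule l2Z_eqI) (simp add: at cscale_at_site bounded_clinear_cscale[OF B] scaleR_cscale cscale_cscale mult.commute)
    fix f
    have "(norm (mult_tensor a B f))\<^sup>2 \<le> (C * D)\<^sup>2 * (norm f)\<^sup>2"
    proof (rule norm_l2Z_le[OF _ has_sum_cmult_right[OF norm_l2Z_has_sum]])
      fix n
      have "norm (a n *\<^sub>R B (at_site f n)) \<le> C * (D * norm (at_site f n))"
        unfolding norm_scaleR using C by (intro mult_mono a D) auto
      then show "(norm (at_site (mult_tensor a B f) n))\<^sup>2 \<le> (C * D)\<^sup>2 * (norm (at_site f n))\<^sup>2"
        unfolding at by (metis mult.assoc norm_ge_zero power_mono power_mult_distrib)
    qed
    then have "(norm (mult_tensor a B f))\<^sup>2 \<le> (norm f * (C * D))\<^sup>2" by (simp add: power_mult_distrib mult.commute)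
    then show "norm (mult_tensor a B f) \<le> norm f * (C * D)"
      by (rule power2_le_imp_le) (use C D(1) in simp)
  qed
qed

lemma cadjoint_mult_tensor:
  assumes B: "bounded_clinear B" and a: "\<And>n. \<bar>a n\<bar> \<le> C"
  shows "cadjoint (mult_tensor a B) = mult_tensor a (cadjoint B)"
proof (rule cadjoint_eqI)
  note B' = bounded_clinear_cadjoint[OF B]
  show "bounded_clinear (mult_tensor a (cadjoint B))" by (rule bounded_clinear_mult_tensor[OF B' a])
  show "cinner (mult_tensor a B f) g = cinner f (mult_tensor a (cadjoint B) g)" for f g
    unfolding cinner_l2Z_def at_site_mult_tensor[OF B a] at_site_mult_tensor[OF B' a]
    by (simp add: cinner_scaleR_left cinner_scaleR_right cinner_cadjoint_right[OF B])
qed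

lemma cinner_shift_l2Z: "cinner f (shift_l2Z j g) = cinner (shift_l2Z (- j) f) g"
proof -
  have "bij (\<lambda>n::int. n + j)"
    by (rule bij_betw_byWitness[of _ "\<lambda>n. n - j"]) auto
  from infsum_reindex_bij_betw[OF this, of "\<lambda>n. cinner (at_site f n) (at_site g (n - j))"]
  show ?thesis by (simp add: cinner_l2Z_def shift_l2Z.rep_eq)
qed

lemma neg_laplacian_shift:
  "neg_laplacian h f = (1 / h\<^sup>2) *\<^sub>R (2 *\<^sub>R f - shift_l2Z (- 1) f - shift_l2Z 1 f)"
  by (rule l2Z_eqI) (simp add: neg_laplacian.rep_eq scaleR_l2Z.rep_eq minus_l2Z.rep_eq shift_l2Z.rep_eq)

lemma cinner_neg_laplacian: "cinner f (neg_laplacian h g) = cinner (neg_laplacian h f) g"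
  unfolding neg_laplacian_shift
  by (simp add: cinner_scaleR_left cinner_scaleR_right cinner_diff_left cinner_diff_right cinner_shift_l2Z)

context
  fixes h :: real and Q :: "'g :: complex_hilbert \<Rightarrow> 'g" and d :: nat and \<mu> :: "nat \<Rightarrow> real"
  assumes h: "h > 0" and dec: "finite_spectral_decomposition Q d \<mu>"
begin

lemma Q_selfadjoint: "selfadjoint_op Q"
  using dec by (simp add: finite_spectral_decomposition_def)

lemma finite_I_Q: "finite (I_Q Q d)"
  by (simp add: I_Q_def)

lemma inj_on_eigenvalues: "inj_on \<mu> (I_Q Q d)"
  using dec by (auto simp: finite_spectral_decomposition_def I_Q_def)

lemma eigenspace_decomposition:
  "\<exists>y. (\<forall>s\<in>I_Q Q d. y s \<in> eigspace Q (\<mu> s)) \<and> x = (\<Sum>s\<in>I_Q Q d. y s)"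
proof (cases "Q = (\<lambda>_. 0)")
  case True
  then have "\<mu> 0 = 0" using dec by (simp add: finite_spectral_decomposition_def)
  then show ?thesis using True by (intro exI[of _ "\<lambda>_. x"]) (simp add: I_Q_def eigspace_def)
next
  case False
  then show ?thesis using dec by (simp add: finite_spectral_decomposition_def I_Q_def)
qed

lemma eigspace_subspace: "cvec.subspace (eigspace Q \<kappa>)"
  by (rule cvec.subspaceI)
     (auto simp: eigspace_def bounded_clinear_zero bounded_clinear_add bounded_clinear_cscale
       selfadjoint_opD(1)[OF Q_selfadjoint] cscale_add_right cscale_cscale mult.commute)

text \<open>Eigenspaces for different eigenvalues are orthogonal, so the algebraic components of x
  already satisfy the description of the orthogonal projections.\<close>

lemma pi_proj_component:
  assumes "\<And>s. s \<in> I_Q Q d \<Longrightarrow> y s \<in> eigspace Q (\<mu> s)" "x = (\<Sum>s\<in>I_Q Q d. y s)" "s \<in> I_Q Q d"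
  shows "pi_proj Q \<mu> s x = y s"
  unfolding pi_proj_def
proof (rule orth_proj_eqI[OF eigspace_subspace assms(1)[OF assms(3)]])
  fix z assume z: "z \<in> eigspace Q (\<mu> s)"
  have "x - y s = (\<Sum>t\<in>I_Q Q d - {s}. y t)"
    using sum.remove[OF finite_I_Q assms(3), of y] assms(2) by simp
  moreover have "cinner z (y t) = 0" if "t \<in> I_Q Q d - {s}" for t
    using eigenvectors_orthogonal[OF Q_selfadjoint, of z "\<mu> s" "y t" "\<mu> t"] z assms(1)[of t] that
      inj_on_eigenvalues assms(3) by (auto simp: eigspace_def inj_on_def)
  ultimately show "cinner z (x - y s) = 0" by (simp add: cinner_sum_right)
qed

lemma pi_proj_in_eigspace:
  assumes s: "s \<in> I_Q Q d"
  shows "Q (pi_proj Q \<mu> s x) = complex_of_real (\<mu> s) *\<^sub>C pi_proj Q \<mu> s x"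
proof -
  obtain y where y: "\<And>s. s \<in> I_Q Q d \<Longrightarrow> y s \<in> eigspace Q (\<mu> s)" "x = (\<Sum>s\<in>I_Q Q d. y s)"
    using eigenspace_decomposition[of x] by auto
  have "pi_proj Q \<mu> s x = y s" using y s by (intro pi_proj_component) auto
  then show ?thesis using y(1)[OF s] by (simp add: eigspace_def)
qed

lemma sum_pi_proj: "(\<Sum>s\<in>I_Q Q d. pi_proj Q \<mu> s x) = x"
proof -
  obtain y where y: "\<And>s. s \<in> I_Q Q d \<Longrightarrow> y s \<in> eigspace Q (\<mu> s)" "x = (\<Sum>s\<in>I_Q Q d. y s)"
    using eigenspace_decomposition[of x] by auto
  have "(\<Sum>s\<in>I_Q Q d. pi_proj Q \<mu> s x) = (\<Sum>s\<in>I_Q Q d. y s)"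
    by (rule sum.cong[OF refl]) (rule pi_proj_component[of y, OF y])
  then show ?thesis using y(2) by simp
qed

lemma cinner_pi_proj:
  assumes "s \<in> I_Q Q d"
  shows "cinner (pi_proj Q \<mu> s x) y = cinner (pi_proj Q \<mu> s x) (pi_proj Q \<mu> s y)"
proof -
  have "cinner (pi_proj Q \<mu> s x) (pi_proj Q \<mu> t y) = 0" if "t \<in> I_Q Q d - {s}" for t
    using eigenvectors_orthogonal[OF Q_selfadjoint pi_proj_in_eigspace pi_proj_in_eigspace, of s t] that assms
      inj_on_eigenvalues by (auto simp: inj_on_def)
  then have "(\<Sum>t\<in>I_Q Q d - {s}. cinner (pi_proj Q \<mu> s x) (pi_proj Q \<mu> t y)) = 0" by simp
  moreover have "cinner (pi_proj Q \<mu> s x) y = (\<Sum>t\<in>I_Q Q d. cinner (pi_proj Q \<mu> s x) (pi_proj Q \<mu> t y))"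
    by (simp add: sum_pi_proj flip: cinner_sum_right)
  ultimately show ?thesis using sum.remove[OF finite_I_Q assms, of "\<lambda>t. cinner (pi_proj Q \<mu> s x) (pi_proj Q \<mu> t y)"]
    by simp
qed

lemma pi_proj_selfadjoint:
  assumes s: "s \<in> I_Q Q d"
  shows "selfadjoint_op (pi_proj Q \<mu> s)" "norm (pi_proj Q \<mu> s x) \<le> norm x"
    "cinner x (pi_proj Q \<mu> s x) = cinner (pi_proj Q \<mu> s x) (pi_proj Q \<mu> s x)"
proof -
  have sym: "cinner (pi_proj Q \<mu> s x) y = cinner x (pi_proj Q \<mu> s y)" for x y
    by (metis cinner_pi_proj[OF s] cinner_commute)
  have n: "norm (pi_proj Q \<mu> s x) \<le> norm x" for x
  proof (cases "pi_proj Q \<mu> s x = 0")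
    case False
    have "(norm (pi_proj Q \<mu> s x))\<^sup>2 = cmod (cinner (pi_proj Q \<mu> s x) x)"
      unfolding cinner_pi_proj[OF s, of x x] by (simp add: cinner_self norm_power)
    also have "\<dots> \<le> norm (pi_proj Q \<mu> s x) * norm x" by (rule norm_cinner_le)
    finally show ?thesis using False by (simp add: power2_eq_square)
  qed simp
  show "norm (pi_proj Q \<mu> s x) \<le> norm x" by (rule n)
  have "bounded_clinear (pi_proj Q \<mu> s)"
  proof (rule bounded_clinearI[where K = 1])
    show "pi_proj Q \<mu> s (x + y) = pi_proj Q \<mu> s x + pi_proj Q \<mu> s y" for x y
      by (rule cinner_ext) (simp add: cinner_add_right flip: sym)
    show "pi_proj Q \<mu> s (c *\<^sub>C x) = c *\<^sub>C pi_proj Q \<mu> s x" for c x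
      by (rule cinner_ext) (simp add: cinner_cscale_right flip: sym)
  qed (simp add: n)
  then show "selfadjoint_op (pi_proj Q \<mu> s)" by (simp add: selfadjoint_op_def sym)
  show "cinner x (pi_proj Q \<mu> s x) = cinner (pi_proj Q \<mu> s x) (pi_proj Q \<mu> s x)"
    by (metis cinner_pi_proj[OF s] sym)
qed

lemmas bounded_clinear_pi_proj = selfadjoint_opD(1)[OF pi_proj_selfadjoint(1)]

lemma at_site_H_free:
  "at_site (H_free h Q f) n = (1 / h\<^sup>2) *\<^sub>R (2 *\<^sub>R at_site f n - at_site f (n + 1) - at_site f (n - 1)) + Q (at_site f n)"
  using at_site_mult_tensor[OF selfadjoint_opD(1)[OF Q_selfadjoint], of "\<lambda>_. 1" 1 f n]
  by (simp add: H_free_def plus_l2Z.rep_eq neg_laplacian.rep_eq)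

text \<open>The value of w + 1/w that belongs to the energy z - \<mu>(s) measured from the bottom of
  the band.\<close>

definition char_coeff :: "complex \<Rightarrow> nat \<Rightarrow> complex" where
  "char_coeff z s = 2 - complex_of_real (h\<^sup>2) * (z - complex_of_real (\<mu> s))"

text \<open>A symmetric operator has no nonreal eigenvalue. Injectivity is needed because
  \<open>resolvent\<close> is an \<open>inv\<close>.\<close>

lemma H_free_injective:
  assumes z: "Im z \<noteq> 0" and "H_free h Q f - z *\<^sub>C f = H_free h Q g - z *\<^sub>C g"
  shows "f = g"
proof -
  define u where "u = f - g"
  note mt = bounded_clinear_mult_tensor[OF selfadjoint_opD(1)[OF Q_selfadjoint], of "\<lambda>_. 1" 1]
  have sa: "cinner u (mult_tensor (\<lambda>_. 1) Q u) = cinner (mult_tensor (\<lambda>_. 1) Q u) u"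
    using cinner_cadjoint_right[OF mt] cadjoint_mult_tensor[OF selfadjoint_opD(1)[OF Q_selfadjoint], of "\<lambda>_. 1" 1]
    by (simp add: selfadjoint_op_cadjoint[OF Q_selfadjoint])
  have "neg_laplacian h u = neg_laplacian h f - neg_laplacian h g"
    unfolding u_def by (rule l2Z_eqI) (simp add: neg_laplacian.rep_eq minus_l2Z.rep_eq scaleR_diff_right algebra_simps)
  then have "H_free h Q u = H_free h Q f - H_free h Q g"
    using bounded_clinear_diff[OF mt, of f g] by (simp add: H_free_def u_def)
  also have "\<dots> = z *\<^sub>C f - z *\<^sub>C g" using assms(2) by (simp add: algebra_simps)
  also have "\<dots> = z *\<^sub>C u" by (simp add: u_def cvec.scale_right_diff_distrib)
  finally have Hu: "H_free h Q u = z *\<^sub>C u" .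
  have "cinner u (H_free h Q u) = cinner (H_free h Q u) u"
    by (simp add: H_free_def cinner_add_left cinner_add_right sa cinner_neg_laplacian)
  then have "(z - cnj z) * cinner u u = 0" by (simp add: Hu cinner_cscale_left cinner_cscale_right algebra_simps)
  moreover have "z - cnj z \<noteq> 0" using z by (simp add: complex_eq_iff)
  ultimately have "cinner u u = 0" by simp
  then show ?thesis by (simp add: u_def cinner_self)
qed

definition free_resolvent :: "complex \<Rightarrow> 'g l2Z \<Rightarrow> 'g l2Z" where
  "free_resolvent z f = (\<Sum>s\<in>I_Q Q d. conv_l2Z (green h (small_root (char_coeff z s)))
     (mult_tensor (\<lambda>_. 1) (pi_proj Q \<mu> s) f))"

lemma free_resolvent_component:
  assumes "Im z > 0" "s \<in> I_Q Q d"
  shows "((\<lambda>m. green h (small_root (char_coeff z s)) (n - m) *\<^sub>C pi_proj Q \<mu> s (at_site f m))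
    has_sum at_site (conv_l2Z (green h (small_root (char_coeff z s)))
      (mult_tensor (\<lambda>_. 1) (pi_proj Q \<mu> s) f)) n) UNIV"
proof -
  have "Im (char_coeff z s) < 0" using assms h by (simp add: char_coeff_def)
  from at_site_conv_l2Z[OF green_summable[OF small_root_nonreal(1)[OF this], of h], of n "mult_tensor (\<lambda>_. 1) (pi_proj Q \<mu> s) f"]
  show ?thesis
    using at_site_mult_tensor[OF bounded_clinear_pi_proj[OF assms(2)], of "\<lambda>_. 1" 1 f] by simp
qed

text \<open>On the eigenspace of \<mu>(s) the equation decouples into scalar difference equations
  solved by the Green function; by injectivity a solution is the value of the inverse.\<close>

lemma resolvent_H_free:
  assumes z: "Im z > 0"
  shows "resolvent (H_free h Q) z f = free_resolvent z f"
  unfolding resolvent_def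
proof (rule inv_f_eq)
  show "inj (\<lambda>x. H_free h Q x - z *\<^sub>C x)"
    by (rule injI, rule H_free_injective[of z]) (use z in auto)
  show "H_free h Q (free_resolvent z f) - z *\<^sub>C free_resolvent z f = f"
  proof (rule l2Z_eqI)
    fix n
    define u where "u s = at_site (conv_l2Z (green h (small_root (char_coeff z s)))
      (mult_tensor (\<lambda>_. 1) (pi_proj Q \<mu> s) f))" for s
    note Qc = selfadjoint_opD(1)[OF Q_selfadjoint]
    have comp: "(1 / h\<^sup>2) *\<^sub>R (2 *\<^sub>R u s n - u s (n + 1) - u s (n - 1)) + Q (u s n) - z *\<^sub>C u s n
        = pi_proj Q \<mu> s (at_site f n)" if s: "s \<in> I_Q Q d" for s
    proof -
      have im: "Im (char_coeff z s) < 0" using z h by (simp add: char_coeff_def)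
      then have "char_coeff z s \<noteq> 2" "char_coeff z s \<noteq> - 2" by auto
      note w = small_root[OF this]
      \<comment> \<open>Q passes through the convergent sum, so the s-th component stays in the
        eigenspace of \<mu>(s).\<close>
      have "((\<lambda>m. Q (green h (small_root (char_coeff z s)) (n - m) *\<^sub>C pi_proj Q \<mu> s (at_site f m))) has_sum Q (u s n)) UNIV"
        unfolding u_def
        by (rule has_sum_bounded_linear[OF bounded_clinear_linear[OF Qc] free_resolvent_component[OF z s]])
      moreover have "((\<lambda>m. complex_of_real (\<mu> s) *\<^sub>C (green h (small_root (char_coeff z s)) (n - m) *\<^sub>C pi_proj Q \<mu> s (at_site f m)))
          has_sum complex_of_real (\<mu> s) *\<^sub>C u s n) UNIV"
        unfolding u_def
        by (rule has_sum_bounded_linear[OF bounded_bilinear.bounded_linear_right[OF bounded_bilinear_cscale]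
              free_resolvent_component[OF z s]])
      ultimately have Qu: "Q (u s n) = complex_of_real (\<mu> s) *\<^sub>C u s n"
        by (simp add: bounded_clinear_cscale[OF Qc] pi_proj_in_eigspace[OF s] cscale_cscale mult.commute has_sum_unique)
      have "complex_of_real (1 / h\<^sup>2) * (small_root (char_coeff z s) + 1 / small_root (char_coeff z s) - 2)
          = complex_of_real (\<mu> s) - z"
        unfolding w(2) using h by (simp add: char_coeff_def field_simps)
      with conv_green_equation[OF w(1) small_root_nonreal(1)[OF im] h, of "mult_tensor (\<lambda>_. 1) (pi_proj Q \<mu> s) f" n]
      have "(1 / h\<^sup>2) *\<^sub>R (2 *\<^sub>R u s n - u s (n + 1) - u s (n - 1)) + (complex_of_real (\<mu> s) - z) *\<^sub>C u s n
          = at_site (mult_tensor (\<lambda>_. 1) (pi_proj Q \<mu> s) f) n"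
        by (simp only: u_def)
      then show ?thesis
        using at_site_mult_tensor[OF bounded_clinear_pi_proj[OF s], of "\<lambda>_. 1" 1 f]
        by (simp add: Qu cvec.scale_left_diff_distrib algebra_simps)
    qed
    have U: "at_site (free_resolvent z f) m = (\<Sum>s\<in>I_Q Q d. u s m)" for m
      by (simp add: free_resolvent_def at_site_sum u_def)
    have "at_site (H_free h Q (free_resolvent z f) - z *\<^sub>C free_resolvent z f) n
        = (\<Sum>s\<in>I_Q Q d. (1 / h\<^sup>2) *\<^sub>R (2 *\<^sub>R u s n - u s (n + 1) - u s (n - 1)) + Q (u s n) - z *\<^sub>C u s n)"
      by (simp add: minus_l2Z.rep_eq at_site_H_free U cscale_at_site bounded_clinear_sum[OF Qc]
          scaleR_sum_right sum_subtractf sum.distrib cvec.scale_sum_right scaleR_diff_right)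
    also have "\<dots> = at_site f n" by (simp add: comp sum_pi_proj)
    finally show "at_site (H_free h Q (free_resolvent z f) - z *\<^sub>C free_resolvent z f) n = at_site f n" .
  qed
qed

end

section \<open>The boundary value of the sandwiched resolvent\<close>

lemma green_even: "green h w (- j) = green h w j"
  by (simp add: green_def)

lemma lat_kernel_symmetric: "lat_kernel \<nu> h w m n = lat_kernel \<nu> h w n m"
  using green_even[of h w "n - m"] by (simp add: lat_kernel_def mult.commute)

lemma selfadjoint_opI:
  assumes "bounded_clinear A" "cadjoint A = A"
  shows "selfadjoint_op A"
  using cinner_cadjoint_right[OF assms(1)] assms by (simp add: selfadjoint_op_def)

lemma l2_seq_psi:
  assumes \<nu>: "\<nu> > 3" and u: "\<And>n. \<bar>psi \<nu> n * u n\<bar> \<le> B * lat_weight \<nu> n"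
  shows "l2_seq (\<lambda>n. complex_of_real (psi \<nu> n * u n))"
    "l2_sq (\<lambda>n. complex_of_real (psi \<nu> n * u n)) \<le> B\<^sup>2 * infsum (\<lambda>n. (lat_weight \<nu> n)\<^sup>2) UNIV"
proof -
  have *: "cmod (complex_of_real (psi \<nu> n * u n)) \<le> B * lat_weight \<nu> n" for n
    using u by (simp only: norm_of_real)
  show "l2_seq (\<lambda>n. complex_of_real (psi \<nu> n * u n))"
    "l2_sq (\<lambda>n. complex_of_real (psi \<nu> n * u n)) \<le> B\<^sup>2 * infsum (\<lambda>n. (lat_weight \<nu> n)\<^sup>2) UNIV"
    by (rule l2_seq_dominated[OF lat_weight_nonneg lat_weight_summable[OF \<nu>] *])+
qed

text \<open>Uniqueness for the description in \<open>boundary_value\<close>: at one common e both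
  differences have squared norm at most r / 4, and the two-term inequality turns this into r for A -
  B.\<close>

lemma hs_limit_unique:
  fixes A B :: "'a :: complex_hilbert \<Rightarrow> 'b :: complex_hilbert"
  assumes A: "bounded_clinear A" and B: "bounded_clinear B" and T: "\<And>e. 0 < e \<Longrightarrow> bounded_clinear (T e)"
    and lim: "((\<lambda>e. hs_norm_sq (\<lambda>x. T e x - A x)) \<longlongrightarrow> 0) (at_right (0::real))"
      "((\<lambda>e. hs_norm_sq (\<lambda>x. T e x - B x)) \<longlongrightarrow> 0) (at_right (0::real))"
  shows "A = B"
proof
  fix x
  have "hs_le (\<lambda>x. A x - B x) 0"
    unfolding hs_le_def
  proof (intro allI impI)
    fix F :: "'a set" assume F: "finite F \<and> F \<subseteq> some_onb"
    show "(\<Sum>e\<in>F. (norm (A e - B e))\<^sup>2) \<le> 0"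
    proof (rule field_le_epsilon)
      fix r :: real assume r: "r > 0"
      have "\<forall>\<^sub>F e in at_right 0. hs_norm_sq (\<lambda>x. T e x - A x) < ennreal (r / 4)"
        "\<forall>\<^sub>F e in at_right 0. hs_norm_sq (\<lambda>x. T e x - B x) < ennreal (r / 4)"
        using order_tendstoD(2)[OF lim(1), of "ennreal (r / 4)"] order_tendstoD(2)[OF lim(2), of "ennreal (r / 4)"] r
        by (auto simp: ennreal_zero_less_divide)
      then have "\<forall>\<^sub>F e in at_right 0. hs_norm_sq (\<lambda>x. T e x - A x) < ennreal (r / 4)
          \<and> hs_norm_sq (\<lambda>x. T e x - B x) < ennreal (r / 4)" by (rule eventually_conj)
      from eventually_happens'[OF trivial_limit_at_right_real this]
      obtain e where "hs_norm_sq (\<lambda>x. T e x - A x) \<le> ennreal (r / 4)"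
          "hs_norm_sq (\<lambda>x. T e x - B x) \<le> ennreal (r / 4)"
        by (blast dest: less_imp_le)
      then have "hs_le (\<lambda>x. T e x - A x) (r / 4)" "hs_le (\<lambda>x. T e x - B x) (r / 4)"
        using r by (simp_all add: hs_norm_sq_le_iff)
      moreover have "hs_le (\<lambda>x. - (T e x - A x)) (1\<^sup>2 * (r / 4))"
        by (rule hs_le_dominated[OF calculation(1)]) (simp add: norm_minus_commute)
      ultimately have "hs_le (\<lambda>x. - (T e x - A x) + (T e x - B x)) (2 * (1\<^sup>2 * (r / 4)) + 2 * (r / 4))"
        by (intro hs_le_add)
      then show "(\<Sum>e\<in>F. (norm (A e - B e))\<^sup>2) \<le> 0 + r" using F by (simp add: hs_le_def)
    qed
  qed
  from hs_le_zero_imp[OF bounded_clinear_minus_op[OF A B] this] show "A x = B x"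
    by (simp add: eq_iff_diff_eq_0[symmetric])
qed

context
  fixes h \<nu> :: real and Q K :: "'g :: complex_hilbert \<Rightarrow> 'g" and \<V> :: "'g l2Z \<Rightarrow> 'g l2Z"
    and d :: nat and \<mu> :: "nat \<Rightarrow> real"
  assumes h: "h > 0" and dec: "finite_spectral_decomposition Q d \<mu>" and \<nu>: "\<nu> > 3"
    and V: "nonneg_op \<V>" and K: "hilbert_schmidt K"
begin

lemma root_clinear: "bounded_clinear (op_sqrt \<V>)" and root_selfadjoint: "selfadjoint_op (op_sqrt \<V>)"
  using nonneg_op_op_sqrt[OF V] nonneg_op_selfadjoint by (auto simp: nonneg_op_def)

lemma K_clinear: "bounded_clinear K"
  using K by (simp add: hilbert_schmidt_iff)

lemmas K_adj_clinear = bounded_clinear_cadjoint[OF K_clinear]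
lemmas pi_clinear = bounded_clinear_pi_proj[OF h dec]
lemmas weight_facts = lat_weight_nonneg lat_weight_summable[OF \<nu>]

text \<open>What remains of the sandwich on the second tensor factor once the two multiplications by
  psi have moved into the kernel.\<close>

definition band_op :: "nat \<Rightarrow> 'g \<Rightarrow> 'g" where
  "band_op s x = K (pi_proj Q \<mu> s (cadjoint K x))"

lemma band_op_clinear: "s \<in> I_Q Q d \<Longrightarrow> bounded_clinear (band_op s)"
  unfolding band_op_def[abs_def]
  by (rule bounded_clinear_compose[OF K_clinear bounded_clinear_compose[OF pi_clinear K_adj_clinear]])

lemma band_op_selfadjoint: "s \<in> I_Q Q d \<Longrightarrow> selfadjoint_op (band_op s)"
  unfolding selfadjoint_op_def
  by (auto simp: band_op_clinear) (simp add: band_op_def cinner_cadjoint_right[OF K_clinear, symmetric]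
      selfadjoint_opD(2)[OF pi_proj_selfadjoint(1)[OF h dec]] cinner_cadjoint_left[OF K_clinear, symmetric])

lemma band_op_hs: "\<exists>c. \<forall>s\<in>I_Q Q d. hs_le (band_op s) c"
proof -
  obtain c where c: "hs_le K c" using K by (auto simp: hilbert_schmidt_iff)
  obtain k where k: "k > 0" "\<And>x. norm (K x) \<le> k * norm x" using bounded_clinear_bounded[OF K_clinear] by metis
  have "hs_le (band_op s) (k\<^sup>2 * c)" if s: "s \<in> I_Q Q d" for s
    unfolding band_op_def[abs_def]
  proof (rule hs_le_compose_right[OF K_clinear c bounded_clinear_compose[OF pi_clinear[OF s] K_adj_clinear]])
    show "norm (pi_proj Q \<mu> s (cadjoint K x)) \<le> k * norm x" for x
      by (rule order_trans[OF pi_proj_selfadjoint(2)[OF h dec s] norm_cadjoint_le[OF K_clinear k(2)]]) (use k in simp)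
  qed (use k in simp)
  then show ?thesis by blast
qed

text \<open>The assignment is linear in the kernels, so limits, adjoints and real and imaginary
  parts of the sandwiched resolvent become operations on scalar kernels.\<close>

definition sand :: "(nat \<Rightarrow> int \<Rightarrow> int \<Rightarrow> complex) \<Rightarrow> 'g l2Z \<Rightarrow> 'g l2Z" where
  "sand k f = op_sqrt \<V> (\<Sum>s\<in>I_Q Q d. lat_op (k s) (band_op s) (op_sqrt \<V> f))"

definition band_kernels :: "(nat \<Rightarrow> int \<Rightarrow> int \<Rightarrow> complex) \<Rightarrow> (nat \<Rightarrow> real) \<Rightarrow> bool" where
  "band_kernels k B \<longleftrightarrow> (\<forall>s\<in>I_Q Q d. kernel_le (lat_weight \<nu>) (k s) (B s))"

lemma sand_clinear:
  assumes "band_kernels k B"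
  shows "bounded_clinear (sand k)"
proof -
  have "bounded_clinear (lat_op (k s) (band_op s))" if "s \<in> I_Q Q d" for s
    by (rule bounded_clinear_lat_op[OF weight_facts _ band_op_clinear[OF that]])
       (use assms that in \<open>auto simp: band_kernels_def\<close>)
  then have "bounded_clinear (\<lambda>f. \<Sum>s\<in>I_Q Q d. lat_op (k s) (band_op s) f)"
    by (rule bounded_clinear_sum_op)
  then have "bounded_clinear (\<lambda>f. op_sqrt \<V> ((\<lambda>f. \<Sum>s\<in>I_Q Q d. lat_op (k s) (band_op s) f) (op_sqrt \<V> f)))"
    by (rule bounded_clinear_compose[OF root_clinear bounded_clinear_compose[OF _ root_clinear]])
  then show ?thesis by (simp add: sand_def[abs_def])
qed

text \<open>The constant is chosen before the kernels, so bounds on kernels that are uniform in the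
  energy yield uniform Hilbert--Schmidt bounds.\<close>

lemma sand_hs:
  "\<exists>C\<ge>0. \<forall>k B. band_kernels k B \<longrightarrow> hs_le (sand k) (C * (\<Sum>s\<in>I_Q Q d. (B s)\<^sup>2))"
proof -
  obtain c where c: "\<And>s. s \<in> I_Q Q d \<Longrightarrow> hs_le (band_op s) c" using band_op_hs by blast
  obtain r where r: "r > 0" "\<And>x. norm (op_sqrt \<V> x) \<le> r * norm x"
    using bounded_clinear_bounded[OF root_clinear] by metis
  let ?S = "infsum (\<lambda>n. (lat_weight \<nu> n)\<^sup>2) UNIV"
  define C where "C = r\<^sup>2 * (r\<^sup>2 * (2 ^ card (I_Q Q d) * (?S\<^sup>2 * max 0 c)))"
  have "hs_le (sand k) (C * (\<Sum>s\<in>I_Q Q d. (B s)\<^sup>2))" if kB: "band_kernels k B" for k B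
  proof -
    have kern: "kernel_le (lat_weight \<nu>) (k s) (B s)" if "s \<in> I_Q Q d" for s
      using kB that by (auto simp: band_kernels_def)
    have "hs_le (lat_op (k s) (band_op s)) ((B s)\<^sup>2 * (?S\<^sup>2 * max 0 c))" if s: "s \<in> I_Q Q d" for s
      by (rule hs_le_mono[OF hs_le_lat_op[OF weight_facts kern[OF s] band_op_clinear[OF s] c[OF s]]])
         (auto simp: power_mult_distrib mult.assoc intro!: mult_left_mono)
    then have 1: "hs_le (\<lambda>f. \<Sum>s\<in>I_Q Q d. lat_op (k s) (band_op s) f)
        (2 ^ card (I_Q Q d) * (\<Sum>s\<in>I_Q Q d. (B s)\<^sup>2 * (?S\<^sup>2 * max 0 c)))"
      by (rule hs_le_sum[OF finite_I_Q[OF h dec]])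
    have 2: "bounded_clinear (\<lambda>f. \<Sum>s\<in>I_Q Q d. lat_op (k s) (band_op s) f)"
      by (rule bounded_clinear_sum_op) (rule bounded_clinear_lat_op[OF weight_facts kern band_op_clinear])
    from hs_le_compose_right[OF 2 1 root_clinear less_imp_le[OF r(1)] r(2)]
    have "hs_le (\<lambda>f. op_sqrt \<V> (\<Sum>s\<in>I_Q Q d. lat_op (k s) (band_op s) (op_sqrt \<V> f)))
        (r\<^sup>2 * (r\<^sup>2 * (2 ^ card (I_Q Q d) * (\<Sum>s\<in>I_Q Q d. (B s)\<^sup>2 * (?S\<^sup>2 * max 0 c)))))"
      by (rule hs_le_dominated) (rule r(2))
    then show ?thesis
      by (simp add: sand_def[abs_def] C_def sum_distrib_left sum_distrib_right mult_ac)
  qed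
  moreover have "C \<ge> 0" by (simp add: C_def)
  ultimately show ?thesis by blast
qed

lemma band_kernelsD: "band_kernels k B \<Longrightarrow> s \<in> I_Q Q d \<Longrightarrow> kernel_le (lat_weight \<nu>) (k s) (B s)"
  by (simp add: band_kernels_def)

lemma sand_diff:
  assumes "band_kernels k B" "band_kernels l C"
  shows "sand (\<lambda>s n m. k s n m - l s n m) f = sand k f - sand l f"
proof -
  have "(\<Sum>s\<in>I_Q Q d. lat_op (\<lambda>n m. k s n m - l s n m) (band_op s) (op_sqrt \<V> f))
      = (\<Sum>s\<in>I_Q Q d. lat_op (k s) (band_op s) (op_sqrt \<V> f) - lat_op (l s) (band_op s) (op_sqrt \<V> f))"
    by (rule sum.cong[OF refl], rule lat_op_diff[OF weight_facts band_kernelsD[OF assms(1)] band_kernelsD[OF assms(2)] band_op_clinear])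
  then show ?thesis by (simp add: sand_def sum_subtractf bounded_clinear_diff[OF root_clinear])
qed

lemma sand_add:
  assumes "band_kernels k B" "band_kernels l C"
  shows "sand (\<lambda>s n m. k s n m + l s n m) f = sand k f + sand l f"
proof -
  have "(\<Sum>s\<in>I_Q Q d. lat_op (\<lambda>n m. k s n m + l s n m) (band_op s) (op_sqrt \<V> f))
      = (\<Sum>s\<in>I_Q Q d. lat_op (k s) (band_op s) (op_sqrt \<V> f) + lat_op (l s) (band_op s) (op_sqrt \<V> f))"
    by (rule sum.cong[OF refl], rule lat_op_add[OF weight_facts band_kernelsD[OF assms(1)] band_kernelsD[OF assms(2)] band_op_clinear])
  then show ?thesis by (simp add: sand_def sum.distrib bounded_clinear_add[OF root_clinear])
qed

lemma sand_scale:
  assumes "band_kernels k B"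
  shows "sand (\<lambda>s n m. c * k s n m) f = c *\<^sub>C sand k f"
proof -
  have "(\<Sum>s\<in>I_Q Q d. lat_op (\<lambda>n m. c * k s n m) (band_op s) (op_sqrt \<V> f))
      = (\<Sum>s\<in>I_Q Q d. c *\<^sub>C lat_op (k s) (band_op s) (op_sqrt \<V> f))"
    by (rule sum.cong[OF refl], rule lat_op_scale[OF weight_facts band_kernelsD[OF assms] band_op_clinear])
  then show ?thesis by (simp add: sand_def cvec.scale_sum_right[symmetric] bounded_clinear_cscale[OF root_clinear])
qed

lemma cadjoint_sand:
  assumes "band_kernels k B"
  shows "cadjoint (sand k) = sand (\<lambda>s n m. cnj (k s m n))"
proof (rule cadjoint_eqI)
  have "band_kernels (\<lambda>s n m. cnj (k s m n)) B"
    using assms by (auto simp: band_kernels_def intro: kernel_le_cnj_swap)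
  then show "bounded_clinear (sand (\<lambda>s n m. cnj (k s m n)))" by (rule sand_clinear)
  fix f g
  have "cinner (lat_op (k s) (band_op s) (op_sqrt \<V> f)) (op_sqrt \<V> g)
      = cinner (op_sqrt \<V> f) (lat_op (\<lambda>n m. cnj (k s m n)) (band_op s) (op_sqrt \<V> g))" if s: "s \<in> I_Q Q d" for s
    using cinner_cadjoint_right[OF bounded_clinear_lat_op[OF weight_facts band_kernelsD[OF assms s] band_op_clinear[OF s]]]
      cadjoint_lat_op[OF weight_facts band_kernelsD[OF assms s] band_op_clinear[OF s]]
    by (simp add: selfadjoint_op_cadjoint[OF band_op_selfadjoint[OF s]])
  then have "cinner (\<Sum>s\<in>I_Q Q d. lat_op (k s) (band_op s) (op_sqrt \<V> f)) (op_sqrt \<V> g)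
      = cinner (op_sqrt \<V> f) (\<Sum>s\<in>I_Q Q d. lat_op (\<lambda>n m. cnj (k s m n)) (band_op s) (op_sqrt \<V> g))"
    by (simp add: cinner_sum_left cinner_sum_right)
  then show "cinner (sand k f) g = cinner f (sand (\<lambda>s n m. cnj (k s m n)) g)"
    unfolding sand_def by (simp only: selfadjoint_opD(2)[OF root_selfadjoint])
qed

lemma M_factor_cadjoint: "cadjoint (M_factor \<nu> \<V> K) = (\<lambda>f. mult_tensor (psi \<nu>) (cadjoint K) (op_sqrt \<V> f))"
  and M_factor_clinear: "bounded_clinear (M_factor \<nu> \<V> K)"
proof -
  have psi: "\<bar>psi \<nu> n\<bar> \<le> 1" for n using psi_le_one[of \<nu> n] psi_nonneg[of \<nu> n] \<nu> by simp
  note mt = bounded_clinear_mult_tensor[OF K_clinear psi]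
  have M: "M_factor \<nu> \<V> K = (\<lambda>f. op_sqrt \<V> (mult_tensor (psi \<nu>) K f))" by (auto simp: M_factor_def)
  show "bounded_clinear (M_factor \<nu> \<V> K)" unfolding M by (rule bounded_clinear_compose[OF root_clinear mt])
  show "cadjoint (M_factor \<nu> \<V> K) = (\<lambda>f. mult_tensor (psi \<nu>) (cadjoint K) (op_sqrt \<V> f))"
    unfolding M cadjoint_compose[OF root_clinear mt] cadjoint_mult_tensor[OF K_clinear psi]
    by (simp add: selfadjoint_op_cadjoint[OF root_selfadjoint])
qed

lemma sandwiched_resolvent_eq:
  assumes z: "Im z > 0"
  shows "sandwiched_resolvent (H_free h Q) (M_factor \<nu> \<V> K) z f
    = sand (\<lambda>s. lat_kernel \<nu> h (small_root (char_coeff h \<mu> z s))) f"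
proof -
  have psi: "\<bar>psi \<nu> n\<bar> \<le> 1" for n using psi_le_one[of \<nu> n] psi_nonneg[of \<nu> n] \<nu> by simp
  define w where "w s = small_root (char_coeff h \<mu> z s)" for s
  have w1: "cmod (w s) \<le> 1" for s
  proof -
    have "Im (char_coeff h \<mu> z s) < 0" using z h by (simp add: char_coeff_def[OF h dec])
    then show ?thesis using small_root_nonreal(1) by (simp add: w_def less_imp_le)
  qed
  define y where "y = op_sqrt \<V> f"
  define g where "g = mult_tensor (psi \<nu>) (cadjoint K) y"
  have gm: "at_site g m = psi \<nu> m *\<^sub>R cadjoint K (at_site y m)" for m
    unfolding g_def by (rule at_site_mult_tensor[OF K_adj_clinear psi])
  have "mult_tensor (psi \<nu>) K (free_resolvent h Q d \<mu> z g)
      = (\<Sum>s\<in>I_Q Q d. lat_op (lat_kernel \<nu> h (w s)) (band_op s) y)"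
  proof (rule l2Z_eqI)
    fix n
    have comp: "psi \<nu> n *\<^sub>R K (at_site (conv_l2Z (green h (w s)) (mult_tensor (\<lambda>_. 1) (pi_proj Q \<mu> s) g)) n)
        = band_op s (lat_bra (lat_kernel \<nu> h (w s) n) y)" if s: "s \<in> I_Q Q d" for s
    proof (rule has_sum_unique)
      have "bounded_linear (\<lambda>x. psi \<nu> n *\<^sub>R K x)"
        by (rule bounded_clinear_linear[OF bounded_clinear_scaledR[OF K_clinear]])
      from has_sum_bounded_linear[OF this free_resolvent_component[OF h dec z s, of n g]]
      show "((\<lambda>m. lat_kernel \<nu> h (w s) n m *\<^sub>C band_op s (at_site y m)) has_sum
        psi \<nu> n *\<^sub>R K (at_site (conv_l2Z (green h (w s)) (mult_tensor (\<lambda>_. 1) (pi_proj Q \<mu> s) g)) n)) UNIV"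
        by (simp add: w_def[symmetric] gm bounded_clinear_scaleR[OF pi_clinear[OF s]] bounded_clinear_cscale[OF K_clinear]
            band_op_def scaleR_cscale cscale_cscale lat_kernel_def mult_ac bounded_clinear_cscale[OF pi_clinear[OF s]])
      have "l2_seq (lat_kernel \<nu> h (w s) n)"
        by (rule kernel_row(1)[OF weight_facts kernel_le_lat_kernel[OF w1]])
      from has_sum_bounded_linear[OF bounded_clinear_linear[OF band_op_clinear[OF s]] lat_bra_has_sum[OF this, of y]]
      show "((\<lambda>m. lat_kernel \<nu> h (w s) n m *\<^sub>C band_op s (at_site y m)) has_sum
        band_op s (lat_bra (lat_kernel \<nu> h (w s) n) y)) UNIV"
        by (simp add: bounded_clinear_cscale[OF band_op_clinear[OF s]])
    qed
    have "at_site (mult_tensor (psi \<nu>) K (free_resolvent h Q d \<mu> z g)) n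
        = (\<Sum>s\<in>I_Q Q d. psi \<nu> n *\<^sub>R K (at_site (conv_l2Z (green h (w s)) (mult_tensor (\<lambda>_. 1) (pi_proj Q \<mu> s) g)) n))"
      by (simp add: at_site_mult_tensor[OF K_clinear psi] free_resolvent_def[OF h dec] at_site_sum w_def
          bounded_clinear_sum[OF K_clinear] scaleR_sum_right)
    also have "\<dots> = (\<Sum>s\<in>I_Q Q d. at_site (lat_op (lat_kernel \<nu> h (w s)) (band_op s) y) n)"
      by (rule sum.cong[OF refl])
         (simp add: comp at_site_lat_op[OF weight_facts kernel_le_lat_kernel[OF w1] band_op_clinear])
    finally show "at_site (mult_tensor (psi \<nu>) K (free_resolvent h Q d \<mu> z g)) n
        = at_site (\<Sum>s\<in>I_Q Q d. lat_op (lat_kernel \<nu> h (w s)) (band_op s) y) n"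
      by (simp add: at_site_sum)
  qed
  then show ?thesis
    unfolding sandwiched_resolvent_def M_factor_cadjoint
    by (simp add: resolvent_H_free[OF h dec z] M_factor_def sand_def w_def y_def g_def)
qed

section \<open>Boundary values at energies off the thresholds\<close>

definition band_coeff :: "real \<Rightarrow> nat \<Rightarrow> real" where
  "band_coeff E s = 2 - h\<^sup>2 * (E - \<mu> s)"

definition band_root :: "real \<Rightarrow> nat \<Rightarrow> complex" where
  "band_root E s = small_root (complex_of_real (band_coeff E s))"

text \<open>The coefficient is 2 at the energy \<mu>(s) and -2 at 4/h^2 + \<mu>(s), so these are the
  energies outside the threshold set.\<close>

definition regular_energy :: "real \<Rightarrow> bool" where
  "regular_energy E \<longleftrightarrow> (\<forall>s\<in>I_Q Q d. \<bar>band_coeff E s\<bar> \<noteq> 2)"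

lemma band_root:
  assumes "regular_energy E" "s \<in> I_Q Q d"
  shows "cmod (band_root E s) \<le> 1" "(band_root E s)\<^sup>2 \<noteq> 1"
proof -
  have "\<bar>band_coeff E s\<bar> \<noteq> 2" using assms by (simp add: regular_energy_def)
  then have "complex_of_real (band_coeff E s) \<noteq> 2" "complex_of_real (band_coeff E s) \<noteq> - 2"
    by (auto simp: complex_eq_iff)
  from small_root(4,5)[OF this] show "cmod (band_root E s) \<le> 1" "(band_root E s)\<^sup>2 \<noteq> 1"
    by (simp_all add: band_root_def)
qed

lemma boundary_band_kernels:
  "regular_energy E \<Longrightarrow> band_kernels (\<lambda>s. lat_kernel \<nu> h (band_root E s)) (\<lambda>s. h\<^sup>2 / cmod (1 - (band_root E s)\<^sup>2))"
  by (simp add: band_kernels_def kernel_le_lat_kernel band_root)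

text \<open>The limiting absorption principle: at a regular energy every root converges to its
  boundary branch away from 1 and -1, so the bounds for the kernel differences tend to 0, and so do
  the operators in Hilbert--Schmidt norm.\<close>

lemma boundary_value_eq:
  assumes E: "regular_energy E"
  shows "boundary_value (H_free h Q) (M_factor \<nu> \<V> K) E = sand (\<lambda>s. lat_kernel \<nu> h (band_root E s))"
proof -
  define T where "T e = sandwiched_resolvent (H_free h Q) (M_factor \<nu> \<V> K) (Complex E e)" for e
  define w where "w e s = small_root (char_coeff h \<mu> (Complex E e) s)" for e s
  define D where "D e s = h\<^sup>2 * (cmod (w e s - band_root E s) / cmod (1 - (w e s)\<^sup>2)
      + cmod (1 / (1 - (w e s)\<^sup>2) - 1 / (1 - (band_root E s)\<^sup>2)))" for e s
  let ?L = "sand (\<lambda>s. lat_kernel \<nu> h (band_root E s))"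
  have im: "Im (char_coeff h \<mu> (Complex E e) s) < 0" if "e > 0" for e s
    using that h by (simp add: char_coeff_def[OF h dec])
  have w: "cmod (w e s) \<le> 1" "(w e s)\<^sup>2 \<noteq> 1" if "e > 0" for e s
  proof -
    have "char_coeff h \<mu> (Complex E e) s \<noteq> 2" "char_coeff h \<mu> (Complex E e) s \<noteq> - 2" using im[OF that, of s] by auto
    from small_root(4,5)[OF this] show "cmod (w e s) \<le> 1" "(w e s)\<^sup>2 \<noteq> 1" by (simp_all add: w_def)
  qed
  have T: "T e = sand (\<lambda>s. lat_kernel \<nu> h (w e s))" if "e > 0" for e
    using sandwiched_resolvent_eq[of "Complex E e"] that by (auto simp: T_def w_def)
  have bk: "band_kernels (\<lambda>s. lat_kernel \<nu> h (w e s)) (\<lambda>s. h\<^sup>2 / cmod (1 - (w e s)\<^sup>2))" if "e > 0" for e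
    using w[OF that] by (simp add: band_kernels_def kernel_le_lat_kernel)
  note bkE = boundary_band_kernels[OF E]
  obtain C where C: "C \<ge> 0" "\<And>k B. band_kernels k B \<Longrightarrow> hs_le (sand k) (C * (\<Sum>s\<in>I_Q Q d. (B s)\<^sup>2))"
    using sand_hs by blast
  have wlim: "((\<lambda>e. w e s) \<longlongrightarrow> band_root E s) (at_right 0)" if "s \<in> I_Q Q d" for s
    unfolding w_def band_root_def
  proof (rule small_root_tendsto)
    show "\<bar>band_coeff E s\<bar> \<noteq> 2" using E that by (simp add: regular_energy_def)
    have "((\<lambda>e. 2 - complex_of_real (h\<^sup>2) * (Complex E e - complex_of_real (\<mu> s))) \<longlongrightarrow>
        2 - complex_of_real (h\<^sup>2) * (Complex E 0 - complex_of_real (\<mu> s))) (at_right 0)"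
      by (intro tendsto_intros)
    moreover have "2 - complex_of_real (h\<^sup>2) * (Complex E 0 - complex_of_real (\<mu> s)) = complex_of_real (band_coeff E s)"
      by (simp add: band_coeff_def complex_eq_iff)
    ultimately show "((\<lambda>e. char_coeff h \<mu> (Complex E e) s) \<longlongrightarrow> complex_of_real (band_coeff E s)) (at_right 0)"
      by (simp add: char_coeff_def[OF h dec])
    show "\<forall>\<^sub>F e in at_right 0. Im (char_coeff h \<mu> (Complex E e) s) < 0"
      using im by (auto simp: eventually_at_right_field intro: exI[of _ 1])
  qed
  have Dlim: "((\<lambda>e. D e s) \<longlongrightarrow> 0) (at_right 0)" if s: "s \<in> I_Q Q d" for s
  proof -
    have ne: "1 - (band_root E s)\<^sup>2 \<noteq> 0" using band_root(2)[OF E s] by simp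
    have "((\<lambda>e. D e s) \<longlongrightarrow> h\<^sup>2 * (cmod (band_root E s - band_root E s) / cmod (1 - (band_root E s)\<^sup>2)
      + cmod (1 / (1 - (band_root E s)\<^sup>2) - 1 / (1 - (band_root E s)\<^sup>2)))) (at_right 0)"
      unfolding D_def using ne by (intro tendsto_intros wlim[OF s]) auto
    then show ?thesis by simp
  qed
  have hs: "hs_norm_sq (\<lambda>x. T e x - ?L x) \<le> ennreal (C * (\<Sum>s\<in>I_Q Q d. (D e s)\<^sup>2))" if e: "e > 0" for e
  proof -
    have "band_kernels (\<lambda>s n m. lat_kernel \<nu> h (w e s) n m - lat_kernel \<nu> h (band_root E s) n m) (D e)"
      unfolding band_kernels_def D_def
      by (intro ballI kernel_le_lat_kernel_diff w[OF e] band_root[OF E])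
    from C(2)[OF this] have "hs_le (\<lambda>x. T e x - ?L x) (C * (\<Sum>s\<in>I_Q Q d. (D e s)\<^sup>2))"
      by (simp add: T[OF e] sand_diff[OF bk[OF e] bkE, abs_def])
    then show ?thesis using C(1) by (simp add: hs_norm_sq_le_iff sum_nonneg)
  qed
  have "((\<lambda>e. C * (\<Sum>s\<in>I_Q Q d. (D e s)\<^sup>2)) \<longlongrightarrow> C * (\<Sum>s\<in>I_Q Q d. 0\<^sup>2)) (at_right 0)"
    by (intro tendsto_intros Dlim)
  then have "((\<lambda>e. ennreal (C * (\<Sum>s\<in>I_Q Q d. (D e s)\<^sup>2))) \<longlongrightarrow> ennreal 0) (at_right 0)"
    by (intro tendsto_ennrealI) simp
  then have "((\<lambda>e. ennreal (C * (\<Sum>s\<in>I_Q Q d. (D e s)\<^sup>2))) \<longlongrightarrow> 0) (at_right 0)" by simp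
  then have lim: "((\<lambda>e. hs_norm_sq (\<lambda>x. T e x - ?L x)) \<longlongrightarrow> 0) (at_right 0)"
    by (rule tendsto_sandwich[OF _ _ tendsto_const, rotated 2])
       (use hs in \<open>auto simp: eventually_at_right_field intro: exI[of _ 1]\<close>)
  have L: "hilbert_schmidt ?L"
    using C(2)[OF bkE] sand_clinear[OF bkE] by (auto simp: hilbert_schmidt_iff)
  show ?thesis
    unfolding boundary_value_def T_def[symmetric]
  proof (rule the_equality)
    show "hilbert_schmidt ?L \<and> ((\<lambda>e. hs_norm_sq (\<lambda>x. T e x - ?L x)) \<longlongrightarrow> 0) (at_right 0)"
      using L lim by blast
    fix A assume A: "hilbert_schmidt A \<and> ((\<lambda>e. hs_norm_sq (\<lambda>x. T e x - A x)) \<longlongrightarrow> 0) (at_right 0)"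
    show "A = ?L"
    proof (rule hs_limit_unique)
      show "bounded_clinear (T e)" if "e > 0" for e unfolding T[OF that] by (rule sand_clinear[OF bk[OF that]])
    qed (use A L lim in \<open>auto simp: hilbert_schmidt_iff\<close>)
  qed
qed

text \<open>The kernels are symmetric in n and m, so the adjoint just conjugates each entry.\<close>

lemma
  assumes E: "regular_energy E"
  defines "k \<equiv> \<lambda>s. lat_kernel \<nu> h (band_root E s)"
  shows re_part_boundary_value: "re_part (boundary_value (H_free h Q) (M_factor \<nu> \<V> K) E)
      = sand (\<lambda>s n m. complex_of_real (Re (k s n m)))"
    and im_part_boundary_value: "im_part (boundary_value (H_free h Q) (M_factor \<nu> \<V> K) E)
      = sand (\<lambda>s n m. complex_of_real (Im (k s n m)))"
proof -
  obtain B where bk: "band_kernels k B" using boundary_band_kernels[OF E] unfolding k_def by blast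
  have sym: "k s m n = k s n m" for s n m by (simp add: k_def lat_kernel_symmetric)
  have bk': "band_kernels (\<lambda>s n m. cnj (k s n m)) B"
    using bk by (auto simp: band_kernels_def kernel_le_def)
  have "(\<lambda>s n m. cnj (k s m n)) = (\<lambda>s n m. cnj (k s n m))"
    by (intro ext) (rule arg_cong[OF sym])
  then have adj: "cadjoint (sand k) = sand (\<lambda>s n m. cnj (k s n m))"
    by (simp only: cadjoint_sand[OF bk])
  have bkp: "band_kernels (\<lambda>s n m. k s n m + cnj (k s n m)) (\<lambda>s. B s + B s)"
    using bk bk' unfolding band_kernels_def by (intro ballI kernel_le_add) auto
  have bkm: "band_kernels (\<lambda>s n m. k s n m - cnj (k s n m)) (\<lambda>s. B s + B s)"
    using bk bk' unfolding band_kernels_def by (intro ballI kernel_le_diff) auto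
  have re: "1 / 2 * (z + cnj z) = complex_of_real (Re z)" "1 / (2 * \<i>) * (z - cnj z) = complex_of_real (Im z)" for z
    by (simp_all add: complex_eq_iff)
  show "re_part (boundary_value (H_free h Q) (M_factor \<nu> \<V> K) E) = sand (\<lambda>s n m. complex_of_real (Re (k s n m)))"
    unfolding boundary_value_eq[OF E] k_def[symmetric] re_part_def[abs_def] adj sand_add[OF bk bk', symmetric]
      sand_scale[OF bkp, symmetric] re ..
  show "im_part (boundary_value (H_free h Q) (M_factor \<nu> \<V> K) E) = sand (\<lambda>s n m. complex_of_real (Im (k s n m)))"
    unfolding boundary_value_eq[OF E] k_def[symmetric] im_part_def[abs_def] adj sand_diff[OF bk bk', symmetric]
      sand_scale[OF bkm, symmetric] re ..
qed

lemma sand_selfadjoint: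
  assumes "band_kernels k B" "\<And>s n m. cnj (k s m n) = k s n m"
  shows "selfadjoint_op (sand k)"
  by (rule selfadjoint_opI[OF sand_clinear[OF assms(1)]]) (simp add: cadjoint_sand[OF assms(1)] assms(2))

end

section \<open>Nonnegative operators of bounded trace\<close>

text \<open>For a nonnegative Hilbert--Schmidt operator this says that the trace is at most C,
  tested on finite orthonormal families.\<close>

definition trace_le :: "('a :: complex_hilbert \<Rightarrow> 'a) \<Rightarrow> real \<Rightarrow> bool" where
  "trace_le S C \<longleftrightarrow> selfadjoint_op S \<and> (\<exists>c. hs_le S c) \<and> (\<forall>x. 0 \<le> inner x (S x)) \<and>
     (\<forall>F. finite F \<and> orthonormal F \<longrightarrow> (\<Sum>e\<in>F. inner e (S e)) \<le> C)"

lemma trace_leD: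
  assumes "trace_le S C"
  shows "selfadjoint_op S" "\<exists>c. hs_le S c" "0 \<le> inner x (S x)"
    "finite F \<Longrightarrow> orthonormal F \<Longrightarrow> (\<Sum>e\<in>F. inner e (S e)) \<le> C"
  using assms by (auto simp: trace_le_def)

lemma trace_le_mono: "trace_le S C \<Longrightarrow> C \<le> D \<Longrightarrow> trace_le S D"
  unfolding trace_le_def by (meson order_trans)

lemma trace_le_nonneg: "trace_le S C \<Longrightarrow> 0 \<le> C"
  using trace_leD(4)[of S C "{}"] by (simp add: orthonormal_def)

definition gram :: "('a :: complex_hilbert \<Rightarrow> 'b :: complex_hilbert) \<Rightarrow> 'a \<Rightarrow> 'a" where
  "gram Z x = cadjoint Z (Z x)"

lemma inner_gram: "bounded_clinear Z \<Longrightarrow> inner x (gram Z x) = (norm (Z x))\<^sup>2"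
  by (simp add: gram_def inner_cinner cinner_cadjoint_right cinner_self)

lemma selfadjoint_op_gram: "bounded_clinear Z \<Longrightarrow> selfadjoint_op (gram Z)"
  unfolding selfadjoint_op_def gram_def[abs_def]
  by (auto intro!: bounded_clinear_compose[of "cadjoint Z" Z] bounded_clinear_cadjoint
      simp: cinner_cadjoint_left cinner_cadjoint_right)

lemma hs_le_gram:
  assumes "bounded_clinear Z" "hs_le Z c"
  shows "\<exists>c. hs_le (gram Z) c"
proof -
  obtain k where k: "k > 0" "\<And>x. norm (cadjoint Z x) \<le> k * norm x"
    using bounded_clinear_bounded[OF bounded_clinear_cadjoint[OF assms(1)]] by metis
  have "hs_le (gram Z) (k\<^sup>2 * c)"
    by (rule hs_le_dominated[OF assms(2)]) (simp add: gram_def k(2))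
  then show ?thesis by blast
qed

lemma trace_le_gram:
  assumes "bounded_clinear Z" "hs_le Z c"
  shows "trace_le (gram Z) c"
  unfolding trace_le_def
  using selfadjoint_op_gram[OF assms(1)] hs_le_gram[OF assms] hs_le_orthonormal[OF assms]
  by (auto simp: inner_gram[OF assms(1)])

lemma trace_le_scale:
  assumes "trace_le S C" "0 \<le> a"
  shows "trace_le (\<lambda>x. a *\<^sub>R S x) (a * C)"
proof -
  note S = trace_leD[OF assms(1)]
  obtain c where "hs_le S c" using S(2) by blast
  then have "hs_le (\<lambda>x. a *\<^sub>R S x) (a\<^sup>2 * c)" by (rule hs_le_dominated) (simp add: assms(2))
  moreover have "selfadjoint_op (\<lambda>x. a *\<^sub>R S x)"
    using bounded_clinear_scaledR[OF selfadjoint_opD(1)[OF S(1)]] selfadjoint_opD(2)[OF S(1)]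
    by (simp add: selfadjoint_op_def cinner_scaleR_left cinner_scaleR_right)
  ultimately show ?thesis using S(3,4) assms(2)
    by (auto simp: trace_le_def sum_distrib_left[symmetric] intro!: mult_left_mono)
qed

lemma trace_le_zero: "trace_le (\<lambda>x. 0) 0"
  using hs_le_zero by (auto simp: trace_le_def selfadjoint_op_def bounded_clinear_const_zero)

lemma trace_le_add:
  assumes "trace_le S C" "trace_le T D"
  shows "trace_le (\<lambda>x. S x + T x) (C + D)"
proof -
  note S = trace_leD[OF assms(1)] and T = trace_leD[OF assms(2)]
  obtain c c' where "hs_le S c" "hs_le T c'" using S(2) T(2) by blast
  then have "hs_le (\<lambda>x. S x + T x) (2 * c + 2 * c')" by (rule hs_le_add)
  moreover have "selfadjoint_op (\<lambda>x. S x + T x)"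
    using bounded_clinear_plus[OF selfadjoint_opD(1)[OF S(1)] selfadjoint_opD(1)[OF T(1)]]
      selfadjoint_opD(2)[OF S(1)] selfadjoint_opD(2)[OF T(1)]
    by (simp add: selfadjoint_op_def cinner_add_left cinner_add_right)
  ultimately show ?thesis using S(3,4) T(3,4)
    by (auto simp: trace_le_def inner_add_right sum.distrib intro!: add_mono add_nonneg_nonneg)
qed

lemma trace_le_sum:
  assumes "finite I" "\<And>i. i \<in> I \<Longrightarrow> trace_le (S i) (C i)"
  shows "trace_le (\<lambda>x. \<Sum>i\<in>I. S i x) (\<Sum>i\<in>I. C i)"
  using assms by (induction I rule: finite_induct) (auto intro: trace_le_add trace_le_zero)

text \<open>A variational form of the fact that the products of Y with its adjoint in either order
  have the same nonzero spectrum. If x is orthogonal to the adjoint image of F, then Y x is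
  orthogonal to F, and Cauchy--Schwarz compares the two forms.\<close>

lemma codim_le_cadjoint:
  assumes Y: "bounded_clinear Y" and r: "0 < r"
    and k: "codim_le (\<lambda>x. (norm (cadjoint Y x))\<^sup>2 - r * (norm x)\<^sup>2) k"
  shows "codim_le (\<lambda>x. (norm (Y x))\<^sup>2 - r * (norm x)\<^sup>2) k"
proof -
  obtain F where F: "finite F" "card F \<le> k"
    "\<And>x. (\<forall>f\<in>F. cinner f x = 0) \<Longrightarrow> (norm (cadjoint Y x))\<^sup>2 \<le> r * (norm x)\<^sup>2"
    using k unfolding codim_le_def by force
  have "(norm (Y x))\<^sup>2 - r * (norm x)\<^sup>2 \<le> 0" if x: "\<forall>f\<in>cadjoint Y ` F. cinner f x = 0" for x
  proof (cases "Y x = 0")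
    case False
    have "\<forall>f\<in>F. cinner f (Y x) = 0" using x by (simp add: cinner_cadjoint_left[OF Y])
    then have 1: "(norm (cadjoint Y (Y x)))\<^sup>2 \<le> r * (norm (Y x))\<^sup>2" by (rule F(3))
    have "(norm (Y x))\<^sup>2 = cmod (cinner x (cadjoint Y (Y x)))"
      by (simp add: cinner_cadjoint_right[OF Y] cinner_self norm_power)
    also have "\<dots> \<le> norm x * norm (cadjoint Y (Y x))" by (rule norm_cinner_le)
    finally have "((norm (Y x))\<^sup>2)\<^sup>2 \<le> (norm x)\<^sup>2 * (norm (cadjoint Y (Y x)))\<^sup>2"
      by (metis norm_ge_zero power_mono power_mult_distrib zero_le_power2)
    also have "\<dots> \<le> (norm x)\<^sup>2 * (r * (norm (Y x))\<^sup>2)" by (intro mult_left_mono 1) simp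
    finally have "(norm (Y x))\<^sup>2 * (norm (Y x))\<^sup>2 \<le> (norm (Y x))\<^sup>2 * (r * (norm x)\<^sup>2)"
      by (simp add: power2_eq_square mult_ac)
    from mult_left_le_imp_le[OF this] False show ?thesis by simp
  qed (use r in simp)
  then show ?thesis
    unfolding codim_le_def using F(1,2) card_image_le[OF F(1), of "cadjoint Y"]
    by (intro exI[of _ "cadjoint Y ` F"]) auto
qed

section \<open>Kernels on the unit circle\<close>

text \<open>This factor Im w cancels the one in the denominator of the Green function, which keeps
  its real part bounded at the band edge.\<close>

lemma abs_Im_power_le:
  assumes "cmod w \<le> 1"
  shows "\<bar>Im (w ^ n)\<bar> \<le> real n * \<bar>Im w\<bar>"
proof (induction n)
  case (Suc n)
  have "\<bar>Im (w ^ Suc n)\<bar> \<le> \<bar>Re w\<bar> * \<bar>Im (w ^ n)\<bar> + \<bar>Im w\<bar> * \<bar>Re (w ^ n)\<bar>"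
    using abs_triangle_ineq[of "Re w * Im (w ^ n)" "Im w * Re (w ^ n)"] by (simp add: abs_mult)
  also have "\<dots> \<le> 1 * (real n * \<bar>Im w\<bar>) + \<bar>Im w\<bar> * 1"
  proof (intro add_mono mult_mono Suc)
    show "\<bar>Re w\<bar> \<le> 1" using abs_Re_le_cmod[of w] assms by linarith
    show "\<bar>Re (w ^ n)\<bar> \<le> 1"
      using abs_Re_le_cmod[of "w ^ n"] power_le_one[OF norm_ge_zero assms, of n] by (simp add: norm_power)
  qed auto
  finally show ?case by (simp add: algebra_simps)
qed simp

lemma unit_powi:
  assumes "cmod w = 1"
  shows "w powi n = (if n \<ge> 0 then w ^ nat \<bar>n\<bar> else cnj (w ^ nat \<bar>n\<bar>))" "cnj (w powi n) = w powi (- n)"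
    "cmod (w powi n) = 1" "Re (w powi n) = Re (w ^ nat \<bar>n\<bar>)"
proof -
  have w0: "w \<noteq> 0" using assms by auto
  have inv: "inverse w = cnj w"
    using assms w0 by (simp add: field_simps complex_norm_square[symmetric])
  show 1: "w powi n = (if n \<ge> 0 then w ^ nat \<bar>n\<bar> else cnj (w ^ nat \<bar>n\<bar>))" for n
    by (simp add: power_int_def inv)
  show "cnj (w powi n) = w powi (- n)" by (cases "n = 0"; cases "n > 0") (simp_all add: 1)
  show "cmod (w powi n) = 1" by (simp add: norm_power_int assms)
  show "Re (w powi n) = Re (w ^ nat \<bar>n\<bar>)"
    by (cases "0 \<le> n") (simp_all only: 1 if_True if_False cnj.simps)
qed

lemma unit_powi_diff:
  assumes "cmod w = 1" "cmod v = 1"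
  shows "cmod (w powi n - v powi n) \<le> \<bar>real_of_int n\<bar> * cmod (w - v)"
proof -
  have "cmod (w powi n - v powi n) = cmod (w ^ nat \<bar>n\<bar> - v ^ nat \<bar>n\<bar>)"
    unfolding unit_powi(1)[OF assms(1)] unit_powi(1)[OF assms(2)]
    by (simp flip: complex_cnj_diff complex_cnj_power)
  also have "\<dots> \<le> real (nat \<bar>n\<bar>) * cmod (w - v)" by (rule norm_power_diff) (use assms in auto)
  finally show ?thesis by simp
qed

text \<open>The addition theorem for cos((n - m) \<theta>); it splits a convolution kernel into two
  product kernels.\<close>

lemma Re_unit_power_diff:
  assumes "cmod w = 1"
  shows "Re (w ^ nat \<bar>n - m\<bar>) = Re (w powi n) * Re (w powi m) + Im (w powi n) * Im (w powi m)"
proof -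
  have w0: "w \<noteq> 0" using assms by auto
  have *: "w powi (n - m) = w powi n * cnj (w powi m)"
    unfolding unit_powi(2)[OF assms] using w0 by (simp flip: power_int_add)
  show ?thesis unfolding unit_powi(4)[OF assms, symmetric] * times_complex.sel cnj.sel by simp
qed

text \<open>On the circle 1/w - w = -2 i Im w. Hence the imaginary part is a cosine and the real
  part a sine, both divided by Im w.\<close>

lemma green_unit:
  assumes "cmod w = 1" "Im w > 0"
  shows "green h w j = \<i> * complex_of_real (h\<^sup>2 / (2 * Im w)) * w ^ nat \<bar>j\<bar>"
proof -
  have w0: "w \<noteq> 0" using assms by auto
  have "w * cnj w = 1" using assms(1) complex_norm_square[of w] by simp
  then have "1 - w\<^sup>2 = - (w * (w - cnj w))" by (simp add: power2_eq_square algebra_simps)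
  also have "w - cnj w = 2 * \<i> * complex_of_real (Im w)" by (simp add: complex_eq_iff)
  finally have "green h w j = complex_of_real (h\<^sup>2) * (w * w ^ nat \<bar>j\<bar>) / - (w * (2 * \<i> * complex_of_real (Im w)))"
    by (simp add: green_def)
  also have "\<dots> = \<i> * complex_of_real (h\<^sup>2 / (2 * Im w)) * w ^ nat \<bar>j\<bar>"
    using w0 assms(2) by (simp add: field_simps)
  finally show ?thesis .
qed

text \<open>A product kernel is a ket after a bra, so the quadratic form sees y only through two
  vectors of the second tensor factor.\<close>

lemma cinner_rank_two:
  fixes p q :: "int \<Rightarrow> real" and \<phi> a
  defines "P \<equiv> \<lambda>n. complex_of_real (p n)" and "R \<equiv> \<lambda>n. complex_of_real (q n)"
  assumes w: "\<And>n. 0 \<le> \<phi> n" "(\<lambda>n. (\<phi> n)\<^sup>2) summable_on UNIV"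
    and k: "kernel_le \<phi> (\<lambda>n m. complex_of_real (a * (p n * p m + q n * q m))) B"
    and PR: "l2_seq P" "l2_seq R" and L: "bounded_clinear L"
  shows "cinner y (lat_op (\<lambda>n m. complex_of_real (a * (p n * p m + q n * q m))) L y)
    = complex_of_real a * (cinner (lat_bra P y) (L (lat_bra P y)) + cinner (lat_bra R y) (L (lat_bra R y)))"
proof -
  have ket: "cinner y (lat_ket c g) = cinner (lat_bra c y) g" if "l2_seq c" for c g
    by (metis cinner_lat_ket[OF that] cinner_commute)
  have row: "lat_bra (\<lambda>m. complex_of_real (a * (p n * p m + q n * q m))) y
      = complex_of_real (a * p n) *\<^sub>C lat_bra P y + complex_of_real (a * q n) *\<^sub>C lat_bra R y" for n
  proof -
    have eq: "(\<lambda>m. complex_of_real (a * (p n * p m + q n * q m)))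
        = (\<lambda>m. complex_of_real (a * p n) * P m + complex_of_real (a * q n) * R m)"
      by (simp add: P_def R_def fun_eq_iff algebra_simps)
    show ?thesis
      unfolding eq lat_bra_add[OF l2_seq_scale[OF PR(1)] l2_seq_scale[OF PR(2)]]
        lat_bra_scale[OF PR(1)] lat_bra_scale[OF PR(2)] ..
  qed
  have "lat_op (\<lambda>n m. complex_of_real (a * (p n * p m + q n * q m))) L y
      = complex_of_real a *\<^sub>C (lat_ket P (L (lat_bra P y)) + lat_ket R (L (lat_bra R y)))"
    by (rule l2Z_eqI)
       (simp only: at_site_lat_op[OF w k L] row bounded_clinear_add[OF L] bounded_clinear_cscale[OF L]
          cscale_at_site plus_l2Z.rep_eq at_site_lat_ket[OF PR(1)] at_site_lat_ket[OF PR(2)],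
        simp add: P_def R_def cscale_add_right cscale_cscale)
  then show ?thesis by (simp add: cinner_cscale_right cinner_add_right ket PR)
qed

text \<open>Linear growth is the largest that \<open>lat_weight\<close> absorbs after multiplication
  by psi.\<close>

definition site_bound :: "(int \<Rightarrow> real) \<Rightarrow> real \<Rightarrow> bool" where
  "site_bound u B \<longleftrightarrow> 0 \<le> B \<and> (\<forall>n. \<bar>u n\<bar> \<le> B * (1 + \<bar>real_of_int n\<bar>))"

context
  fixes h \<nu> :: real and Q K :: "'g :: complex_hilbert \<Rightarrow> 'g" and \<V> :: "'g l2Z \<Rightarrow> 'g l2Z"
    and d :: nat and \<mu> :: "nat \<Rightarrow> real"
  assumes h: "h > 0" and dec: "finite_spectral_decomposition Q d \<mu>" and \<nu>: "\<nu> > 3"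
    and V: "nonneg_op \<V>" and K: "hilbert_schmidt K"
begin

abbreviation "bcoeff \<equiv> band_coeff h \<mu>"
abbreviation "broot \<equiv> band_root h \<mu>"
abbreviation "bvalue E \<equiv> boundary_value (H_free h Q) (M_factor \<nu> \<V> K) E"

lemmas defs_eq = sand_def[OF h dec \<nu> V K] band_kernels_def[OF h dec \<nu> V K] band_coeff_def[OF h dec \<nu> V K]
  band_root_def[OF h dec \<nu> V K] regular_energy_def[OF h dec \<nu> V K] band_op_def[OF h dec \<nu> V K]

lemmas root_lin = root_clinear[OF h dec \<nu> V K] and root_sa = root_selfadjoint[OF h dec \<nu> V K]
lemmas K_lin = K_clinear[OF h dec \<nu> V K] and Kadj_lin = K_adj_clinear[OF h dec \<nu> V K]
lemmas pi_lin = bounded_clinear_pi_proj[OF h dec] and pi_sa = pi_proj_selfadjoint[OF h dec]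

lemma broot_inside:
  assumes "\<bar>bcoeff E s\<bar> < 2"
  shows "cmod (broot E s) = 1" "Re (broot E s) = bcoeff E s / 2" "Im (broot E s) = sqrt (4 - (bcoeff E s)\<^sup>2) / 2"
    "Im (broot E s) > 0"
proof -
  show "cmod (broot E s) = 1" "Re (broot E s) = bcoeff E s / 2" and im: "Im (broot E s) = sqrt (4 - (bcoeff E s)\<^sup>2) / 2"
    using small_root_inside[OF assms] by (simp_all add: defs_eq)
  have "(bcoeff E s)\<^sup>2 < 4" using assms abs_square_less_1[of "bcoeff E s / 2"] by (simp add: power_divide)
  then show "Im (broot E s) > 0" unfolding im by simp
qed

text \<open>The approached edge is reached from inside the band, where the bound does not depend on
  E. The second case only concerns bands whose distance from their edges is controlled by
  nondegeneracy.\<close>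

definition re_bound :: "real \<Rightarrow> nat \<Rightarrow> real" where
  "re_bound E s = (if \<bar>bcoeff E s\<bar> < 2 then h\<^sup>2 / 2 else h\<^sup>2 / sqrt ((bcoeff E s)\<^sup>2 - 4))"

text \<open>Inside the band the real part is -h^2 sin(|j| \<theta>) / (2 sin \<theta>), at most h^2
  |j| / 2 in modulus up to the edge. Outside, the powers of the root are at most 1 and the
  denominator 1/w - w has modulus sqrt(b^2 - 4).\<close>

lemma re_kernels:
  assumes E: "regular_energy h Q d \<mu> E"
  shows "band_kernels \<nu> Q d (\<lambda>s n m. complex_of_real (Re (lat_kernel \<nu> h (broot E s) n m))) (re_bound E)"
  unfolding defs_eq(2)
proof
  fix s assume s: "s \<in> I_Q Q d"
  have "kernel_le (lat_weight \<nu>) (\<lambda>n m. complex_of_real (psi \<nu> n * psi \<nu> m) * complex_of_real (Re (green h (broot E s) (n - m))))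
      (re_bound E s)"
  proof (rule kernel_le_weighted)
    show "0 \<le> re_bound E s"
      using power_mono[of 2 "\<bar>bcoeff E s\<bar>" 2] by (auto simp: re_bound_def intro!: divide_nonneg_nonneg)
    fix j
    show "cmod (complex_of_real (Re (green h (broot E s) j))) \<le> re_bound E s * (1 + \<bar>real_of_int j\<bar>)"
    proof (cases "\<bar>bcoeff E s\<bar> < 2")
      case True
      note w = broot_inside[OF True]
      have "Re (green h (broot E s) j) = - (h\<^sup>2 / (2 * Im (broot E s))) * Im (broot E s ^ nat \<bar>j\<bar>)"
        unfolding green_unit[OF w(1,4)] by simp
      then have "\<bar>Re (green h (broot E s) j)\<bar> = h\<^sup>2 / (2 * Im (broot E s)) * \<bar>Im (broot E s ^ nat \<bar>j\<bar>)\<bar>"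
        using w(4) by (simp add: abs_mult)
      also have "\<dots> \<le> h\<^sup>2 / (2 * Im (broot E s)) * (real (nat \<bar>j\<bar>) * \<bar>Im (broot E s)\<bar>)"
        using w by (intro mult_left_mono abs_Im_power_le) auto
      also have "\<dots> = h\<^sup>2 / 2 * \<bar>real_of_int j\<bar>" using w(4) by simp
      also have "\<dots> \<le> h\<^sup>2 / 2 * (1 + \<bar>real_of_int j\<bar>)" by (intro mult_left_mono) auto
      finally show ?thesis using True by (simp add: re_bound_def)
    next
      case False
      have ab: "\<bar>bcoeff E s\<bar> > 2" using False E s by (auto simp: defs_eq)
      let ?w = "broot E s"
      note w = small_root_outside[OF ab, folded defs_eq(4)]
      have w0: "?w \<noteq> 0" using small_root(1) ab by (auto simp: defs_eq(4) complex_eq_iff)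
      have "green h ?w j = complex_of_real (h\<^sup>2) * ?w ^ nat \<bar>j\<bar> / (1 / ?w - ?w)"
        using w0 by (simp add: green_def field_simps power2_eq_square)
      then have "cmod (green h ?w j) = h\<^sup>2 * cmod ?w ^ nat \<bar>j\<bar> / sqrt ((bcoeff E s)\<^sup>2 - 4)"
        by (simp only: norm_divide norm_mult norm_power w(3) norm_of_real abs_of_nonneg[OF zero_le_power2])
      also have "\<dots> \<le> h\<^sup>2 * 1 / sqrt ((bcoeff E s)\<^sup>2 - 4)"
        using w(1) power_mono[of 2 "\<bar>bcoeff E s\<bar>" 2] ab
        by (intro divide_right_mono mult_left_mono power_le_one) auto
      also have "\<dots> = h\<^sup>2 / sqrt ((bcoeff E s)\<^sup>2 - 4) * 1" by simp
      also have "\<dots> \<le> h\<^sup>2 / sqrt ((bcoeff E s)\<^sup>2 - 4) * (1 + \<bar>real_of_int j\<bar>)"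
        using power_mono[of 2 "\<bar>bcoeff E s\<bar>" 2] ab by (intro mult_left_mono) auto
      finally have "cmod (green h ?w j) \<le> re_bound E s * (1 + \<bar>real_of_int j\<bar>)"
        using False by (simp add: re_bound_def)
      then show ?thesis using abs_Re_le_cmod[of "green h ?w j"] by simp
    qed
  qed
  then show "kernel_le (lat_weight \<nu>) (\<lambda>n m. complex_of_real (Re (lat_kernel \<nu> h (broot E s) n m))) (re_bound E s)"
    by (simp add: lat_kernel_def)
qed

section \<open>The imaginary part as a sum of squares\<close>

definition psi_seq :: "(int \<Rightarrow> real) \<Rightarrow> int \<Rightarrow> complex" where
  "psi_seq u n = complex_of_real (psi \<nu> n * u n)"

text \<open>The adjoint of this operator times the operator itself is the contribution of the
  product kernel u(n) u(m), weighted by psi, to band s of the sandwich, because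
  \<open>pi_proj\<close> is an orthogonal projection.\<close>

definition Y_op :: "(int \<Rightarrow> real) \<Rightarrow> nat \<Rightarrow> 'g l2Z \<Rightarrow> 'g" where
  "Y_op u s f = pi_proj Q \<mu> s (cadjoint K (lat_bra (psi_seq u) (op_sqrt \<V> f)))"

lemma psi_seq_l2:
  assumes "site_bound u B"
  shows "l2_seq (psi_seq u)" "l2_sq (psi_seq u) \<le> B\<^sup>2 * infsum (\<lambda>n. (lat_weight \<nu> n)\<^sup>2) UNIV"
proof -
  have "\<bar>psi \<nu> n * u n\<bar> \<le> B * lat_weight \<nu> n" for n
    using assms mult_left_mono[of "\<bar>u n\<bar>" "B * (1 + \<bar>real_of_int n\<bar>)" "psi \<nu> n"] psi_nonneg[of \<nu> n]
    by (simp add: site_bound_def lat_weight_def abs_mult mult_ac)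
  from l2_seq_psi[OF \<nu> this] show "l2_seq (psi_seq u)"
    "l2_sq (psi_seq u) \<le> B\<^sup>2 * infsum (\<lambda>n. (lat_weight \<nu> n)\<^sup>2) UNIV"
    by (simp_all add: psi_seq_def[abs_def])
qed

lemma Y_op_clinear:
  assumes "site_bound u B" "s \<in> I_Q Q d"
  shows "bounded_clinear (Y_op u s)"
proof -
  have "bounded_clinear (\<lambda>f. lat_bra (psi_seq u) (op_sqrt \<V> f))"
    by (rule bounded_clinear_compose[OF bounded_clinear_lat_bra[OF psi_seq_l2(1)[OF assms(1)]] root_lin])
  from bounded_clinear_compose[OF pi_lin[OF assms(2)] bounded_clinear_compose[OF Kadj_lin this]]
  show ?thesis by (simp add: Y_op_def[abs_def])
qed

text \<open>The bound is quadratic in the size B of u with a constant independent of u, so a small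
  change of the sequence costs a small trace.\<close>

lemma Y_op_hs: "\<exists>C\<ge>0. \<forall>u B s. site_bound u B \<longrightarrow> s \<in> I_Q Q d \<longrightarrow> hs_le (Y_op u s) (C * B\<^sup>2)"
proof -
  obtain c where "hs_le K c" using K by (auto simp: hilbert_schmidt_iff)
  then have c: "hs_le (cadjoint K) c" by (rule hs_le_cadjoint[OF K_lin])
  obtain r where r: "r > 0" "\<And>x. norm (op_sqrt \<V> x) \<le> r * norm x" using bounded_clinear_bounded[OF root_lin] by metis
  let ?S = "infsum (\<lambda>n. (lat_weight \<nu> n)\<^sup>2) UNIV"
  have S: "0 \<le> ?S" by (rule weight_sum_nonneg[OF lat_weight_nonneg lat_weight_summable[OF \<nu>]])
  have "hs_le (Y_op u s) ((?S * r\<^sup>2 * c) * B\<^sup>2)" if u: "site_bound u B" and s: "s \<in> I_Q Q d" for u B s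
  proof -
    have B: "0 \<le> B" using u by (simp add: site_bound_def)
    have bd: "norm (lat_bra (psi_seq u) (op_sqrt \<V> f)) \<le> (B * sqrt ?S * r) * norm f" for f
    proof -
      have "norm (lat_bra (psi_seq u) (op_sqrt \<V> f)) \<le> sqrt (l2_sq (psi_seq u)) * norm (op_sqrt \<V> f)"
        by (rule norm_lat_bra[OF psi_seq_l2(1)[OF u]])
      also have "\<dots> \<le> (B * sqrt ?S) * (r * norm f)"
        using real_sqrt_le_mono[OF psi_seq_l2(2)[OF u]] B S
        by (intro mult_mono r) (auto simp: real_sqrt_mult)
      finally show ?thesis by (simp add: mult_ac)
    qed
    have lin: "bounded_clinear (\<lambda>f. lat_bra (psi_seq u) (op_sqrt \<V> f))"
      by (rule bounded_clinear_compose[OF bounded_clinear_lat_bra[OF psi_seq_l2(1)[OF u]] root_lin])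
    have "hs_le (\<lambda>f. cadjoint K (lat_bra (psi_seq u) (op_sqrt \<V> f))) ((B * sqrt ?S * r)\<^sup>2 * c)"
      by (rule hs_le_compose_right[OF Kadj_lin c lin _ bd]) (use B S r in simp)
    from hs_le_dominated[OF this, of "Y_op u s" 1] pi_sa(2)[OF s]
    have "hs_le (Y_op u s) ((B * sqrt ?S * r)\<^sup>2 * c)" by (simp add: Y_op_def)
    then show ?thesis using S by (simp add: power_mult_distrib mult_ac)
  qed
  moreover have "0 \<le> ?S * r\<^sup>2 * c" using S hs_le_nonneg[OF c] by simp
  ultimately show ?thesis by blast
qed

lemma Y_op_diff:
  assumes "site_bound u A" "site_bound v B" "s \<in> I_Q Q d"
  shows "Y_op (\<lambda>n. u n - v n) s f = Y_op u s f - Y_op v s f"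
proof -
  have "psi_seq (\<lambda>n. u n - v n) = (\<lambda>n. psi_seq u n - psi_seq v n)"
    by (simp add: psi_seq_def fun_eq_iff algebra_simps)
  then show ?thesis
    by (simp add: Y_op_def lat_bra_diff psi_seq_l2(1)[OF assms(1)] psi_seq_l2(1)[OF assms(2)]
        bounded_clinear_diff[OF Kadj_lin] bounded_clinear_diff[OF pi_lin[OF assms(3)]])
qed

text \<open>Inside a band the root is exp(i \<theta>), so this and \<open>sin_seq\<close> are cos(n
  \<theta>) and sin(n \<theta>).\<close>

definition cos_seq :: "real \<Rightarrow> nat \<Rightarrow> int \<Rightarrow> real" where "cos_seq E s n = Re (broot E s powi n)"
definition sin_seq :: "real \<Rightarrow> nat \<Rightarrow> int \<Rightarrow> real" where "sin_seq E s n = Im (broot E s powi n)"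

lemma site_bound_cos_sin:
  assumes "\<bar>bcoeff E s\<bar> < 2"
  shows "site_bound (cos_seq E s) 1" "site_bound (sin_seq E s) 1"
proof -
  have "\<bar>Re (broot E s powi n)\<bar> \<le> 1 + \<bar>real_of_int n\<bar>" "\<bar>Im (broot E s powi n)\<bar> \<le> 1 + \<bar>real_of_int n\<bar>" for n
    using abs_Re_le_cmod[of "broot E s powi n"] abs_Im_le_cmod[of "broot E s powi n"]
      unit_powi(3)[OF broot_inside(1)[OF assms], of n] by linarith+
  then show "site_bound (cos_seq E s) 1" "site_bound (sin_seq E s) 1"
    by (simp_all add: site_bound_def cos_seq_def sin_seq_def)
qed

definition inside_bands :: "real \<Rightarrow> nat set" where
  "inside_bands E = {s \<in> I_Q Q d. \<bar>bcoeff E s\<bar> < 2}"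

text \<open>Outside its band the root, hence the Green function, is real and contributes nothing.
  Inside, the addition theorem gives two squares, and h^2 / sqrt(4 - b^2) is h^2 / (2 Im w).\<close>

lemma im_part_form:
  assumes E: "regular_energy h Q d \<mu> E"
  shows "inner f (im_part (bvalue E) f) = (\<Sum>s\<in>inside_bands E. h\<^sup>2 / sqrt (4 - (bcoeff E s)\<^sup>2) *
    ((norm (Y_op (cos_seq E s) s f))\<^sup>2 + (norm (Y_op (sin_seq E s) s f))\<^sup>2))"
proof -
  let ?k = "\<lambda>s n m. complex_of_real (Im (lat_kernel \<nu> h (broot E s) n m))"
  let ?y = "op_sqrt \<V> f"
  have kern: "kernel_le (lat_weight \<nu>) (?k s) (h\<^sup>2 / cmod (1 - (broot E s)\<^sup>2))" if "s \<in> I_Q Q d" for s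
  proof -
    have "kernel_le (lat_weight \<nu>) (lat_kernel \<nu> h (broot E s)) (h\<^sup>2 / cmod (1 - (broot E s)\<^sup>2))"
      by (rule kernel_le_lat_kernel) (rule band_root(1)[OF h dec \<nu> V K E that])
    then show ?thesis by (auto simp: kernel_le_def intro: order_trans[OF abs_Im_le_cmod])
  qed
  have summand: "Re (cinner ?y (lat_op (?k s) (band_op Q K \<mu> s) ?y)) = (if \<bar>bcoeff E s\<bar> < 2 then
      h\<^sup>2 / sqrt (4 - (bcoeff E s)\<^sup>2) * ((norm (Y_op (cos_seq E s) s f))\<^sup>2 + (norm (Y_op (sin_seq E s) s f))\<^sup>2) else 0)"
    if s: "s \<in> I_Q Q d" for s
  proof (cases "\<bar>bcoeff E s\<bar> < 2")
    case True
    note w = broot_inside[OF True] and sb = site_bound_cos_sin[OF True]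
    let ?a = "h\<^sup>2 / sqrt (4 - (bcoeff E s)\<^sup>2)"
    have a: "h\<^sup>2 / (2 * Im (broot E s)) = ?a" by (simp add: w(3))
    have k: "?k s = (\<lambda>n m. complex_of_real (?a * ((psi \<nu> n * cos_seq E s n) * (psi \<nu> m * cos_seq E s m)
        + (psi \<nu> n * sin_seq E s n) * (psi \<nu> m * sin_seq E s m))))"
    proof (intro ext, rule arg_cong[of _ _ complex_of_real])
      fix n m
      have "Im (lat_kernel \<nu> h (broot E s) n m) = psi \<nu> n * psi \<nu> m * (?a * Re (broot E s ^ nat \<bar>n - m\<bar>))"
        unfolding lat_kernel_def green_unit[OF w(1,4)] a by simp
      also have "\<dots> = ?a * ((psi \<nu> n * cos_seq E s n) * (psi \<nu> m * cos_seq E s m)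
        + (psi \<nu> n * sin_seq E s n) * (psi \<nu> m * sin_seq E s m))"
        unfolding Re_unit_power_diff[OF w(1)] cos_seq_def sin_seq_def by (simp add: algebra_simps)
      finally show "Im (lat_kernel \<nu> h (broot E s) n m) = ?a * ((psi \<nu> n * cos_seq E s n) * (psi \<nu> m * cos_seq E s m)
        + (psi \<nu> n * sin_seq E s n) * (psi \<nu> m * sin_seq E s m))" .
    qed
    have L: "cinner g (band_op Q K \<mu> s g) = complex_of_real ((norm (pi_proj Q \<mu> s (cadjoint K g)))\<^sup>2)" for g
      by (simp add: defs_eq cinner_cadjoint_left[OF K_lin, symmetric] pi_sa(3)[OF s] cinner_self)
    have "cinner ?y (lat_op (?k s) (band_op Q K \<mu> s) ?y) = complex_of_real ?a *
        (complex_of_real ((norm (Y_op (cos_seq E s) s f))\<^sup>2) + complex_of_real ((norm (Y_op (sin_seq E s) s f))\<^sup>2))"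
      unfolding k
      by (subst cinner_rank_two[OF lat_weight_nonneg lat_weight_summable[OF \<nu>] kern[OF s, unfolded k]
            psi_seq_l2(1)[OF sb(1), unfolded psi_seq_def[abs_def]] psi_seq_l2(1)[OF sb(2), unfolded psi_seq_def[abs_def]]
            band_op_clinear[OF h dec \<nu> V K s]])
         (simp add: L Y_op_def psi_seq_def[abs_def])
    then show ?thesis using True by simp
  next
    case False
    have ab: "\<bar>bcoeff E s\<bar> > 2" using False E s by (auto simp: defs_eq)
    obtain x where x: "broot E s = complex_of_real x"
      using small_root_outside(2)[OF ab] by (metis defs_eq(4) complex_is_Real_iff Reals_cases)
    have "lat_kernel \<nu> h (broot E s) n m = complex_of_real (psi \<nu> n * psi \<nu> m * (h\<^sup>2 * x ^ (nat \<bar>n - m\<bar> + 1) / (1 - x\<^sup>2)))" for n m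
      unfolding lat_kernel_def green_def x by simp
    then have z: "complex_of_real (Im (lat_kernel \<nu> h (broot E s) n m)) = 0" for n m
      by (simp only: Im_complex_of_real of_real_0)
    have "lat_op (?k s) (band_op Q K \<mu> s) ?y = 0"
    proof (rule l2Z_eqI)
      fix n
      have "lat_bra (?k s n) ?y = 0" by (simp add: lat_bra_def z)
      then show "at_site (lat_op (?k s) (band_op Q K \<mu> s) ?y) n = at_site 0 n"
        unfolding at_site_lat_op[OF lat_weight_nonneg lat_weight_summable[OF \<nu>] kern[OF s] band_op_clinear[OF h dec \<nu> V K s]]
        by (simp add: bounded_clinear_zero[OF band_op_clinear[OF h dec \<nu> V K s]] zero_l2Z.rep_eq)
    qed
    then show ?thesis using False by simp
  qed
  have "inner f (im_part (bvalue E) f) = (\<Sum>s\<in>I_Q Q d. Re (cinner ?y (lat_op (?k s) (band_op Q K \<mu> s) ?y)))"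
    unfolding im_part_boundary_value[OF h dec \<nu> V K E] defs_eq(1) inner_cinner
    by (simp add: selfadjoint_opD(2)[OF root_sa, symmetric] cinner_sum_right)
  also have "\<dots> = (\<Sum>s\<in>inside_bands E. h\<^sup>2 / sqrt (4 - (bcoeff E s)\<^sup>2) *
    ((norm (Y_op (cos_seq E s) s f))\<^sup>2 + (norm (Y_op (sin_seq E s) s f))\<^sup>2))"
    unfolding inside_bands_def sum.inter_filter[OF finite_I_Q[OF h dec]]
    by (rule sum.cong[OF refl]) (rule summand)
  finally show ?thesis .
qed

end

section \<open>The effective operator and the threshold estimate\<close>

text \<open>Both are Young's inequality for the cross term: a relative loss \<epsilon> on u is paid
  for by a term of order 1 / \<epsilon> on v.\<close>

lemma norm_add_sq_bounds:
  fixes u v :: "'a :: real_normed_vector"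
  assumes "0 < \<epsilon>"
  shows "(norm (u + v))\<^sup>2 \<le> (1 + \<epsilon>) * (norm u)\<^sup>2 + (1 + 1 / \<epsilon>) * (norm v)\<^sup>2"
    and "(1 - \<epsilon>) * (norm u)\<^sup>2 - 1 / \<epsilon> * (norm v)\<^sup>2 \<le> (norm (u + v))\<^sup>2"
proof -
  have "0 \<le> (sqrt \<epsilon> * norm u - norm v / sqrt \<epsilon>)\<^sup>2" by simp
  also have "\<dots> = \<epsilon> * (norm u)\<^sup>2 + 1 / \<epsilon> * (norm v)\<^sup>2 - 2 * (norm u * norm v)"
    using assms by (simp add: power2_diff power_mult_distrib power_divide)
  finally have c: "2 * (norm u * norm v) \<le> \<epsilon> * (norm u)\<^sup>2 + 1 / \<epsilon> * (norm v)\<^sup>2" by simp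
  have "(norm (u + v))\<^sup>2 \<le> (norm u + norm v)\<^sup>2" by (intro power_mono norm_triangle_ineq) simp
  then have "(norm (u + v))\<^sup>2 \<le> (norm u)\<^sup>2 + (norm v)\<^sup>2 + 2 * (norm u * norm v)" by (simp add: power2_sum)
  with c show "(norm (u + v))\<^sup>2 \<le> (1 + \<epsilon>) * (norm u)\<^sup>2 + (1 + 1 / \<epsilon>) * (norm v)\<^sup>2"
    by (simp add: distrib_right)
  have "(norm u - norm v)\<^sup>2 \<le> (norm (u + v))\<^sup>2"
    using norm_triangle_ineq3[of u "- v"] by (simp add: abs_le_square_iff[symmetric])
  then have "(norm u)\<^sup>2 + (norm v)\<^sup>2 - 2 * (norm u * norm v) \<le> (norm (u + v))\<^sup>2" by (simp add: power2_diff)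
  moreover have "0 \<le> (norm v)\<^sup>2" by simp
  ultimately show "(1 - \<epsilon>) * (norm u)\<^sup>2 - 1 / \<epsilon> * (norm v)\<^sup>2 \<le> (norm (u + v))\<^sup>2"
    using c unfolding left_diff_distrib mult_1 by linarith
qed

text \<open>The limit of the band root at the threshold; its powers at the upper edge are the
  alternating signs of J.\<close>

definition edge_sign :: "nat \<Rightarrow> real" where
  "edge_sign i = (if i = 1 then 1 else - 1)"

lemma edge_sign: "\<bar>edge_sign i\<bar> = 1" "edge_sign i * edge_sign i = 1"
  by (simp_all add: edge_sign_def)

lemma abs_edge_sign_powi: "\<bar>edge_sign i powi n\<bar> = 1"
  using norm_power_int[of "edge_sign i" n] by (simp add: edge_sign)

lemma site_bound_edge_sign: "site_bound (\<lambda>n. edge_sign i powi n) 1"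
  by (simp add: site_bound_def abs_edge_sign_powi)

context
  fixes h \<nu> :: real and Q K :: "'g :: complex_hilbert \<Rightarrow> 'g" and \<V> :: "'g l2Z \<Rightarrow> 'g l2Z"
    and d s :: nat and \<mu> :: "nat \<Rightarrow> real"
  assumes h: "h > 0" and dec: "finite_spectral_decomposition Q d \<mu>" and \<nu>: "\<nu> > 3"
    and V: "nonneg_op \<V>" and K: "hilbert_schmidt K" and s: "s \<in> I_Q Q d"
begin

abbreviation "Yop \<equiv> Y_op \<nu> Q K \<V> \<mu>"
abbreviation "bcf \<equiv> band_coeff h \<mu>"
abbreviation "bval E \<equiv> boundary_value (H_free h Q) (M_factor \<nu> \<V> K) E"

text \<open>The limit of the cosine factor at the band edge, hence independent of the
  energy.\<close>

definition edge_op :: "nat \<Rightarrow> 'g l2Z \<Rightarrow> 'g" where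
  "edge_op i = Yop (\<lambda>n. edge_sign i powi n) s"

lemma edge_op_clinear: "bounded_clinear (edge_op i)"
  unfolding edge_op_def by (rule Y_op_clinear[OF h dec \<nu> V K site_bound_edge_sign s])

lemma edge_op_hs: "\<exists>c. hs_le (edge_op i) c"
  unfolding edge_op_def using Y_op_hs[OF h dec \<nu> V K] site_bound_edge_sign s by blast

lemma lat_bra_psi: "bra_tensor (psi \<nu>) (pi_proj Q \<mu> s) f = pi_proj Q \<mu> s (lat_bra (psi_seq \<nu> (\<lambda>_. 1)) f)"
proof -
  note pi = bounded_clinear_pi_proj[OF h dec s]
  have "site_bound (\<lambda>_. 1) 1" by (simp add: site_bound_def)
  from has_sum_bounded_linear[OF bounded_clinear_linear[OF pi] lat_bra_has_sum[OF psi_seq_l2(1)[OF h dec \<nu> V K this], of f]]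
  show ?thesis
    unfolding bra_tensor_def
    by (intro infsumI) (simp add: psi_seq_def[OF h dec \<nu> V K] bounded_clinear_cscale[OF pi] scaleR_cscale)
qed

text \<open>Let D be \<open>P_op\<close> after J (the identity at the lower edge) after tensoring
  with the adjoint of K. Then \<open>edge_op i\<close> is D after the root of \<V>, and the
  effective operator is D \<V> followed on the right by the adjoint of D.\<close>

lemma effective_operator:
  assumes i: "i \<in> {1, 2}"
  shows "P_op \<nu> Q \<mu> s \<circ> (if i = 1 then bold_V \<V> K else bold_V_J \<V> K) \<circ> cadjoint (P_op \<nu> Q \<mu> s)
    = (\<lambda>g. edge_op i (cadjoint (edge_op i) g))"
proof -
  let ?R = "op_sqrt \<V>" and ?P = "P_op \<nu> Q \<mu> s"
  define m where "m = mult_tensor (\<lambda>_. 1) (cadjoint K)"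
  define m' where "m' = mult_tensor (\<lambda>_. 1) K"
  define J where "J = (if i = 1 then (\<lambda>f. f) else (J_op :: 'g l2Z \<Rightarrow> 'g l2Z))"
  note Rl = root_clinear[OF h dec \<nu> V K] and Rs = root_selfadjoint[OF h dec \<nu> V K]
  note Kl = K_clinear[OF h dec \<nu> V K] and Ka = K_adj_clinear[OF h dec \<nu> V K]
  note pi = bounded_clinear_pi_proj[OF h dec s]
  have one: "site_bound (\<lambda>_. 1) 1" by (simp add: site_bound_def)
  note l1 = psi_seq_l2(1)[OF h dec \<nu> V K one] and le = psi_seq_l2(1)[OF h dec \<nu> V K site_bound_edge_sign[of i]]
  have mc: "bounded_clinear m" "bounded_clinear m'"
    unfolding m_def m'_def
    by (rule bounded_clinear_mult_tensor[where C = 1, OF Ka], simp) (rule bounded_clinear_mult_tensor[where C = 1, OF Kl], simp)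
  have m: "cadjoint m = m'"
    unfolding m_def m'_def by (subst cadjoint_mult_tensor[where C = 1, OF Ka]) (simp_all add: cadjoint_cadjoint[OF Kl])
  have sgn: "\<bar>(- 1 :: real) powi n\<bar> \<le> 1" for n using norm_power_int[of "- 1 :: real" n] by simp
  have Jop: "bounded_clinear (J_op :: 'g l2Z \<Rightarrow> 'g l2Z)" "cadjoint (J_op :: 'g l2Z \<Rightarrow> 'g l2Z) = J_op"
    "at_site (J_op f) n = (- 1) powi n *\<^sub>R at_site f n" for f :: "'g l2Z" and n
  proof -
    have id: "cadjoint (\<lambda>x::'g. x) = (\<lambda>x. x)" by (rule cadjoint_eqI[OF bounded_clinear_ident]) simp
    show "bounded_clinear (J_op :: 'g l2Z \<Rightarrow> 'g l2Z)" unfolding J_op_def by (rule bounded_clinear_mult_tensor[OF bounded_clinear_ident sgn])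
    show "cadjoint (J_op :: 'g l2Z \<Rightarrow> 'g l2Z) = J_op" unfolding J_op_def cadjoint_mult_tensor[OF bounded_clinear_ident sgn] id ..
    show "at_site (J_op f) n = (- 1) powi n *\<^sub>R at_site f n" unfolding J_op_def by (rule at_site_mult_tensor[OF bounded_clinear_ident sgn])
  qed
  have J: "bounded_clinear J" "cadjoint J = J" "at_site (J f) n = edge_sign i powi n *\<^sub>R at_site f n" for f n
    using Jop cadjoint_eqI[OF bounded_clinear_ident, of "\<lambda>x. x"] bounded_clinear_ident
    by (auto simp: J_def edge_sign_def)
  have P: "?P = (\<lambda>f. pi_proj Q \<mu> s (lat_bra (psi_seq \<nu> (\<lambda>_. 1)) f))"
    unfolding P_op_def by (rule ext) (rule lat_bra_psi)
  have Pc: "bounded_clinear ?P"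
    unfolding P by (rule bounded_clinear_compose[OF pi bounded_clinear_lat_bra[OF l1]])
  have braJ: "lat_bra (psi_seq \<nu> (\<lambda>_. 1)) (J f) = lat_bra (psi_seq \<nu> (\<lambda>n. edge_sign i powi n)) f" for f
    by (simp add: lat_bra_def J(3) psi_seq_def[OF h dec \<nu> V K] scaleR_cscale cscale_cscale)
  have bram: "lat_bra a (m f) = cadjoint K (lat_bra a f)" if "l2_seq a" for a f
  proof (rule has_sum_unique[OF lat_bra_has_sum[OF that]])
    have "at_site (m f) n = cadjoint K (at_site f n)" for n
      unfolding m_def by (subst at_site_mult_tensor[where C = 1, OF Ka]) simp_all
    then show "((\<lambda>n. a n *\<^sub>C at_site (m f) n) has_sum cadjoint K (lat_bra a f)) UNIV"
      using has_sum_bounded_linear[OF bounded_clinear_linear[OF Ka] lat_bra_has_sum[OF that, of f]]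
      by (simp add: bounded_clinear_cscale[OF Ka])
  qed
  define D where "D f = ?P (J (m f))" for f
  have JmC: "bounded_clinear (\<lambda>f. J (m f))" by (rule bounded_clinear_compose[OF J(1) mc(1)])
  have Dc: "bounded_clinear D" unfolding D_def[abs_def] by (rule bounded_clinear_compose[OF Pc JmC])
  have Dadj: "cadjoint D = (\<lambda>g. m' (J (cadjoint ?P g)))"
    unfolding D_def[abs_def] cadjoint_compose[OF Pc JmC] cadjoint_compose[OF J(1) mc(1)] m J(2) ..
  have "edge_op i = (\<lambda>f. D (?R f))"
    by (simp add: edge_op_def Y_op_def[OF h dec \<nu> V K] D_def P braJ bram[OF le] fun_eq_iff)
  moreover have "cadjoint (\<lambda>f. D (?R f)) = (\<lambda>g. ?R (cadjoint D g))"
    unfolding cadjoint_compose[OF Dc Rl] selfadjoint_op_cadjoint[OF Rs] ..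
  ultimately have "(\<lambda>g. edge_op i (cadjoint (edge_op i) g)) = (\<lambda>g. D (\<V> (cadjoint D g)))"
    by (simp add: op_sqrt_sq[OF V])
  also have "\<dots> = ?P \<circ> (if i = 1 then bold_V \<V> K else bold_V_J \<V> K) \<circ> cadjoint ?P"
    unfolding Dadj D_def
    by (auto simp: bold_V_def bold_V_J_def J_def Jop(2) m_def m'_def fun_eq_iff)
  finally show ?thesis by simp
qed

text \<open>\<open>Phi\<close> counts for \<open>edge_op\<close> times its adjoint, acting on the
  small space, whereas the form estimates concern the opposite product;
  \<open>codim_le_cadjoint\<close> identifies the counts.\<close>

lemma Phi_counting:
  assumes i: "i \<in> {1, 2}" and r: "r > 0"
  obtains N :: nat where "Phi i \<nu> Q \<mu> s \<V> K r = real N"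
    "\<And>k. N \<le> k \<longleftrightarrow> codim_le (\<lambda>x. (norm (edge_op i x))\<^sup>2 - r * (norm x)\<^sup>2) k"
proof -
  note Y = edge_op_clinear[of i] and Y' = bounded_clinear_cadjoint[OF edge_op_clinear[of i]]
  obtain c where "hs_le (edge_op i) c" using edge_op_hs by blast
  then have "hs_le (cadjoint (edge_op i)) c" by (rule hs_le_cadjoint[OF Y])
  then obtain c' where c': "hs_le (gram (cadjoint (edge_op i))) c'" using hs_le_gram[OF Y'] by blast
  have sa: "selfadjoint_op (gram (cadjoint (edge_op i)))" by (rule selfadjoint_op_gram[OF Y'])
  have g: "(\<lambda>g. edge_op i (cadjoint (edge_op i) g)) = gram (cadjoint (edge_op i))"
    by (simp add: gram_def[abs_def] cadjoint_cadjoint[OF Y])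
  have "Phi i \<nu> Q \<mu> s \<V> K r = real (N_plus r (gram (cadjoint (edge_op i))))"
    unfolding Phi_def effective_operator[OF i] g by (rule counting_le_iff(2)[OF sa c' r])
  moreover have "N_plus r (gram (cadjoint (edge_op i))) \<le> k \<longleftrightarrow> codim_le (\<lambda>x. (norm (edge_op i x))\<^sup>2 - r * (norm x)\<^sup>2) k" for k
    unfolding counting_le_iff(1)[OF sa c' r] inner_gram[OF Y']
    using codim_le_cadjoint[OF Y r, of k] codim_le_cadjoint[OF Y' r, of k] by (auto simp: cadjoint_cadjoint[OF Y])
  ultimately show ?thesis using that by blast
qed

text \<open>C is fixed before all other parameters. Here \<delta> is h^2 times the distance to the
  threshold, and \<gamma> bounds the other bands away from their edges. The quotient 2 / sqrt(4 -
  \<delta>) compares the coefficient of band s with its leading term h^2 / (2 sqrt \<delta>); the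
  last condition leaves half of \<eta> for Young's inequality.\<close>

lemma pointwise_estimate:
  obtains C where "\<And>E i \<delta> \<gamma> \<eta>. 0 < \<delta> \<Longrightarrow> \<delta> < 1 \<Longrightarrow> edge_sign i * bcf E s = 2 - \<delta> \<Longrightarrow>
      (\<And>t. t \<in> I_Q Q d - {s} \<Longrightarrow> 0 < \<gamma> t \<and> \<gamma> t \<le> \<bar>4 - (bcf E t)\<^sup>2\<bar>) \<Longrightarrow>
      0 < \<eta> \<Longrightarrow> \<eta> < 1 \<Longrightarrow> 2 / sqrt (4 - \<delta>) \<le> (1 + \<eta>) / (1 + \<eta> / 2) \<Longrightarrow>
      selfadjoint_op (re_part (bval E)) \<and>
      hs_le (re_part (bval E)) (C * (\<Sum>t\<in>I_Q Q d. (h\<^sup>2 / 2 + (if t = s then 0 else h\<^sup>2 / sqrt (\<gamma> t)))\<^sup>2)) \<and>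
      selfadjoint_op (im_part (bval E)) \<and> (\<exists>c. hs_le (im_part (bval E)) c) \<and>
      (\<forall>x. 0 \<le> inner x (im_part (bval E) x)) \<and>
      (\<exists>S. trace_le S (2 * C * (\<Sum>t\<in>I_Q Q d - {s}. h\<^sup>2 / sqrt (\<gamma> t)) + h\<^sup>2 * (2 + 2 / \<eta>) * C) \<and>
        (\<forall>x. (1 - \<eta>) * (h\<^sup>2 / (2 * sqrt \<delta>)) * (norm (edge_op i x))\<^sup>2 - inner x (S x) \<le> inner x (im_part (bval E) x) \<and>
          inner x (im_part (bval E) x) \<le> (1 + \<eta>) * (h\<^sup>2 / (2 * sqrt \<delta>)) * (norm (edge_op i x))\<^sup>2 + inner x (S x)))"
proof -
  note ctx = h dec \<nu> V K
  obtain C0 where C0: "C0 \<ge> 0" "\<And>k B. band_kernels \<nu> Q d k B \<Longrightarrow> hs_le (sand Q K \<V> d \<mu> k) (C0 * (\<Sum>s\<in>I_Q Q d. (B s)\<^sup>2))"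
    using sand_hs[OF ctx] by blast
  obtain C1 where C1: "C1 \<ge> 0" "\<And>u B t. site_bound u B \<Longrightarrow> t \<in> I_Q Q d \<Longrightarrow> hs_le (Yop u t) (C1 * B\<^sup>2)"
    using Y_op_hs[OF ctx] by blast
  show ?thesis
  proof (rule that[of "max C0 C1"], goal_cases)
    case (1 E i \<delta> \<gamma> \<eta>)
    note \<delta> = 1(1,2) and sb = 1(3) and \<gamma> = 1(4) and \<eta> = 1(5,6) and fac = 1(7)
    let ?\<sigma> = "edge_sign i" and ?b = "bcf E s" and ?A = "re_part (bval E)" and ?B = "im_part (bval E)"
    have absb: "\<bar>?b\<bar> = 2 - \<delta>"
    proof -
      have "\<bar>?b\<bar> = \<bar>?\<sigma> * ?b\<bar>" by (simp add: abs_mult edge_sign)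
      then show ?thesis using sb \<delta> by simp
    qed
    then have b2: "\<bar>?b\<bar> < 2" using \<delta> by simp
    have reg: "regular_energy h Q d \<mu> E"
      unfolding regular_energy_def[OF ctx]
    proof
      fix t assume t: "t \<in> I_Q Q d"
      show "\<bar>bcf E t\<bar> \<noteq> 2"
      proof (cases "t = s")
        case False
        then have "\<bar>4 - (bcf E t)\<^sup>2\<bar> > 0" using \<gamma>[of t] t by force
        moreover have "(bcf E t)\<^sup>2 = 2\<^sup>2" if "\<bar>bcf E t\<bar> = 2"
          unfolding that[symmetric] by (rule power2_abs[symmetric])
        ultimately show ?thesis by force
      qed (use absb \<delta> in simp)
    qed
    note inI = finite_I_Q[OF h dec]
    have sym: "cnj (complex_of_real (f (lat_kernel \<nu> h w m n))) = complex_of_real (f (lat_kernel \<nu> h w n m))"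
      for f :: "complex \<Rightarrow> real" and w n m by (simp add: lat_kernel_symmetric[of \<nu> h w m n])
    note reK = re_kernels[OF ctx reg]
    have A1: "selfadjoint_op ?A"
      unfolding re_part_boundary_value[OF ctx reg] by (rule sand_selfadjoint[OF ctx reK sym])
    have "hs_le ?A (C0 * (\<Sum>t\<in>I_Q Q d. (re_bound h \<mu> E t)\<^sup>2))"
      unfolding re_part_boundary_value[OF ctx reg] by (rule C0(2)[OF reK])
    moreover have "C0 * (\<Sum>t\<in>I_Q Q d. (re_bound h \<mu> E t)\<^sup>2)
        \<le> max C0 C1 * (\<Sum>t\<in>I_Q Q d. (h\<^sup>2 / 2 + (if t = s then 0 else h\<^sup>2 / sqrt (\<gamma> t)))\<^sup>2)"
    proof (intro mult_mono sum_mono power_mono sum_nonneg)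
      fix t assume t: "t \<in> I_Q Q d"
      show "re_bound h \<mu> E t \<le> h\<^sup>2 / 2 + (if t = s then 0 else h\<^sup>2 / sqrt (\<gamma> t))"
      proof (cases "\<bar>bcf E t\<bar> < 2")
        case True
        then show ?thesis using \<gamma>[of t] t by (auto simp: re_bound_def[OF ctx] less_imp_le)
      next
        case False
        then have ts: "t \<noteq> s" using b2 by auto
        have b4: "4 \<le> (bcf E t)\<^sup>2" using False power_mono[of 2 "\<bar>bcf E t\<bar>" 2] by simp
        then have "sqrt (\<gamma> t) \<le> sqrt ((bcf E t)\<^sup>2 - 4)" using \<gamma>[of t] t ts by (intro real_sqrt_le_mono) auto
        then have "h\<^sup>2 / sqrt ((bcf E t)\<^sup>2 - 4) \<le> h\<^sup>2 / sqrt (\<gamma> t)"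
          using \<gamma>[of t] t ts by (intro divide_left_mono mult_pos_pos) (auto intro: less_le_trans)
        moreover have "0 \<le> h\<^sup>2 / 2" by simp
        ultimately have "h\<^sup>2 / sqrt ((bcf E t)\<^sup>2 - 4) \<le> h\<^sup>2 / 2 + h\<^sup>2 / sqrt (\<gamma> t)" by linarith
        then show ?thesis using False ts by (simp add: re_bound_def[OF ctx])
      qed
      show "0 \<le> re_bound h \<mu> E t"
        using power_mono[of 2 "\<bar>bcf E t\<bar>" 2] by (auto simp: re_bound_def[OF ctx] intro!: divide_nonneg_nonneg)
    qed (use C0 in auto)
    ultimately have A2: "hs_le ?A (max C0 C1 * (\<Sum>t\<in>I_Q Q d. (h\<^sup>2 / 2 + (if t = s then 0 else h\<^sup>2 / sqrt (\<gamma> t)))\<^sup>2))"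
      by (rule hs_le_mono)
    have imK: "band_kernels \<nu> Q d (\<lambda>s n m. complex_of_real (Im (lat_kernel \<nu> h (band_root h \<mu> E s) n m)))
        (\<lambda>s. h\<^sup>2 / cmod (1 - (band_root h \<mu> E s)\<^sup>2))"
      using boundary_band_kernels[OF ctx reg]
      by (auto simp: band_kernels_def[OF ctx] kernel_le_def intro: order_trans[OF abs_Im_le_cmod])
    have B1: "selfadjoint_op ?B"
      unfolding im_part_boundary_value[OF ctx reg] by (rule sand_selfadjoint[OF ctx imK sym])
    have B2: "\<exists>c. hs_le ?B c"
      unfolding im_part_boundary_value[OF ctx reg] using C0(2)[OF imK] by blast
    define a where "a t = h\<^sup>2 / sqrt (4 - (bcf E t)\<^sup>2)" for t
    define In where "In = inside_bands h Q d \<mu> E"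
    have In: "t \<in> In \<longleftrightarrow> t \<in> I_Q Q d \<and> \<bar>bcf E t\<bar> < 2" for t by (simp add: In_def inside_bands_def[OF ctx])
    have fIn: "finite In" unfolding In_def inside_bands_def[OF ctx] using inI by simp
    have sIn: "s \<in> In" using s b2 by (simp add: In)
    have lt4: "(bcf E t)\<^sup>2 < 4" if "t \<in> In" for t
      using that abs_square_less_1[of "bcf E t / 2"] by (simp add: In power_divide)
    have a0: "0 \<le> a t" if "t \<in> In" for t using lt4[OF that] by (simp add: a_def)
    let ?c = "cos_seq h \<mu> E" and ?s = "sin_seq h \<mu> E"
    define G where "G t x = (norm (Yop (?c t) t x))\<^sup>2 + (norm (Yop (?s t) t x))\<^sup>2" for t x
    have form: "inner x (?B x) = a s * G s x + (\<Sum>t\<in>In - {s}. a t * G t x)" for x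
      unfolding im_part_form[OF ctx reg] a_def[symmetric] In_def[symmetric] G_def[symmetric]
      by (rule sum.remove[OF fIn sIn])
    have B3: "\<forall>x. 0 \<le> inner x (?B x)"
    proof
      fix x
      show "0 \<le> inner x (?B x)" unfolding form
        using a0 sIn by (intro add_nonneg_nonneg sum_nonneg mult_nonneg_nonneg) (auto simp: G_def)
    qed
    define w where "w = band_root h \<mu> E s"
    note w = broot_inside[OF ctx b2, folded w_def]
    let ?sc = "complex_of_real ?\<sigma>"
    have sc: "cmod ?sc = 1" by (simp add: edge_sign)
    \<comment> \<open>On the unit circle the squared distance to the sign \<sigma> is 2 - 2 \<sigma>
      Re w, and 2 Re w is the band coefficient.\<close>
    have wd: "(cmod (w - ?sc))\<^sup>2 = \<delta>"
    proof -
      have "(cmod (w - ?sc))\<^sup>2 = (cmod w)\<^sup>2 - 2 * (?\<sigma> * Re w) + ?\<sigma> * ?\<sigma>"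
        by (simp add: cmod_power2 power2_diff) (simp add: power2_eq_square)
      then show ?thesis using sb by (simp add: w(1,2) edge_sign diff_divide_distrib)
    qed
    then have wd': "cmod (w - ?sc) = sqrt \<delta>" by (metis norm_ge_zero real_sqrt_unique)
    have pw: "cmod (w powi n - complex_of_real (?\<sigma> powi n)) \<le> sqrt \<delta> * (1 + \<bar>real_of_int n\<bar>)" for n
    proof -
      have "cmod (w powi n - ?sc powi n) \<le> \<bar>real_of_int n\<bar> * sqrt \<delta>"
        unfolding wd'[symmetric] by (rule unit_powi_diff[OF w(1) sc])
      also have "\<dots> \<le> sqrt \<delta> * (1 + \<bar>real_of_int n\<bar>)" using \<delta> by (simp add: algebra_simps)
      finally show ?thesis by simp
    qed
    \<comment> \<open>This deviation and the sine are the real and imaginary parts of w^n -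
      \<sigma>^n, so both have size sqrt \<delta> with linear growth in n.\<close>
    define e where "e n = ?c s n - ?\<sigma> powi n" for n
    have sbe: "site_bound e (sqrt \<delta>)"
      unfolding site_bound_def
    proof (intro conjI allI)
      fix n
      have "e n = Re (w powi n - complex_of_real (?\<sigma> powi n))"
        by (simp only: e_def cos_seq_def[OF ctx] w_def minus_complex.sel Re_complex_of_real)
      then show "\<bar>e n\<bar> \<le> sqrt \<delta> * (1 + \<bar>real_of_int n\<bar>)" using pw[of n] abs_Re_le_cmod order_trans by metis
    qed (use \<delta> in simp)
    have sbs: "site_bound (?s s) (sqrt \<delta>)"
      unfolding site_bound_def
    proof (intro conjI allI)
      fix n
      have "?s s n = Im (w powi n - complex_of_real (?\<sigma> powi n))"
        by (simp only: sin_seq_def[OF ctx] w_def minus_complex.sel Im_complex_of_real diff_0_right)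
      then show "\<bar>?s s n\<bar> \<le> sqrt \<delta> * (1 + \<bar>real_of_int n\<bar>)" using pw[of n] abs_Im_le_cmod order_trans by metis
    qed (use \<delta> in simp)
    have sq: "(sqrt \<delta>)\<^sup>2 = \<delta>" using \<delta> by simp
    have b_sq: "4 - ?b\<^sup>2 = \<delta> * (4 - \<delta>)"
    proof -
      have "?b\<^sup>2 = (2 - \<delta>)\<^sup>2" using absb by (metis power2_abs)
      then show ?thesis by (simp add: power2_eq_square algebra_simps)
    qed
    have as: "a s = h\<^sup>2 / (2 * sqrt \<delta>) * (2 / sqrt (4 - \<delta>))"
      unfolding a_def b_sq by (simp add: real_sqrt_mult)
    have s4: "0 < sqrt (4 - \<delta>)" "sqrt (4 - \<delta>) \<le> 2" using \<delta> real_sqrt_le_mono[of "4 - \<delta>" 4] by auto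
    have sd: "0 < sqrt \<delta>" "sqrt \<delta> \<le> 1" using \<delta> by auto
    let ?\<kappa> = "h\<^sup>2 / (2 * sqrt \<delta>)"
    have \<kappa>: "0 < ?\<kappa>" using h sd by simp
    have as_lower: "?\<kappa> \<le> a s"
    proof -
      have "?\<kappa> * 1 \<le> ?\<kappa> * (2 / sqrt (4 - \<delta>))" using \<kappa> s4 by (intro mult_left_mono) auto
      then show ?thesis by (simp add: as)
    qed
    have as_upper: "a s * (1 + \<eta> / 2) \<le> (1 + \<eta>) * ?\<kappa>"
    proof -
      have "a s * (1 + \<eta> / 2) \<le> ?\<kappa> * ((1 + \<eta>) / (1 + \<eta> / 2)) * (1 + \<eta> / 2)"
        unfolding as using fac \<kappa> \<eta> by (intro mult_right_mono mult_left_mono) auto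
      also have "\<dots> = (1 + \<eta>) * ?\<kappa>"
      proof -
        have "k * (p / m) * m = p * k" if "m \<noteq> 0" for k p m :: real using that by simp
        then show ?thesis using \<eta> by simp
      qed
      finally show ?thesis .
    qed
    \<comment> \<open>The singular coefficient, of order 1 / sqrt \<delta>, meets the squared size
      \<delta> of the deviations; this keeps the trace of the error in band s bounded.\<close>
    have as_\<delta>: "a s * \<delta> \<le> h\<^sup>2"
    proof -
      have "a s * \<delta> = h\<^sup>2 * (sqrt \<delta> * (1 / sqrt (4 - \<delta>)))"
        using sd s4 sq by (simp add: as field_simps power2_eq_square)
      also have "\<dots> \<le> h\<^sup>2 * (1 * 1)"
      proof (intro mult_left_mono mult_mono)
        have "1 \<le> sqrt (4 - \<delta>)" using \<delta> by simp
        then show "1 / sqrt (4 - \<delta>) \<le> 1" by simp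
      qed (use sd s4 in auto)
      finally show ?thesis by simp
    qed
    \<comment> \<open>The error consists of the other bands, the cosine deviation with the weight
      required by Young's inequality, and the sine part.\<close>
    define S where "S x = (\<Sum>t\<in>In - {s}. a t *\<^sub>R (gram (Yop (?c t) t) x + gram (Yop (?s t) t) x))
        + ((a s * (1 + 2 / \<eta>)) *\<^sub>R gram (Yop e s) x + a s *\<^sub>R gram (Yop (?s s) s) x)" for x
    have sbt: "site_bound (?c t) 1" "site_bound (?s t) 1" if "t \<in> In" for t
      using site_bound_cos_sin[OF ctx] that by (auto simp: In)
    note Yc = Y_op_clinear[OF ctx]
    have InI: "t \<in> In \<Longrightarrow> t \<in> I_Q Q d" for t by (simp add: In)
    have tr: "trace_le S ((\<Sum>t\<in>In - {s}. a t * (C1 * 1\<^sup>2 + C1 * 1\<^sup>2))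
        + ((a s * (1 + 2 / \<eta>)) * (C1 * (sqrt \<delta>)\<^sup>2) + a s * (C1 * (sqrt \<delta>)\<^sup>2)))"
      unfolding S_def[abs_def]
    proof (rule trace_le_add[OF trace_le_sum trace_le_add])
      fix t assume "t \<in> In - {s}"
      then have t: "t \<in> In" by simp
      show "trace_le (\<lambda>x. a t *\<^sub>R (gram (Yop (?c t) t) x + gram (Yop (?s t) t) x)) (a t * (C1 * 1\<^sup>2 + C1 * 1\<^sup>2))"
        by (rule trace_le_scale[OF trace_le_add a0[OF t]])
           (rule trace_le_gram[OF Yc[OF sbt(1)[OF t] InI[OF t]] C1(2)[OF sbt(1)[OF t] InI[OF t]]],
            rule trace_le_gram[OF Yc[OF sbt(2)[OF t] InI[OF t]] C1(2)[OF sbt(2)[OF t] InI[OF t]]])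
    next
      show "trace_le (\<lambda>x. (a s * (1 + 2 / \<eta>)) *\<^sub>R gram (Yop e s) x) ((a s * (1 + 2 / \<eta>)) * (C1 * (sqrt \<delta>)\<^sup>2))"
        by (rule trace_le_scale[OF trace_le_gram[OF Yc[OF sbe s] C1(2)[OF sbe s]]]) (use a0[OF sIn] \<eta> in simp)
      show "trace_le (\<lambda>x. a s *\<^sub>R gram (Yop (?s s) s) x) (a s * (C1 * (sqrt \<delta>)\<^sup>2))"
        by (rule trace_le_scale[OF trace_le_gram[OF Yc[OF sbs s] C1(2)[OF sbs s]] a0[OF sIn]])
    qed (use fIn in simp)
    have tr_bound: "(\<Sum>t\<in>In - {s}. a t * (C1 * 1\<^sup>2 + C1 * 1\<^sup>2))
        + ((a s * (1 + 2 / \<eta>)) * (C1 * (sqrt \<delta>)\<^sup>2) + a s * (C1 * (sqrt \<delta>)\<^sup>2))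
        \<le> 2 * max C0 C1 * (\<Sum>t\<in>I_Q Q d - {s}. h\<^sup>2 / sqrt (\<gamma> t)) + h\<^sup>2 * (2 + 2 / \<eta>) * max C0 C1"
    proof (rule add_mono)
      have "(\<Sum>t\<in>In - {s}. a t * (C1 * 1\<^sup>2 + C1 * 1\<^sup>2)) = 2 * C1 * (\<Sum>t\<in>In - {s}. a t)"
        by (simp add: sum_distrib_left mult_ac)
      also have "(\<Sum>t\<in>In - {s}. a t) \<le> (\<Sum>t\<in>In - {s}. h\<^sup>2 / sqrt (\<gamma> t))"
      proof (rule sum_mono)
        fix t assume t: "t \<in> In - {s}"
        then have "0 < \<gamma> t" "\<gamma> t \<le> 4 - (bcf E t)\<^sup>2" using \<gamma>[of t] lt4[of t] by (auto simp: In)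
        then show "a t \<le> h\<^sup>2 / sqrt (\<gamma> t)"
          unfolding a_def by (intro divide_left_mono mult_pos_pos real_sqrt_le_mono) auto
      qed
      also have "\<dots> \<le> (\<Sum>t\<in>I_Q Q d - {s}. h\<^sup>2 / sqrt (\<gamma> t))"
        using inI \<gamma> by (intro sum_mono2) (auto simp: In less_imp_le)
      finally have "(\<Sum>t\<in>In - {s}. a t * (C1 * 1\<^sup>2 + C1 * 1\<^sup>2)) \<le> 2 * C1 * (\<Sum>t\<in>I_Q Q d - {s}. h\<^sup>2 / sqrt (\<gamma> t))"
        using C1(1) by (simp add: mult_left_mono)
      also have "\<dots> \<le> 2 * max C0 C1 * (\<Sum>t\<in>I_Q Q d - {s}. h\<^sup>2 / sqrt (\<gamma> t))"
        using \<gamma> by (intro mult_right_mono sum_nonneg) (auto simp: less_imp_le)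
      finally show "(\<Sum>t\<in>In - {s}. a t * (C1 * 1\<^sup>2 + C1 * 1\<^sup>2))
          \<le> 2 * max C0 C1 * (\<Sum>t\<in>I_Q Q d - {s}. h\<^sup>2 / sqrt (\<gamma> t))" .
      have "(a s * (1 + 2 / \<eta>)) * (C1 * (sqrt \<delta>)\<^sup>2) + a s * (C1 * (sqrt \<delta>)\<^sup>2) = (a s * \<delta>) * ((2 + 2 / \<eta>) * C1)"
        unfolding sq by (simp add: algebra_simps)
      also have "\<dots> \<le> h\<^sup>2 * ((2 + 2 / \<eta>) * max C0 C1)"
        using as_\<delta> C1(1) \<eta> by (intro mult_mono) auto
      finally show "(a s * (1 + 2 / \<eta>)) * (C1 * (sqrt \<delta>)\<^sup>2) + a s * (C1 * (sqrt \<delta>)\<^sup>2) \<le> h\<^sup>2 * (2 + 2 / \<eta>) * max C0 C1"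
        by (simp add: mult.assoc)
    qed
    have bounds: "(1 - \<eta>) * ?\<kappa> * (norm (edge_op i x))\<^sup>2 - inner x (S x) \<le> inner x (?B x) \<and>
          inner x (?B x) \<le> (1 + \<eta>) * ?\<kappa> * (norm (edge_op i x))\<^sup>2 + inner x (S x)" for x
    proof -
      let ?u = "edge_op i x" and ?v = "Yop e s x" and ?z = "(norm (Yop (?s s) s x))\<^sup>2"
      let ?rest = "\<Sum>t\<in>In - {s}. a t * G t x"
      have rest: "0 \<le> ?rest" using a0 by (intro sum_nonneg mult_nonneg_nonneg) (auto simp: G_def)
      have "?v = Yop (?c s) s x - ?u"
        unfolding e_def[abs_def] edge_op_def by (rule Y_op_diff[OF ctx sbt(1)[OF sIn] site_bound_edge_sign s])
      then have uv: "Yop (?c s) s x = ?u + ?v" by simp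
      have Sx: "inner x (S x) = ?rest + (a s * (1 + 2 / \<eta>) * (norm ?v)\<^sup>2 + a s * ?z)"
      proof -
        have "(\<Sum>t\<in>In - {s}. a t * (inner x (gram (Yop (?c t) t) x) + inner x (gram (Yop (?s t) t) x))) = ?rest"
        proof (rule sum.cong[OF refl])
          fix t assume "t \<in> In - {s}"
          then have t: "t \<in> In" by simp
          show "a t * (inner x (gram (Yop (?c t) t) x) + inner x (gram (Yop (?s t) t) x)) = a t * G t x"
            unfolding inner_gram[OF Yc[OF sbt(1)[OF t] InI[OF t]]] inner_gram[OF Yc[OF sbt(2)[OF t] InI[OF t]]] G_def ..
        qed
        then show ?thesis
          by (simp add: S_def inner_add_right inner_sum_right inner_gram[OF Yc[OF sbe s]] inner_gram[OF Yc[OF sbs s]]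
              del: scaleR_add_right)
      qed
      have Bx: "inner x (?B x) = a s * ((norm (?u + ?v))\<^sup>2 + ?z) + ?rest" unfolding form G_def uv ..
      have as0: "0 \<le> a s" by (rule a0[OF sIn])
      have dl: "c * (p * q + r * w) = (c * p) * q + c * r * w" "c * (p * q - r * w) = (c * p) * q - c * r * w"
        for c p q r w :: real by (simp_all add: algebra_simps)
      \<comment> \<open>Young's inequality with \<eta> / 2; the other half of \<eta> pays for
        replacing the coefficient by its leading term.\<close>
      have "(norm (?u + ?v))\<^sup>2 \<le> (1 + \<eta> / 2) * (norm ?u)\<^sup>2 + (1 + 2 / \<eta>) * (norm ?v)\<^sup>2"
        using norm_add_sq_bounds(1)[of "\<eta> / 2" ?u ?v] \<eta> by simp
      from mult_left_mono[OF this as0]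
      have up: "a s * (norm (?u + ?v))\<^sup>2 \<le> (a s * (1 + \<eta> / 2)) * (norm ?u)\<^sup>2 + a s * (1 + 2 / \<eta>) * (norm ?v)\<^sup>2"
        by (simp only: dl)
      have "(a s * (1 + \<eta> / 2)) * (norm ?u)\<^sup>2 \<le> ((1 + \<eta>) * ?\<kappa>) * (norm ?u)\<^sup>2"
        by (rule mult_right_mono[OF as_upper]) simp
      with up have U: "inner x (?B x) \<le> (1 + \<eta>) * ?\<kappa> * (norm ?u)\<^sup>2 + inner x (S x)"
        unfolding Bx Sx distrib_left[of "a s" "(norm (?u + ?v))\<^sup>2" ?z] by linarith
      have "(1 - \<eta>) * (norm ?u)\<^sup>2 - (1 + 2 / \<eta>) * (norm ?v)\<^sup>2 \<le> (norm (?u + ?v))\<^sup>2"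
      proof -
        have "1 / \<eta> * (norm ?v)\<^sup>2 \<le> (1 + 2 / \<eta>) * (norm ?v)\<^sup>2"
          using \<eta> by (intro mult_right_mono) (auto simp: field_simps)
        then show ?thesis using norm_add_sq_bounds(2)[OF \<eta>(1), of ?u ?v] by linarith
      qed
      from mult_left_mono[OF this as0]
      have lo: "(a s * (1 - \<eta>)) * (norm ?u)\<^sup>2 - a s * (1 + 2 / \<eta>) * (norm ?v)\<^sup>2 \<le> a s * (norm (?u + ?v))\<^sup>2"
        by (simp only: dl)
      have "((1 - \<eta>) * ?\<kappa>) * (norm ?u)\<^sup>2 \<le> ((1 - \<eta>) * a s) * (norm ?u)\<^sup>2"
        using as_lower \<eta> by (intro mult_right_mono mult_left_mono) auto
      then have le: "((1 - \<eta>) * ?\<kappa>) * (norm ?u)\<^sup>2 \<le> (a s * (1 - \<eta>)) * (norm ?u)\<^sup>2" by (simp add: mult.commute)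
      have "0 \<le> a s * ?z" using as0 by simp
      with lo le rest have "(1 - \<eta>) * ?\<kappa> * (norm ?u)\<^sup>2 - inner x (S x) \<le> inner x (?B x)"
        unfolding Bx Sx distrib_left[of "a s" "(norm (?u + ?v))\<^sup>2" ?z] by linarith
      with U show ?thesis by blast
    qed
    from A1 A2 B1 B2 B3 trace_le_mono[OF tr tr_bound] bounds show ?case by blast
  qed
qed

section \<open>Uniform estimates as the energy approaches the threshold\<close>

lemma toward_threshold_facts:
  assumes i: "i \<in> {1, 2}"
  defines "z \<equiv> threshold h (\<mu> s) i"
  shows "((\<lambda>E. E) \<longlongrightarrow> z) (toward_threshold h (\<mu> s) i)"
    and "\<forall>\<^sub>F E in toward_threshold h (\<mu> s) i. E \<noteq> z \<and> edge_sign i * bcf E s = 2 - h\<^sup>2 * \<bar>z - E\<bar>"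
proof -
  note b = band_coeff_def[OF h dec \<nu> V K]
  consider "i = 1" | "i = 2" using i by blast
  then have "((\<lambda>E. E) \<longlongrightarrow> z) (toward_threshold h (\<mu> s) i) \<and>
    (\<forall>\<^sub>F E in toward_threshold h (\<mu> s) i. E \<noteq> z \<and> edge_sign i * bcf E s = 2 - h\<^sup>2 * \<bar>z - E\<bar>)"
  proof cases
    case 1
    have "\<forall>\<^sub>F E in at_right (\<mu> s). E \<in> {\<mu> s<..<\<mu> s + 1}" by (rule eventually_at_right_real) simp
    then have "\<forall>\<^sub>F E in at_right (\<mu> s). E \<noteq> \<mu> s \<and> 2 - h\<^sup>2 * (E - \<mu> s) = 2 - h\<^sup>2 * \<bar>\<mu> s - E\<bar>"
      by (rule eventually_mono) auto
    then show ?thesis by (simp add: 1 z_def threshold_def toward_threshold_def edge_sign_def b)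
  next
    case 2
    let ?z = "4 / h\<^sup>2 + \<mu> s"
    have "\<forall>\<^sub>F E in at_left ?z. E \<in> {?z - 1<..<?z}" by (rule eventually_at_left_real) simp
    then have "\<forall>\<^sub>F E in at_left ?z. E \<noteq> ?z \<and> - (2 - h\<^sup>2 * (E - \<mu> s)) = 2 - h\<^sup>2 * \<bar>?z - E\<bar>"
    proof (rule eventually_mono)
      fix E assume "E \<in> {?z - 1<..<?z}"
      then have "E < ?z" by simp
      then have "h\<^sup>2 * \<bar>?z - E\<bar> = h\<^sup>2 * (?z - E)" by simp
      also have "\<dots> = 4 - h\<^sup>2 * (E - \<mu> s)" using h by (simp add: algebra_simps)
      finally show "E \<noteq> ?z \<and> - (2 - h\<^sup>2 * (E - \<mu> s)) = 2 - h\<^sup>2 * \<bar>?z - E\<bar>" using \<open>E < ?z\<close> by simp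
    qed
    then show ?thesis by (simp add: 2 z_def threshold_def toward_threshold_def edge_sign_def b)
  qed
  then show "((\<lambda>E. E) \<longlongrightarrow> z) (toward_threshold h (\<mu> s) i)"
    and "\<forall>\<^sub>F E in toward_threshold h (\<mu> s) i. E \<noteq> z \<and> edge_sign i * bcf E s = 2 - h\<^sup>2 * \<bar>z - E\<bar>"
    by blast+
qed

text \<open>The order of the quantifiers matters: C bounds the real part for every \<eta>, while the
  trace bound D contains a term of order 1 / \<eta>, so \<eta> has to be fixed before the energy
  moves.\<close>

lemma threshold_estimate:
  assumes nd: "nondegenerate_lower h Q d \<mu> s" "nondegenerate_upper h Q d \<mu> s" and i: "i \<in> {1, 2}"
  defines "\<rho> \<equiv> \<lambda>E. 2 / h * sqrt \<bar>threshold h (\<mu> s) i - E\<bar>"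
  obtains C where "\<And>\<eta>. 0 < \<eta> \<Longrightarrow> \<eta> < 1 \<Longrightarrow> \<exists>D. \<forall>\<^sub>F E in toward_threshold h (\<mu> s) i. 0 < \<rho> E \<and>
      selfadjoint_op (re_part (bval E)) \<and> hs_le (re_part (bval E)) C \<and>
      selfadjoint_op (im_part (bval E)) \<and> (\<exists>c. hs_le (im_part (bval E)) c) \<and>
      (\<forall>x. 0 \<le> inner x (im_part (bval E) x)) \<and>
      (\<exists>S. trace_le S D \<and>
        (\<forall>x. (1 - \<eta>) / \<rho> E * (norm (edge_op i x))\<^sup>2 - inner x (S x) \<le> inner x (im_part (bval E) x) \<and>
          inner x (im_part (bval E) x) \<le> (1 + \<eta>) / \<rho> E * (norm (edge_op i x))\<^sup>2 + inner x (S x)))"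
proof -
  let ?z = "threshold h (\<mu> s) i" and ?F = "toward_threshold h (\<mu> s) i"
  note b = band_coeff_def[OF h dec \<nu> V K] and tz = toward_threshold_facts[OF i]
  define g where "g t E = \<bar>4 - (bcf E t)\<^sup>2\<bar>" for t E
  have gz: "0 < g t ?z" if t: "t \<in> I_Q Q d - {s}" for t
  proof -
    have ne: "\<mu> t \<noteq> \<mu> s" using inj_on_eigenvalues[OF h dec] t s by (auto simp: inj_on_def)
    have "\<mu> s \<noteq> 4 / h\<^sup>2 + \<mu> t" "4 / h\<^sup>2 + \<mu> s \<noteq> \<mu> t"
      using nd t by (auto simp: nondegenerate_lower_def nondegenerate_upper_def)
    then have z: "?z \<noteq> \<mu> t" "?z \<noteq> 4 / h\<^sup>2 + \<mu> t" using ne by (auto simp: threshold_def)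
    have "4 - (bcf ?z t)\<^sup>2 = (h\<^sup>2 * (?z - \<mu> t)) * (4 - h\<^sup>2 * (?z - \<mu> t))"
      by (simp add: b power2_eq_square algebra_simps)
    moreover have "h\<^sup>2 * (?z - \<mu> t) \<noteq> 0" using h z(1) by simp
    moreover have "4 - h\<^sup>2 * (?z - \<mu> t) \<noteq> 0" using h z(2) by (auto simp: field_simps)
    ultimately show ?thesis by (simp add: g_def)
  qed
  \<comment> \<open>Half of the value at the threshold, which nondegeneracy makes positive; by
    continuity it is a lower bound nearby.\<close>
  define \<gamma> where "\<gamma> t = g t ?z / 2" for t
  obtain C where C: "\<And>E i \<delta> \<gamma> \<eta>. 0 < \<delta> \<Longrightarrow> \<delta> < 1 \<Longrightarrow> edge_sign i * bcf E s = 2 - \<delta> \<Longrightarrow>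
      (\<And>t. t \<in> I_Q Q d - {s} \<Longrightarrow> 0 < \<gamma> t \<and> \<gamma> t \<le> \<bar>4 - (bcf E t)\<^sup>2\<bar>) \<Longrightarrow>
      0 < \<eta> \<Longrightarrow> \<eta> < 1 \<Longrightarrow> 2 / sqrt (4 - \<delta>) \<le> (1 + \<eta>) / (1 + \<eta> / 2) \<Longrightarrow>
      selfadjoint_op (re_part (bval E)) \<and>
      hs_le (re_part (bval E)) (C * (\<Sum>t\<in>I_Q Q d. (h\<^sup>2 / 2 + (if t = s then 0 else h\<^sup>2 / sqrt (\<gamma> t)))\<^sup>2)) \<and>
      selfadjoint_op (im_part (bval E)) \<and> (\<exists>c. hs_le (im_part (bval E)) c) \<and>
      (\<forall>x. 0 \<le> inner x (im_part (bval E) x)) \<and>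
      (\<exists>S. trace_le S (2 * C * (\<Sum>t\<in>I_Q Q d - {s}. h\<^sup>2 / sqrt (\<gamma> t)) + h\<^sup>2 * (2 + 2 / \<eta>) * C) \<and>
        (\<forall>x. (1 - \<eta>) * (h\<^sup>2 / (2 * sqrt \<delta>)) * (norm (edge_op i x))\<^sup>2 - inner x (S x) \<le> inner x (im_part (bval E) x) \<and>
          inner x (im_part (bval E) x) \<le> (1 + \<eta>) * (h\<^sup>2 / (2 * sqrt \<delta>)) * (norm (edge_op i x))\<^sup>2 + inner x (S x)))"
    using pointwise_estimate by blast
  have ev1: "\<forall>\<^sub>F E in ?F. \<forall>t\<in>I_Q Q d - {s}. \<gamma> t < g t E"
  proof (rule eventually_ball_finite)
    show "\<forall>t\<in>I_Q Q d - {s}. \<forall>\<^sub>F E in ?F. \<gamma> t < g t E"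
    proof
      fix t assume t: "t \<in> I_Q Q d - {s}"
      have "((\<lambda>E. g t E) \<longlongrightarrow> g t ?z) ?F" unfolding g_def b by (intro tendsto_intros tz(1))
      moreover have "\<gamma> t < g t ?z" using gz[OF t] unfolding \<gamma>_def by linarith
      ultimately show "\<forall>\<^sub>F E in ?F. \<gamma> t < g t E" by (rule order_tendstoD(1))
    qed
  qed (simp add: finite_I_Q[OF h dec])
  define \<delta> where "\<delta> E = h\<^sup>2 * \<bar>?z - E\<bar>" for E
  have "((\<lambda>E. \<delta> E) \<longlongrightarrow> h\<^sup>2 * \<bar>?z - ?z\<bar>) ?F" unfolding \<delta>_def by (intro tendsto_intros tz(1))
  then have \<delta>lim: "((\<lambda>E. \<delta> E) \<longlongrightarrow> 0) ?F" by simp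
  then have ev2: "\<forall>\<^sub>F E in ?F. \<delta> E < 1" by (rule order_tendstoD(2)) simp
  \<comment> \<open>Hence 1 / \<rho> is the leading coefficient h^2 / (2 sqrt \<delta>) of the
    imaginary part.\<close>
  have \<rho>\<delta>: "\<rho> E = 2 * sqrt (\<delta> E) / h\<^sup>2" for E
    using h by (simp add: \<rho>_def \<delta>_def real_sqrt_mult power2_eq_square)
  show ?thesis
  proof (rule that, intro exI)
    fix \<eta> :: real assume \<eta>: "0 < \<eta>" "\<eta> < 1"
    have "((\<lambda>E. 2 / sqrt (4 - \<delta> E)) \<longlongrightarrow> 2 / sqrt (4 - 0)) ?F" by (intro tendsto_intros \<delta>lim) simp
    then have "\<forall>\<^sub>F E in ?F. 2 / sqrt (4 - \<delta> E) < (1 + \<eta>) / (1 + \<eta> / 2)"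
      by (rule order_tendstoD(2)) (use \<eta> in \<open>simp add: field_simps\<close>)
    with ev1 ev2 tz(2)
    show "\<forall>\<^sub>F E in ?F. 0 < \<rho> E \<and>
      selfadjoint_op (re_part (bval E)) \<and>
      hs_le (re_part (bval E)) (C * (\<Sum>t\<in>I_Q Q d. (h\<^sup>2 / 2 + (if t = s then 0 else h\<^sup>2 / sqrt (\<gamma> t)))\<^sup>2)) \<and>
      selfadjoint_op (im_part (bval E)) \<and> (\<exists>c. hs_le (im_part (bval E)) c) \<and>
      (\<forall>x. 0 \<le> inner x (im_part (bval E) x)) \<and>
      (\<exists>S. trace_le S (2 * C * (\<Sum>t\<in>I_Q Q d - {s}. h\<^sup>2 / sqrt (\<gamma> t)) + h\<^sup>2 * (2 + 2 / \<eta>) * C) \<and>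
        (\<forall>x. (1 - \<eta>) / \<rho> E * (norm (edge_op i x))\<^sup>2 - inner x (S x) \<le> inner x (im_part (bval E) x) \<and>
          inner x (im_part (bval E) x) \<le> (1 + \<eta>) / \<rho> E * (norm (edge_op i x))\<^sup>2 + inner x (S x)))"
    proof eventually_elim
      case (elim E)
      have d0: "0 < \<delta> E" using elim(3) h by (simp add: \<delta>_def)
      have r: "c / \<rho> E = c * (h\<^sup>2 / (2 * sqrt (\<delta> E)))" for c by (simp add: \<rho>\<delta>)
      have "0 < \<rho> E" using d0 h by (simp add: \<rho>\<delta>)
      moreover note C[OF d0 elim(2), of i E \<gamma> \<eta>]
      moreover have "0 < \<gamma> t \<and> \<gamma> t \<le> \<bar>4 - (bcf E t)\<^sup>2\<bar>" if "t \<in> I_Q Q d - {s}" for t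
        using gz[OF that] elim(1) that by (auto simp: \<gamma>_def g_def less_imp_le)
      moreover have "edge_sign i * bcf E s = 2 - \<delta> E" using elim(3) by (simp add: \<delta>_def)
      ultimately show ?case unfolding r using \<eta> elim(4) by (meson less_imp_le)
    qed
  qed
qed

end

section \<open>Integrals of counting functions\<close>

text \<open>The substitution t = sqrt(u / (1 - u)) gives half of Beta(x, 1 - x) with x = (1 +
  \<alpha>) / 2. The reflection formula evaluates the latter as \<pi> / sin(\<pi> x) = \<pi> /
  cos(\<pi> \<alpha> / 2).\<close>

lemma stieltjes_weight:
  fixes \<alpha> :: real
  assumes \<alpha>: "0 \<le> \<alpha>" "\<alpha> < 1"
  shows "set_integrable lborel {0<..} (\<lambda>t. t powr \<alpha> / (1 + t\<^sup>2))"
    and "(LINT t:{0<..}|lborel. t powr \<alpha> / (1 + t\<^sup>2)) = pi / (2 * cos (pi * \<alpha> / 2))"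
proof -
  define x where "x = (1 + \<alpha>) / 2"
  have x: "0 < x" "0 < 1 - x" using \<alpha> by (auto simp: x_def)
  define b where "b u = u powr (x - 1) * (1 - u) powr ((1 - x) - 1)" for u
  have bI: "(b has_integral Beta x (1 - x)) {0..1}"
    unfolding b_def by (rule has_integral_Beta_real[OF x])
  have bm: "b \<in> borel_measurable borel" unfolding b_def by measurable
  have b_nonneg: "0 \<le> b u" if "u \<in> {0..1}" for u by (simp add: b_def)
  have "set_integrable lebesgue {0..1} b"
    using nonnegative_absolutely_integrable_1[OF has_integral_integrable[OF bI] b_nonneg] by simp
  then have sb: "set_integrable lborel {0..1} b"
    unfolding set_integrable_def by (subst (asm) integrable_completion) (use bm in measurable)
  have "(LINT u:{0..1}|lborel. b u) = Beta x (1 - x)"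
    using set_borel_integral_eq_integral(2)[OF sb] integral_unique[OF bI] by simp
  then have LB: "(LBINT u=ereal 0..ereal 1. b u) = Beta x (1 - x)"
    by (simp add: interval_integral_Icc del: zero_ereal_def)
  have beta: "Beta x (1 - x) = pi / cos (pi * \<alpha> / 2)"
  proof -
    have "complex_of_real (Beta x (1 - x)) = Gamma (complex_of_real x) * Gamma (1 - complex_of_real x)"
      unfolding Beta_def by (simp flip: Gamma_complex_of_real)
    also have "\<dots> = complex_of_real (pi / sin (pi * x))"
      unfolding Gamma_reflection_complex by (simp flip: sin_of_real)
    finally have "Beta x (1 - x) = pi / sin (pi * x)" by (simp only: of_real_eq_iff)
    moreover have "pi * x = pi / 2 + pi * \<alpha> / 2" by (simp add: x_def field_simps)
    ultimately show ?thesis by (simp add: sin_add)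
  qed
  define g where "g u = sqrt (u / (1 - u))" for u :: real
  define g' where "g' u = inverse (sqrt (u / (1 - u))) / 2 * (1 / (1 - u)\<^sup>2)" for u :: real
  define f where "f t = t powr \<alpha> / (1 + t\<^sup>2)" for t :: real
  have fg: "f (g u) * g' u = b u / 2" if u: "0 < u" "u < 1" for u
  proof -
    define w q where "w = 1 - u" and "q = u / w"
    have w: "0 < w" "0 < q" using u by (simp_all add: w_def q_def)
    have uq: "u / (1 - u) = q" "1 - u = w" by (simp_all add: w_def q_def)
    have "1 + q = (w + u) / w" unfolding q_def add_divide_distrib using w(1) by simp
    then have "1 + q = 1 / w" by (simp add: w_def)
    moreover have "(g u)\<^sup>2 = q" "g u = q powr (1 / 2)"
      unfolding g_def uq(1) using w(2) by (simp_all add: powr_half_sqrt)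
    ultimately have "f (g u) = q powr (\<alpha> / 2) * w" by (simp add: f_def powr_powr)
    moreover have "g' u = q powr (- 1 / 2) / 2 * w powr (- 2)"
      unfolding g'_def uq(1) unfolding uq(2) using w by (simp add: powr_minus powr_half_sqrt powr_numeral inverse_eq_divide)
    ultimately have "f (g u) * g' u = q powr (\<alpha> / 2) * w * (q powr (- 1 / 2) / 2 * w powr (- 2))" by simp
    also have "\<dots> = (u powr (\<alpha> / 2) * u powr (- 1 / 2)) *
        (w powr (- \<alpha> / 2) * w powr (1 / 2) * w powr 1 * w powr (- 2)) / 2"
    proof -
      have "q powr c = u powr c * w powr (- c)" for c
        using u(1) w(1) unfolding q_def by (simp add: powr_divide powr_minus_divide)
      from this[of "\<alpha> / 2"] this[of "- 1 / 2"] show ?thesis using w(1) by simp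
    qed
    also have "\<dots> = u powr (x - 1) * w powr ((1 - x) - 1) / 2"
    proof -
      have e: "\<alpha> / 2 + - 1 / 2 = x - 1" "- \<alpha> / 2 + 1 / 2 + 1 + - 2 = (1 - x) - 1" by (simp_all add: x_def field_simps)
      show ?thesis unfolding powr_add[symmetric] e ..
    qed
    finally show ?thesis by (simp only: b_def w_def)
  qed
  have sub: "set_integrable lborel (einterval (ereal 0) \<infinity>) f"
    "(LBINT t=ereal 0..\<infinity>. f t) = (LBINT u=ereal 0..ereal 1. f (g u) * g' u)"
  proof (atomize (full), rule conjI)
    have int: "set_integrable lborel (einterval (ereal 0) (ereal 1)) (\<lambda>u. f (g u) * g' u)"
    proof -
      have "set_integrable lborel {0<..<1} b" by (rule set_integrable_subset[OF sb]) auto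
      then have "set_integrable lborel {0<..<1} (\<lambda>u. b u / 2)" by (rule set_integrable_divide)
      then show ?thesis
        by (rule set_integrable_cong[THEN iffD1, rotated -1]) (auto simp: fg einterval_def)
    qed
    have dg: "DERIV g u :> g' u" if "ereal 0 < ereal u" "ereal u < ereal 1" for u
      unfolding g_def g'_def using that
      by (auto intro!: derivative_eq_intros simp: power2_eq_square field_simps)
    have cf: "isCont f (g u)" if "ereal 0 < ereal u" "ereal u < ereal 1" for u
    proof -
      have "g u > 0" using that by (simp add: g_def)
      moreover have "1 + (g u)\<^sup>2 \<noteq> 0" using zero_le_power2[of "g u"] by linarith
      ultimately show ?thesis unfolding f_def by (auto intro!: continuous_intros)
    qed
    have cg': "isCont g' u" if "ereal 0 < ereal u" "ereal u < ereal 1" for u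
      unfolding g'_def using that by (auto intro!: continuous_intros)
    have A: "((ereal \<circ> g \<circ> real_of_ereal) \<longlongrightarrow> ereal 0) (at_right (ereal 0))"
    proof -
      have "(g \<longlongrightarrow> 0) (at_right 0)" unfolding g_def by real_asymp
      then show ?thesis unfolding ereal_tendsto_simps1 unfolding o_def by (rule tendsto_ereal)
    qed
    have B: "((ereal \<circ> g \<circ> real_of_ereal) \<longlongrightarrow> \<infinity>) (at_left (ereal 1))"
    proof -
      have "filterlim g at_top (at_left 1)" unfolding g_def by real_asymp
      then show ?thesis unfolding ereal_tendsto_simps1 unfolding o_def by (simp add: tendsto_PInfty_eq_at_top)
    qed
    note S = interval_integral_substitution_nonneg[of "ereal 0" "ereal 1" g g' f "ereal 0" \<infinity>, OF _ dg cf cg' _ _ A B int]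
    show "set_integrable lborel (einterval (ereal 0) \<infinity>) f"
      by (rule S(1)) (auto simp: f_def g'_def)
    show "(LBINT t=ereal 0..\<infinity>. f t) = (LBINT u=ereal 0..ereal 1. f (g u) * g' u)"
      by (rule S(2)) (auto simp: f_def g'_def)
  qed
  have "(LBINT u=ereal 0..ereal 1. f (g u) * g' u) = (LBINT u=ereal 0..ereal 1. b u / 2)"
    by (rule interval_integral_cong) (auto simp: fg einterval_def)
  also have "\<dots> = pi / (2 * cos (pi * \<alpha> / 2))"
    using LB beta by (simp add: interval_lebesgue_integral_divide del: zero_ereal_def)
  finally have "(LBINT t=ereal 0..\<infinity>. f t) = pi / (2 * cos (pi * \<alpha> / 2))" using sub(2) by simp
  moreover have e: "einterval (ereal 0) \<infinity> = {0<..}" by (auto simp: einterval_def)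
  ultimately show "(LINT t:{0<..}|lborel. t powr \<alpha> / (1 + t\<^sup>2)) = pi / (2 * cos (pi * \<alpha> / 2))"
    by (simp add: interval_lebesgue_integral_def f_def[abs_def] del: zero_ereal_def)
  show "set_integrable lborel {0<..} (\<lambda>t. t powr \<alpha> / (1 + t\<^sup>2))"
    using sub(1) unfolding e f_def[abs_def] .
qed

lemma integrable_inverse_1_plus_sq: "integrable lborel (\<lambda>t :: real. 1 / (1 + t\<^sup>2))"
proof -
  define k where "k = (\<lambda>t :: real. indicator {0<..} t * (1 / (1 + t\<^sup>2)))"
  have "integrable lborel (\<lambda>t :: real. indicator {0<..} t *\<^sub>R (t powr 0 / (1 + t\<^sup>2)))"
    using stieltjes_weight(1)[of 0] by (simp add: set_integrable_def)
  then have k: "integrable lborel k"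
    by (rule Bochner_Integration.integrable_cong[THEN iffD1, rotated -1]) (auto simp: k_def indicator_def)
  have "integrable lborel (\<lambda>t. k (0 + (- 1) * t))" by (rule lborel_integrable_real_affine[OF k]) simp
  then have "integrable lborel (\<lambda>t. k t + k (- t))" using k by simp
  then show ?thesis
  proof (rule integrable_cong_AE_imp)
    show "AE t in lborel. k t + k (- t) = 1 / (1 + t\<^sup>2)"
      using AE_lborel_singleton[of "0 :: real"] by eventually_elim (auto simp: k_def indicator_def)
  qed measurable
qed

lemma nn_integral_tail_le:
  fixes a :: real
  assumes "0 < a"
  shows "(\<integral>\<^sup>+t. ennreal (indicator {a<..} t / (1 + t\<^sup>2)) \<partial>lborel) \<le> ennreal (1 / a)"
proof -
  have "(\<integral>\<^sup>+t. ennreal (indicator {a<..} t / (1 + t\<^sup>2)) \<partial>lborel) \<le>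
      (\<integral>\<^sup>+t. ennreal (1 / t\<^sup>2) * indicator {a..} t \<partial>lborel)"
  proof (rule nn_integral_mono)
    fix t :: real
    show "ennreal (indicator {a<..} t / (1 + t\<^sup>2)) \<le> ennreal (1 / t\<^sup>2) * indicator {a..} t"
      using assms by (auto simp: indicator_def intro!: ennreal_leI divide_left_mono mult_pos_pos add_pos_nonneg)
  qed
  also have "\<dots> = ennreal (0 - (- (1 / a)))"
  proof (rule nn_integral_FTC_atLeast)
    show "DERIV (\<lambda>t. - (1 / t)) t :> 1 / t\<^sup>2" if "a \<le> t" for t
      using that assms by (auto intro!: derivative_eq_intros simp: power2_eq_square)
    show "((\<lambda>t :: real. - (1 / t)) \<longlongrightarrow> 0) at_top" by real_asymp
  qed auto
  finally show ?thesis by simp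
qed

text \<open>With the value 0 for t \<le> 0 the function is increasing on the whole line, hence
  measurable.\<close>

lemma measurable_antimono_rescale:
  fixes n :: "real \<Rightarrow> real"
  assumes anti: "\<And>r r'. 0 < r \<Longrightarrow> r \<le> r' \<Longrightarrow> n r' \<le> n r" and nonneg: "\<And>r. 0 < r \<Longrightarrow> 0 \<le> n r" and a: "0 < a"
  shows "(\<lambda>t. if 0 < t then n (a / t) else 0) \<in> borel_measurable borel"
proof (rule borel_measurable_mono, rule monoI)
  fix t u :: real assume "t \<le> u"
  then show "(if 0 < t then n (a / t) else 0) \<le> (if 0 < u then n (a / u) else 0)"
    using anti[of "a / u" "a / t"] nonneg[of "a / u"] a by (auto simp: frac_le)
qed

text \<open>If \<open>\<kappa>\<^sub>j\<close> are the eigenvalues of \<open>S\<close>, then \<open>N_plus (\<epsilon> / t) S\<close> counts the \<open>j\<close> with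
  \<open>t > \<epsilon> / \<kappa>\<^sub>j\<close>, and the half-line beyond \<open>\<epsilon> / \<kappa>\<^sub>j\<close> has measure at most \<open>\<kappa>\<^sub>j / \<epsilon>\<close>.\<close>

lemma trace_counting_integral:
  assumes S: "trace_le S C" and \<epsilon>: "0 < \<epsilon>"
  defines "w \<equiv> \<lambda>t. (if 0 < t then real (N_plus (\<epsilon> / t) S) else 0) / (1 + t\<^sup>2)"
  shows "integrable lborel w" and "(LINT t|lborel. w t) \<le> C / \<epsilon>"
proof -
  note SD = trace_leD[OF S]
  obtain c where c: "hs_le S c" using SD(2) by blast
  have anti: "real (N_plus r' S) \<le> real (N_plus r S)" if "0 < r" "r \<le> r'" for r r'
  proof -
    have "codim_le (\<lambda>x. inner x (S x) - r * (norm x)\<^sup>2) (N_plus r S)"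
      using counting_le_iff(1)[OF SD(1) c that(1)] by blast
    then have "codim_le (\<lambda>x. inner x (S x) - r' * (norm x)\<^sup>2) (N_plus r S)"
      by (rule codim_le_mono) (use that in \<open>auto intro: mult_right_mono\<close>)
    then show ?thesis using counting_le_iff(1)[OF SD(1) c, of r'] that by simp
  qed
  have wm: "w \<in> borel_measurable lborel"
    using measurable_antimono_rescale[of "\<lambda>r. real (N_plus r S)", OF anti _ \<epsilon>] unfolding w_def by simp
  have w0: "0 \<le> w t" for t by (simp add: w_def)
  \<comment> \<open>For t up to m only the finitely many eigenvalues above \<epsilon> / T are
    counted, so the integral splits into finitely many tails; monotone convergence in m then removes
    the cutoff.\<close>
  have part: "(\<integral>\<^sup>+t. ennreal (w t * indicator {..real m} t) \<partial>lborel) \<le> ennreal (C / \<epsilon>)" for m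
  proof -
    \<comment> \<open>Adding one keeps \<open>T\<close> positive when m = 0.\<close>
    define T where "T = real m + 1"
    have T: "0 < T" by (simp add: T_def)
    obtain E where E: "finite E" "orthonormal E"
      "\<And>e. e \<in> E \<Longrightarrow> \<exists>\<kappa>>\<epsilon> / T. S e = complex_of_real \<kappa> *\<^sub>C e"
      "(\<Union>\<kappa>\<in>{\<epsilon> / T<..}. eigspace S \<kappa>) \<subseteq> cvec.span E"
      "\<And>x. (\<And>e. e \<in> E \<Longrightarrow> cinner e x = 0) \<Longrightarrow> inner x (S x) \<le> \<epsilon> / T * (norm x)\<^sup>2"
      using hs_spectral_above[OF SD(1) c divide_pos_pos[OF \<epsilon> T]] by metis
    have "\<forall>e\<in>E. \<exists>\<kappa>. \<epsilon> / T < \<kappa> \<and> S e = complex_of_real \<kappa> *\<^sub>C e" using E(3) by blast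
    from bchoice[OF this] obtain \<kappa> where
      \<kappa>: "\<And>e. e \<in> E \<Longrightarrow> \<epsilon> / T < \<kappa> e" "\<And>e. e \<in> E \<Longrightarrow> S e = complex_of_real (\<kappa> e) *\<^sub>C e" by blast
    have "0 < \<epsilon> / T" using \<epsilon> T by simp
    then have \<kappa>0: "0 < \<kappa> e" if "e \<in> E" for e using \<kappa>(1)[OF that] by linarith
    have count: "N_plus r S = card {e\<in>E. r < \<kappa> e}" if r: "\<epsilon> / T \<le> r" for r
    proof -
      let ?E = "{e\<in>E. r < \<kappa> e}"
      have fin: "finite ?E" "orthonormal ?E" using E(1,2) orthonormal_subset[of E ?E] by auto
      have "v \<in> cvec.span ?E" if k: "r < k" "v \<in> eigspace S k" for k v
      proof -
        have v: "S v = complex_of_real k *\<^sub>C v" using k(2) by (simp add: eigspace_def)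
        have "v \<in> cvec.span E" using k E(4) r by force
        then have "v = (\<Sum>e\<in>E. cinner e v *\<^sub>C e)"
          using proj_onto_span[OF E(2,1)] by (simp add: proj_onto_def)
        also have "\<dots> = (\<Sum>e\<in>?E. cinner e v *\<^sub>C e)"
        proof (rule sum.mono_neutral_right[OF E(1)])
          show "\<forall>e\<in>E - ?E. cinner e v *\<^sub>C e = 0"
          proof
            fix e assume e: "e \<in> E - ?E"
            then have "\<kappa> e \<noteq> k" using k(1) by auto
            then have "cinner e v = 0" using eigenvectors_orthogonal[OF SD(1) \<kappa>(2) v] e by blast
            then show "cinner e v *\<^sub>C e = 0" by simp
          qed
        qed auto
        also have "\<dots> \<in> cvec.span ?E" by (intro cvec.span_sum cvec.span_scale cvec.span_base)
        finally show ?thesis .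
      qed
      then have "spectral_proj_above r S = proj_onto ?E"
        by (intro spectral_proj_above_eq[OF fin]) (use \<kappa> in auto)
      then show ?thesis using op_rank_proj_onto[OF fin] by (simp add: N_plus_def)
    qed
    have "(\<integral>\<^sup>+t. ennreal (w t * indicator {..real m} t) \<partial>lborel) \<le>
        (\<integral>\<^sup>+t. (\<Sum>e\<in>E. ennreal (indicator {\<epsilon> / \<kappa> e<..} t / (1 + t\<^sup>2))) \<partial>lborel)"
    proof (rule nn_integral_mono)
      fix t :: real
      have "w t * indicator {..real m} t \<le> (\<Sum>e\<in>E. indicator {\<epsilon> / \<kappa> e<..} t / (1 + t\<^sup>2))"
      proof (cases "0 < t \<and> t \<le> real m")
        case True
        then have "N_plus (\<epsilon> / t) S = card {e\<in>E. \<epsilon> / t < \<kappa> e}"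
          using \<epsilon> by (intro count) (auto simp: T_def intro!: divide_left_mono)
        moreover have "\<epsilon> / t < \<kappa> e \<longleftrightarrow> t \<in> {\<epsilon> / \<kappa> e<..}" if "e \<in> E" for e
          using True \<kappa>0[OF that] by (auto simp: field_simps)
        ultimately have "real (N_plus (\<epsilon> / t) S) = (\<Sum>e\<in>E. indicator {\<epsilon> / \<kappa> e<..} t)"
          using E(1) by (simp add: indicator_def sum.If_cases Int_def cong: conj_cong)
        then show ?thesis using True by (simp add: w_def sum_divide_distrib)
      next
        case False
        then show ?thesis by (auto simp: w_def indicator_def intro!: sum_nonneg)
      qed
      then show "ennreal (w t * indicator {..real m} t) \<le> (\<Sum>e\<in>E. ennreal (indicator {\<epsilon> / \<kappa> e<..} t / (1 + t\<^sup>2)))"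
        by (subst sum_ennreal) (auto intro: ennreal_leI)
    qed
    also have "\<dots> = (\<Sum>e\<in>E. \<integral>\<^sup>+t. ennreal (indicator {\<epsilon> / \<kappa> e<..} t / (1 + t\<^sup>2)) \<partial>lborel)"
      by (rule nn_integral_sum) measurable
    also have "\<dots> \<le> (\<Sum>e\<in>E. ennreal (\<kappa> e / \<epsilon>))"
    proof (rule sum_mono)
      fix e assume "e \<in> E"
      then show "(\<integral>\<^sup>+t. ennreal (indicator {\<epsilon> / \<kappa> e<..} t / (1 + t\<^sup>2)) \<partial>lborel) \<le> ennreal (\<kappa> e / \<epsilon>)"
        using nn_integral_tail_le[of "\<epsilon> / \<kappa> e"] \<kappa>0 \<epsilon> by simp
    qed
    also have "\<dots> = ennreal (\<Sum>e\<in>E. \<kappa> e / \<epsilon>)" using \<kappa>0 \<epsilon> by (intro sum_ennreal) (simp add: less_imp_le)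
    also have "(\<Sum>e\<in>E. \<kappa> e / \<epsilon>) \<le> C / \<epsilon>"
    proof -
      have "inner e (S e) = \<kappa> e" if "e \<in> E" for e
      proof -
        have "inner e e = 1" using E(2) that by (simp add: orthonormal_def dot_square_norm)
        then show ?thesis using \<kappa>(2)[OF that] by (simp flip: scaleR_cscale)
      qed
      then have "(\<Sum>e\<in>E. \<kappa> e) \<le> C" using SD(4)[OF E(1,2)] by simp
      then show ?thesis using \<epsilon> by (simp add: divide_right_mono flip: sum_divide_distrib)
    qed
    finally show ?thesis by (simp add: ennreal_leI)
  qed
  have "(\<integral>\<^sup>+t. ennreal (w t) \<partial>lborel) = (SUP m. \<integral>\<^sup>+t. ennreal (w t * indicator {..real m} t) \<partial>lborel)"
  proof -
    have "ennreal (w t) = (SUP m. ennreal (w t * indicator {..real m} t))" for t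
    proof (rule antisym)
      obtain m where "t \<le> real m" using real_arch_simple by blast
      then have "ennreal (w t) = ennreal (w t * indicator {..real m} t)" by simp
      then show "ennreal (w t) \<le> (SUP m. ennreal (w t * indicator {..real m} t))"
        by (intro SUP_upper2[of m]) simp_all
      show "(SUP m. ennreal (w t * indicator {..real m} t)) \<le> ennreal (w t)"
        by (rule SUP_least, rule ennreal_leI) (use w0 in \<open>auto simp: indicator_def\<close>)
    qed
    then have "(\<integral>\<^sup>+t. ennreal (w t) \<partial>lborel) = (\<integral>\<^sup>+t. (SUP m. ennreal (w t * indicator {..real m} t)) \<partial>lborel)"
      by simp
    also have "\<dots> = (SUP m. \<integral>\<^sup>+t. ennreal (w t * indicator {..real m} t) \<partial>lborel)"
    proof (rule nn_integral_monotone_convergence_SUP)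
      show "incseq (\<lambda>m t. ennreal (w t * indicator {..real m} t))"
        by (intro incseq_SucI le_funI ennreal_leI) (use w0 in \<open>auto simp: indicator_def\<close>)
    qed (use wm in measurable)
    finally show ?thesis .
  qed
  then have le: "(\<integral>\<^sup>+t. ennreal (w t) \<partial>lborel) \<le> ennreal (C / \<epsilon>)" using part by (simp add: SUP_le_iff)
  show int: "integrable lborel w"
  proof (rule integrableI_bounded)
    show "(\<integral>\<^sup>+t. ennreal (norm (w t)) \<partial>lborel) < \<infinity>" using le w0 by (simp add: order_le_less_trans)
  qed (rule wm)
  show "(LINT t|lborel. w t) \<le> C / \<epsilon>"
    using le nn_integral_eq_integral[OF int] w0 trace_le_nonneg[OF S] \<epsilon> by simp
qed

text \<open>The level 1 is shared out: \<eta> goes to A and \<eta> to t S, which leaves 1 - 2 \<eta>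
  for the leading form; the lower bound needs 1 + 2 \<eta> instead. The count of A above \<eta> is
  at most C / \<eta>^2, and the counts of S integrate to at most D / \<eta>, which gives L.\<close>

lemma counting_integral_bounds:
  fixes A B S :: "'a :: complex_hilbert \<Rightarrow> 'a" and Y :: "'a \<Rightarrow> 'b :: complex_hilbert" and n :: "real \<Rightarrow> nat"
  assumes A: "selfadjoint_op A" "hs_le A C"
    and B: "selfadjoint_op B" "hs_le B b" "\<And>x. 0 \<le> inner x (B x)"
    and S: "trace_le S D" and \<eta>: "0 < \<eta>" "\<eta> < 1 / 2" and \<rho>: "0 < \<rho>"
    and n: "\<And>r k. 0 < r \<Longrightarrow> n r \<le> k \<longleftrightarrow> codim_le (\<lambda>x. (norm (Y x))\<^sup>2 - r * (norm x)\<^sup>2) k"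
    and lower: "\<And>x. (1 - \<eta>) / \<rho> * (norm (Y x))\<^sup>2 - inner x (S x) \<le> inner x (B x)"
    and upper: "\<And>x. inner x (B x) \<le> (1 + \<eta>) / \<rho> * (norm (Y x))\<^sup>2 + inner x (S x)"
  defines "G \<equiv> \<lambda>a t. (if 0 < t then real (n (a / t)) else 0) / (1 + t\<^sup>2)"
    and "J \<equiv> LINT t|lborel. real (N_plus 1 (\<lambda>x. A x + t *\<^sub>R B x)) / (1 + t\<^sup>2)"
    and "L \<equiv> C / \<eta>\<^sup>2 * (LINT t|lborel. 1 / (1 + t\<^sup>2)) + D / \<eta>"
  assumes int: "integrable lborel (G ((1 - 2 * \<eta>) / (1 + \<eta>) * \<rho>))"
  shows "(LINT t|lborel. G ((1 + 2 * \<eta>) / (1 - \<eta>) * \<rho>) t) - L \<le> J"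
    and "J \<le> (LINT t|lborel. G ((1 - 2 * \<eta>) / (1 + \<eta>) * \<rho>) t) + L"
proof -
  note AD = selfadjoint_opD[OF A(1)] and BD = selfadjoint_opD[OF B(1)] and SD = trace_leD[OF S]
  obtain c where c: "hs_le S c" using SD(2) by blast
  define c1 c2 where "c1 = (1 - 2 * \<eta>) / (1 + \<eta>) * \<rho>" and "c2 = (1 + 2 * \<eta>) / (1 - \<eta>) * \<rho>"
  have c12: "0 < c1" "0 < c2" using \<eta> \<rho> by (auto simp: c1_def c2_def)
  define f where "f t = N_plus 1 (\<lambda>x. A x + t *\<^sub>R B x)" for t
  have f: "f t \<le> k \<longleftrightarrow> codim_le (\<lambda>x. inner x (A x) + t * inner x (B x) - (norm x)\<^sup>2) k" for t k
  proof -
    have "selfadjoint_op (\<lambda>x. A x + t *\<^sub>R B x)"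
      using bounded_clinear_plus[OF AD(1) bounded_clinear_scaledR[OF BD(1)]] AD(2) BD(2)
      by (simp add: selfadjoint_op_def cinner_add_left cinner_add_right cinner_scaleR_left cinner_scaleR_right)
    moreover have "hs_le (\<lambda>x. t *\<^sub>R B x) (\<bar>t\<bar>\<^sup>2 * b)" by (rule hs_le_dominated[OF B(2)]) simp
    from hs_le_add[OF A(2) this] have "hs_le (\<lambda>x. A x + t *\<^sub>R B x) (2 * C + 2 * (\<bar>t\<bar>\<^sup>2 * b))" .
    ultimately show ?thesis unfolding f_def
      using counting_le_iff(1)[of "\<lambda>x. A x + t *\<^sub>R B x" _ 1 k] by (simp add: inner_add_right)
  qed
  have mono_f: "f t \<le> f u" if "t \<le> u" for t u
    unfolding f
    by (rule codim_le_mono[OF f[THEN iffD1, OF order_refl, of u]]) (use that B(3) in \<open>auto intro: mult_right_mono\<close>)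
  have anti: "n r' \<le> n r" if "0 < r" "r \<le> r'" for r r'
    by (subst n, use that in simp, rule codim_le_mono[OF n[THEN iffD1, OF that(1) order_refl]])
       (use that in \<open>auto intro: mult_right_mono\<close>)
  define kp km where "kp = N_plus \<eta> A" and "km = N_plus \<eta> (\<lambda>x. - A x)"
  have mA: "selfadjoint_op (\<lambda>x. - A x)" "hs_le (\<lambda>x. - A x) C"
    using bounded_clinear_scaledR[OF AD(1), of "- 1"] AD(2) A(2)
    by (simp_all add: selfadjoint_op_def hs_le_def cinner_minus_left cinner_minus_right)
  have kp: "codim_le (\<lambda>x. inner x (A x) - \<eta> * (norm x)\<^sup>2) kp"
    unfolding kp_def counting_le_iff(1)[OF A \<eta>(1), symmetric] ..
  have km: "codim_le (\<lambda>x. - inner x (A x) - \<eta> * (norm x)\<^sup>2) km"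
    using counting_le_iff(1)[OF mA \<eta>(1), of km] unfolding km_def by simp
  have k_le: "real kp \<le> C / \<eta>\<^sup>2" "real km \<le> C / \<eta>\<^sup>2"
    unfolding kp_def km_def by (rule N_plus_hs_le[OF A \<eta>(1)], rule N_plus_hs_le[OF mA \<eta>(1)])
  define N1 where "N1 t = (if 0 < t then real (N_plus (\<eta> / t) S) else 0)" for t
  have Sk: "codim_le (\<lambda>x. t * (inner x (S x) - \<eta> / t * (norm x)\<^sup>2)) (N_plus (\<eta> / t) S)" if "0 < t" for t
    by (rule codim_le_scale) (use counting_le_iff(1)[OF SD(1) c, of "\<eta> / t"] \<eta> that in auto)
  have dl: "a * (y - b * x) = a * y - (a * b) * x" for a b x y :: real by (simp add: algebra_simps)
  have up: "real (f t) \<le> (if 0 < t then real (n (c1 / t)) else 0) + N1 t + C / \<eta>\<^sup>2" for t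
  proof (cases "0 < t")
    case True
    have "0 < c1 / t" using c12 True by simp
    then have "codim_le (\<lambda>x. (norm (Y x))\<^sup>2 - c1 / t * (norm x)\<^sup>2) (n (c1 / t))" using n by blast
    then have "codim_le (\<lambda>x. t * (1 + \<eta>) / \<rho> * ((norm (Y x))\<^sup>2 - c1 / t * (norm x)\<^sup>2)) (n (c1 / t))"
      by (rule codim_le_scale) (use True \<eta> \<rho> in simp)
    from codim_le_add[OF codim_le_add[OF kp Sk[OF True]] this]
    have "f t \<le> kp + N_plus (\<eta> / t) S + n (c1 / t)"
      unfolding f
    proof (rule codim_le_mono)
      fix x
      have "t * inner x (B x) \<le> t * ((1 + \<eta>) / \<rho> * (norm (Y x))\<^sup>2) + t * inner x (S x)"
        unfolding distrib_left[of t, symmetric] using upper True by (intro mult_left_mono) auto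
      moreover have e: "t * (1 + \<eta>) / \<rho> * (c1 / t) = 1 - 2 * \<eta>" using True \<eta> \<rho> by (simp add: c1_def)
      moreover have "t * (1 + \<eta>) / \<rho> * ((norm (Y x))\<^sup>2 - c1 / t * (norm x)\<^sup>2) =
          t * ((1 + \<eta>) / \<rho> * (norm (Y x))\<^sup>2) - (1 - 2 * \<eta>) * (norm x)\<^sup>2"
        unfolding dl unfolding e by simp
      moreover have "t * (inner x (S x) - \<eta> / t * (norm x)\<^sup>2) = t * inner x (S x) - \<eta> * (norm x)\<^sup>2"
        unfolding dl using True by simp
      moreover have "(1 - 2 * \<eta>) * (norm x)\<^sup>2 = (norm x)\<^sup>2 - 2 * (\<eta> * (norm x)\<^sup>2)"
        by (simp add: algebra_simps)
      ultimately show "inner x (A x) + t * inner x (B x) - (norm x)\<^sup>2 \<le>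
          inner x (A x) - \<eta> * (norm x)\<^sup>2 + t * (inner x (S x) - \<eta> / t * (norm x)\<^sup>2) +
          t * (1 + \<eta>) / \<rho> * ((norm (Y x))\<^sup>2 - c1 / t * (norm x)\<^sup>2)"
        by linarith
    qed simp
    then have "real (f t) \<le> real (kp + N_plus (\<eta> / t) S + n (c1 / t))" by (rule of_nat_mono)
    then show ?thesis using True k_le(1) by (simp add: N1_def)
  next
    case False
    \<comment> \<open>For t \<le> 0 the term t B only lowers the form, and \<eta> < 1, so the count
      of A alone suffices.\<close>
    have "f t \<le> kp"
      unfolding f
    proof (rule codim_le_mono[OF kp])
      fix x
      have "t * inner x (B x) \<le> 0" using False B(3) by (simp add: mult_nonpos_nonneg)
      moreover have "\<eta> * (norm x)\<^sup>2 \<le> 1 * (norm x)\<^sup>2" using \<eta> by (intro mult_right_mono) auto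
      ultimately show "inner x (A x) + t * inner x (B x) - (norm x)\<^sup>2 \<le> inner x (A x) - \<eta> * (norm x)\<^sup>2" by simp
    qed simp
    then have "real (f t) \<le> real kp" by simp
    then show ?thesis using False k_le(1) by (simp add: N1_def)
  qed
  have lo: "(if 0 < t then real (n (c2 / t)) else 0) \<le> real (f t) + N1 t + C / \<eta>\<^sup>2" for t
  proof (cases "0 < t")
    case True
    have e: "t * (1 - \<eta>) / \<rho> * (c2 / t) = 1 + 2 * \<eta>" using True \<eta> \<rho> by (simp add: c2_def)
    \<comment> \<open>The lower bound is read backwards: the leading form is bounded by that of A +
      t B, of -A and of t S, whose levels 1, \<eta> and \<eta> add up to 1 + 2 \<eta>.\<close>
    have "codim_le (\<lambda>x. t * (1 - \<eta>) / \<rho> * ((norm (Y x))\<^sup>2 - c2 / t * (norm x)\<^sup>2)) (f t + km + N_plus (\<eta> / t) S)"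
    proof (rule codim_le_mono[OF codim_le_add[OF codim_le_add[OF f[THEN iffD1, OF order_refl] km] Sk[OF True]]])
      fix x
      have "t * ((1 - \<eta>) / \<rho> * (norm (Y x))\<^sup>2) - t * inner x (S x) \<le> t * inner x (B x)"
        unfolding right_diff_distrib[of t, symmetric] using lower True by (intro mult_left_mono) auto
      moreover have "t * (1 - \<eta>) / \<rho> * ((norm (Y x))\<^sup>2 - c2 / t * (norm x)\<^sup>2) =
          t * ((1 - \<eta>) / \<rho> * (norm (Y x))\<^sup>2) - (1 + 2 * \<eta>) * (norm x)\<^sup>2"
        unfolding dl unfolding e by simp
      moreover have "t * (inner x (S x) - \<eta> / t * (norm x)\<^sup>2) = t * inner x (S x) - \<eta> * (norm x)\<^sup>2"
        unfolding dl using True by simp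
      moreover have "(1 + 2 * \<eta>) * (norm x)\<^sup>2 = (norm x)\<^sup>2 + 2 * (\<eta> * (norm x)\<^sup>2)"
        by (simp add: algebra_simps)
      ultimately show "t * (1 - \<eta>) / \<rho> * ((norm (Y x))\<^sup>2 - c2 / t * (norm x)\<^sup>2) \<le>
          inner x (A x) + t * inner x (B x) - (norm x)\<^sup>2 + (- inner x (A x) - \<eta> * (norm x)\<^sup>2) +
          t * (inner x (S x) - \<eta> / t * (norm x)\<^sup>2)"
        by linarith
    qed simp
    then have "codim_le (\<lambda>x. \<rho> / (t * (1 - \<eta>)) * (t * (1 - \<eta>) / \<rho> * ((norm (Y x))\<^sup>2 - c2 / t * (norm x)\<^sup>2)))
        (f t + km + N_plus (\<eta> / t) S)"
      by (rule codim_le_scale) (use True \<eta> \<rho> in simp)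
    moreover have "\<rho> / (t * (1 - \<eta>)) * (t * (1 - \<eta>) / \<rho> * y) = y" for y using True \<eta> \<rho> by simp
    ultimately have "n (c2 / t) \<le> f t + km + N_plus (\<eta> / t) S"
      using n[of "c2 / t"] c12 True by simp
    then have "real (n (c2 / t)) \<le> real (f t + km + N_plus (\<eta> / t) S)" by (rule of_nat_mono)
    then show ?thesis using True k_le(2) by (simp add: N1_def)
  next
    case False
    then show ?thesis using hs_le_nonneg[OF A(2)] by (simp add: N1_def)
  qed
  let ?e = "\<lambda>t :: real. C / \<eta>\<^sup>2 * (1 / (1 + t\<^sup>2))" and ?w = "\<lambda>t. N1 t / (1 + t\<^sup>2)" and ?u = "\<lambda>t. real (f t) / (1 + t\<^sup>2)"
  have w: "integrable lborel ?w" "(LINT t|lborel. ?w t) \<le> D / \<eta>"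
    using trace_counting_integral[OF S \<eta>(1)] unfolding N1_def by simp_all
  have e: "integrable lborel ?e" by (rule integrable_mult_right) (rule integrable_inverse_1_plus_sq)
  have p: "0 < 1 + t\<^sup>2" for t :: real by (simp add: add_pos_nonneg)
  have up': "?u t \<le> G c1 t + ?w t + ?e t" for t
    using divide_right_mono[OF up less_imp_le[OF p[of t]], of t] by (simp add: G_def add_divide_distrib)
  have lo': "G c2 t \<le> ?u t + ?w t + ?e t" for t
    using divide_right_mono[OF lo less_imp_le[OF p[of t]], of t] by (simp add: G_def add_divide_distrib)
  have pos: "0 \<le> ?u t" "0 \<le> G a t" for t a using p[of t] by (auto simp: G_def)
  have g1: "integrable lborel (G c1)" using int unfolding c1_def .
  have fm: "(\<lambda>t. real (f t)) \<in> borel_measurable borel"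
    by (rule borel_measurable_mono) (auto intro!: monoI mono_f)
  have u: "integrable lborel ?u"
  proof (rule Bochner_Integration.integrable_bound)
    show "integrable lborel (\<lambda>t. G c1 t + ?w t + ?e t)" using g1 w(1) e by simp
    show "AE t in lborel. norm (?u t) \<le> norm (G c1 t + ?w t + ?e t)"
      using up' pos(1) by (intro always_eventually allI) (metis abs_of_nonneg order_trans real_norm_def)
  qed (use fm in measurable)
  have g2: "integrable lborel (G c2)"
  proof (rule Bochner_Integration.integrable_bound)
    show "integrable lborel (\<lambda>t. ?u t + ?w t + ?e t)" using u w(1) e by simp
    show "AE t in lborel. norm (G c2 t) \<le> norm (?u t + ?w t + ?e t)"
      using lo' pos(2) by (intro always_eventually allI) (metis abs_of_nonneg order_trans real_norm_def)
    show "G c2 \<in> borel_measurable lborel"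
      using measurable_antimono_rescale[of "\<lambda>r. real (n r)", OF _ _ c12(2)] anti unfolding G_def by simp
  qed
  have J: "J = (LINT t|lborel. ?u t)" by (simp add: J_def f_def)
  have Le: "(LINT t|lborel. ?e t) = C / \<eta>\<^sup>2 * (LINT t|lborel. 1 / (1 + t\<^sup>2))"
    by (rule Bochner_Integration.integral_mult_right_zero)
  have "J \<le> (LINT t|lborel. G c1 t + ?w t + ?e t)"
    unfolding J by (rule integral_mono) (use u g1 w(1) e up' in auto)
  then show "J \<le> (LINT t|lborel. G ((1 - 2 * \<eta>) / (1 + \<eta>) * \<rho>) t) + L"
    using w g1 e Le unfolding L_def c1_def[symmetric] by simp
  have "(LINT t|lborel. G c2 t) \<le> (LINT t|lborel. ?u t + ?w t + ?e t)"
    by (rule integral_mono) (use u g2 w(1) e lo' in auto)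
  then show "(LINT t|lborel. G ((1 + 2 * \<eta>) / (1 - \<eta>) * \<rho>) t) - L \<le> J"
    using w u e Le unfolding L_def c2_def[symmetric] J by simp
qed

section \<open>Regular variation\<close>

text \<open>Halving the argument multiplies \<Phi> by at most 2^\<beta> near 0 for some \<beta>
  above \<alpha>. Iterating dyadically gives a majorant growing like t^\<beta>, which is still
  integrable because \<beta> < 1.\<close>

lemma karamata_integral:
  fixes \<Phi> :: "real \<Rightarrow> real"
  assumes \<alpha>: "0 \<le> \<alpha>" "\<alpha> < 1" and anti: "\<And>r r'. 0 < r \<Longrightarrow> r \<le> r' \<Longrightarrow> \<Phi> r' \<le> \<Phi> r"
    and nonneg: "\<And>r. 0 < r \<Longrightarrow> 0 \<le> \<Phi> r" and pos: "\<forall>\<^sub>F r in at_right 0. 0 < \<Phi> r"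
    and rv: "\<And>l. 0 < l \<Longrightarrow> ((\<lambda>r. \<Phi> (l * r) / \<Phi> r) \<longlongrightarrow> l powr - \<alpha>) (at_right 0)"
  defines "G \<equiv> \<lambda>a t. (if 0 < t then \<Phi> (a / t) else 0) / (1 + t\<^sup>2)"
  shows "\<forall>\<^sub>F a in at_right 0. integrable lborel (G a)"
    and "((\<lambda>a. (LINT t|lborel. G a t) / \<Phi> a) \<longlongrightarrow> pi / (2 * cos (pi * \<alpha> / 2))) (at_right 0)"
proof -
  \<comment> \<open>The midpoint between \<alpha> and 1.\<close>
  define \<beta> where "\<beta> = (1 + \<alpha>) / 2"
  have \<beta>: "0 \<le> \<beta>" "\<alpha> < \<beta>" "\<beta> < 1" using \<alpha> by (auto simp: \<beta>_def)
  have "(1 / 2) powr - \<alpha> < (2 powr \<beta> :: real)" using \<beta> by (simp add: powr_minus powr_divide)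
  from order_tendstoD(2)[OF rv[of "1 / 2"] this]
  have "\<forall>\<^sub>F r in at_right 0. \<Phi> (1 / 2 * r) / \<Phi> r < 2 powr \<beta>" by simp
  with pos have "\<forall>\<^sub>F r in at_right 0. 0 < \<Phi> r \<and> \<Phi> (r / 2) \<le> 2 powr \<beta> * \<Phi> r"
    by eventually_elim (simp add: pos_divide_less_eq less_imp_le)
  then obtain r0 where r0: "0 < r0" "\<And>r. 0 < r \<Longrightarrow> r < r0 \<Longrightarrow> 0 < \<Phi> r \<and> \<Phi> (r / 2) \<le> 2 powr \<beta> * \<Phi> r"
    unfolding eventually_at_right_field by blast
  have dyadic: "\<Phi> (a / 2 ^ k) \<le> (2 ^ k) powr \<beta> * \<Phi> a" if a: "0 < a" "a < r0" for a k
  proof (induction k)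
    case (Suc k)
    have "a / 2 ^ k \<le> a / 1" using a by (intro divide_left_mono) auto
    then have "\<Phi> (a / 2 ^ k / 2) \<le> 2 powr \<beta> * \<Phi> (a / 2 ^ k)" using a r0(2)[of "a / 2 ^ k"] by simp
    also have "\<dots> \<le> 2 powr \<beta> * ((2 ^ k) powr \<beta> * \<Phi> a)" using Suc by (intro mult_left_mono) auto
    also have "\<dots> = (2 ^ Suc k) powr \<beta> * \<Phi> a" by (simp add: powr_mult)
    finally show ?case by (simp add: mult.commute)
  qed simp
  have potter: "\<Phi> (a / t) \<le> (1 + 2 * t powr \<beta>) * \<Phi> a" if a: "0 < a" "a < r0" and t: "0 < t" for a t
  proof (cases "t \<le> 1")
    case True
    then have "\<Phi> (a / t) \<le> 1 * \<Phi> a" using a t by (simp add: anti field_simps)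
    also have "\<dots> \<le> (1 + 2 * t powr \<beta>) * \<Phi> a" using r0(2)[OF a] by (intro mult_right_mono) auto
    finally show ?thesis .
  next
    case False
    \<comment> \<open>By minimality 2^(k - 1) < t \<le> 2^k, so rounding up to a power of two at
      most doubles t.\<close>
    define k where "k = (LEAST k. t \<le> 2 ^ k)"
    obtain m where "t < 2 ^ m" using real_arch_pow[of 2 t] by auto
    then have tk: "t \<le> 2 ^ k" unfolding k_def using LeastI[of "\<lambda>k. t \<le> 2 ^ k" m] by simp
    have "k \<noteq> 0" using tk False by (intro notI) simp
    then have "k - 1 < k" by simp
    then have "\<not> t \<le> 2 ^ (k - 1)" by (rule not_less_Least[of "k - 1" "\<lambda>k. t \<le> 2 ^ k", folded k_def])
    moreover have "(2 :: real) ^ k = 2 * 2 ^ (k - 1)" using \<open>k \<noteq> 0\<close> by (cases k) auto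
    ultimately have k2: "2 ^ k \<le> 2 * t" by simp
    have "\<Phi> (a / t) \<le> \<Phi> (a / 2 ^ k)" using a t tk by (intro anti divide_left_mono) auto
    also have "\<dots> \<le> (2 ^ k) powr \<beta> * \<Phi> a" by (rule dyadic[OF a])
    also have "(2 ^ k) powr \<beta> \<le> (2 * t) powr \<beta>" using k2 \<beta>(1) by (intro powr_mono2) auto
    also have "(2 * t) powr \<beta> = 2 powr \<beta> * t powr \<beta>" by (simp add: powr_mult)
    also have "2 powr \<beta> \<le> 2 powr (1 :: real)" using \<beta> by (intro powr_mono) auto
    finally show ?thesis using r0(2)[OF a] by (simp add: mult_right_mono algebra_simps)
  qed
  define M where "M t = 1 / (1 + t\<^sup>2) + 2 * (indicator {0<..} t * (t powr \<beta> / (1 + t\<^sup>2)))" for t :: real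
  have p: "0 < 1 + t\<^sup>2" for t :: real by (simp add: add_pos_nonneg)
  have M: "integrable lborel M"
    unfolding M_def
    by (intro Bochner_Integration.integrable_add integrable_mult_right integrable_inverse_1_plus_sq)
       (use stieltjes_weight(1)[OF \<beta>(1,3)] in \<open>simp only: set_integrable_def real_scaleR_def\<close>)
  have G0: "0 \<le> G a t" if "0 < a" for a t using that nonneg by (simp add: G_def)
  have GM: "G a t / \<Phi> a \<le> M t" if a: "0 < a" "a < r0" for a t
  proof (cases "0 < t")
    case True
    have "G a t \<le> (1 + 2 * t powr \<beta>) * \<Phi> a / (1 + t\<^sup>2)"
      using divide_right_mono[OF potter[OF a True] less_imp_le[OF p]] True by (simp add: G_def)
    also have "\<dots> = M t * \<Phi> a" using True by (simp add: M_def add_divide_distrib distrib_right)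
    finally show ?thesis using r0(2)[OF a] by (simp add: pos_divide_le_eq)
  qed (simp add: G_def M_def)
  have Gm: "G a \<in> borel_measurable borel" if "0 < a" for a
    using measurable_antimono_rescale[of \<Phi>, OF anti nonneg that] unfolding G_def by simp
  have "integrable lborel (G a)" if a: "0 < a" "a < r0" for a
  proof (rule Bochner_Integration.integrable_bound)
    show "integrable lborel (\<lambda>t. \<Phi> a * M t)" using M by simp
    show "AE t in lborel. norm (G a t) \<le> norm (\<Phi> a * M t)"
    proof (intro always_eventually allI)
      fix t
      have "G a t \<le> \<Phi> a * M t" using GM[OF a] r0(2)[OF a] by (simp add: pos_divide_le_eq mult.commute)
      then show "norm (G a t) \<le> norm (\<Phi> a * M t)" using G0[OF a(1), of t] by simp
    qed
  qed (use Gm[OF a(1)] in simp)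
  then show "\<forall>\<^sub>F a in at_right 0. integrable lborel (G a)"
    using r0(1) unfolding eventually_at_right_field by blast
  \<comment> \<open>The limit a -> 0 is taken along a = 1 / i with i -> \<infinity>; the default 0
    for i \<le> 0 makes every \<open>s i\<close> measurable.\<close>
  define s where "s i t = (if 0 < i then G (inverse i) t / \<Phi> (inverse i) else 0)" for i t
  define f where "f t = indicator {0<..} t * (t powr \<alpha> / (1 + t\<^sup>2))" for t :: real
  have ev: "\<forall>\<^sub>F i in at_top. 0 < i \<and> inverse i < r0"
    using eventually_gt_at_top[of "0 :: real"] eventually_gt_at_top[of "inverse r0"]
    by eventually_elim (use r0(1) in \<open>auto simp: field_simps\<close>)
  have s_lim: "((\<lambda>i. LINT t|lborel. s i t) \<longlongrightarrow> (LINT t|lborel. f t)) at_top"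
  proof (rule integral_dominated_convergence_at_top[where w = M])
    show "f \<in> borel_measurable lborel" unfolding f_def by measurable
    show "s i \<in> borel_measurable lborel" for i
      using Gm[of "inverse i"] unfolding s_def by (cases "0 < i") auto
    show "\<forall>\<^sub>F i in at_top. AE t in lborel. norm (s i t) \<le> M t"
      using ev
    proof eventually_elim
      case (elim i)
      then have i: "0 < inverse i" "inverse i < r0" by auto
      have "norm (s i t) \<le> M t" for t
        using GM[OF i, of t] G0[OF i(1), of t] r0(2)[OF i] elim by (simp add: s_def)
      then show ?case by simp
    qed
    show "AE t in lborel. ((\<lambda>i. s i t) \<longlongrightarrow> f t) at_top"
    proof (intro always_eventually allI)
      fix t :: real
      show "((\<lambda>i. s i t) \<longlongrightarrow> f t) at_top"
      proof (cases "0 < t")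
        case True
        have "((\<lambda>a. \<Phi> (1 / t * a) / \<Phi> a / (1 + t\<^sup>2)) \<longlongrightarrow> (1 / t) powr - \<alpha> / (1 + t\<^sup>2)) (at_right 0)"
          using True p[of t] by (intro tendsto_intros rv) auto
        moreover have "(1 / t) powr - \<alpha> / (1 + t\<^sup>2) = f t"
          using True by (simp add: f_def powr_divide powr_minus)
        ultimately have "((\<lambda>i. \<Phi> (1 / t * inverse i) / \<Phi> (inverse i) / (1 + t\<^sup>2)) \<longlongrightarrow> f t) at_top"
          unfolding filterlim_at_right_to_top by simp
        moreover have "\<forall>\<^sub>F i in at_top. \<Phi> (1 / t * inverse i) / \<Phi> (inverse i) / (1 + t\<^sup>2) = s i t"
          using eventually_gt_at_top[of 0] by eventually_elim (simp add: s_def G_def True mult.commute divide_inverse)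
        ultimately show ?thesis by (rule Lim_transform_eventually)
      next
        case False
        then have "s i t = 0" for i by (simp add: s_def G_def)
        then show ?thesis using False by (simp add: f_def)
      qed
    qed
  qed (rule M)
  have f_int: "(LINT t|lborel. f t) = pi / (2 * cos (pi * \<alpha> / 2))"
    using stieltjes_weight(2)[OF \<alpha>] by (simp add: set_lebesgue_integral_def f_def)
  have "\<forall>\<^sub>F i in at_top. (LINT t|lborel. s i t) = (LINT t|lborel. G (inverse i) t) / \<Phi> (inverse i)"
    using eventually_gt_at_top[of 0] by eventually_elim (simp add: s_def)
  from Lim_transform_eventually[OF s_lim[unfolded f_int] this]
  have "((\<lambda>i. (LINT t|lborel. G (inverse i) t) / \<Phi> (inverse i)) \<longlongrightarrow> pi / (2 * cos (pi * \<alpha> / 2))) at_top" .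
  then show "((\<lambda>a. (LINT t|lborel. G a t) / \<Phi> a) \<longlongrightarrow> pi / (2 * cos (pi * \<alpha> / 2))) (at_right 0)"
    unfolding filterlim_at_right_to_top .
qed

lemma filterlim_scale_at_right_0:
  fixes l :: real
  assumes "0 < l"
  shows "filterlim (\<lambda>r. l * r) (at_right 0) (at_right 0)"
  unfolding filterlim_at
proof
  show "((\<lambda>r. l * r) \<longlongrightarrow> 0) (at_right 0)" by (auto intro!: tendsto_eq_intros)
  show "\<forall>\<^sub>F r in at_right 0. l * r \<in> {0<..} \<and> l * r \<noteq> 0"
    using eventually_at_right_less[of "0 :: real"] by eventually_elim (use assms in simp)
qed

text \<open>For fixed \<eta> the constant K vanishes against \<Phi> -> \<infinity>, and each
  dilation by c contributes a factor c^(-\<alpha>), which tends to 1 as \<eta> -> 0. Since K depends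
  on \<eta>, the limit in E has to come first.\<close>

lemma sandwiched_ratio_tendsto:
  fixes \<Phi> \<rho> J :: "real \<Rightarrow> real" and W :: "real \<Rightarrow> real"
  assumes \<rho>: "filterlim \<rho> (at_right 0) F" and top: "filterlim \<Phi> at_top (at_right 0)"
    and rv: "\<And>l. 0 < l \<Longrightarrow> ((\<lambda>r. \<Phi> (l * r) / \<Phi> r) \<longlongrightarrow> l powr - \<alpha>) (at_right 0)"
    and W: "((\<lambda>a. W a / \<Phi> a) \<longlongrightarrow> L) (at_right 0)"
    and J: "\<And>\<eta>. 0 < \<eta> \<Longrightarrow> \<eta> < 1 / 2 \<Longrightarrow> \<exists>K. \<forall>\<^sub>F E in F.
      W ((1 + 2 * \<eta>) / (1 - \<eta>) * \<rho> E) - K \<le> J E \<and> J E \<le> W ((1 - 2 * \<eta>) / (1 + \<eta>) * \<rho> E) + K"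
  shows "((\<lambda>E. J E / \<Phi> (\<rho> E)) \<longlongrightarrow> L) F"
proof -
  have top\<rho>: "filterlim (\<lambda>E. \<Phi> (\<rho> E)) at_top F" by (rule filterlim_compose[OF top \<rho>])
  have pos: "\<forall>\<^sub>F E in F. 0 < \<Phi> (\<rho> E)" by (rule filterlim_at_top_dense[THEN iffD1, OF top\<rho>, rule_format])
  have Wc: "((\<lambda>E. (W (c * \<rho> E) + k) / \<Phi> (\<rho> E)) \<longlongrightarrow> L * c powr - \<alpha>) F" if c: "0 < c" for c k
  proof -
    note lim = filterlim_scale_at_right_0[OF c]
    have nz: "\<forall>\<^sub>F r in at_right 0. \<Phi> (c * r) \<noteq> 0"
      using filterlim_at_top_dense[THEN iffD1, OF filterlim_compose[OF top lim], rule_format, of 0]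
      by eventually_elim simp
    have "((\<lambda>r. W (c * r) / \<Phi> (c * r) * (\<Phi> (c * r) / \<Phi> r)) \<longlongrightarrow> L * c powr - \<alpha>) (at_right 0)"
      by (rule tendsto_mult[OF filterlim_compose[OF W lim] rv[OF c]])
    moreover have "\<forall>\<^sub>F r in at_right 0. W (c * r) / \<Phi> (c * r) * (\<Phi> (c * r) / \<Phi> r) = W (c * r) / \<Phi> r"
      using nz by eventually_elim simp
    ultimately have "((\<lambda>r. W (c * r) / \<Phi> r) \<longlongrightarrow> L * c powr - \<alpha>) (at_right 0)"
      by (rule Lim_transform_eventually)
    from filterlim_compose[OF this \<rho>]
    have "((\<lambda>E. W (c * \<rho> E) / \<Phi> (\<rho> E)) \<longlongrightarrow> L * c powr - \<alpha>) F" .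
    moreover have "((\<lambda>E. k / \<Phi> (\<rho> E)) \<longlongrightarrow> 0) F"
      by (rule tendsto_divide_0[OF tendsto_const filterlim_at_top_imp_at_infinity[OF top\<rho>]])
    ultimately have "((\<lambda>E. W (c * \<rho> E) / \<Phi> (\<rho> E) + k / \<Phi> (\<rho> E)) \<longlongrightarrow> L * c powr - \<alpha> + 0) F"
      by (rule tendsto_add)
    then show ?thesis by (simp add: add_divide_distrib)
  qed
  have \<eta>0: "\<forall>\<^sub>F \<eta> in at_right 0. 0 < \<eta> \<and> \<eta> < (1 / 2 :: real)"
    using eventually_at_right_real[of 0 "1 / 2"] by (simp add: greaterThanLessThan_iff)
  have c_lim: "((\<lambda>\<eta>. L * ((1 - 2 * \<eta>) / (1 + \<eta>)) powr - \<alpha>) \<longlongrightarrow> L) (at_right 0)"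
    "((\<lambda>\<eta>. L * ((1 + 2 * \<eta>) / (1 - \<eta>)) powr - \<alpha>) \<longlongrightarrow> L) (at_right 0)"
    by (auto intro!: tendsto_eq_intros)
  show ?thesis
  proof (rule order_tendstoI)
    fix y assume "L < y"
    then obtain \<eta> where \<eta>: "0 < \<eta>" "\<eta> < 1 / 2" "L * ((1 - 2 * \<eta>) / (1 + \<eta>)) powr - \<alpha> < y"
      using eventually_happens'[OF _ eventually_conj[OF \<eta>0 order_tendstoD(2)[OF c_lim(1)]]] by auto
    obtain K where "\<forall>\<^sub>F E in F. W ((1 + 2 * \<eta>) / (1 - \<eta>) * \<rho> E) - K \<le> J E \<and>
        J E \<le> W ((1 - 2 * \<eta>) / (1 + \<eta>) * \<rho> E) + K" using J[OF \<eta>(1,2)] by blast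
    then have K: "\<forall>\<^sub>F E in F. J E \<le> W ((1 - 2 * \<eta>) / (1 + \<eta>) * \<rho> E) + K" by (rule eventually_mono) blast
    have "0 < (1 - 2 * \<eta>) / (1 + \<eta>)" using \<eta> by simp
    from order_tendstoD(2)[OF Wc[OF this, of K] \<eta>(3)] K pos
    show "\<forall>\<^sub>F E in F. J E / \<Phi> (\<rho> E) < y"
      by eventually_elim (meson divide_right_mono le_less_trans less_imp_le)
  next
    fix y assume "y < L"
    then obtain \<eta> where \<eta>: "0 < \<eta>" "\<eta> < 1 / 2" "y < L * ((1 + 2 * \<eta>) / (1 - \<eta>)) powr - \<alpha>"
      using eventually_happens'[OF _ eventually_conj[OF \<eta>0 order_tendstoD(1)[OF c_lim(2)]]] by auto
    obtain K where "\<forall>\<^sub>F E in F. W ((1 + 2 * \<eta>) / (1 - \<eta>) * \<rho> E) - K \<le> J E \<and>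
        J E \<le> W ((1 - 2 * \<eta>) / (1 + \<eta>) * \<rho> E) + K" using J[OF \<eta>(1,2)] by blast
    then have K: "\<forall>\<^sub>F E in F. W ((1 + 2 * \<eta>) / (1 - \<eta>) * \<rho> E) - K \<le> J E" by (rule eventually_mono) blast
    have "0 < (1 + 2 * \<eta>) / (1 - \<eta>)" using \<eta> by simp
    from order_tendstoD(1)[OF Wc[OF this, of "- K"] \<eta>(3)] K pos
    show "\<forall>\<^sub>F E in F. y < J E / \<Phi> (\<rho> E)"
    proof eventually_elim
      case (elim E)
      have "(W ((1 + 2 * \<eta>) / (1 - \<eta>) * \<rho> E) + - K) / \<Phi> (\<rho> E) \<le> J E / \<Phi> (\<rho> E)"
        using elim(2,3) by (intro divide_right_mono) auto
      with elim(1) show ?case by linarith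
    qed
  qed
qed

section \<open>Regular variation of the four model scales\<close>

lemma regular_variation_transfer:
  fixes \<Phi> \<Psi> :: "real \<Rightarrow> real"
  assumes eq: "\<Phi> \<sim>[at_right 0] \<Psi>" and l: "0 < l"
    and lim: "((\<lambda>r. \<Psi> (l * r) / \<Psi> r) \<longlongrightarrow> c) (at_right 0)"
  shows "((\<lambda>r. \<Phi> (l * r) / \<Phi> r) \<longlongrightarrow> c) (at_right 0)"
proof -
  have "(\<lambda>r. \<Phi> (l * r)) \<sim>[at_right 0] (\<lambda>r. \<Psi> (l * r))"
    by (rule asymp_equiv_compose'[OF eq filterlim_scale_at_right_0[OF l]])
  from asymp_equiv_divide[OF this eq] show ?thesis
    using lim asymp_equiv_symI asymp_equiv_tendsto_transfer by blast
qed

lemma power_regular_variation: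
  fixes \<Psi> :: "real \<Rightarrow> real"
  assumes C: "0 < C" and \<alpha>: "0 < \<alpha>" and \<Psi>: "\<forall>\<^sub>F r in at_right 0. \<Psi> r = C * r powr - \<alpha>"
  shows "filterlim \<Psi> at_top (at_right 0)"
    and "0 < l \<Longrightarrow> ((\<lambda>r. \<Psi> (l * r) / \<Psi> r) \<longlongrightarrow> l powr - \<alpha>) (at_right 0)"
proof -
  have "filterlim (\<lambda>r. C * r powr - \<alpha>) at_top (at_right 0)" using C \<alpha> by real_asymp
  then show "filterlim \<Psi> at_top (at_right 0)"
    using filterlim_cong[OF refl refl \<Psi>] by blast
  assume l: "0 < l"
  have "\<forall>\<^sub>F r in at_right 0. \<Psi> (l * r) = C * (l * r) powr - \<alpha>"
    using filterlim_scale_at_right_0[OF l] \<Psi> unfolding filterlim_iff by blast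
  with \<Psi> eventually_at_right_less[of "0 :: real"]
  have "\<forall>\<^sub>F r in at_right 0. \<Psi> (l * r) / \<Psi> r = l powr - \<alpha>"
    by eventually_elim (use C l in \<open>simp add: powr_mult\<close>)
  then show "((\<lambda>r. \<Psi> (l * r) / \<Psi> r) \<longlongrightarrow> l powr - \<alpha>) (at_right 0)"
    by (rule tendsto_eventually)
qed

text \<open>In the variable u = |ln r| a dilation of r is a bounded translation, so slow variation
  of \<Psi> reduces to insensitivity of p to translations.\<close>

lemma log_regular_variation:
  fixes \<Psi> p :: "real \<Rightarrow> real"
  assumes p: "filterlim p at_top at_top" "\<And>m. ((\<lambda>u. p (u - m) / p u) \<longlongrightarrow> 1) at_top"
    and \<Psi>: "\<forall>\<^sub>F r in at_right 0. \<Psi> r = p \<bar>ln r\<bar>"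
  shows "filterlim \<Psi> at_top (at_right 0)"
    and "0 < l \<Longrightarrow> ((\<lambda>r. \<Psi> (l * r) / \<Psi> r) \<longlongrightarrow> 1) (at_right 0)"
proof -
  have abs_ln: "filterlim (\<lambda>r :: real. \<bar>ln r\<bar>) at_top (at_right 0)" by real_asymp
  have "filterlim (\<lambda>r. p \<bar>ln r\<bar>) at_top (at_right 0)" by (rule filterlim_compose[OF p(1) abs_ln])
  then show "filterlim \<Psi> at_top (at_right 0)"
    using filterlim_cong[OF refl refl \<Psi>] by blast
  assume l: "0 < l"
  have "\<forall>\<^sub>F r in at_right 0. \<Psi> (l * r) = p \<bar>ln (l * r)\<bar>"
    using filterlim_scale_at_right_0[OF l] \<Psi> unfolding filterlim_iff by blast
  \<comment> \<open>This range makes both r and l r smaller than 1, which fixes the signs of the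
    logarithms.\<close>
  moreover have "\<forall>\<^sub>F r in at_right 0. r \<in> {0<..<min 1 (1 / l)}"
    by (rule eventually_at_right_real) (use l in simp)
  ultimately have "\<forall>\<^sub>F r in at_right 0. p (\<bar>ln r\<bar> - ln l) / p \<bar>ln r\<bar> = \<Psi> (l * r) / \<Psi> r"
    using \<Psi>
  proof eventually_elim
    case (elim r)
    have "l * r < 1" "r < 1" "0 < r" using elim(2) l by (auto simp: field_simps)
    moreover have "ln (l * r) < 0" "ln r < 0" using calculation l by simp_all
    moreover have "ln (l * r) = ln l + ln r" using calculation l by (simp add: ln_mult)
    ultimately have "\<bar>ln (l * r)\<bar> = \<bar>ln r\<bar> - ln l" by linarith
    then show ?case using elim by simp
  qed
  with filterlim_compose[OF p(2)[of "ln l"] abs_ln] show "((\<lambda>r. \<Psi> (l * r) / \<Psi> r) \<longlongrightarrow> 1) (at_right 0)"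
    by (rule Lim_transform_eventually)
qed

lemma log_scales:
  fixes C \<alpha> :: real
  assumes C: "0 < C"
  shows "0 < \<alpha> \<Longrightarrow> filterlim (\<lambda>u. C * u powr \<alpha>) at_top at_top"
    "0 < \<alpha> \<Longrightarrow> filterlim (\<lambda>u. C * ln u powr \<alpha>) at_top at_top"
    "filterlim (\<lambda>u. C * u / ln u) at_top at_top"
    "((\<lambda>u. (C * (u - m) powr \<alpha>) / (C * u powr \<alpha>)) \<longlongrightarrow> 1) at_top"
    "((\<lambda>u. (C * ln (u - m) powr \<alpha>) / (C * ln u powr \<alpha>)) \<longlongrightarrow> 1) at_top"
    "((\<lambda>u. (C * (u - m) / ln (u - m)) / (C * u / ln u)) \<longlongrightarrow> 1) at_top"
proof -
  show "0 < \<alpha> \<Longrightarrow> filterlim (\<lambda>u. C * u powr \<alpha>) at_top at_top" using C by real_asymp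
  show "0 < \<alpha> \<Longrightarrow> filterlim (\<lambda>u. C * ln u powr \<alpha>) at_top at_top" using C by real_asymp
  show "filterlim (\<lambda>u. C * u / ln u) at_top at_top" using C by real_asymp
  have r1: "((\<lambda>u. (u - m) / u) \<longlongrightarrow> 1) at_top" by real_asymp
  have r2: "((\<lambda>u. ln (u - m) / ln u) \<longlongrightarrow> 1) at_top" by real_asymp
  have ev: "\<forall>\<^sub>F u in at_top. 1 < u \<and> 1 < u - m"
    using eventually_gt_at_top[of 1] eventually_gt_at_top[of "1 + m"] by eventually_elim simp
  have "((\<lambda>u. ((u - m) / u) powr \<alpha>) \<longlongrightarrow> 1 powr \<alpha>) at_top" by (intro tendsto_powr r1 tendsto_const) simp
  moreover have "\<forall>\<^sub>F u in at_top. ((u - m) / u) powr \<alpha> = (C * (u - m) powr \<alpha>) / (C * u powr \<alpha>)"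
    using ev by eventually_elim (use C in \<open>simp add: powr_divide\<close>)
  ultimately show "((\<lambda>u. (C * (u - m) powr \<alpha>) / (C * u powr \<alpha>)) \<longlongrightarrow> 1) at_top"
    by (simp add: tendsto_cong)
  have "((\<lambda>u. (ln (u - m) / ln u) powr \<alpha>) \<longlongrightarrow> 1 powr \<alpha>) at_top" by (intro tendsto_powr r2 tendsto_const) simp
  moreover have "\<forall>\<^sub>F u in at_top. (ln (u - m) / ln u) powr \<alpha> = (C * ln (u - m) powr \<alpha>) / (C * ln u powr \<alpha>)"
    using ev by eventually_elim (use C in \<open>simp add: powr_divide\<close>)
  ultimately show "((\<lambda>u. (C * ln (u - m) powr \<alpha>) / (C * ln u powr \<alpha>)) \<longlongrightarrow> 1) at_top"
    by (simp add: tendsto_cong)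
  have "((\<lambda>u. ((u - m) / u) / (ln (u - m) / ln u)) \<longlongrightarrow> 1 / 1) at_top" by (intro tendsto_divide r1 r2) simp
  moreover have "\<forall>\<^sub>F u in at_top. ((u - m) / u) / (ln (u - m) / ln u) = (C * (u - m) / ln (u - m)) / (C * u / ln u)"
    using ev by eventually_elim (use C in \<open>simp add: field_simps\<close>)
  ultimately show "((\<lambda>u. (C * (u - m) / ln (u - m)) / (C * u / ln u)) \<longlongrightarrow> 1) at_top"
    by (simp add: tendsto_cong)
qed

section \<open>Asymptotics of the spectral shift function\<close>

context
  fixes h \<nu> :: real and Q K :: "'g :: complex_hilbert \<Rightarrow> 'g" and \<V> :: "'g l2Z \<Rightarrow> 'g l2Z"
    and d s :: nat and \<mu> :: "nat \<Rightarrow> real"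
  assumes h: "h > 0" and dec: "finite_spectral_decomposition Q d \<mu>" and \<nu>: "\<nu> > 3"
    and V: "nonneg_op \<V>" and K: "hilbert_schmidt K" and s: "s \<in> I_Q Q d"
begin

lemma filterlim_threshold_scale:
  assumes i: "i \<in> {1, 2}"
  shows "filterlim (\<lambda>E. 2 / h * sqrt \<bar>threshold h (\<mu> s) i - E\<bar>) (at_right 0) (toward_threshold h (\<mu> s) i)"
  unfolding filterlim_at
proof
  note facts = toward_threshold_facts[OF h dec \<nu> V K s i]
  have "((\<lambda>E. 2 / h * sqrt \<bar>threshold h (\<mu> s) i - E\<bar>) \<longlongrightarrow>
      2 / h * sqrt \<bar>threshold h (\<mu> s) i - threshold h (\<mu> s) i\<bar>) (toward_threshold h (\<mu> s) i)"
    by (intro tendsto_intros facts(1)) (use h in simp)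
  then show "((\<lambda>E. 2 / h * sqrt \<bar>threshold h (\<mu> s) i - E\<bar>) \<longlongrightarrow> 0) (toward_threshold h (\<mu> s) i)" by simp
  show "\<forall>\<^sub>F E in toward_threshold h (\<mu> s) i. 2 / h * sqrt \<bar>threshold h (\<mu> s) i - E\<bar> \<in> {0<..} \<and>
      2 / h * sqrt \<bar>threshold h (\<mu> s) i - E\<bar> \<noteq> 0"
    using facts(2) by eventually_elim (use h in simp)
qed

text \<open>Both spectral shift functions reduce to the same counting integral with A replaced by
  \<sigma> A for a sign \<sigma>, and the bounds on A do not see that sign.\<close>

lemma ssf_asymptotics:
  assumes nd: "nondegenerate_lower h Q d \<mu> s" "nondegenerate_upper h Q d \<mu> s" and i: "i \<in> {1, 2}"
    and \<alpha>: "0 \<le> \<alpha>" "\<alpha> < 1" and eq: "Phi i \<nu> Q \<mu> s \<V> K \<sim>[at_right 0] \<Psi>"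
    and top: "filterlim \<Psi> at_top (at_right 0)"
    and rv: "\<And>l. 0 < l \<Longrightarrow> ((\<lambda>r. \<Psi> (l * r) / \<Psi> r) \<longlongrightarrow> l powr - \<alpha>) (at_right 0)"
  defines "\<rho> \<equiv> \<lambda>E. 2 / h * sqrt \<bar>threshold h (\<mu> s) i - E\<bar>"
  shows "ssf_plus (H_free h Q) (M_factor \<nu> \<V> K) \<sim>[toward_threshold h (\<mu> s) i]
      (\<lambda>E. 1 / (2 * cos (pi * \<alpha> / 2)) * \<Psi> (\<rho> E))"
    and "ssf_minus (H_free h Q) (M_factor \<nu> \<V> K) \<sim>[toward_threshold h (\<mu> s) i]
      (\<lambda>E. - (1 / (2 * cos (pi * \<alpha> / 2))) * \<Psi> (\<rho> E))"
proof -
  let ?F = "toward_threshold h (\<mu> s) i" and ?\<Phi> = "Phi i \<nu> Q \<mu> s \<V> K"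
  let ?T = "\<lambda>E. boundary_value (H_free h Q) (M_factor \<nu> \<V> K) E"
  let ?A = "\<lambda>E. re_part (?T E)" and ?B = "\<lambda>E. im_part (?T E)" and ?Y = "edge_op \<nu> Q K \<V> s \<mu> i"
  \<comment> \<open>\<open>Phi\<close> is real-valued by definition but integral for r > 0; rounding
    extracts the integer there.\<close>
  define n where "n r = nat \<lfloor>?\<Phi> r\<rfloor>" for r
  have n: "?\<Phi> r = real (n r)" "n r \<le> k \<longleftrightarrow> codim_le (\<lambda>x. (norm (?Y x))\<^sup>2 - r * (norm x)\<^sup>2) k"
    if r: "0 < r" for r k
  proof -
    obtain N :: nat where N: "?\<Phi> r = real N"
      "\<And>k. N \<le> k \<longleftrightarrow> codim_le (\<lambda>x. (norm (?Y x))\<^sup>2 - r * (norm x)\<^sup>2) k"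
      by (rule Phi_counting[OF h dec \<nu> V K s i r]) blast
    have "n r = N" by (simp add: n_def N(1))
    with N show "?\<Phi> r = real (n r)" "n r \<le> k \<longleftrightarrow> codim_le (\<lambda>x. (norm (?Y x))\<^sup>2 - r * (norm x)\<^sup>2) k"
      by simp_all
  qed
  have anti: "?\<Phi> r' \<le> ?\<Phi> r" if r: "0 < r" "r \<le> r'" for r r'
  proof -
    have "0 < r'" using r by simp
    have "codim_le (\<lambda>x. (norm (?Y x))\<^sup>2 - r' * (norm x)\<^sup>2) (n r)"
      by (rule codim_le_mono[OF n(2)[OF r(1), THEN iffD1, OF order_refl]])
         (use r in \<open>auto intro: mult_right_mono\<close>)
    then show ?thesis using n r \<open>0 < r'\<close> by simp
  qed
  have top\<Phi>: "filterlim ?\<Phi> at_top (at_right 0)"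
    using asymp_equiv_at_top_transfer[OF asymp_equiv_symI[OF eq] top] .
  have rv\<Phi>: "((\<lambda>r. ?\<Phi> (l * r) / ?\<Phi> r) \<longlongrightarrow> l powr - \<alpha>) (at_right 0)" if "0 < l" for l
    by (rule regular_variation_transfer[OF eq that rv[OF that]])
  have pos: "\<forall>\<^sub>F r in at_right 0. 0 < ?\<Phi> r"
    by (rule filterlim_at_top_dense[THEN iffD1, OF top\<Phi>, rule_format])
  define G where "G a t = (if 0 < t then ?\<Phi> (a / t) else 0) / (1 + t\<^sup>2)" for a t
  define W where "W a = (LINT t|lborel. G a t)" for a
  have karamata: "\<forall>\<^sub>F a in at_right 0. integrable lborel (G a)"
    "((\<lambda>a. W a / ?\<Phi> a) \<longlongrightarrow> pi / (2 * cos (pi * \<alpha> / 2))) (at_right 0)"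
    unfolding W_def G_def[abs_def] using karamata_integral[OF \<alpha> anti _ pos rv\<Phi>] n(1) by simp_all
  have Gn: "G a = (\<lambda>t. (if 0 < t then real (n (a / t)) else 0) / (1 + t\<^sup>2))" if "0 < a" for a
    using that n(1) by (auto simp: G_def fun_eq_iff)
  have \<rho>: "filterlim \<rho> (at_right 0) ?F"
    unfolding \<rho>_def by (rule filterlim_threshold_scale[OF i])
  obtain C where C: "\<And>\<eta>. 0 < \<eta> \<Longrightarrow> \<eta> < 1 \<Longrightarrow> \<exists>D. \<forall>\<^sub>F E in ?F. 0 < \<rho> E \<and>
      selfadjoint_op (?A E) \<and> hs_le (?A E) C \<and> selfadjoint_op (?B E) \<and> (\<exists>c. hs_le (?B E) c) \<and>
      (\<forall>x. 0 \<le> inner x (?B E x)) \<and>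
      (\<exists>S. trace_le S D \<and>
        (\<forall>x. (1 - \<eta>) / \<rho> E * (norm (?Y x))\<^sup>2 - inner x (S x) \<le> inner x (?B E x) \<and>
          inner x (?B E x) \<le> (1 + \<eta>) / \<rho> E * (norm (?Y x))\<^sup>2 + inner x (S x)))"
    unfolding \<rho>_def by (rule threshold_estimate[OF h dec \<nu> V K s nd i]) blast
  have ratio: "((\<lambda>E. (LINT t|lborel. real (N_plus 1 (\<lambda>x. \<sigma> *\<^sub>R ?A E x + t *\<^sub>R ?B E x)) / (1 + t\<^sup>2)) / ?\<Phi> (\<rho> E))
      \<longlongrightarrow> pi / (2 * cos (pi * \<alpha> / 2))) ?F" if \<sigma>: "\<sigma> = 1 \<or> \<sigma> = - 1" for \<sigma> :: real
  proof (rule sandwiched_ratio_tendsto[OF \<rho> top\<Phi> rv\<Phi> karamata(2)])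
    fix \<eta> :: real assume \<eta>: "0 < \<eta>" "\<eta> < 1 / 2"
    let ?c = "(1 - 2 * \<eta>) / (1 + \<eta>)" and ?c' = "(1 + 2 * \<eta>) / (1 - \<eta>)"
    let ?J = "\<lambda>E. LINT t|lborel. real (N_plus 1 (\<lambda>x. \<sigma> *\<^sub>R ?A E x + t *\<^sub>R ?B E x)) / (1 + t\<^sup>2)"
    have c: "0 < ?c" "0 < ?c'" using \<eta> by simp_all
    have "\<eta> < 1" using \<eta> by simp
    from C[OF \<eta>(1) this] obtain D where D: "\<forall>\<^sub>F E in ?F. 0 < \<rho> E \<and>
      selfadjoint_op (?A E) \<and> hs_le (?A E) C \<and> selfadjoint_op (?B E) \<and> (\<exists>c. hs_le (?B E) c) \<and>
      (\<forall>x. 0 \<le> inner x (?B E x)) \<and>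
      (\<exists>S. trace_le S D \<and>
        (\<forall>x. (1 - \<eta>) / \<rho> E * (norm (?Y x))\<^sup>2 - inner x (S x) \<le> inner x (?B E x) \<and>
          inner x (?B E x) \<le> (1 + \<eta>) / \<rho> E * (norm (?Y x))\<^sup>2 + inner x (S x)))" by blast
    have "\<forall>\<^sub>F E in ?F. integrable lborel (G (?c * \<rho> E))"
      using filterlim_compose[OF filterlim_scale_at_right_0[OF c(1)] \<rho>] karamata(1)
      unfolding filterlim_iff by blast
    with D have "\<forall>\<^sub>F E in ?F. W (?c' * \<rho> E) - (C / \<eta>\<^sup>2 * (LINT t|lborel. 1 / (1 + t\<^sup>2)) + D / \<eta>) \<le> ?J E \<and>
        ?J E \<le> W (?c * \<rho> E) + (C / \<eta>\<^sup>2 * (LINT t|lborel. 1 / (1 + t\<^sup>2)) + D / \<eta>)"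
    proof eventually_elim
      case (elim E)
      then have \<rho>E: "0 < \<rho> E" and A: "selfadjoint_op (?A E)" "hs_le (?A E) C" and B: "selfadjoint_op (?B E)"
        "\<And>x. 0 \<le> inner x (?B E x)" by blast+
      obtain b where b: "hs_le (?B E) b" using elim(1) by blast
      obtain S where S: "trace_le S D"
        "\<And>x. (1 - \<eta>) / \<rho> E * (norm (?Y x))\<^sup>2 - inner x (S x) \<le> inner x (?B E x)"
        "\<And>x. inner x (?B E x) \<le> (1 + \<eta>) / \<rho> E * (norm (?Y x))\<^sup>2 + inner x (S x)" using elim(1) by blast
      have sA: "selfadjoint_op (\<lambda>x. \<sigma> *\<^sub>R ?A E x)"
        using bounded_clinear_scaledR[OF selfadjoint_opD(1)[OF A(1)]] selfadjoint_opD(2)[OF A(1)]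
        by (simp add: selfadjoint_op_def cinner_scaleR_left cinner_scaleR_right)
      have "norm (\<sigma> *\<^sub>R ?A E x) \<le> 1 * norm (?A E x)" for x using \<sigma> by auto
      from hs_le_dominated[OF A(2) this] have hA: "hs_le (\<lambda>x. \<sigma> *\<^sub>R ?A E x) C" by simp
      have p: "0 < ?c * \<rho> E" "0 < ?c' * \<rho> E" using c \<rho>E by (metis mult_pos_pos)+
      show ?case
        using counting_integral_bounds[OF sA hA B(1) b B(2) S(1) \<eta> \<rho>E n(2) S(2,3) elim(2)[unfolded Gn[OF p(1)]]]
        unfolding W_def Gn[OF p(1)] Gn[OF p(2)] by blast
    qed
    then show "\<exists>K. \<forall>\<^sub>F E in ?F. W (?c' * \<rho> E) - K \<le> ?J E \<and> ?J E \<le> W (?c * \<rho> E) + K" by blast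
  qed
  define L where "L = 1 / (2 * cos (pi * \<alpha> / 2))"
  have "0 < cos (pi * \<alpha> / 2)" using \<alpha> by (intro cos_gt_zero_pi) (auto intro: less_le_trans[of _ 0])
  then have L: "L \<noteq> 0" by (simp add: L_def)
  have \<Phi>\<Psi>: "(\<lambda>E. ?\<Phi> (\<rho> E)) \<sim>[?F] (\<lambda>E. \<Psi> (\<rho> E))" by (rule asymp_equiv_compose'[OF eq \<rho>])
  \<comment> \<open>Here \<sigma> is the sign put on the real part and \<tau> the sign of the
    spectral shift function.\<close>
  have key: "f \<sim>[?F] (\<lambda>E. \<tau> * L * \<Psi> (\<rho> E))"
    if f: "\<And>E. f E = \<tau> * (1 / pi * (LINT t|lborel. real (N_plus 1 (\<lambda>x. \<sigma> *\<^sub>R ?A E x + t *\<^sub>R ?B E x)) / (1 + t\<^sup>2)))"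
      and \<sigma>: "\<sigma> = 1 \<or> \<sigma> = - 1" and \<tau>: "\<tau> \<noteq> 0" for f and \<sigma> \<tau> :: real
  proof -
    have "((\<lambda>E. f E / (\<tau> * L * ?\<Phi> (\<rho> E))) \<longlongrightarrow> 1) ?F"
    proof -
      have "((\<lambda>E. 1 / (pi * L) * ((LINT t|lborel. real (N_plus 1 (\<lambda>x. \<sigma> *\<^sub>R ?A E x + t *\<^sub>R ?B E x)) / (1 + t\<^sup>2)) / ?\<Phi> (\<rho> E)))
          \<longlongrightarrow> 1 / (pi * L) * (pi / (2 * cos (pi * \<alpha> / 2)))) ?F"
        by (intro tendsto_mult tendsto_const ratio[OF \<sigma>])
      moreover have "1 / (pi * L) * (pi / (2 * cos (pi * \<alpha> / 2))) = 1" using L by (simp add: L_def)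
      moreover have "(\<lambda>E. f E / (\<tau> * L * ?\<Phi> (\<rho> E))) = (\<lambda>E. 1 / (pi * L) *
          ((LINT t|lborel. real (N_plus 1 (\<lambda>x. \<sigma> *\<^sub>R ?A E x + t *\<^sub>R ?B E x)) / (1 + t\<^sup>2)) / ?\<Phi> (\<rho> E)))"
        unfolding f using \<tau> by (simp add: fun_eq_iff)
      ultimately show ?thesis by (simp only:)
    qed
    then have "f \<sim>[?F] (\<lambda>E. \<tau> * L * ?\<Phi> (\<rho> E))" by (rule asymp_equivI')
    also have "(\<lambda>E. \<tau> * L * ?\<Phi> (\<rho> E)) \<sim>[?F] (\<lambda>E. \<tau> * L * \<Psi> (\<rho> E))"
      by (intro asymp_equiv_mult asymp_equiv_refl \<Phi>\<Psi>)
    finally show ?thesis .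
  qed
  have "ssf_plus (H_free h Q) (M_factor \<nu> \<V> K) \<sim>[?F] (\<lambda>E. 1 * L * \<Psi> (\<rho> E))"
  proof (rule key)
    fix E
    \<comment> \<open>Since -(A + t B) = -A + (-t) B, the reflection t -> -t turns
      \<open>N_minus\<close> for A into \<open>N_plus\<close> for -A with B keeping its
      sign.\<close>
    define f where "f t = real (N_plus 1 (\<lambda>x. - 1 *\<^sub>R ?A E x + t *\<^sub>R ?B E x)) / (1 + t\<^sup>2)" for t
    have "real (N_minus 1 (\<lambda>x. ?A E x + t *\<^sub>R ?B E x)) / (1 + t\<^sup>2) = f (0 + (- 1) * t)" for t
      by (simp add: f_def N_minus_eq)
    then have "ssf_plus (H_free h Q) (M_factor \<nu> \<V> K) E = 1 / pi * (LINT t|lborel. f (0 + (- 1) * t))"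
      by (simp only: ssf_plus_def)
    also have "(LINT t|lborel. f (0 + (- 1) * t)) = (LINT t|lborel. f t)"
      using lborel_integral_real_affine[of "- 1" f 0] by simp
    finally show "ssf_plus (H_free h Q) (M_factor \<nu> \<V> K) E =
        1 * (1 / pi * (LINT t|lborel. real (N_plus 1 (\<lambda>x. - 1 *\<^sub>R ?A E x + t *\<^sub>R ?B E x)) / (1 + t\<^sup>2)))"
      by (simp only: f_def mult_1_left)
  qed auto
  then show "ssf_plus (H_free h Q) (M_factor \<nu> \<V> K) \<sim>[?F] (\<lambda>E. 1 / (2 * cos (pi * \<alpha> / 2)) * \<Psi> (\<rho> E))"
    by (simp only: L_def mult_1_left)
  have "ssf_minus (H_free h Q) (M_factor \<nu> \<V> K) \<sim>[?F] (\<lambda>E. - 1 * L * \<Psi> (\<rho> E))"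
    by (rule key[of _ _ 1]) (simp_all add: ssf_minus_def)
  then show "ssf_minus (H_free h Q) (M_factor \<nu> \<V> K) \<sim>[?F] (\<lambda>E. - (1 / (2 * cos (pi * \<alpha> / 2))) * \<Psi> (\<rho> E))"
    by (simp add: L_def)
qed

end

text \<open>The factor in the power case is the integral of t^\<alpha> / (1 + t^2) over t > 0,
  divided by \<pi>. It is finite and positive for every \<alpha> in (0, 1) and tends to the factor
  1/2 of the logarithmic cases as \<alpha> -> 0. With \<pi> / \<alpha> as the argument of the cosine
  this would fail: at \<alpha> = 2/3 that cosine vanishes.\<close>

theorem theorem5p18:
  fixes h \<nu> :: real and d s :: nat and \<mu> :: "nat \<Rightarrow> real"
    and Q K :: "'g :: complex_hilbert \<Rightarrow> 'g"
    and \<V> :: "'g l2Z \<Rightarrow> 'g l2Z"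
    and \<Psi> :: "nat \<Rightarrow> real \<Rightarrow> real"
  assumes "h > 0"
    and "\<exists>D :: 'g set. countable D \<and> closure D = UNIV"
    and "\<nexists>B :: 'g set. finite B \<and> cvec.span B = UNIV"
    and "finite_spectral_decomposition Q d \<mu>"
    and "\<nu> > 3"
    and "nonneg_op \<V>"
    and "hilbert_schmidt K"
    and "s \<in> I_Q Q d"
    and "nondegenerate_lower h Q d \<mu> s"
    and "nondegenerate_upper h Q d \<mu> s"
    and "\<forall>i\<in>{1, 2}. Phi i \<nu> Q \<mu> s \<V> K \<sim>[at_right 0] \<Psi> i"
  shows "(\<forall>i\<in>{1, 2}. \<forall>C0 \<alpha>. C0 > 0 \<and> 0 < \<alpha> \<and> \<alpha> < 1 \<and>
      (\<forall>\<^sub>F r in at_right 0. \<Psi> i r = C0 * r powr (- \<alpha>)) \<longrightarrow>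
        (ssf_plus (H_free h Q) (M_factor \<nu> \<V> K) \<sim>[toward_threshold h (\<mu> s) i]
          (\<lambda>E. 1 / (2 * cos (pi * \<alpha> / 2)) * \<Psi> i (2 / h * sqrt \<bar>threshold h (\<mu> s) i - E\<bar>))) \<and>
        (ssf_minus (H_free h Q) (M_factor \<nu> \<V> K) \<sim>[toward_threshold h (\<mu> s) i]
          (\<lambda>E. - (1 / (2 * cos (pi * \<alpha> / 2))) * \<Psi> i (2 / h * sqrt \<bar>threshold h (\<mu> s) i - E\<bar>)))) \<and>
    (\<forall>i\<in>{1, 2}. \<forall>C0 \<alpha>. C0 > 0 \<and>
      ((\<alpha> > 0 \<and> (\<forall>\<^sub>F r in at_right 0. \<Psi> i r = C0 * \<bar>ln r\<bar> powr \<alpha>)) \<or>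
       (\<alpha> > 0 \<and> (\<forall>\<^sub>F r in at_right 0. \<Psi> i r = C0 * (ln \<bar>ln r\<bar>) powr \<alpha>)) \<or>
       (\<forall>\<^sub>F r in at_right 0. \<Psi> i r = C0 * \<bar>ln r\<bar> / ln \<bar>ln r\<bar>)) \<longrightarrow>
        (ssf_plus (H_free h Q) (M_factor \<nu> \<V> K) \<sim>[toward_threshold h (\<mu> s) i]
          (\<lambda>E. 1 / 2 * \<Psi> i (2 / h * sqrt \<bar>threshold h (\<mu> s) i - E\<bar>))) \<and>
        (ssf_minus (H_free h Q) (M_factor \<nu> \<V> K) \<sim>[toward_threshold h (\<mu> s) i]
          (\<lambda>E. - (1 / 2) * \<Psi> i (2 / h * sqrt \<bar>threshold h (\<mu> s) i - E\<bar>))))"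
proof -
  note ctx = assms(1,4,5,6,7,8) and nd = assms(9,10)
  note asymptotics = ssf_asymptotics[OF ctx nd]
  have eq: "Phi i \<nu> Q \<mu> s \<V> K \<sim>[at_right 0] \<Psi> i" if "i \<in> {1, 2}" for i using assms(11) that by blast
  have power: "(ssf_plus (H_free h Q) (M_factor \<nu> \<V> K) \<sim>[toward_threshold h (\<mu> s) i]
      (\<lambda>E. 1 / (2 * cos (pi * \<alpha> / 2)) * \<Psi> i (2 / h * sqrt \<bar>threshold h (\<mu> s) i - E\<bar>))) \<and>
    (ssf_minus (H_free h Q) (M_factor \<nu> \<V> K) \<sim>[toward_threshold h (\<mu> s) i]
      (\<lambda>E. - (1 / (2 * cos (pi * \<alpha> / 2))) * \<Psi> i (2 / h * sqrt \<bar>threshold h (\<mu> s) i - E\<bar>)))"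
    if i: "i \<in> {1, 2}" and C0: "C0 > 0" and \<alpha>: "0 < \<alpha>" "\<alpha> < 1"
      and \<Psi>: "\<forall>\<^sub>F r in at_right 0. \<Psi> i r = C0 * r powr (- \<alpha>)" for i C0 \<alpha>
    using asymptotics[OF i less_imp_le[OF \<alpha>(1)] \<alpha>(2) eq[OF i] power_regular_variation[OF C0 \<alpha>(1) \<Psi>]] by blast
  have slow: "(ssf_plus (H_free h Q) (M_factor \<nu> \<V> K) \<sim>[toward_threshold h (\<mu> s) i]
      (\<lambda>E. 1 / 2 * \<Psi> i (2 / h * sqrt \<bar>threshold h (\<mu> s) i - E\<bar>))) \<and>
    (ssf_minus (H_free h Q) (M_factor \<nu> \<V> K) \<sim>[toward_threshold h (\<mu> s) i]
      (\<lambda>E. - (1 / 2) * \<Psi> i (2 / h * sqrt \<bar>threshold h (\<mu> s) i - E\<bar>)))"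
    if i: "i \<in> {1, 2}" and p: "filterlim p at_top at_top" "\<And>m. ((\<lambda>u. p (u - m) / p u) \<longlongrightarrow> 1) at_top"
      and \<Psi>: "\<forall>\<^sub>F r in at_right 0. \<Psi> i r = p \<bar>ln r\<bar>" for i and p :: "real \<Rightarrow> real"
  proof -
    \<comment> \<open>The logarithmic scales have index 0, where the cosine is 1 and the factor
      becomes 1/2.\<close>
    have "((\<lambda>r. \<Psi> i (l * r) / \<Psi> i r) \<longlongrightarrow> l powr - 0) (at_right 0)" if "0 < l" for l
      using log_regular_variation(2)[OF p \<Psi> that] that by simp
    from asymptotics[OF i _ _ eq[OF i] log_regular_variation(1)[OF p \<Psi>] this] show ?thesis by simp
  qed
  show ?thesis
  proof (intro conjI[where P = "Ball _ _"] ballI allI impI)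
    fix i :: nat and C0 \<alpha> :: real
    assume "i \<in> {1, 2}" and "C0 > 0 \<and> 0 < \<alpha> \<and> \<alpha> < 1 \<and> (\<forall>\<^sub>F r in at_right 0. \<Psi> i r = C0 * r powr (- \<alpha>))"
    then show "(ssf_plus (H_free h Q) (M_factor \<nu> \<V> K) \<sim>[toward_threshold h (\<mu> s) i]
        (\<lambda>E. 1 / (2 * cos (pi * \<alpha> / 2)) * \<Psi> i (2 / h * sqrt \<bar>threshold h (\<mu> s) i - E\<bar>))) \<and>
      (ssf_minus (H_free h Q) (M_factor \<nu> \<V> K) \<sim>[toward_threshold h (\<mu> s) i]
        (\<lambda>E. - (1 / (2 * cos (pi * \<alpha> / 2))) * \<Psi> i (2 / h * sqrt \<bar>threshold h (\<mu> s) i - E\<bar>)))"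
      by (elim conjE) (rule power)
  next
    fix i :: nat and C0 \<alpha> :: real
    assume i: "i \<in> {1, 2}" and "C0 > 0 \<and>
      ((\<alpha> > 0 \<and> (\<forall>\<^sub>F r in at_right 0. \<Psi> i r = C0 * \<bar>ln r\<bar> powr \<alpha>)) \<or>
       (\<alpha> > 0 \<and> (\<forall>\<^sub>F r in at_right 0. \<Psi> i r = C0 * (ln \<bar>ln r\<bar>) powr \<alpha>)) \<or>
       (\<forall>\<^sub>F r in at_right 0. \<Psi> i r = C0 * \<bar>ln r\<bar> / ln \<bar>ln r\<bar>))"
    then consider "C0 > 0" "\<alpha> > 0" "\<forall>\<^sub>F r in at_right 0. \<Psi> i r = C0 * \<bar>ln r\<bar> powr \<alpha>"
      | "C0 > 0" "\<alpha> > 0" "\<forall>\<^sub>F r in at_right 0. \<Psi> i r = C0 * (ln \<bar>ln r\<bar>) powr \<alpha>"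
      | "C0 > 0" "\<forall>\<^sub>F r in at_right 0. \<Psi> i r = C0 * \<bar>ln r\<bar> / ln \<bar>ln r\<bar>" by blast
    then show "(ssf_plus (H_free h Q) (M_factor \<nu> \<V> K) \<sim>[toward_threshold h (\<mu> s) i]
        (\<lambda>E. 1 / 2 * \<Psi> i (2 / h * sqrt \<bar>threshold h (\<mu> s) i - E\<bar>))) \<and>
      (ssf_minus (H_free h Q) (M_factor \<nu> \<V> K) \<sim>[toward_threshold h (\<mu> s) i]
        (\<lambda>E. - (1 / 2) * \<Psi> i (2 / h * sqrt \<bar>threshold h (\<mu> s) i - E\<bar>)))"
    proof cases
      case 1
      show ?thesis by (rule slow[OF i log_scales(1,4)[OF 1(1)] 1(3)]) (rule 1(2))
    next
      case 2
      show ?thesis by (rule slow[OF i log_scales(2,5)[OF 2(1)] 2(3)]) (rule 2(2))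
    next
      case 3
      show ?thesis by (rule slow[OF i log_scales(3,6)[OF 3(1)] 3(2)])
    qed
  qed
qed

end
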